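(* For every $C>0$ there exists $\delta>0$ such that for any $\widehat{V}_0 \in L^1 \cap L^\infty$ (with $V_0 = \mathcal{F}^{-1}\widehat{V}_0$) satisfying $$\|\widehat{V}_0\|_{L^1}+\|\widehat{V}_0\|_{L^{\infty}} \leq \delta ,$$ the solution $A = A_{\sqrt{1/3}} + V$ of the Ginzburg-Landau equation $$\partial_T A = \partial_X^2 A + A - A|A|^2$$ with $V|_{T=0}=V_0$ satisfies $$\|\widehat{V}(T)\|_{L^{\infty}} \le C \qquad\text{and}\qquad \|V(T)\|_{L^{\infty}} \leq \|\widehat{V}(T)\|_{L^1} \leq C(1+T)^{-\frac14}$$ for all $T\ge 0$.
   Context: The real Ginzburg-Landau equation $\partial_T A = \partial_X^2 A + A - A|A|^2$ is considered for $T\ge 0$, $X\in\mathbb{R}$, $A(X,T)\in\mathbb{C}$. For a wave number $q$ it has the stationary solution $A_q(X)=\sqrt{1-q^2}\,e^{iqX}$; in particular $A_{\sqrt{1/3}}(X)=\sqrt{2/3}\,e^{i\sqrt{1/3}\,X}$. The perturbation $V=V(X,T)$ is complex-valued, and $V_0=V_0(X)$. The Fourier transform is in the $X$ variable, with the convention $\widehat{u}(k)=(\mathcal{F}u)(k)=\frac{1}{2\pi}\int_{\mathbb{R}}u(x)e^{-ikx}\,\mathrm{d}x$ and $u(x)=(\mathcal{F}^{-1}\widehat{u})(x)=\int_{\mathbb{R}}\widehat{u}(k)e^{ikx}\,\mathrm{d}k$. Here $\widehat{V}(T)$ denotes the Fourier transform of $X\mapsto V(X,T)$. $L^1$ and $L^\infty$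 are the usual Lebesgue spaces over $\mathbb{R}$; for functions $u$ with $\widehat u\in L^1$, $\|u\|_{L^\infty}=\sup_{x\in\mathbb{R}}|u(x)|$ (the norm in the space of bounded uniformly continuous functions). *)

theory Defs
  imports "HOL-Analysis.Analysis" "HOL-Probability.Essential_Supremum"
begin

(* Functions of the wave number k represent elements of L^1 and L^infinity over the real line;
   every such class has a Borel representative, so lborel is used throughout. *)

definition L1_norm :: "(real \<Rightarrow> complex) \<Rightarrow> real" where
  "L1_norm f = (LINT k|lborel. norm (f k))"

definition Linf_norm :: "(real \<Rightarrow> complex) \<Rightarrow> ereal" where
  "Linf_norm f = esssup lborel (\<lambda>k. ereal (norm (f k)))"

definition sup_norm :: "(real \<Rightarrow> complex) \<Rightarrow> ereal" where
  "sup_norm u = (SUP x. ereal (norm (u x)))"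

definition inverse_fourier :: "(real \<Rightarrow> complex) \<Rightarrow> real \<Rightarrow> complex" where
  "inverse_fourier f x = (LINT k|lborel. f k * exp (\<i> * of_real (k * x)))"

(* "The Fourier transform of u is the L^1 function f".  The solutions below are bounded but in
   general not integrable in X, so the integral of u(x) exp(-ikx) / (2 pi) need not converge
   absolutely, and the transform is the generalised one.  When it lies in L^1 it is exactly the
   integrable f with u = F^(-1) f, and f is determined up to a null set.  The factor 1 / (2 pi)
   sits in the forward transform, so there is none in inverse_fourier. *)
definition has_fourier_transform :: "(real \<Rightarrow> complex) \<Rightarrow> (real \<Rightarrow> complex) \<Rightarrow> bool" where
  "has_fourier_transform u f \<longleftrightarrow> integrable lborel f \<and> u = inverse_fourier f"

definition wave_train :: "real \<Rightarrow> real \<Rightarrow> complex" where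
  "wave_train q X = of_real (sqrt (1 - q\<^sup>2)) * exp (\<i> * of_real (q * X))"

(* Global solutions A T X that are continuous for T >= 0 with values in the bounded uniformly
   continuous functions (sup norm) and satisfy the equation classically for T > 0; the values
   for T < 0 are irrelevant.  Initial data in this space need not be differentiable, so
   the equation is not imposed at T = 0.  AX and AXX are the first two X-derivatives of A. *)
definition ginzburg_landau_solution :: "(real \<Rightarrow> real \<Rightarrow> complex) \<Rightarrow> bool" where
  "ginzburg_landau_solution A \<longleftrightarrow>
     (\<forall>T\<ge>0. bounded (range (A T)) \<and> uniformly_continuous_on UNIV (A T)) \<and>
     (\<forall>T\<ge>0. uniform_limit UNIV A (A T) (at T within {0..})) \<and>
     (\<exists>AX AXX. \<forall>T>0. \<forall>X.
        ((\<lambda>x. A T x) has_vector_derivative AX T X) (at X) \<and>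
        ((\<lambda>x. AX T x) has_vector_derivative AXX T X) (at X) \<and>
        ((\<lambda>t. A t X) has_vector_derivative
           (AXX T X + A T X - A T X * of_real ((norm (A T X))\<^sup>2))) (at T))"

end

theory Submission
  imports Defs "HOL-Probability.Sinc_Integral"
begin

text \<open>
The wave number \<open>q = sqrt (1/3)\<close> sits on the Eckhaus boundary: the effective diffusivity
\<open>(1 - 3 q^2) / (1 - q^2)\<close> of the phase vanishes, and long waves are damped by a fourth order
operator only. This is where the decay rate \<open>(1 + T)^(-1/4)\<close> comes from, and it makes the
nonlinearity marginal, so that the proof has to find a cancellation in it.

Write \<open>A = A_q exp (\<rho> + \<i> \<phi>)\<close> with real \<open>\<rho>\<close> and \<open>\<phi>\<close>. The equation becomes
\<open>\<rho>_T = \<rho>_XX - (4/3) \<rho> - 2 q \<phi>_X + \<rho>_X^2 - \<phi>_X^2 - (2/3) (exp (2 \<rho>) - 1 - 2 \<rho>)\<close>,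
\<open>\<phi>_T = \<phi>_XX + 2 q \<rho>_X + 2 \<rho>_X \<phi>_X\<close>.
With \<open>\<sigma> = sqrt (1 + 3 k^2)\<close> the linear part is diagonal in Fourier space in a stable mode with
rate \<open>(\<sigma> + 1)^2 / 3 \<ge> 1\<close> and a critical mode with rate \<open>(\<sigma> - 1)^2 / 3\<close>, which behaves like
\<open>(3/4) k^4\<close> near \<open>k = 0\<close> (\<open>amp_linear\<close>, \<open>pha_linear\<close>).

All estimates are pointwise in \<open>k\<close>. The critical mode is kept below a multiple of
\<open>(1 + |k| (1 + T)^(1/4))^(-5)\<close>: this is bounded in \<open>k\<close>, its integral decays like
\<open>(1 + T)^(-1/4)\<close>, each factor \<open>|k|\<close> is worth one more factor \<open>(1 + T)^(-1/4)\<close>, and so is each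
convolution. By this count \<open>\<phi>_X\<close> and \<open>\<rho>\<close>, in which the critical mode carries a factor \<open>k\<close>, are of
order \<open>(1 + T)^(-1/4)\<close>, and the quadratic term \<open>\<rho>_X \<phi>_X\<close> in the critical equation is of order
\<open>(1 + T)^(-1)\<close>. Its time integral near \<open>k = 0\<close> diverges logarithmically. The remedy is that \<open>\<rho>\<close> is slaved to \<open>\<phi>\<close>: the combination
\<open>y = \<rho> + (sqrt 3 / 2) \<phi>_X\<close> carries a factor \<open>k^3\<close> on the critical mode, and
\<open>2 \<rho>_X \<phi>_X = (4 / sqrt 3) \<rho>_X y - (2 / sqrt 3) (\<rho>^2)_X\<close> (\<open>pol_phi_conservative\<close>).
The first term is of order \<open>(1 + T)^(-6/4)\<close>, which is integrable in time; the second is a total derivative: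
\<open>\<rho>^2\<close> is of order \<open>(1 + T)^(-3/4)\<close>, its time integral grows like \<open>(1 + T)^(1/4)\<close>, and the factor \<open>|k|\<close>
compensates this growth exactly. The terms of the
\<open>\<rho>\<close> equation enter the critical mode with a factor \<open>k\<close> as well. Hence the Duhamel integral of
the majorant of the nonlinearity reproduces the majorant of the solution (\<open>duhamel_polH\<close>), and Picard
iteration converges for all times at once (\<open>mild_solution_exists\<close>).

The polar ansatz needs data below \<open>(1 + |k|)^(-5)\<close>, whereas the given data are only in
\<open>L^1\<close> and \<open>L^\<infinity>\<close>. On the time interval \<open>[0,2]\<close> the equation is therefore solved in
Cartesian coordinates, \<open>A = exp (\<i> q X) (sqrt (2/3) + a + \<i> b)\<close>. The given data lie below
a function \<open>m\<close> with \<open>m * m \<le> \<epsilon> m\<close> (\<open>convolution_majorant\<close>), and the solution stays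
below a multiple of \<open>m exp (- |k| T)\<close>. At \<open>T = 1\<close> it is below a
multiple of \<open>exp (- |k|)\<close>, its logarithm is a convergent series of convolution powers, and the polar
solution takes over. The two solutions agree on \<open>[1,2)\<close> by uniqueness, which follows from a maximum
principle for \<open>|A - B|^2\<close> (\<open>gl_on_unique\<close>).
\<close>

section \<open>Integrals depending on a parameter\<close>

lemma borel_measurable_curried:
  fixes f :: "real \<Rightarrow> real \<Rightarrow> 'b::topological_space"
  assumes "case_prod f \<in> borel_measurable (borel \<Otimes>\<^sub>M borel)"
    and "g \<in> borel_measurable M" "h \<in> borel_measurable M"
  shows "(\<lambda>x. f (g x :: real) (h x :: real)) \<in> borel_measurable M"
  using measurable_compose[OF measurable_Pair[OF assms(2,3)] assms(1)] by simp

lemma integrable_dominated: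
  fixes f :: "real \<Rightarrow> 'b::{banach,second_countable_topology}"
  assumes "f \<in> borel_measurable borel" "integrable lborel g" "\<And>k. norm (f k) \<le> (g k :: real)"
  shows "integrable lborel f"
proof (rule Bochner_Integration.integrable_bound[OF assms(2)])
  show "AE x in lborel. norm (f x) \<le> norm (g x)"
    using assms(3) by (auto intro!: AE_I2 order_trans[OF _ abs_ge_self])
qed (use assms in simp)

lemma tendsto_integral_dominated:
  fixes f :: "real \<Rightarrow> real \<Rightarrow> 'b::{banach,second_countable_topology}"
  assumes meas: "\<And>t. t \<in> S \<Longrightarrow> f t \<in> borel_measurable borel"
    and bound: "\<And>t k. t \<in> S \<Longrightarrow> norm (f t k) \<le> g k"
    and g: "integrable lborel g" and F: "F \<in> borel_measurable borel"
    and lim: "\<And>k. ((\<lambda>t. f t k) \<longlongrightarrow> F k) (at t0 within S)"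
  shows "((\<lambda>t. LINT k|lborel. f t k) \<longlongrightarrow> (LINT k|lborel. F k)) (at t0 within S)"
  unfolding tendsto_at_iff_sequentially
proof (intro allI impI)
  fix X assume X: "\<forall>i. X i \<in> S - {t0}" "X \<longlonglongrightarrow> t0"
  show "((\<lambda>t. LINT k|lborel. f t k) \<circ> X) \<longlonglongrightarrow> (LINT k|lborel. F k)"
    unfolding o_def
  proof (rule integral_dominated_convergence[where w = g])
    show "AE k in lborel. (\<lambda>i. f (X i) k) \<longlonglongrightarrow> F k"
      using lim[unfolded tendsto_at_iff_sequentially] X by (auto simp: o_def)
    show "AE k in lborel. norm (f (X i) k) \<le> g k" for i
      using bound X(1) by auto
    show "f (X i) \<in> borel_measurable lborel" for i
      using meas X(1) by auto
  qed (use g F in simp_all)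
qed

lemma has_vector_derivative_iff_quotient:
  fixes f :: "real \<Rightarrow> 'b::real_normed_vector"
  shows "(f has_vector_derivative D) (at t0) \<longleftrightarrow> ((\<lambda>t. (f t - f t0) /\<^sub>R (t - t0)) \<longlongrightarrow> D) (at t0)"
proof -
  have "((\<lambda>t. norm (f t - f t0 - (t - t0) *\<^sub>R D) / norm (t - t0)) \<longlongrightarrow> 0) (at t0) \<longleftrightarrow>
        ((\<lambda>t. norm ((f t - f t0) /\<^sub>R (t - t0) - D)) \<longlongrightarrow> 0) (at t0)"
  proof (rule filterlim_cong[OF refl refl])
    have "norm (f t - f t0 - (t - t0) *\<^sub>R D) / norm (t - t0) = norm ((f t - f t0) /\<^sub>R (t - t0) - D)"
      if "t \<noteq> t0" for t
    proof -
      have "(f t - f t0) /\<^sub>R (t - t0) - D = (f t - f t0 - (t - t0) *\<^sub>R D) /\<^sub>R (t - t0)"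
        using that by (simp add: scaleR_diff_right)
      then show ?thesis by (simp add: divide_inverse_commute)
    qed
    then show "\<forall>\<^sub>F t in at t0. norm (f t - f t0 - (t - t0) *\<^sub>R D) / norm (t - t0) = norm ((f t - f t0) /\<^sub>R (t - t0) - D)"
      by (auto simp: eventually_at_filter)
  qed
  moreover have "\<dots> \<longleftrightarrow> ((\<lambda>t. (f t - f t0) /\<^sub>R (t - t0)) \<longlongrightarrow> D) (at t0)"
    unfolding tendsto_norm_zero_iff by (rule LIM_zero_iff)
  ultimately show ?thesis
    by (simp add: has_vector_derivative_def has_derivative_iff_norm bounded_linear_scaleR_left)
qed

text \<open>The mean value inequality bounds the difference quotients by a multiple of the majorant of the derivatives,
so dominated convergence applies to them.\<close>

lemma has_vector_derivative_integral_dominated: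
  fixes f f' :: "real \<Rightarrow> real \<Rightarrow> 'b::{banach,second_countable_topology}"
  assumes t0: "t0 \<in> {a<..<b}"
    and int: "\<And>t. t \<in> {a<..<b} \<Longrightarrow> integrable lborel (f t)"
    and deriv: "\<And>t k. t \<in> {a<..<b} \<Longrightarrow> ((\<lambda>t. f t k) has_vector_derivative f' t k) (at t)"
    and bound: "\<And>t k. t \<in> {a<..<b} \<Longrightarrow> norm (f' t k) \<le> g k"
    and g: "integrable lborel g" and F: "f' t0 \<in> borel_measurable borel"
  shows "((\<lambda>t. LINT k|lborel. f t k) has_vector_derivative (LINT k|lborel. f' t0 k)) (at t0)"
proof -
  have q: "norm ((f t k - f t0 k) /\<^sub>R (t - t0)) \<le> 3 * g k" if "t \<in> {a<..<b} - {t0}" for t k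
  proof -
    have seg: "closed_segment t0 t \<subseteq> {a<..<b}"
      using t0 that by (auto simp: closed_segment_eq_real_ivl split: if_splits)
    have "norm (f t k - f t0 k - (t - t0) *\<^sub>R f' t0 k) \<le> norm (t - t0) * (2 * g k)"
    proof (rule vector_differentiable_bound_linearization[OF _ seg _ t0])
      fix x assume x: "x \<in> {a<..<b}"
      show "((\<lambda>t. f t k) has_vector_derivative f' x k) (at x within {a<..<b})"
        using deriv[OF x] by (rule has_vector_derivative_at_within)
      show "norm (f' x k - f' t0 k) \<le> 2 * g k"
        using bound[OF x, of k] bound[OF t0, of k] norm_triangle_ineq4[of "f' x k" "f' t0 k"] by simp
    qed
    moreover have "norm ((t - t0) *\<^sub>R f' t0 k) \<le> norm (t - t0) * g k"
      using bound[OF t0, of k] by (simp add: mult_left_mono)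
    ultimately have "norm (f t k - f t0 k) \<le> norm (t - t0) * (3 * g k)"
      using norm_triangle_sub[of "f t k - f t0 k" "(t - t0) *\<^sub>R f' t0 k"] by (simp add: algebra_simps)
    then show ?thesis using that
      by (simp add: divide_inverse_commute[symmetric] pos_divide_le_eq mult.commute)
  qed
  have "((\<lambda>t. LINT k|lborel. (f t k - f t0 k) /\<^sub>R (t - t0)) \<longlongrightarrow> (LINT k|lborel. f' t0 k)) (at t0 within {a<..<b} - {t0})"
  proof (rule tendsto_integral_dominated[where g = "\<lambda>k. 3 * g k"])
    fix k
    show "((\<lambda>t. (f t k - f t0 k) /\<^sub>R (t - t0)) \<longlongrightarrow> f' t0 k) (at t0 within {a<..<b} - {t0})"
      by (rule tendsto_within_subset[OF deriv[OF t0, unfolded has_vector_derivative_iff_quotient]]) simp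
  next
    fix t assume "t \<in> {a<..<b} - {t0}"
    then show "(\<lambda>k. (f t k - f t0 k) /\<^sub>R (t - t0)) \<in> borel_measurable borel"
      using borel_measurable_integrable[OF int[of t]] borel_measurable_integrable[OF int[OF t0]] by simp
  next
    show "integrable lborel (\<lambda>k. 3 * g k)" using g by simp
  qed (rule q, assumption, rule F)
  then have lim: "((\<lambda>t. LINT k|lborel. (f t k - f t0 k) /\<^sub>R (t - t0)) \<longlongrightarrow> (LINT k|lborel. f' t0 k)) (at t0)"
    using at_within_open[OF t0] by (simp add: at_within_def Diff_idemp)
  have eq: "(LINT k|lborel. (f t k - f t0 k) /\<^sub>R (t - t0))
      = ((LINT k|lborel. f t k) - (LINT k|lborel. f t0 k)) /\<^sub>R (t - t0)" if "t \<in> {a<..<b}" for t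
    unfolding integral_scaleR_right Bochner_Integration.integral_diff[OF int[OF that] int[OF t0]] ..
  have "\<forall>\<^sub>F t in at t0. t \<in> {a<..<b}" using t0 by (intro eventually_at_in_open') auto
  then have ev: "\<forall>\<^sub>F t in at t0. (LINT k|lborel. (f t k - f t0 k) /\<^sub>R (t - t0))
      = ((LINT k|lborel. f t k) - (LINT k|lborel. f t0 k)) /\<^sub>R (t - t0)"
    by (rule eventually_mono) (rule eq)
  show ?thesis
    unfolding has_vector_derivative_iff_quotient by (rule Lim_transform_eventually[OF lim ev])
qed

section \<open>Inverse Fourier transforms\<close>

lemma norm_fourier_kernel [simp]: "norm (exp (\<i> * of_real y)) = 1"
  by simp

lemma integrable_fourier:
  assumes "integrable lborel f"
  shows "integrable lborel (\<lambda>k. f k * exp (\<i> * of_real (k * x)))"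
proof (rule integrable_dominated[where g = "\<lambda>k. norm (f k)"])
  have [measurable]: "f \<in> borel_measurable borel"
    using borel_measurable_integrable[OF assms] by simp
  show "(\<lambda>k. f k * exp (\<i> * of_real (k * x))) \<in> borel_measurable borel" by measurable
  show "norm (f k * exp (\<i> * of_real (k * x))) \<le> norm (f k)" for k
    unfolding norm_mult norm_fourier_kernel by simp
qed (use assms in simp)

lemma inverse_fourier_norm_le:
  assumes "integrable lborel f"
  shows "norm (inverse_fourier f x) \<le> (LINT k|lborel. norm (f k))"
  unfolding inverse_fourier_def
proof (rule Bochner_Integration.integral_norm_bound_integral[OF integrable_fourier[OF assms] integrable_norm[OF assms]])
qed (simp only: norm_mult norm_fourier_kernel mult_1_right order_refl)

lemma inverse_fourier_add:
  "integrable lborel f \<Longrightarrow> integrable lborel g \<Longrightarrow>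
    inverse_fourier (\<lambda>k. f k + g k) x = inverse_fourier f x + inverse_fourier g x"
  unfolding inverse_fourier_def distrib_right
  by (rule Bochner_Integration.integral_add; rule integrable_fourier)

lemma inverse_fourier_diff:
  "integrable lborel f \<Longrightarrow> integrable lborel g \<Longrightarrow>
    inverse_fourier (\<lambda>k. f k - g k) x = inverse_fourier f x - inverse_fourier g x"
  unfolding inverse_fourier_def left_diff_distrib
  by (rule Bochner_Integration.integral_diff; rule integrable_fourier)

lemma inverse_fourier_cmult: "inverse_fourier (\<lambda>k. c * f k) x = c * inverse_fourier f x"
  unfolding inverse_fourier_def mult.assoc by (rule integral_mult_right_zero)

lemma inverse_fourier_shift:
  "inverse_fourier (\<lambda>k. f (k - q)) x = exp (\<i> * of_real (q * x)) * inverse_fourier f x"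
proof -
  have "inverse_fourier (\<lambda>k. f (k - q)) x = (LINT k|lborel. f (q + 1 * k - q) * exp (\<i> * of_real ((q + 1 * k) * x)))"
    unfolding inverse_fourier_def by (subst lborel_integral_real_affine[where c = 1 and t = q]) auto
  also have "\<dots> = (LINT k|lborel. exp (\<i> * of_real (q * x)) * (f k * exp (\<i> * of_real (k * x))))"
    by (intro Bochner_Integration.integral_cong refl) (simp add: algebra_simps exp_add)
  finally show ?thesis by (simp add: inverse_fourier_def)
qed

lemma inverse_fourier_has_vector_derivative:
  assumes f: "integrable lborel f" and kf: "integrable lborel (\<lambda>k. of_real k * f k)"
  shows "(inverse_fourier f has_vector_derivative inverse_fourier (\<lambda>k. \<i> * of_real k * f k) x) (at x)"
proof -
  have [measurable]: "f \<in> borel_measurable borel"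
    using borel_measurable_integrable[OF f] by simp
  have "((\<lambda>x. LINT k|lborel. f k * exp (\<i> * of_real (k * x))) has_vector_derivative
        (LINT k|lborel. (\<i> * of_real k * f k) * exp (\<i> * of_real (k * x)))) (at x)"
  proof (rule has_vector_derivative_integral_dominated[where a = "x - 1" and b = "x + 1" and g = "\<lambda>k. norm (of_real k * f k)"])
    fix t k
    have "((\<lambda>z. exp (\<i> * of_real k * z)) has_field_derivative exp (\<i> * of_real k * of_real t) * (\<i> * of_real k)) (at (of_real t))"
      by (auto intro!: derivative_eq_intros)
    from has_vector_derivative_real_field[OF this]
    have "((\<lambda>t. exp (\<i> * of_real (k * t))) has_vector_derivative exp (\<i> * of_real (k * t)) * (\<i> * of_real k)) (at t)"
      by (simp add: mult.assoc)
    then show "((\<lambda>t. f k * exp (\<i> * of_real (k * t))) has_vector_derivative \<i> * of_real k * f k * exp (\<i> * of_real (k * t))) (at t)"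
      by (rule has_vector_derivative_mult_right[THEN has_vector_derivative_eq_rhs]) (simp add: mult_ac)
    show "norm (\<i> * of_real k * f k * exp (\<i> * of_real (k * t))) \<le> norm (of_real k * f k)"
      by (simp only: norm_mult norm_fourier_kernel) simp
  next
    show "integrable lborel (\<lambda>k. f k * exp (\<i> * of_real (k * t)))" for t by (rule integrable_fourier[OF f])
    show "integrable lborel (\<lambda>k. norm (of_real k * f k))" using kf by (rule integrable_norm)
  qed (simp, measurable)
  then show ?thesis by (simp add: inverse_fourier_def[abs_def])
qed

text \<open>The modulus of continuity is at most the integral of \<open>|f k| |exp (\<i> k h) - 1|\<close>, which tends to zero with \<open>h\<close>
by dominated convergence.\<close>

lemma inverse_fourier_uniformly_continuous:
  assumes f: "integrable lborel f"
  shows "uniformly_continuous_on UNIV (inverse_fourier f)"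
proof -
  have [measurable]: "f \<in> borel_measurable borel"
    using borel_measurable_integrable[OF f] by simp
  define g where "g h k = norm (f k) * norm (exp (\<i> * of_real (k * h)) - 1)" for h k
  have meas: "g h \<in> borel_measurable borel" for h
    unfolding g_def[abs_def] by measurable
  have bound: "norm (g h k) \<le> 2 * norm (f k)" for h k
  proof -
    have "norm (exp (\<i> * of_real (k * h)) - 1) \<le> 1 + 1"
      by (rule order_trans[OF norm_triangle_ineq4]) simp
    then have "norm (f k) * norm (exp (\<i> * of_real (k * h)) - 1) \<le> norm (f k) * 2"
      by (intro mult_left_mono) auto
    then show ?thesis by (simp add: g_def mult.commute del: of_real_mult)
  qed
  have "((\<lambda>h. LINT k|lborel. g h k) \<longlongrightarrow> (LINT k::real|lborel. (0::real))) (at 0 within UNIV)"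
  proof (rule tendsto_integral_dominated[where f = g and F = "\<lambda>k. 0" and g = "\<lambda>k. 2 * norm (f k)"])
    show "norm (g h k) \<le> 2 * norm (f k)" for h k by (rule bound)
  next
    fix k
    have "isCont (\<lambda>h. g h k) 0" unfolding g_def by (intro continuous_intros)
    then show "((\<lambda>h. g h k) \<longlongrightarrow> 0) (at 0)" by (simp add: isCont_def g_def)
  qed (use f meas in auto)
  then have lim: "((\<lambda>h. LINT k|lborel. g h k) \<longlongrightarrow> 0) (at 0)" by simp
  have int: "integrable lborel (g h)" for h
    by (rule integrable_dominated[OF meas _ bound]) (use f in simp)
  have diff: "norm (inverse_fourier f y - inverse_fourier f x) \<le> (LINT k|lborel. g (y - x) k)" for x y
  proof -
    have "inverse_fourier f y - inverse_fourier f x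
        = (LINT k|lborel. f k * exp (\<i> * of_real (k * y)) - f k * exp (\<i> * of_real (k * x)))"
      unfolding inverse_fourier_def
      by (rule Bochner_Integration.integral_diff[symmetric]; rule integrable_fourier[OF f])
    also have "norm \<dots> \<le> (LINT k|lborel. g (y - x) k)"
    proof (rule Bochner_Integration.integral_norm_bound_integral)
      fix k
      have "f k * exp (\<i> * of_real (k * y)) - f k * exp (\<i> * of_real (k * x))
          = f k * (exp (\<i> * of_real (k * (y - x))) - 1) * exp (\<i> * of_real (k * x))"
        by (simp add: algebra_simps flip: exp_add)
      then show "norm (f k * exp (\<i> * of_real (k * y)) - f k * exp (\<i> * of_real (k * x))) \<le> g (y - x) k"
        by (simp add: norm_mult g_def)
    next
      show "integrable lborel (\<lambda>k. f k * exp (\<i> * of_real (k * y)) - f k * exp (\<i> * of_real (k * x)))"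
        by (intro Bochner_Integration.integrable_diff integrable_fourier f)
    qed (rule int)
    finally show ?thesis .
  qed
  show ?thesis unfolding uniformly_continuous_on_def
  proof (intro allI impI)
    fix e :: real assume "e > 0"
    then obtain d where d: "d > 0" "\<And>h. h \<noteq> 0 \<Longrightarrow> norm h < d \<Longrightarrow> norm (LINT k|lborel. g h k) < e"
      using lim[unfolded LIM_def] by (metis dist_0_norm dist_commute)
    have "dist (inverse_fourier f y) (inverse_fourier f x) < e" if "dist y x < d" for x y
    proof (cases "y = x")
      case False
      then show ?thesis
        using d(2)[of "y - x"] diff[of y x] that by (simp add: dist_norm)
    qed (use \<open>e > 0\<close> in simp)
    then show "\<exists>d>0. \<forall>x\<in>UNIV. \<forall>x'\<in>UNIV. dist x' x < d \<longrightarrow> dist (inverse_fourier f x') (inverse_fourier f x) < e"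
      using d(1) by auto
  qed
qed

text \<open>The symmetry that characterises the Fourier transforms of real-valued functions.\<close>

definition hermitian :: "(real \<Rightarrow> complex) \<Rightarrow> bool" where
  "hermitian f \<longleftrightarrow> (\<forall>k. f (- k) = cnj (f k))"

lemma inverse_fourier_hermitian:
  assumes "hermitian f"
  shows "Im (inverse_fourier f x) = 0"
proof -
  have "inverse_fourier f x = (LINT k|lborel. f (0 + (-1) * k) * exp (\<i> * of_real ((0 + (-1) * k) * x)))"
    unfolding inverse_fourier_def by (subst lborel_integral_real_affine[where c = "-1" and t = 0]) auto
  also have "\<dots> = (LINT k|lborel. cnj (f k * exp (\<i> * of_real (k * x))))"
    using assms by (intro Bochner_Integration.integral_cong refl) (simp add: hermitian_def exp_cnj)
  also have "\<dots> = cnj (inverse_fourier f x)"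
    unfolding inverse_fourier_def by (rule Bochner_Integration.integral_cnj)
  finally show ?thesis by (simp add: complex_eq_iff)
qed

section \<open>Convolutions\<close>

definition conv :: "(real \<Rightarrow> complex) \<Rightarrow> (real \<Rightarrow> complex) \<Rightarrow> real \<Rightarrow> complex" where
  "conv f g k = (LINT l|lborel. f l * g (k - l))"

lemma measurable_conv_param:
  fixes f g :: "real \<Rightarrow> real \<Rightarrow> complex"
  assumes "case_prod f \<in> borel_measurable (borel \<Otimes>\<^sub>M borel)" "case_prod g \<in> borel_measurable (borel \<Otimes>\<^sub>M borel)"
  shows "case_prod (\<lambda>t. conv (f t) (g t)) \<in> borel_measurable (borel \<Otimes>\<^sub>M borel)"
proof -
  have "(\<lambda>x. f (fst (fst x)) (snd x) * g (fst (fst x)) (snd (fst x) - snd x))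
       \<in> borel_measurable ((borel \<Otimes>\<^sub>M borel) \<Otimes>\<^sub>M lborel)"
    by (intro borel_measurable_times borel_measurable_curried[OF assms(1)] borel_measurable_curried[OF assms(2)]) measurable
  then have "(\<lambda>x. LINT l|lborel. f (fst x) l * g (fst x) (snd x - l)) \<in> borel_measurable (borel \<Otimes>\<^sub>M borel)"
    by (intro lborel.borel_measurable_lebesgue_integral) (simp add: case_prod_beta')
  then show ?thesis by (simp add: case_prod_beta' conv_def)
qed

lemma measurable_conv [measurable]:
  assumes [measurable]: "f \<in> borel_measurable borel" "g \<in> borel_measurable borel"
  shows "conv f g \<in> borel_measurable borel"
  unfolding conv_def[abs_def] by measurable

lemma conv_commute: "conv f g k = conv g f k"
  unfolding conv_def
  by (subst lborel_integral_real_affine[where c = "-1" and t = k]) (auto simp: mult.commute)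

lemma hermitian_conv:
  assumes "hermitian f" "hermitian g"
  shows "hermitian (conv f g)"
  unfolding hermitian_def
proof
  fix k
  have "conv f g (- k) = (LINT l|lborel. f (0 + (-1) * l) * g (- k - (0 + (-1) * l)))"
    unfolding conv_def by (subst lborel_integral_real_affine[where c = "-1" and t = 0]) auto
  also have "\<dots> = (LINT l|lborel. cnj (f l * g (k - l)))"
  proof (intro Bochner_Integration.integral_cong refl)
    fix l
    have "g (- k - (0 + (-1) * l)) = g (- (k - l))" by simp
    then show "f (0 + (-1) * l) * g (- k - (0 + (-1) * l)) = cnj (f l * g (k - l))"
      using assms by (simp add: hermitian_def del: minus_diff_eq)
  qed
  finally show "conv f g (- k) = cnj (conv f g k)"
    by (simp add: conv_def del: complex_cnj_mult)
qed

text \<open>Fubini; the factor \<open>exp (\<i> k x)\<close> splits between \<open>l\<close> and \<open>k - l\<close>.\<close>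

lemma inverse_fourier_conv:
  assumes f: "integrable lborel f" and g: "integrable lborel g"
  shows "inverse_fourier (conv f g) x = inverse_fourier f x * inverse_fourier g x"
proof -
  have [measurable]: "f \<in> borel_measurable borel" "g \<in> borel_measurable borel"
    using borel_measurable_integrable[OF f] borel_measurable_integrable[OF g] by simp_all
  define e where "e k = exp (\<i> * of_real (k * x))" for k
  have [measurable]: "e \<in> borel_measurable borel" unfolding e_def by measurable
  have ne: "norm (e k) = 1" for k unfolding e_def by simp
  have g': "integrable lborel (\<lambda>k. g (k - l))" for l
    using lborel_integrable_real_affine[OF g, of 1 "- l"] by (simp add: add.commute)
  have gnorm: "(LINT k|lborel. norm (g (k - l))) = (LINT k|lborel. norm (g k))" for l
    by (subst lborel_integral_real_affine[where c = 1 and t = l]) auto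
  have I: "integrable (lborel \<Otimes>\<^sub>M lborel) (case_prod (\<lambda>l k. f l * g (k - l) * e k))"
  proof (rule lborel_pair.Fubini_integrable)
    show "integrable lborel (\<lambda>l. LINT k|lborel. norm (case (l, k) of (l, k) \<Rightarrow> f l * g (k - l) * e k))"
      using f by (simp add: norm_mult ne gnorm)
    show "AE l in lborel. integrable lborel (\<lambda>k. case (l, k) of (l, k) \<Rightarrow> f l * g (k - l) * e k)"
    proof (intro AE_I2)
      fix l
      have "integrable lborel (\<lambda>k. f l * (g (k - l) * e k))"
        unfolding e_def by (intro integrable_mult_right integrable_fourier g')
      then show "integrable lborel (\<lambda>k. case (l, k) of (l, k) \<Rightarrow> f l * g (k - l) * e k)"
        by (simp add: mult.assoc)
    qed
  qed measurable
  have "inverse_fourier (conv f g) x = (LINT k|lborel. LINT l|lborel. f l * g (k - l) * e k)"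
    unfolding inverse_fourier_def conv_def e_def by simp
  also have "\<dots> = (LINT l|lborel. LINT k|lborel. f l * g (k - l) * e k)"
    by (rule lborel_pair.Fubini_integral[OF I])
  also have "\<dots> = (LINT l|lborel. f l * e l * inverse_fourier g x)"
  proof (intro Bochner_Integration.integral_cong refl)
    fix l
    have "(LINT k|lborel. f l * g (k - l) * e k) = f l * inverse_fourier (\<lambda>k. g (k - l)) x"
      by (simp add: inverse_fourier_def e_def mult.assoc)
    then show "(LINT k|lborel. f l * g (k - l) * e k) = f l * e l * inverse_fourier g x"
      by (simp add: inverse_fourier_shift e_def)
  qed
  finally show ?thesis by (simp add: inverse_fourier_def e_def)
qed

section \<open>Weights that convolution preserves\<close>

text \<open>Measurability is part of the notion so that domination by an integrable weight implies integrability, and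
the algebra of convolutions can be carried out on \<open>dominated\<close> facts alone.\<close>

definition dominated :: "(real \<Rightarrow> real) \<Rightarrow> real \<Rightarrow> (real \<Rightarrow> complex) \<Rightarrow> bool" where
  "dominated M a f \<longleftrightarrow> f \<in> borel_measurable borel \<and> (\<forall>k. norm (f k) \<le> a * M k)"

lemma dominatedI: "f \<in> borel_measurable borel \<Longrightarrow> (\<And>k. norm (f k) \<le> a * M k) \<Longrightarrow> dominated M a f"
  by (simp add: dominated_def)

lemma dominated_measurable: "dominated M a f \<Longrightarrow> f \<in> borel_measurable borel"
  and dominated_le: "dominated M a f \<Longrightarrow> norm (f k) \<le> a * M k"
  by (simp_all add: dominated_def)

lemma dominated_add:
  "dominated M a f \<Longrightarrow> dominated M b g \<Longrightarrow> dominated M (a + b) (\<lambda>k. f k + g k)"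
  by (auto simp: dominated_def distrib_right intro!: norm_triangle_le add_mono)

lemma dominated_cmult:
  assumes "dominated M a f"
  shows "dominated M (norm c * a) (\<lambda>k. c * f k)"
  using assms by (auto simp: dominated_def norm_mult mult.assoc intro!: mult_left_mono)

lemma dominated_mono:
  assumes "dominated M a f" "\<And>k. a * M k \<le> b * N k"
  shows "dominated N b f"
  using assms order_trans by (fastforce simp: dominated_def)

lemma dominated_scale_mono:
  assumes "dominated M a f" "a \<le> b" "\<And>k. 0 \<le> M k"
  shows "dominated M b f"
  using assms(1) by (rule dominated_mono) (use assms in \<open>simp add: mult_right_mono\<close>)

text \<open>The exponent is shifted by one, because the unit of convolution is not a function:
\<open>conv_power f n\<close> is the transform of the power \<open>n + 1\<close> of the inverse transform of \<open>f\<close>.\<close>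

primrec conv_power :: "(real \<Rightarrow> complex) \<Rightarrow> nat \<Rightarrow> real \<Rightarrow> complex" where
  "conv_power f 0 = f"
| "conv_power f (Suc n) = conv f (conv_power f n)"

text \<open>The transform of the power series \<open>a 0 w + a 1 w^2 + ...\<close> in \<open>w = inverse_fourier f\<close>, which has no
constant term.\<close>

definition conv_series :: "(nat \<Rightarrow> real) \<Rightarrow> (real \<Rightarrow> complex) \<Rightarrow> real \<Rightarrow> complex" where
  "conv_series a f k = (\<Sum>n. of_real (a n) * conv_power f n k)"

lemma hermitian_add: "hermitian f \<Longrightarrow> hermitian g \<Longrightarrow> hermitian (\<lambda>k. f k + g k)"
  and hermitian_diff: "hermitian f \<Longrightarrow> hermitian g \<Longrightarrow> hermitian (\<lambda>k. f k - g k)"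
  and hermitian_cmult: "hermitian f \<Longrightarrow> hermitian (\<lambda>k. of_real c * f k)"
  and hermitian_derivative: "hermitian f \<Longrightarrow> hermitian (\<lambda>k. \<i> * of_real k * f k)"
  by (simp_all add: hermitian_def)

lemma hermitian_conv_power: "hermitian f \<Longrightarrow> hermitian (conv_power f n)"
  by (induction n) (auto intro: hermitian_conv)

lemma measurable_conv_power_param:
  fixes f :: "real \<Rightarrow> real \<Rightarrow> complex"
  assumes "case_prod f \<in> borel_measurable (borel \<Otimes>\<^sub>M borel)"
  shows "case_prod (\<lambda>t. conv_power (f t) n) \<in> borel_measurable (borel \<Otimes>\<^sub>M borel)"
proof (induction n)
  case (Suc n)
  show ?case unfolding conv_power.simps by (rule measurable_conv_param[OF assms Suc])
qed (use assms in simp)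

lemma measurable_conv_series_param:
  fixes f :: "real \<Rightarrow> real \<Rightarrow> complex"
  assumes "case_prod f \<in> borel_measurable (borel \<Otimes>\<^sub>M borel)"
  shows "case_prod (\<lambda>t. conv_series a (f t)) \<in> borel_measurable (borel \<Otimes>\<^sub>M borel)"
proof -
  have [measurable]: "(\<lambda>x. conv_power (f (fst x)) n (snd x)) \<in> borel_measurable (borel \<Otimes>\<^sub>M borel)" for n
    using measurable_conv_power_param[OF assms, of n] by (simp add: case_prod_beta')
  show ?thesis unfolding conv_series_def case_prod_beta' by measurable
qed

text \<open>A weight whose convolution square is at most \<open>\<kappa>\<close> times itself turns pointwise bounds by
multiples of the weight into a Banach algebra under convolution. The number \<open>\<kappa>\<close> measures the gain from one
convolution: it is of order \<open>(1 + t)^(-1/4)\<close> for the self-similar weights, and a small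
constant for the weights of the initial layer.\<close>

locale conv_weight =
  fixes M :: "real \<Rightarrow> real" and \<kappa> :: real
  assumes M_integrable: "integrable lborel M"
    and M_nonneg: "\<And>k. 0 \<le> M k"
    and M_bounded: "\<exists>B. \<forall>k. M k \<le> B"
    and M_conv_le: "\<And>k. (LINT l|lborel. M l * M (k - l)) \<le> \<kappa> * M k"
    and \<kappa>_nonneg: "0 \<le> \<kappa>"
begin

lemma dominated_integrable:
  assumes "dominated M a f"
  shows "integrable lborel f"
  by (rule integrable_dominated[OF dominated_measurable[OF assms] _ dominated_le[OF assms]])
    (use M_integrable in simp)

lemma M_conv_integrable: "integrable lborel (\<lambda>l. M l * M (k - l))"
proof -
  obtain B where B: "\<And>k. M k \<le> B" using M_bounded by auto
  show ?thesis
  proof (rule integrable_dominated)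
    show "norm (M l * M (k - l)) \<le> M l * B" for l
      using M_nonneg B by (simp add: mult_left_mono)
  qed (use M_integrable in auto)
qed

lemma conv_integrand_le:
  assumes "dominated M a f" "dominated M b g" "0 \<le> a"
  shows "norm (f l * g (k - l)) \<le> a * b * (M l * M (k - l))"
proof -
  have "norm (f l) * norm (g (k - l)) \<le> (a * M l) * (b * M (k - l))"
    using assms M_nonneg by (intro mult_mono dominated_le) auto
  then show ?thesis by (simp add: norm_mult mult_ac)
qed

lemma conv_integrable:
  assumes "dominated M a f" "dominated M b g" "0 \<le> a"
  shows "integrable lborel (\<lambda>l. f l * g (k - l))"
proof (rule integrable_dominated[OF _ _ conv_integrand_le[OF assms]])
  have [measurable]: "f \<in> borel_measurable borel" "g \<in> borel_measurable borel"
    using assms by (auto simp: dominated_def)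
  show "(\<lambda>l. f l * g (k - l)) \<in> borel_measurable borel" by measurable
qed (use M_conv_integrable in simp)

lemma dominated_conv:
  assumes f: "dominated M a f" and g: "dominated M b g" and ab: "0 \<le> a" "0 \<le> b"
  shows "dominated M (a * b * \<kappa>) (conv f g)"
proof (rule dominatedI)
  show "conv f g \<in> borel_measurable borel"
    using f g by (intro measurable_conv) (auto simp: dominated_def)
  fix k
  have "norm (conv f g k) \<le> (LINT l|lborel. a * b * (M l * M (k - l)))"
    unfolding conv_def
    by (rule Bochner_Integration.integral_norm_bound_integral[OF conv_integrable[OF f g ab(1)] _
        conv_integrand_le[OF f g ab(1)]]) (use M_conv_integrable in simp)
  also have "\<dots> \<le> a * b * (\<kappa> * M k)"
    using M_conv_le ab by (simp add: mult_left_mono)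
  finally show "norm (conv f g k) \<le> a * b * \<kappa> * M k" by (simp add: mult.assoc)
qed

lemma conv_diff_left:
  assumes "dominated M a f" "dominated M a' f'" "dominated M b g" "0 \<le> a" "0 \<le> a'"
  shows "conv (\<lambda>k. f k - f' k) g k = conv f g k - conv f' g k"
  unfolding conv_def left_diff_distrib
  by (rule Bochner_Integration.integral_diff[OF conv_integrable[OF assms(1,3,4)] conv_integrable[OF assms(2,3,5)]])

lemma conv_diff_right:
  assumes "dominated M a f" "dominated M b g" "dominated M b' g'" "0 \<le> a"
  shows "conv f (\<lambda>k. g k - g' k) k = conv f g k - conv f g' k"
  unfolding conv_def right_diff_distrib
  by (rule Bochner_Integration.integral_diff[OF conv_integrable[OF assms(1,2,4)] conv_integrable[OF assms(1,3,4)]])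

lemma conv_add_right:
  assumes "dominated M a f" "dominated M b g" "dominated M b' g'" "0 \<le> a"
  shows "conv f (\<lambda>k. g k + g' k) k = conv f g k + conv f g' k"
  unfolding conv_def distrib_left
  by (rule Bochner_Integration.integral_add[OF conv_integrable[OF assms(1,2,4)] conv_integrable[OF assms(1,3,4)]])

lemma conv_diff_conv:
  assumes "dominated M a f" "dominated M a' f'" "dominated M b g" "dominated M b' g'" "0 \<le> a" "0 \<le> a'"
  shows "conv f g k - conv f' g' k = conv (\<lambda>k. f k - f' k) g k + conv f' (\<lambda>k. g k - g' k) k"
  using assms by (simp add: conv_diff_left conv_diff_right)

lemma dominated_conv_diff:
  assumes f: "dominated M a f" "dominated M a f'" and g: "dominated M b g" "dominated M b g'"
    and df: "dominated M (a * D) (\<lambda>k. f k - f' k)" and dg: "dominated M (b * D) (\<lambda>k. g k - g' k)"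
    and nn: "0 \<le> a" "0 \<le> b" "0 \<le> D"
  shows "dominated M (2 * a * b * \<kappa> * D) (\<lambda>k. conv f g k - conv f' g' k)"
proof -
  have "dominated M (a * D * b * \<kappa> + a * (b * D) * \<kappa>)
      (\<lambda>k. conv (\<lambda>k. f k - f' k) g k + conv f' (\<lambda>k. g k - g' k) k)"
    using f g df dg nn by (intro dominated_add dominated_conv) auto
  then show ?thesis
    using conv_diff_conv[OF f g nn(1,1)] by (simp add: algebra_simps)
qed

lemma dominated_conv_power:
  assumes "dominated M \<epsilon> f" "0 \<le> \<epsilon>"
  shows "dominated M (\<epsilon> * (\<epsilon> * \<kappa>) ^ n) (conv_power f n)"
proof (induction n)
  case (Suc n)
  have "dominated M (\<epsilon> * (\<epsilon> * (\<epsilon> * \<kappa>) ^ n) * \<kappa>) (conv f (conv_power f n))"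
    by (rule dominated_conv[OF assms(1) Suc]) (use assms \<kappa>_nonneg in auto)
  then show ?case by (simp add: mult_ac)
qed (use assms in simp)

text \<open>Telescoping \<open>f^(n+1) - g^(n+1)\<close> gives \<open>n + 1\<close> terms, each with one factor \<open>f - g\<close>.\<close>

lemma dominated_conv_power_diff:
  assumes f: "dominated M \<epsilon> f" and g: "dominated M \<epsilon> g" and d: "dominated M D (\<lambda>k. f k - g k)"
    and nn: "0 \<le> \<epsilon>" "0 \<le> D"
  shows "dominated M (real (n + 1) * (D * (\<epsilon> * \<kappa>) ^ n)) (\<lambda>k. conv_power f n k - conv_power g n k)"
proof (induction n)
  case (Suc n)
  note pf = dominated_conv_power[OF f nn(1), of n] and pg = dominated_conv_power[OF g nn(1), of n]
  have "dominated M (D * (\<epsilon> * (\<epsilon> * \<kappa>) ^ n) * \<kappa> + \<epsilon> * (real (n + 1) * (D * (\<epsilon> * \<kappa>) ^ n)) * \<kappa>)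
      (\<lambda>k. conv (\<lambda>k. f k - g k) (conv_power f n) k + conv g (\<lambda>k. conv_power f n k - conv_power g n k) k)"
    by (intro dominated_add dominated_conv pf d g Suc) (use nn \<kappa>_nonneg in auto)
  then show ?case
    using conv_diff_conv[OF f g pf pg nn(1,1)] by (simp add: algebra_simps)
qed (use d in simp)

lemma inverse_fourier_conv_power:
  assumes "dominated M \<epsilon> f" "0 \<le> \<epsilon>"
  shows "inverse_fourier (conv_power f n) x = inverse_fourier f x ^ Suc n"
proof (induction n)
  case (Suc n)
  show ?case
    using inverse_fourier_conv[OF dominated_integrable[OF assms(1)]
        dominated_integrable[OF dominated_conv_power[OF assms, of n]]] Suc by simp
qed simp

text \<open>The bounds \<open>|a n| \<le> 2\<close> and \<open>\<epsilon> \<kappa> \<le> 1/4\<close> cover the exponential and the logarithm and leave a convergent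
geometric series even after the factor \<open>n + 1\<close> that differences produce.\<close>

lemma conv_series_term_le:
  assumes f: "dominated M \<epsilon> f" "0 \<le> \<epsilon>" and a: "\<And>n. \<bar>a n\<bar> \<le> 2" and small: "\<epsilon> * \<kappa> \<le> 1/4"
  shows "norm (of_real (a n) * conv_power f n k) \<le> 2 * \<epsilon> * M k * (1/4) ^ n"
proof -
  have "norm (conv_power f n k) \<le> \<epsilon> * (\<epsilon> * \<kappa>) ^ n * M k"
    by (rule dominated_le[OF dominated_conv_power[OF f]])
  also have "\<dots> \<le> \<epsilon> * (1/4) ^ n * M k"
    using f(2) \<kappa>_nonneg small M_nonneg by (intro mult_right_mono mult_left_mono power_mono) auto
  finally have "\<bar>a n\<bar> * norm (conv_power f n k) \<le> 2 * (\<epsilon> * (1/4) ^ n * M k)"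
    using a by (intro mult_mono) auto
  then show ?thesis by (simp add: norm_mult mult_ac)
qed

lemma conv_series_summable:
  assumes "dominated M \<epsilon> f" "0 \<le> \<epsilon>" "\<And>n. \<bar>a n\<bar> \<le> 2" "\<epsilon> * \<kappa> \<le> 1/4"
  shows "summable (\<lambda>n. norm (of_real (a n) * conv_power f n k))"
  by (rule summable_comparison_test'[where g = "\<lambda>n. 2 * \<epsilon> * M k * (1/4) ^ n" and N = 0])
    (use conv_series_term_le[where a = a, OF assms] in \<open>auto intro!: summable_mult summable_geometric\<close>)

lemma dominated_conv_series:
  assumes f: "dominated M \<epsilon> f" "0 \<le> \<epsilon>" and a: "\<And>n. \<bar>a n\<bar> \<le> 2" and small: "\<epsilon> * \<kappa> \<le> 1/4"
  shows "dominated M (4 * \<epsilon>) (conv_series a f)"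
proof (rule dominatedI)
  have "conv_power f n \<in> borel_measurable borel" for n
    using dominated_conv_power[OF f, of n] by (simp add: dominated_def)
  then show "conv_series a f \<in> borel_measurable borel"
    unfolding conv_series_def[abs_def] by measurable
  fix k
  have geo: "(\<lambda>n. 2 * \<epsilon> * M k * (1/4) ^ n) sums (2 * \<epsilon> * M k * (1 / (1 - 1/4)))"
    by (intro sums_mult geometric_sums) simp
  have "norm (conv_series a f k) \<le> (\<Sum>n. 2 * \<epsilon> * M k * (1/4) ^ n)"
    unfolding conv_series_def
    by (rule norm_suminf_le[OF conv_series_term_le[where a = a, OF f a small] sums_summable[OF geo]])
  also have "\<dots> \<le> 4 * \<epsilon> * M k"
    using f(2) M_nonneg[of k] by (simp flip: sums_unique[OF geo])
  finally show "norm (conv_series a f k) \<le> 4 * \<epsilon> * M k" .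
qed

text \<open>Since the linear term vanishes, the series is quadratic, and the Lipschitz constant
is itself of the order \<open>\<epsilon> \<kappa>\<close> of the arguments.\<close>

lemma dominated_conv_series_diff:
  assumes f: "dominated M \<epsilon> f" and g: "dominated M \<epsilon> g" and d: "dominated M D (\<lambda>k. f k - g k)"
    and nn: "0 \<le> \<epsilon>" "0 \<le> D" and a: "\<And>n. \<bar>a n\<bar> \<le> 2" and small: "\<epsilon> * \<kappa> \<le> 1/4" and a0: "a 0 = 0"
  shows "dominated M (8 * \<epsilon> * \<kappa> * D) (\<lambda>k. conv_series a f k - conv_series a g k)"
proof (rule dominatedI)
  note mf = dominated_measurable[OF dominated_conv_series[where a = a, OF f nn(1) a small]]
    and mg = dominated_measurable[OF dominated_conv_series[where a = a, OF g nn(1) a small]]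
  show "(\<lambda>k. conv_series a f k - conv_series a g k) \<in> borel_measurable borel"
    using mf mg by (rule borel_measurable_diff)
  fix k
  define x where "x = \<epsilon> * \<kappa>"
  have x: "0 \<le> x" "x \<le> 1/4" using nn \<kappa>_nonneg small by (auto simp: x_def)
  define b where "b n = 4 * D * M k * x * (1/2) ^ n" for n :: nat
  have bnd: "norm (of_real (a (Suc n)) * conv_power f (Suc n) k - of_real (a (Suc n)) * conv_power g (Suc n) k) \<le> b n" for n
  proof -
    have "norm (conv_power f (Suc n) k - conv_power g (Suc n) k) \<le> real (Suc n + 1) * (D * x ^ Suc n) * M k"
      unfolding x_def by (rule dominated_le[OF dominated_conv_power_diff[OF f g d nn]])
    also have "\<dots> \<le> (2 ^ Suc n) * (D * x ^ Suc n) * M k"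
    proof -
      have "n + 2 \<le> 2 ^ Suc n" by (induction n) auto
      then have "real (n + 2) \<le> 2 ^ Suc n"
        using of_nat_le_iff[of "n + 2" "2 ^ Suc n", where 'a = real] by simp
      then show ?thesis
        using nn x M_nonneg by (intro mult_right_mono) auto
    qed
    also have "\<dots> = 2 * x * (2 * x) ^ n * D * M k" by (simp add: power_mult_distrib mult_ac)
    also have "\<dots> \<le> 2 * x * (1/2) ^ n * D * M k"
      using nn x M_nonneg by (intro mult_right_mono mult_left_mono power_mono) auto
    finally have "\<bar>a (Suc n)\<bar> * norm (conv_power f (Suc n) k - conv_power g (Suc n) k) \<le> 2 * (2 * x * (1/2) ^ n * D * M k)"
      using a by (intro mult_mono) auto
    then show ?thesis by (simp add: b_def mult_ac flip: right_diff_distrib norm_mult)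
        (simp add: norm_mult mult_ac)
  qed
  note sf = summable_norm_cancel[OF conv_series_summable[where a = a and k = k, OF f nn(1) a small]]
    and sg = summable_norm_cancel[OF conv_series_summable[where a = a, OF g nn(1) a small, where k = k]]
  have geo: "b sums (4 * D * M k * x * (1 / (1 - 1/2)))"
    unfolding b_def[abs_def] by (intro sums_mult geometric_sums) simp
  have "conv_series a f k - conv_series a g k
      = (\<Sum>n. of_real (a (Suc n)) * conv_power f (Suc n) k - of_real (a (Suc n)) * conv_power g (Suc n) k)"
    using suminf_split_head[OF summable_diff[OF sf sg]] suminf_diff[OF sf sg] a0
    by (simp add: conv_series_def)
  also have "norm \<dots> \<le> (\<Sum>n. b n)"
    by (rule norm_suminf_le[OF bnd sums_summable[OF geo]])
  also have "\<dots> = 8 * \<epsilon> * \<kappa> * D * M k"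
    by (simp add: x_def flip: sums_unique[OF geo])
  finally show "norm (conv_series a f k - conv_series a g k) \<le> 8 * \<epsilon> * \<kappa> * D * M k" .
qed

lemma inverse_fourier_conv_series:
  assumes f: "dominated M \<epsilon> f" "0 \<le> \<epsilon>" and a: "\<And>n. \<bar>a n\<bar> \<le> 2" and small: "\<epsilon> * \<kappa> \<le> 1/4"
  shows "(\<lambda>n. of_real (a n) * inverse_fourier f x ^ Suc n) sums inverse_fourier (conv_series a f) x"
proof -
  define e where "e k = exp (\<i> * of_real (k * x))" for k
  have ne: "norm (e k) = 1" for k by (simp add: e_def)
  have int: "integrable lborel (\<lambda>k. of_real (a n) * conv_power f n k * e k)" for n
    unfolding e_def
    by (intro integrable_fourier integrable_mult_right dominated_integrable[OF dominated_conv_power[OF f]])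
  have sm: "summable (\<lambda>n. norm (of_real (a n) * conv_power f n k * e k))" for k
    using conv_series_summable[where a = a and k = k, OF f a small] by (simp add: norm_mult ne)
  have smi: "summable (\<lambda>n. LINT k|lborel. norm (of_real (a n) * conv_power f n k * e k))"
  proof (rule summable_comparison_test'[where N = 0])
    show "summable (\<lambda>n. 2 * \<epsilon> * (LINT k|lborel. M k) * (1/4) ^ n)"
      by (intro summable_mult summable_geometric) simp
    fix n
    have "(LINT k|lborel. norm (of_real (a n) * conv_power f n k * e k)) \<le> (LINT k|lborel. 2 * \<epsilon> * M k * (1/4) ^ n)"
    proof (rule integral_mono)
      show "integrable lborel (\<lambda>k. norm (of_real (a n) * conv_power f n k * e k))"
        by (rule integrable_norm[OF int])
      show "norm (of_real (a n) * conv_power f n k * e k) \<le> 2 * \<epsilon> * M k * (1/4) ^ n" for k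
        using conv_series_term_le[where a = a, OF f a small, of n k] by (simp add: norm_mult ne)
    qed (use M_integrable in simp)
    then show "norm (LINT k|lborel. norm (of_real (a n) * conv_power f n k * e k)) \<le> 2 * \<epsilon> * (LINT k|lborel. M k) * (1/4) ^ n"
      by simp
  qed
  have "(\<lambda>n. LINT k|lborel. of_real (a n) * conv_power f n k * e k) sums (LINT k|lborel. (\<Sum>n. of_real (a n) * conv_power f n k * e k))"
    by (rule sums_integral[OF int _ smi]) (use sm in simp)
  moreover have "(\<Sum>n. of_real (a n) * conv_power f n k * e k) = conv_series a f k * e k" for k
    unfolding conv_series_def
    by (rule suminf_mult2[symmetric, OF summable_norm_cancel[OF conv_series_summable[where a = a, OF f a small]]])
  moreover have "(LINT k|lborel. of_real (a n) * conv_power f n k * e k) = of_real (a n) * inverse_fourier f x ^ Suc n" for n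
    using inverse_fourier_cmult[of "of_real (a n)" "conv_power f n" x] inverse_fourier_conv_power[OF f, of n x]
    by (simp add: inverse_fourier_def e_def)
  ultimately show ?thesis by (simp add: inverse_fourier_def e_def)
qed

lemma hermitian_conv_series:
  assumes f: "dominated M \<epsilon> f" "0 \<le> \<epsilon>" and a: "\<And>n. \<bar>a n\<bar> \<le> 2" and small: "\<epsilon> * \<kappa> \<le> 1/4" and h: "hermitian f"
  shows "hermitian (conv_series a f)"
  unfolding hermitian_def
proof
  fix k
  have "(\<lambda>n. of_real (a n) * conv_power f n k) sums conv_series a f k"
    unfolding conv_series_def by (rule summable_sums[OF summable_norm_cancel[OF conv_series_summable[where a = a, OF f a small]]])
  then have "(\<lambda>n. cnj (of_real (a n) * conv_power f n k)) sums cnj (conv_series a f k)"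
    by (rule bounded_linear.sums[OF bounded_linear_cnj])
  moreover have "cnj (of_real (a n) * conv_power f n k) = of_real (a n) * conv_power f n (- k)" for n
    using hermitian_conv_power[OF h, of n] by (simp add: hermitian_def)
  ultimately have "(\<lambda>n. of_real (a n) * conv_power f n (- k)) sums cnj (conv_series a f k)"
    by (simp only:)
  then show "conv_series a f (- k) = cnj (conv_series a f k)"
    unfolding conv_series_def[of a f "- k"] by (rule sums_unique[symmetric])
qed

lemma continuous_conv:
  fixes f g :: "real \<Rightarrow> real \<Rightarrow> complex"
  assumes f: "\<And>t. t \<in> S \<Longrightarrow> dominated M a (f t)" and g: "\<And>t. t \<in> S \<Longrightarrow> dominated M b (g t)"
    and cf: "\<And>k. continuous_on S (\<lambda>t. f t k)" and cg: "\<And>k. continuous_on S (\<lambda>t. g t k)" and a: "0 \<le> a"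
  shows "continuous_on S (\<lambda>t. conv (f t) (g t) k)"
  unfolding continuous_on_def conv_def
proof
  fix t assume t: "t \<in> S"
  show "((\<lambda>t. LINT l|lborel. f t l * g t (k - l)) \<longlongrightarrow> (LINT l|lborel. f t l * g t (k - l))) (at t within S)"
  proof (rule tendsto_integral_dominated[where f = "\<lambda>t l. f t l * g t (k - l)" and F = "\<lambda>l. f t l * g t (k - l)"])
    show "((\<lambda>t. f t l * g t (k - l)) \<longlongrightarrow> f t l * g t (k - l)) (at t within S)" for l
      using cf cg t by (intro tendsto_mult) (auto simp: continuous_on_def)
    show m: "(\<lambda>l. f t l * g t (k - l)) \<in> borel_measurable borel" if "t \<in> S" for t
      using borel_measurable_integrable[OF conv_integrable[OF f g a]] that by simp
    from m[OF t] show "(\<lambda>l. f t l * g t (k - l)) \<in> borel_measurable borel" .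
    show "norm (f t l * g t (k - l)) \<le> a * b * (M l * M (k - l))" if "t \<in> S" for t l
      by (rule conv_integrand_le[OF f g a]) (use that in auto)
    show "integrable lborel (\<lambda>l. a * b * (M l * M (k - l)))"
      using M_conv_integrable by simp
  qed
qed

lemma continuous_conv_power:
  fixes f :: "real \<Rightarrow> real \<Rightarrow> complex"
  assumes "\<And>t. t \<in> S \<Longrightarrow> dominated M \<epsilon> (f t)" "\<And>k. continuous_on S (\<lambda>t. f t k)" "0 \<le> \<epsilon>"
  shows "continuous_on S (\<lambda>t. conv_power (f t) n k)"
proof (induction n arbitrary: k)
  case (Suc n)
  show ?case unfolding conv_power.simps
    by (rule continuous_conv[OF assms(1) dominated_conv_power[OF assms(1,3)] assms(2) Suc assms(3)])
qed (use assms in simp)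

lemma continuous_conv_series:
  fixes f :: "real \<Rightarrow> real \<Rightarrow> complex"
  assumes f: "\<And>t. t \<in> S \<Longrightarrow> dominated M \<epsilon> (f t)" and c: "\<And>k. continuous_on S (\<lambda>t. f t k)" and e: "0 \<le> \<epsilon>"
    and a: "\<And>n. \<bar>a n\<bar> \<le> 2" and small: "\<epsilon> * \<kappa> \<le> 1/4"
  shows "continuous_on S (\<lambda>t. conv_series a (f t) k)"
proof -
  have "uniform_limit S (\<lambda>n t. \<Sum>i<n. of_real (a i) * conv_power (f t) i k) (\<lambda>t. conv_series a (f t) k) sequentially"
    unfolding conv_series_def
    by (rule Weierstrass_m_test[where M = "\<lambda>n. 2 * \<epsilon> * M k * (1/4) ^ n"])
      (use conv_series_term_le[where a = a, OF f e a small] in \<open>auto intro!: summable_mult summable_geometric\<close>)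
  then show ?thesis
    by (rule uniform_limit_theorem[rotated])
      (auto intro!: always_eventually continuous_on_sum continuous_on_mult continuous_on_const
        continuous_conv_power[OF f c e])
qed

end

section \<open>Uniqueness by the maximum principle\<close>

lemma second_derivative_nonpos_at_max:
  fixes f f' :: "real \<Rightarrow> real"
  assumes d: "d > 0" and f: "\<And>x. \<bar>x - x0\<bar> < d \<Longrightarrow> (f has_real_derivative f' x) (at x)"
    and f': "(f' has_real_derivative D) (at x0)" and max: "\<And>x. \<bar>x - x0\<bar> < d \<Longrightarrow> f x \<le> f x0"
  shows "D \<le> 0"
proof (rule ccontr)
  assume "\<not> D \<le> 0"
  then obtain e where e: "e > 0" "\<And>h. 0 < h \<Longrightarrow> h < e \<Longrightarrow> f' x0 < f' (x0 + h)"
    using DERIV_pos_inc_right[OF f'] by auto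
  have f0: "f' x0 = 0"
    by (rule DERIV_local_max[OF f[of x0] d]) (use max d in \<open>auto simp: abs_minus_commute\<close>)
  define h where "h = min d e / 2"
  have h: "0 < h" "h < d" "h < e" using d e(1) by (auto simp: h_def)
  have "f x0 < f (x0 + h)"
  proof (rule DERIV_pos_imp_increasing_open[where f = f])
    show "\<exists>y. DERIV f x :> y \<and> 0 < y" if "x0 < x" "x < x0 + h" for x
      using f[of x] e(2)[of "x - x0"] f0 that h by (intro exI[of _ "f' x"]) auto
    show "continuous_on {x0..x0 + h} f"
      by (intro continuous_at_imp_continuous_on ballI DERIV_isCont[OF f]) (use h in auto)
  qed (use h in simp)
  with max[of "x0 + h"] h show False by simp
qed

text \<open>The line is not compact, so a positive value of \<open>u\<close> need not be attained as a maximum. Subtracting the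
barrier \<open>\<epsilon> (1 + x^2 + 3 (t - a))\<close> forces the maximum of the difference into a bounded set. The slope \<open>3\<close>
exceeds the second derivative \<open>2\<close> of \<open>x^2\<close>, which makes the barrier a strict supersolution of the
heat equation; the factor \<open>exp (- \<Lambda> (t - a))\<close> removes the term of order zero.\<close>

lemma maximum_principle_real_line:
  fixes u ut ux uxx :: "real \<Rightarrow> real \<Rightarrow> real"
  assumes cont: "continuous_on ({a..b} \<times> UNIV) (\<lambda>z. u (fst z) (snd z))"
    and bdd: "\<And>t x. t \<in> {a..b} \<Longrightarrow> u t x \<le> B" and init: "\<And>x. u a x \<le> 0"
    and dt: "\<And>t x. t \<in> {a<..<b} \<Longrightarrow> ((\<lambda>t. u t x) has_real_derivative ut t x) (at t)"
    and dx: "\<And>t x. t \<in> {a<..<b} \<Longrightarrow> (u t has_real_derivative ux t x) (at x)"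
    and dxx: "\<And>t x. t \<in> {a<..<b} \<Longrightarrow> (ux t has_real_derivative uxx t x) (at x)"
    and ineq: "\<And>t x. t \<in> {a<..<b} \<Longrightarrow> ut t x \<le> uxx t x + \<Lambda> * u t x"
    and t1: "t1 \<in> {a<..<b}" and L0: "0 \<le> \<Lambda>"
  shows "u t1 x1 \<le> 0"
proof (rule ccontr)
  assume "\<not> u t1 x1 \<le> 0"
  then have pos: "u t1 x1 > 0" by simp
  have B0: "B > 0" using bdd[of t1 x1] t1 pos by auto
  define E where "E t = exp (- \<Lambda> * (t - a))" for t
  have E: "0 < E t" "t \<ge> a \<Longrightarrow> E t \<le> 1" for t using L0 by (auto simp: E_def)
  \<comment> \<open>At this size the barrier takes away half of the positive value at the point \<open>(t1, x1)\<close>.\<close>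
  define \<epsilon> where "\<epsilon> = E t1 * u t1 x1 / (2 * (1 + x1\<^sup>2 + 3 * (t1 - a)))"
  have den: "1 + x1\<^sup>2 + 3 * (t1 - a) > 0" using t1 by (auto intro!: add_pos_nonneg)
  have \<epsilon>: "\<epsilon> > 0" unfolding \<epsilon>_def using den pos E by auto
  define w where "w t x = E t * u t x - \<epsilon> * (1 + x\<^sup>2 + 3 * (t - a))" for t x
  have w1: "w t1 x1 > 0"
  proof -
    have "\<epsilon> * (1 + x1\<^sup>2 + 3 * (t1 - a)) = E t1 * u t1 x1 / 2"
      using den by (simp add: \<epsilon>_def field_simps)
    moreover have "0 < E t1 * u t1 x1" using E(1)[of t1] pos by simp
    ultimately show ?thesis unfolding w_def by linarith
  qed
  \<comment> \<open>For \<open>|x| = L\<close> the barrier exceeds the bound \<open>B\<close> for \<open>u\<close>.\<close>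
  define L where "L = \<bar>x1\<bar> + B / \<epsilon> + 1"
  have "0 < B / \<epsilon>" using B0 \<epsilon> by simp
  then have L: "\<bar>x1\<bar> < L" "B / \<epsilon> \<le> L" "1 \<le> L" by (auto simp: L_def)
  have wneg: "w t x < 0" if "t \<in> {a..t1}" "\<bar>x\<bar> = L" for t x
  proof -
    have "E t * u t x \<le> B"
    proof (cases "u t x \<ge> 0")
      case True
      then have "E t * u t x \<le> 1 * u t x" using E that by (intro mult_right_mono) auto
      also have "\<dots> \<le> B" using bdd that t1 by auto
      finally show ?thesis .
    qed (use E(1)[of t] B0 mult_pos_neg[of "E t" "u t x"] in simp)
    also have "B \<le> \<epsilon> * L" using L(2) \<epsilon> by (simp add: field_simps)
    also have "\<dots> \<le> \<epsilon> * x\<^sup>2"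
    proof -
      have "L * 1 \<le> L * L" using L by (intro mult_left_mono) auto
      moreover have "x\<^sup>2 = L * L" using that(2) by (metis power2_abs power2_eq_square)
      ultimately show ?thesis using \<epsilon> by simp
    qed
    also have "\<dots> < \<epsilon> * (1 + x\<^sup>2 + 3 * (t - a))" using \<epsilon> that by auto
    finally show ?thesis by (simp add: w_def)
  qed
  have "continuous_on ({a..t1} \<times> {-L..L}) (\<lambda>z. w (fst z) (snd z))" (is "continuous_on ?K ?w")
    unfolding w_def E_def
    by (intro continuous_intros continuous_on_subset[OF cont]) (use t1 in auto)
  moreover have "compact ({a..t1} \<times> {-L..L})" by (intro compact_Times) auto
  moreover have "{a..t1} \<times> {-L..L} \<noteq> {}" using t1 L by auto
  ultimately have "\<exists>z\<in>?K. \<forall>y\<in>?K. ?w y \<le> ?w z" by (intro continuous_attains_sup)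
  then obtain z where z: "z \<in> ?K" "\<And>y. y \<in> ?K \<Longrightarrow> ?w y \<le> ?w z" by blast
  obtain t x where tx: "z = (t, x)" by fastforce
  have t: "t \<in> {a..t1}" and x: "x \<in> {-L..L}" using z(1) by (auto simp: tx)
  have max: "w s y \<le> w t x" if "s \<in> {a..t1}" "y \<in> {-L..L}" for s y
    using z(2)[of "(s, y)"] that by (simp add: tx)
  have "w t1 x1 \<le> w t x" by (rule max) (use t1 L(1) in \<open>auto simp: abs_less_iff\<close>)
  then have wpos: "w t x > 0" using w1 by simp
  have xi: "\<bar>x\<bar> < L" using wneg[of t x] wpos t x by (cases "\<bar>x\<bar> = L") auto
  have "t \<noteq> a"
  proof
    assume "t = a"
    then have "w t x \<le> - \<epsilon> * (1 + x\<^sup>2)" using init[of x] by (simp add: w_def E_def)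
    moreover have "\<epsilon> * (1 + x\<^sup>2) \<ge> 0" using \<epsilon> by simp
    ultimately show False using wpos by simp
  qed
  then have ti: "t \<in> {a<..<b}" "a < t" using t t1 by auto
  have "E t * uxx t x - 2 * \<epsilon> \<le> 0"
  proof (rule second_derivative_nonpos_at_max[where f = "w t" and f' = "\<lambda>x. E t * ux t x - 2 * \<epsilon> * x" and ?x0.0 = x and d = "L - \<bar>x\<bar>"])
    show "(w t has_real_derivative E t * ux t y - 2 * \<epsilon> * y) (at y)" for y
      unfolding w_def[abs_def] by (auto intro!: derivative_eq_intros dx ti)
    show "((\<lambda>x. E t * ux t x - 2 * \<epsilon> * x) has_real_derivative E t * uxx t x - 2 * \<epsilon>) (at x)"
      by (auto intro!: derivative_eq_intros dxx ti)
    show "w t y \<le> w t x" if "\<bar>y - x\<bar> < L - \<bar>x\<bar>" for y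
      using max[of t y] t that by (auto simp: abs_if split: if_splits)
  qed (use xi in simp)
  moreover have "E t * ut t x - \<Lambda> * E t * u t x - 3 * \<epsilon> \<ge> 0"
  proof (rule ccontr)
    assume neg: "\<not> ?thesis"
    have "((\<lambda>t. w t x) has_real_derivative (E t * ut t x - \<Lambda> * E t * u t x - 3 * \<epsilon>)) (at t)"
      unfolding w_def E_def by (auto intro!: derivative_eq_intros dt ti simp: algebra_simps)
    from DERIV_neg_dec_left[OF this] neg
    obtain d where d: "d > 0" "\<And>h. 0 < h \<Longrightarrow> h < d \<Longrightarrow> w t x < w (t - h) x" by auto
    define h where "h = min d (t - a) / 2"
    have "0 < h" "h < d" "h < t - a" using d ti by (auto simp: h_def)
    then show False using d(2)[of h] max[of "t - h" x] t x by auto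
  qed
  moreover have "E t * ut t x \<le> E t * (uxx t x + \<Lambda> * u t x)"
    using ineq[OF ti(1)] E(1)[of t] by (intro mult_left_mono) auto
  ultimately show False using \<epsilon> by (simp add: algebra_simps)
qed

text \<open>The solution class of \<open>ginzburg_landau_solution\<close> on a compact time interval, with the equation in its
interior; solutions are constructed on such intervals and then glued.\<close>

definition gl_on :: "real \<Rightarrow> real \<Rightarrow> (real \<Rightarrow> real \<Rightarrow> complex) \<Rightarrow> bool" where
  "gl_on a b A \<longleftrightarrow>
     (\<forall>T\<in>{a..b}. bounded (range (A T)) \<and> uniformly_continuous_on UNIV (A T)) \<and>
     (\<forall>T\<in>{a..b}. uniform_limit UNIV A (A T) (at T within {a..b})) \<and>
     (\<exists>AX AXX. \<forall>T\<in>{a<..<b}. \<forall>X.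
        ((\<lambda>x. A T x) has_vector_derivative AX T X) (at X) \<and>
        ((\<lambda>x. AX T x) has_vector_derivative AXX T X) (at X) \<and>
        ((\<lambda>t. A t X) has_vector_derivative
           (AXX T X + A T X - A T X * of_real ((norm (A T X))\<^sup>2))) (at T))"

lemma gl_on_time_continuous:
  assumes A: "gl_on a b A" and T: "T \<in> {a..b}" and e: "e > 0"
  shows "\<exists>d>0. \<forall>t\<in>{a..b}. dist t T < d \<longrightarrow> (\<forall>x. dist (A t x) (A T x) < e)"
proof -
  have "uniform_limit UNIV A (A T) (at T within {a..b})" using A T by (simp add: gl_on_def)
  then obtain d where d: "d > 0" "\<And>t. t \<in> {a..b} \<Longrightarrow> t \<noteq> T \<Longrightarrow> dist t T < d \<Longrightarrow> \<forall>x. dist (A t x) (A T x) < e"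
    using e unfolding uniform_limit_iff eventually_at by auto
  then show ?thesis using e by (intro exI[of _ d]) (metis dist_self)
qed

lemma gl_on_bounded:
  assumes A: "gl_on a b A"
  shows "\<exists>R\<ge>0. \<forall>t\<in>{a..b}. \<forall>x. norm (A t x) \<le> R"
proof -
  have "\<exists>d R. d > 0 \<and> (\<forall>t\<in>{a..b}. dist t T < d \<longrightarrow> (\<forall>x. norm (A t x) \<le> R))" if T: "T \<in> {a..b}" for T
  proof -
    obtain d where d: "d > 0" "\<And>t x. t \<in> {a..b} \<Longrightarrow> dist t T < d \<Longrightarrow> dist (A t x) (A T x) < 1"
      using gl_on_time_continuous[OF A T, of 1] by auto
    have "bounded (range (A T))" using A T by (simp add: gl_on_def)
    then obtain R where R: "\<And>x. norm (A T x) \<le> R" by (auto simp: bounded_iff)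
    have "norm (A t x) \<le> R + 1" if "t \<in> {a..b}" "dist t T < d" for t x
      using d(2)[OF that, of x] R[of x] norm_triangle_sub[of "A t x" "A T x"] by (simp add: dist_norm)
    then show ?thesis using d(1) by blast
  qed
  then obtain d R where dR: "\<And>T. T \<in> {a..b} \<Longrightarrow> d T > 0"
      "\<And>T t x. T \<in> {a..b} \<Longrightarrow> t \<in> {a..b} \<Longrightarrow> dist t T < d T \<Longrightarrow> norm (A t x) \<le> R T"
    by metis
  have "{a..b} \<subseteq> (\<Union>T\<in>{a..b}. ball T (d T))" using dR(1) by force
  then obtain C where C: "C \<subseteq> {a..b}" "finite C" "{a..b} \<subseteq> (\<Union>T\<in>C. ball T (d T))"
    by (rule compactE_image[OF compact_Icc, rotated]) auto
  have "norm (A t x) \<le> (\<Sum>T\<in>C. \<bar>R T\<bar>)" if t: "t \<in> {a..b}" for t x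
  proof -
    obtain T where T: "T \<in> C" "dist t T < d T" using C(3) t by (auto simp: dist_commute)
    then have "norm (A t x) \<le> \<bar>R T\<bar>" using dR(2)[of T t x] t C(1) by force
    also have "\<dots> \<le> (\<Sum>T\<in>C. \<bar>R T\<bar>)" by (rule member_le_sum) (use T C in auto)
    finally show ?thesis .
  qed
  then show ?thesis by (intro exI[of _ "\<Sum>T\<in>C. \<bar>R T\<bar>"]) (auto intro: sum_nonneg)
qed

lemma gl_on_continuous:
  assumes A: "gl_on a b A"
  shows "continuous_on ({a..b} \<times> UNIV) (\<lambda>z. A (fst z) (snd z))"
  unfolding continuous_on_iff
proof (intro ballI allI impI)
  fix z :: "real \<times> real" and e :: real assume z: "z \<in> {a..b} \<times> UNIV" and e: "e > 0"
  obtain T X where TX: "z = (T, X)" by fastforce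
  have T: "T \<in> {a..b}" using z TX by simp
  obtain d1 where d1: "d1 > 0" "\<And>t x. t \<in> {a..b} \<Longrightarrow> dist t T < d1 \<Longrightarrow> dist (A t x) (A T x) < e / 2"
    using gl_on_time_continuous[OF A T, of "e / 2"] e by auto
  have "uniformly_continuous_on UNIV (A T)" using A T by (simp add: gl_on_def)
  then obtain d2 where d2: "d2 > 0" "\<And>x y. dist x y < d2 \<Longrightarrow> dist (A T x) (A T y) < e / 2"
    unfolding uniformly_continuous_on_def using e by (metis UNIV_I half_gt_zero)
  have "dist (A (fst y) (snd y)) (A (fst z) (snd z)) < e" if "y \<in> {a..b} \<times> UNIV" "dist y z < min d1 d2" for y
  proof -
    have "dist (fst y) T < d1" "dist (snd y) X < d2"
      using that dist_fst_le[of y z] dist_snd_le[of y z] by (auto simp: TX)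
    then have "dist (A (fst y) (snd y)) (A T (snd y)) < e / 2" "dist (A T (snd y)) (A T X) < e / 2"
      using d1 d2 that by auto
    then show ?thesis
      using dist_triangle[of "A (fst y) (snd y)" "A T X" "A T (snd y)"] by (simp add: TX)
  qed
  then show "\<exists>d>0. \<forall>y\<in>{a..b} \<times> UNIV. dist y z < d \<longrightarrow> dist (A (fst y) (snd y)) (A (fst z) (snd z)) < e"
    using d1(1) d2(1) by (intro exI[of _ "min d1 d2"]) auto
qed

lemma cubic_lipschitz:
  fixes z w :: complex
  assumes "norm z \<le> R" "norm w \<le> R"
  shows "norm ((z - z * of_real ((norm z)\<^sup>2)) - (w - w * of_real ((norm w)\<^sup>2))) \<le> (1 + 3 * R\<^sup>2) * norm (z - w)"
proof -
  have R: "0 \<le> R" using assms(1) norm_ge_zero order_trans by blast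
  have "\<bar>(norm z)\<^sup>2 - (norm w)\<^sup>2\<bar> = \<bar>norm z - norm w\<bar> * (norm z + norm w)"
    by (simp add: power2_eq_square square_diff_square_factored abs_mult mult.commute)
  also have "\<dots> \<le> norm (z - w) * (2 * R)"
    using norm_triangle_ineq3[of z w] assms by (intro mult_mono) (linarith | simp)+
  finally have 1: "\<bar>(norm z)\<^sup>2 - (norm w)\<^sup>2\<bar> \<le> norm (z - w) * (2 * R)" .
  have "(z - z * of_real ((norm z)\<^sup>2)) - (w - w * of_real ((norm w)\<^sup>2))
      = (z - w) - (z - w) * of_real ((norm z)\<^sup>2) - w * of_real ((norm z)\<^sup>2 - (norm w)\<^sup>2)" (is "_ = ?X - ?Y - ?Z")
    by (simp add: algebra_simps)
  moreover have "norm (?X - ?Y - ?Z) \<le> norm ?X + norm ?Y + norm ?Z"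
    using norm_triangle_ineq4[of "?X - ?Y" ?Z] norm_triangle_ineq4[of ?X ?Y] by linarith
  moreover have "norm ?Y = norm (z - w) * (norm z)\<^sup>2" "norm ?Z = norm w * \<bar>(norm z)\<^sup>2 - (norm w)\<^sup>2\<bar>"
    unfolding norm_mult norm_of_real by simp_all
  ultimately have "norm ((z - z * of_real ((norm z)\<^sup>2)) - (w - w * of_real ((norm w)\<^sup>2)))
      \<le> norm (z - w) + norm (z - w) * (norm z)\<^sup>2 + norm w * \<bar>(norm z)\<^sup>2 - (norm w)\<^sup>2\<bar>"
    by (simp only:)
  also have "\<dots> \<le> norm (z - w) + norm (z - w) * R\<^sup>2 + R * (norm (z - w) * (2 * R))"
    using assms 1 R by (intro add_mono mult_mono power_mono order_refl) auto
  finally show ?thesis by (simp add: algebra_simps power2_eq_square)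
qed

text \<open>For a difference \<open>D = A - B\<close> the function \<open>|D|^2\<close> satisfies
\<open>(|D|^2)_t \<le> (|D|^2)_xx - 2 |D_x|^2 + \<Lambda> |D|^2\<close> because both solutions are bounded and the cubic
nonlinearity is Lipschitz on bounded sets.\<close>

lemma gl_on_unique:
  assumes A: "gl_on a b A" and B: "gl_on a b B" and init: "A a = B a" and t1: "t1 \<in> {a..<b}"
  shows "A t1 = B t1"
proof (cases "t1 = a")
  case False
  with t1 have t1: "t1 \<in> {a<..<b}" by auto
  obtain RA where RA: "RA \<ge> 0" "\<And>t x. t \<in> {a..b} \<Longrightarrow> norm (A t x) \<le> RA" using gl_on_bounded[OF A] by auto
  obtain RB where RB: "RB \<ge> 0" "\<And>t x. t \<in> {a..b} \<Longrightarrow> norm (B t x) \<le> RB" using gl_on_bounded[OF B] by auto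
  define R where "R = max RA RB"
  have R: "norm (A t x) \<le> R" "norm (B t x) \<le> R" if "t \<in> {a..b}" for t x
    using RA(2)[OF that] RB(2)[OF that] by (auto simp: R_def le_max_iff_disj)
  define f where "f z = z - z * of_real ((norm z)\<^sup>2)" for z :: complex
  obtain AX AXX where AX: "\<And>T X. T \<in> {a<..<b} \<Longrightarrow> ((\<lambda>x. A T x) has_vector_derivative AX T X) (at X)"
      "\<And>T X. T \<in> {a<..<b} \<Longrightarrow> ((\<lambda>x. AX T x) has_vector_derivative AXX T X) (at X)"
      "\<And>T X. T \<in> {a<..<b} \<Longrightarrow> ((\<lambda>t. A t X) has_vector_derivative (AXX T X + f (A T X))) (at T)"
    using A unfolding gl_on_def f_def add_diff_eq by metis
  obtain BX BXX where BX: "\<And>T X. T \<in> {a<..<b} \<Longrightarrow> ((\<lambda>x. B T x) has_vector_derivative BX T X) (at X)"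
      "\<And>T X. T \<in> {a<..<b} \<Longrightarrow> ((\<lambda>x. BX T x) has_vector_derivative BXX T X) (at X)"
      "\<And>T X. T \<in> {a<..<b} \<Longrightarrow> ((\<lambda>t. B t X) has_vector_derivative (BXX T X + f (B T X))) (at T)"
    using B unfolding gl_on_def f_def add_diff_eq by metis
  define D where "D t x = A t x - B t x" for t x
  define DX where "DX t x = AX t x - BX t x" for t x
  define DXX where "DXX t x = AXX t x - BXX t x" for t x
  define N where "N t x = f (A t x) - f (B t x)" for t x
  have D1: "(D T has_vector_derivative DX T X) (at X)" and D2: "(DX T has_vector_derivative DXX T X) (at X)"
    and D3: "((\<lambda>t. D t X) has_vector_derivative DXX T X + N T X) (at T)" if "T \<in> {a<..<b}" for T X
    unfolding D_def[abs_def] DX_def[abs_def] DXX_def N_def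
    using has_vector_derivative_diff[OF AX(1)[OF that, of X] BX(1)[OF that, of X]]
      has_vector_derivative_diff[OF AX(2)[OF that, of X] BX(2)[OF that, of X]]
      has_vector_derivative_diff[OF AX(3)[OF that, of X] BX(3)[OF that, of X]]
    by (simp_all add: algebra_simps)
  note D = D1[unfolded has_vector_derivative_complex_iff] D2[unfolded has_vector_derivative_complex_iff]
    D3[unfolded has_vector_derivative_complex_iff]
  define u where "u t x = (Re (D t x))\<^sup>2 + (Im (D t x))\<^sup>2" for t x
  have u: "u t x = (norm (D t x))\<^sup>2" for t x by (simp add: u_def cmod_power2)
  define \<Lambda> where "\<Lambda> = 2 * (1 + 3 * R\<^sup>2)"
  have "u t1 x \<le> 0" for x
  proof (rule maximum_principle_real_line[where u = u and a = a and b = b and B = "(2 * R)\<^sup>2" and \<Lambda> = \<Lambda>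
      and ux = "\<lambda>t x. 2 * Re (D t x) * Re (DX t x) + 2 * Im (D t x) * Im (DX t x)"
      and uxx = "\<lambda>t x. 2 * (Re (DX t x))\<^sup>2 + 2 * (Im (DX t x))\<^sup>2 + 2 * Re (D t x) * Re (DXX t x) + 2 * Im (D t x) * Im (DXX t x)"
      and ut = "\<lambda>t x. 2 * Re (D t x) * Re (DXX t x + N t x) + 2 * Im (D t x) * Im (DXX t x + N t x)"])
    show "continuous_on ({a..b} \<times> UNIV) (\<lambda>z. u (fst z) (snd z))"
      unfolding u D_def by (intro continuous_intros gl_on_continuous A B)
    show "u t x \<le> (2 * R)\<^sup>2" if "t \<in> {a..b}" for t x
      unfolding u D_def using R[OF that, of x] norm_triangle_ineq4[of "A t x" "B t x"] by (intro power_mono) auto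
    show "u a x \<le> 0" for x by (simp add: u D_def init)
    show "((\<lambda>t. u t x) has_real_derivative 2 * Re (D t x) * Re (DXX t x + N t x) + 2 * Im (D t x) * Im (DXX t x + N t x)) (at t)"
      if "t \<in> {a<..<b}" for t x
      unfolding u_def
      by (rule DERIV_cong[OF DERIV_add[OF
              DERIV_power[OF D(3)[OF that, of x, THEN conjunct1], of 2]
              DERIV_power[OF D(3)[OF that, of x, THEN conjunct2], of 2]]]) simp
    show "(u t has_real_derivative 2 * Re (D t x) * Re (DX t x) + 2 * Im (D t x) * Im (DX t x)) (at x)"
      if "t \<in> {a<..<b}" for t x
      unfolding u_def[abs_def]
      by (rule DERIV_cong[OF DERIV_add[OF
              DERIV_power[OF D(1)[OF that, of x, THEN conjunct1], of 2]
              DERIV_power[OF D(1)[OF that, of x, THEN conjunct2], of 2]]]) simp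
    show "((\<lambda>x. 2 * Re (D t x) * Re (DX t x) + 2 * Im (D t x) * Im (DX t x)) has_real_derivative
       2 * (Re (DX t x))\<^sup>2 + 2 * (Im (DX t x))\<^sup>2 + 2 * Re (D t x) * Re (DXX t x) + 2 * Im (D t x) * Im (DXX t x)) (at x)"
      if "t \<in> {a<..<b}" for t x
      by (rule DERIV_cong[OF DERIV_add[OF
              DERIV_mult[OF DERIV_cmult[OF D(1)[OF that, of x, THEN conjunct1], of 2] D(2)[OF that, of x, THEN conjunct1]]
              DERIV_mult[OF DERIV_cmult[OF D(1)[OF that, of x, THEN conjunct2], of 2] D(2)[OF that, of x, THEN conjunct2]]]])
        (simp add: power2_eq_square)
    fix t x assume t: "t \<in> {a<..<b}"
    have "norm (N t x) \<le> (1 + 3 * R\<^sup>2) * norm (D t x)"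
      unfolding N_def f_def D_def using R[of t x] t by (intro cubic_lipschitz) auto
    then have "norm (D t x) * norm (N t x) \<le> norm (D t x) * ((1 + 3 * R\<^sup>2) * norm (D t x))"
      by (intro mult_left_mono) auto
    moreover have "Re (D t x) * Re (N t x) + Im (D t x) * Im (N t x) \<le> norm (D t x) * norm (N t x)"
      using norm_cauchy_schwarz[of "D t x" "N t x"] by (simp add: inner_complex_def)
    ultimately have "2 * (Re (D t x) * Re (N t x) + Im (D t x) * Im (N t x)) \<le> \<Lambda> * u t x"
      unfolding u \<Lambda>_def by (simp add: power2_eq_square algebra_simps)
    then have "2 * Re (D t x) * Re (N t x) + 2 * Im (D t x) * Im (N t x) \<le> \<Lambda> * u t x"
      by (simp add: algebra_simps)
    then show "2 * Re (D t x) * Re (DXX t x + N t x) + 2 * Im (D t x) * Im (DXX t x + N t x)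
       \<le> 2 * (Re (DX t x))\<^sup>2 + 2 * (Im (DX t x))\<^sup>2 + 2 * Re (D t x) * Re (DXX t x) + 2 * Im (D t x) * Im (DXX t x) + \<Lambda> * u t x"
      unfolding plus_complex.simps distrib_left
      using zero_le_power2[of "Re (DX t x)"] zero_le_power2[of "Im (DX t x)"] by linarith
  qed (use t1 in \<open>auto simp: \<Lambda>_def\<close>)
  then show ?thesis by (auto simp: u D_def fun_eq_iff)
qed (use init in simp)

section \<open>The linearised operator in Fourier variables\<close>

definition sig :: "real \<Rightarrow> real" where "sig k = sqrt (1 + 3 * k\<^sup>2)"

text \<open>The decay rates. The index \<open>True\<close> denotes the critical mode and \<open>False\<close> the stable mode, here and in
all families indexed by \<open>bool\<close>.\<close>

definition nu :: "bool \<Rightarrow> real \<Rightarrow> real" where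
  "nu b k = (if b then (sig k - 1)\<^sup>2 / 3 else (sig k + 1)\<^sup>2 / 3)"

definition beta :: "real \<Rightarrow> real" where "beta k = sqrt 3 * k / (sig k + 1)"

text \<open>The amplitude part \<open>\<rho>\<close> and the phase part \<open>\<phi>\<close> as functions of the modes; this is the inverse of
\<open>modes\<close>. Since \<open>beta k\<close> is of order \<open>k\<close>, the critical mode is the phase up to
a small correction and the stable mode is the amplitude up to a small correction.\<close>

definition amp :: "(bool \<Rightarrow> real \<Rightarrow> complex) \<Rightarrow> real \<Rightarrow> complex" where
  "amp u k = (u False k - \<i> * of_real (beta k) * u True k) / of_real (1 + (beta k)\<^sup>2)"

definition pha :: "(bool \<Rightarrow> real \<Rightarrow> complex) \<Rightarrow> real \<Rightarrow> complex" where
  "pha u k = (u True k - \<i> * of_real (beta k) * u False k) / of_real (1 + (beta k)\<^sup>2)"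

definition modes :: "(real \<Rightarrow> complex) \<Rightarrow> (real \<Rightarrow> complex) \<Rightarrow> bool \<Rightarrow> real \<Rightarrow> complex" where
  "modes f g b k = (if b then g k + \<i> * of_real (beta k) * f k else f k + \<i> * of_real (beta k) * g k)"

lemma sig_sq: "(sig k)\<^sup>2 = 1 + 3 * k\<^sup>2" and sig_ge_1: "1 \<le> sig k"
  and sig_minus: "sig (- k) = sig k"
  by (simp_all add: sig_def)

lemma beta_minus: "beta (- k) = - beta k"
  by (simp add: beta_def sig_minus)

lemma beta_sq: "(beta k)\<^sup>2 = (sig k - 1) / (sig k + 1)"
proof -
  have "(beta k)\<^sup>2 = 3 * k\<^sup>2 / (sig k + 1)\<^sup>2"
    by (simp add: beta_def power_divide power_mult_distrib)
  also have "3 * k\<^sup>2 = (sig k - 1) * (sig k + 1)"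
    using sig_sq[of k] by (simp add: algebra_simps power2_eq_square)
  finally show ?thesis using sig_ge_1[of k] by (simp add: power2_eq_square)
qed

lemma one_plus_beta_sq_pos: "0 < 1 + (beta k)\<^sup>2"
  by (simp add: add_pos_nonneg)

lemma abs_beta_le_1: "\<bar>beta k\<bar> \<le> 1"
proof -
  have "(beta k)\<^sup>2 \<le> 1\<^sup>2" unfolding beta_sq using sig_ge_1[of k] by simp
  then show ?thesis using abs_le_square_iff[of "beta k" 1] by simp
qed

lemma abs_beta_le: "\<bar>beta k\<bar> \<le> \<bar>k\<bar>"
proof -
  have "sqrt 3 \<le> 2" by (rule real_le_lsqrt) auto
  then have "sqrt 3 * \<bar>k\<bar> \<le> (sig k + 1) * \<bar>k\<bar>"
    using sig_ge_1[of k] by (intro mult_right_mono) auto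
  then show ?thesis
    using sig_ge_1[of k] by (simp add: beta_def abs_mult field_simps)
qed

lemma measurable_sig [measurable]: "sig \<in> borel_measurable borel"
  unfolding sig_def[abs_def] by measurable

lemma measurable_nu [measurable]: "nu b \<in> borel_measurable borel"
  unfolding nu_def[abs_def] by measurable

lemma measurable_beta [measurable]: "beta \<in> borel_measurable borel"
  unfolding beta_def[abs_def] by measurable

lemma nu_minus: "nu b (- k) = nu b k"
  by (simp add: nu_def sig_minus)

lemma nu_nonneg: "0 \<le> nu b k"
  by (simp add: nu_def)

lemma amp_modes [simp]: "amp (modes f g) = f" and pha_modes [simp]: "pha (modes f g) = g"
proof -
  have "of_real (1 + (beta k)\<^sup>2) \<noteq> (0::complex)" for k
    using one_plus_beta_sq_pos[of k] by (metis less_irrefl of_real_eq_0_iff)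
  then show "amp (modes f g) = f" "pha (modes f g) = g"
    by (auto simp: fun_eq_iff amp_def pha_def modes_def field_simps power2_eq_square)
qed

lemma norm_amp_le: "norm (amp u k) \<le> norm (u False k) + \<bar>beta k\<bar> * norm (u True k)"
proof -
  have "norm (amp u k) = norm (u False k - \<i> * of_real (beta k) * u True k) / (1 + (beta k)\<^sup>2)"
    unfolding amp_def norm_divide norm_of_real by simp
  also have "\<dots> \<le> norm (u False k - \<i> * of_real (beta k) * u True k)"
    by (simp add: divide_le_eq mult_le_cancel_left1 add_pos_nonneg)
  also have "\<dots> \<le> norm (u False k) + \<bar>beta k\<bar> * norm (u True k)"
    by (rule order_trans[OF norm_triangle_ineq4]) (simp add: norm_mult)
  finally show ?thesis .
qed

lemma norm_pha_le: "norm (pha u k) \<le> norm (u True k) + \<bar>beta k\<bar> * norm (u False k)"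
  using norm_amp_le[of "\<lambda>b. u (\<not> b)" k] by (simp add: amp_def pha_def)

lemma norm_amp_pha_le:
  shows "norm (amp u k) \<le> norm (u True k) + norm (u False k)"
    and "norm (pha u k) \<le> norm (u True k) + norm (u False k)"
  using norm_amp_le[of u k] norm_pha_le[of u k] mult_right_mono[OF abs_beta_le_1, of "norm (u True k)" k]
    mult_right_mono[OF abs_beta_le_1, of "norm (u False k)" k] by auto

lemma norm_modes_le: "norm (modes f g b k) \<le> norm (f k) + norm (g k)"
proof -
  have "norm (\<i> * of_real (beta k) * z) \<le> norm z" for z
    using mult_right_mono[OF abs_beta_le_1, of "norm z" k] by (simp add: norm_mult)
  note le = this
  show ?thesis
    unfolding modes_def
    using norm_triangle_ineq[of "g k" "\<i> * of_real (beta k) * f k"] le[of "f k"]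
      norm_triangle_ineq[of "f k" "\<i> * of_real (beta k) * g k"] le[of "g k"] by (cases b) simp_all
qed

lemma amp_diff: "amp (\<lambda>b k. u b k - v b k) k = amp u k - amp v k"
  and pha_diff: "pha (\<lambda>b k. u b k - v b k) k = pha u k - pha v k"
  by (simp_all add: amp_def pha_def algebra_simps add_divide_distrib diff_divide_distrib)

lemma modes_diff: "modes f g b k - modes f' g' b k = modes (\<lambda>k. f k - f' k) (\<lambda>k. g k - g' k) b k"
  by (simp add: modes_def algebra_simps)

lemma amp_zero: "amp (\<lambda>b k. 0) = (\<lambda>k. 0)" and pha_zero: "pha (\<lambda>b k. 0) = (\<lambda>k. 0)"
  and modes_zero: "modes (\<lambda>k. 0) (\<lambda>k. 0) b k = 0"
  by (auto simp: amp_def pha_def modes_def)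

lemma hermitian_amp: "(\<And>b. hermitian (u b)) \<Longrightarrow> hermitian (amp u)"
  and hermitian_pha: "(\<And>b. hermitian (u b)) \<Longrightarrow> hermitian (pha u)"
  by (simp_all add: hermitian_def amp_def pha_def beta_minus)

lemma hermitian_modes: "hermitian f \<Longrightarrow> hermitian g \<Longrightarrow> hermitian (modes f g b)"
  by (simp add: hermitian_def modes_def beta_minus)

lemma measurable_amp [measurable]:
  assumes [measurable]: "\<And>b. u b \<in> borel_measurable borel"
  shows "amp u \<in> borel_measurable borel" "pha u \<in> borel_measurable borel"
  unfolding amp_def[abs_def] pha_def[abs_def] by measurable

lemma measurable_modes [measurable]:
  assumes [measurable]: "f \<in> borel_measurable borel" "g \<in> borel_measurable borel"
  shows "modes f g b \<in> borel_measurable borel"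
  unfolding modes_def[abs_def] by (cases b) simp_all

lemma measurable_amp_param:
  assumes "\<And>b. case_prod (\<lambda>t::real. u t b) \<in> borel_measurable (borel \<Otimes>\<^sub>M borel)"
  shows "case_prod (\<lambda>t. amp (u t)) \<in> borel_measurable (borel \<Otimes>\<^sub>M borel)"
    and "case_prod (\<lambda>t. pha (u t)) \<in> borel_measurable (borel \<Otimes>\<^sub>M borel)"
proof -
  have [measurable]: "(\<lambda>x. u (fst x) b (snd x)) \<in> borel_measurable (borel \<Otimes>\<^sub>M borel)" for b
    using assms[of b] by (simp add: case_prod_beta')
  show "case_prod (\<lambda>t. amp (u t)) \<in> borel_measurable (borel \<Otimes>\<^sub>M borel)"
    "case_prod (\<lambda>t. pha (u t)) \<in> borel_measurable (borel \<Otimes>\<^sub>M borel)"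
    unfolding case_prod_beta' amp_def pha_def by measurable
qed

lemma measurable_modes_param:
  fixes f g :: "real \<Rightarrow> real \<Rightarrow> complex"
  assumes "case_prod f \<in> borel_measurable (borel \<Otimes>\<^sub>M borel)" "case_prod g \<in> borel_measurable (borel \<Otimes>\<^sub>M borel)"
  shows "case_prod (\<lambda>t. modes (f t) (g t) b) \<in> borel_measurable (borel \<Otimes>\<^sub>M borel)"
proof -
  have [measurable]: "(\<lambda>x. f (fst x) (snd x)) \<in> borel_measurable (borel \<Otimes>\<^sub>M borel)"
      "(\<lambda>x. g (fst x) (snd x)) \<in> borel_measurable (borel \<Otimes>\<^sub>M borel)"
    using assms by (simp_all add: case_prod_beta')
  show ?thesis unfolding case_prod_beta' modes_def by (cases b) simp_all
qed

text \<open>The diagonalisation\<close>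

text \<open>In the coordinates \<open>amp\<close>, \<open>pha\<close> the diagonal operator with rates \<open>nu\<close> becomes the linearisation about the wave train,
\<open>\<rho>_xx - (4/3) \<rho> - 2 q \<phi>_x\<close> and \<open>\<phi>_xx + 2 q \<rho>_x\<close>. It is the same linearisation for the polar and for the Cartesian
form of the perturbation.\<close>

lemma amp_linear:
  "amp (\<lambda>b k. - of_real (nu b k) * u b k) k
    = - of_real (k\<^sup>2 + 4/3) * amp u k - 2 * of_real (sqrt (1/3)) * (\<i> * of_real k * pha u k)"
  and pha_linear:
  "pha (\<lambda>b k. - of_real (nu b k) * u b k) k
    = - of_real (k\<^sup>2) * pha u k + 2 * of_real (sqrt (1/3)) * (\<i> * of_real k * amp u k)"
proof -
  define s where "s = sig k"
  define B where "B = beta k"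
  have s1: "1 \<le> s" by (simp add: s_def sig_ge_1)
  have k2: "k\<^sup>2 = (s\<^sup>2 - 1) / 3" using sig_sq[of k] by (simp add: s_def)
  have q: "sqrt (1/3) = sqrt 3 / 3" by (simp add: real_sqrt_divide field_simps)
  have Bk: "k = B * (s + 1) * sqrt 3 / 3"
    using s1 by (simp add: B_def beta_def s_def)
  have B2: "B\<^sup>2 = (s - 1) / (s + 1)" by (simp add: B_def s_def beta_sq)
  have B2': "B\<^sup>2 * (s + 1) = s - 1" using s1 by (simp add: B2)
  have qk: "2 * sqrt (1/3) * k = 2 * B * (s + 1) / 3"
    unfolding q by (subst Bk) simp
  have N: "nu True k = (s - 1)\<^sup>2 / 3" "nu False k = (s + 1)\<^sup>2 / 3" by (simp_all add: nu_def s_def)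
  have e1: "nu False k = k\<^sup>2 + 4/3 + (2 * sqrt (1/3) * k) * B"
    and e2: "nu True k * B = (k\<^sup>2 + 4/3) * B - 2 * sqrt (1/3) * k"
    and e3: "nu True k = k\<^sup>2 - 2 * sqrt (1/3) * k * B"
    and e4: "nu False k * B = k\<^sup>2 * B + 2 * sqrt (1/3) * k"
    unfolding N qk k2 using B2' by (simp_all add: power2_eq_square field_simps)
  have ne: "of_real (1 + B\<^sup>2) \<noteq> (0::complex)"
    using one_plus_beta_sq_pos[of k] unfolding B_def by (metis less_irrefl of_real_eq_0_iff)
  define K where "K = 2 * sqrt (1/3) * k"
  have E1: "of_real (nu False k) = of_real (k\<^sup>2 + 4/3) + of_real K * (of_real B :: complex)"
    and E2: "of_real (nu True k) * of_real B = of_real (k\<^sup>2 + 4/3) * of_real B - (of_real K :: complex)"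
    and E3: "of_real (nu True k) = of_real (k\<^sup>2) - of_real K * (of_real B :: complex)"
    and E4: "of_real (nu False k) * of_real B = of_real (k\<^sup>2) * of_real B + (of_real K :: complex)"
    using e1 e2 e3 e4 unfolding K_def[symmetric]
    by (simp_all only: of_real_add[symmetric] of_real_mult[symmetric] of_real_diff[symmetric])
  define a where "a = (of_real (k\<^sup>2 + 4/3) :: complex)"
  define c where "c = u True k"
  define d where "d = u False k"
  have K: "2 * of_real (sqrt (1/3)) * (\<i> * of_real k * z) = \<i> * of_real K * z" for z :: complex
    by (simp add: K_def)
  have "- of_real (nu False k) * d + \<i> * (of_real (nu True k) * of_real B) * c
      = - of_real (k\<^sup>2 + 4/3) * (d - \<i> * of_real B * c) - \<i> * of_real K * (c - \<i> * of_real B * d)"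
    unfolding E1 E2 a_def[symmetric] by (simp add: algebra_simps)
  then show "amp (\<lambda>b k. - of_real (nu b k) * u b k) k
    = - of_real (k\<^sup>2 + 4/3) * amp u k - 2 * of_real (sqrt (1/3)) * (\<i> * of_real k * pha u k)"
    unfolding K amp_def pha_def B_def[symmetric] c_def[symmetric] d_def[symmetric]
    by (simp only: a_def[symmetric] times_divide_eq_right flip: diff_divide_distrib) (simp add: mult_ac)
  have "- of_real (nu True k) * c + \<i> * (of_real (nu False k) * of_real B) * d
      = - of_real (k\<^sup>2) * (c - \<i> * of_real B * d) + \<i> * of_real K * (d - \<i> * of_real B * c)"
    unfolding E3 E4 by (simp add: algebra_simps)
  then show "pha (\<lambda>b k. - of_real (nu b k) * u b k) k
    = - of_real (k\<^sup>2) * pha u k + 2 * of_real (sqrt (1/3)) * (\<i> * of_real k * amp u k)"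
    unfolding K amp_def pha_def B_def[symmetric] c_def[symmetric] d_def[symmetric]
    by (simp only: times_divide_eq_right flip: add_divide_distrib) (simp add: mult_ac)
qed

section \<open>Mild solutions\<close>

lemma geometric_increments_converge:
  fixes x :: "nat \<Rightarrow> complex"
  assumes inc: "\<And>n. norm (x (Suc n) - x n) \<le> c / 2 ^ n"
  shows "convergent x" and "norm (lim x - x n) \<le> 2 * c / 2 ^ n"
proof -
  have c: "0 \<le> c" using inc[of 0] norm_ge_zero[of "x (Suc 0) - x 0"] by (simp del: norm_ge_zero)
  have tail: "norm (x (n + j) - x n) \<le> 2 * c / 2 ^ n - 2 * c / 2 ^ (n + j)" for n j
  proof (induction j)
    case (Suc j)
    have "norm (x (n + Suc j) - x n) \<le> norm (x (Suc (n + j)) - x (n + j)) + norm (x (n + j) - x n)"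
      using norm_triangle_ineq[of "x (Suc (n + j)) - x (n + j)" "x (n + j) - x n"] by simp
    also have "\<dots> \<le> c / 2 ^ (n + j) + (2 * c / 2 ^ n - 2 * c / 2 ^ (n + j))"
      by (intro add_mono inc Suc)
    also have "\<dots> = 2 * c / 2 ^ n - 2 * c / 2 ^ (n + Suc j)" by (simp add: field_simps)
    finally show ?case .
  qed simp
  then have tail': "norm (x (n + j) - x n) \<le> 2 * c / 2 ^ n" for n j
  proof -
    have "0 \<le> 2 * c / 2 ^ (n + j)" using c by simp
    then show ?thesis using tail[of n j] by linarith
  qed
  have null: "(\<lambda>n. 2 * c / 2 ^ n) \<longlonglongrightarrow> 0"
    by (rule LIMSEQ_divide_realpow_zero) simp
  have "Cauchy x"
  proof (rule CauchyI')
    fix e :: real assume "e > 0"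
    then obtain M where M: "2 * c / 2 ^ M < e / 2"
      using order_tendstoD(2)[OF null, of "e / 2"] by (auto simp: eventually_sequentially)
    have "dist (x m) (x n) < e" if "m \<ge> M" "n > m" for m n
    proof -
      have "norm (x m - x M) \<le> 2 * c / 2 ^ M" "norm (x n - x M) \<le> 2 * c / 2 ^ M"
        using tail'[of M "m - M"] tail'[of M "n - M"] that by auto
      then show ?thesis
        using norm_triangle_ineq4[of "x m - x M" "x n - x M"] M by (simp add: dist_norm)
    qed
    then show "\<exists>M. \<forall>m\<ge>M. \<forall>n>m. dist (x m) (x n) < e" by blast
  qed
  then show conv: "convergent x" by (rule Cauchy_convergent)
  have "(\<lambda>j. x (j + n) - x n) \<longlonglongrightarrow> lim x - x n"
    using conv by (intro tendsto_diff tendsto_const LIMSEQ_ignore_initial_segment) (simp add: convergent_LIMSEQ_iff)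
  then show "norm (lim x - x n) \<le> 2 * c / 2 ^ n"
  proof (rule Lim_norm_ubound[rotated])
    show "\<forall>\<^sub>F j in sequentially. norm (x (j + n) - x n) \<le> 2 * c / 2 ^ n"
      using tail'[of n] by (intro always_eventually allI) (simp only: add.commute)
  qed simp
qed

text \<open>Hermitian symmetry is included because the equations for \<open>\<rho>\<close> and \<open>\<phi>\<close> describe real-valued fields.\<close>

definition admissible :: "(bool \<Rightarrow> real \<Rightarrow> real) \<Rightarrow> (bool \<Rightarrow> real \<Rightarrow> complex) \<Rightarrow> bool" where
  "admissible w u \<longleftrightarrow> (\<forall>b. u b \<in> borel_measurable borel \<and> hermitian (u b) \<and> (\<forall>k. norm (u b k) \<le> w b k))"

lemma admissibleD:
  "admissible w u \<Longrightarrow> u b \<in> borel_measurable borel" "admissible w u \<Longrightarrow> hermitian (u b)"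
  "admissible w u \<Longrightarrow> norm (u b k) \<le> w b k"
  by (simp_all add: admissible_def)

text \<open>A variation of constants problem for the modes on the time interval \<open>I\<close>. The family \<open>W\<close> is a
pointwise majorant for the solution and \<open>H\<close> one for the nonlinearity. The two essential conditions
say that the Duhamel integral of \<open>H\<close> returns below \<open>W\<close>, and that on the ball
given by \<open>W\<close> the nonlinearity has Lipschitz constant \<open>1/2\<close> from \<open>W\<close> to \<open>H\<close>. Half of \<open>W\<close> is
left for the initial data.\<close>

locale mild_problem =
  fixes N :: "(bool \<Rightarrow> real \<Rightarrow> complex) \<Rightarrow> bool \<Rightarrow> real \<Rightarrow> complex"
    and W H :: "real \<Rightarrow> bool \<Rightarrow> real \<Rightarrow> real" and I :: "real set"
    and u0 :: "bool \<Rightarrow> real \<Rightarrow> complex"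
  assumes I_meas [measurable]: "I \<in> sets borel" and I_nonneg: "I \<subseteq> {0..}"
    and I_down: "\<And>t. t \<in> I \<Longrightarrow> {0..t} \<subseteq> I"
    and W_nonneg: "\<And>t b k. t \<in> I \<Longrightarrow> 0 \<le> W t b k"
    and H_integrable: "\<And>t b k. t \<in> I \<Longrightarrow>
          set_integrable lborel {0..t} (\<lambda>s. exp (- nu b k * (t - s)) * H s b k)"
    and H_le: "\<And>t b k. t \<in> I \<Longrightarrow>
          (LINT s:{0..t}|lborel. exp (- nu b k * (t - s)) * H s b k) \<le> W t b k"
    and u0_measurable: "\<And>b. u0 b \<in> borel_measurable borel" and u0_hermitian: "\<And>b. hermitian (u0 b)"
    and u0_le: "\<And>t b k. t \<in> I \<Longrightarrow> exp (- nu b k * t) * norm (u0 b k) \<le> W t b k / 2"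
    and N_lipschitz: "\<And>t u v D b k. t \<in> I \<Longrightarrow> admissible (W t) u \<Longrightarrow> admissible (W t) v \<Longrightarrow> 0 \<le> D \<Longrightarrow>
          (\<And>b k. norm (u b k - v b k) \<le> D * W t b k) \<Longrightarrow> norm (N u b k - N v b k) \<le> D / 2 * H t b k"
    and N_zero: "\<And>b k. N (\<lambda>b k. 0) b k = 0"
    and N_hermitian: "\<And>t u b. t \<in> I \<Longrightarrow> admissible (W t) u \<Longrightarrow> hermitian (N u b)"
    and N_measurable: "\<And>u b. (\<And>b. case_prod (\<lambda>t::real. u t b) \<in> borel_measurable (borel \<Otimes>\<^sub>M borel)) \<Longrightarrow>
          case_prod (\<lambda>t. N (u t) b) \<in> borel_measurable (borel \<Otimes>\<^sub>M borel)"
    and N_continuous: "\<And>T u b k. T \<in> I \<Longrightarrow> (\<And>t. t \<in> {0..T} \<Longrightarrow> admissible (W t) (u t)) \<Longrightarrow>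
          (\<And>b k. continuous_on {0..T} (\<lambda>t. u t b k)) \<Longrightarrow> continuous_on {0..T} (\<lambda>t. N (u t) b k)"
begin

definition family :: "(real \<Rightarrow> bool \<Rightarrow> real \<Rightarrow> complex) \<Rightarrow> bool" where
  "family u \<longleftrightarrow> (\<forall>b. case_prod (\<lambda>t. u t b) \<in> borel_measurable (borel \<Otimes>\<^sub>M borel)) \<and>
     (\<forall>t\<in>I. admissible (W t) (u t)) \<and> (\<forall>t b k. t \<notin> I \<longrightarrow> u t b k = 0)"

definition picard :: "(real \<Rightarrow> bool \<Rightarrow> real \<Rightarrow> complex) \<Rightarrow> real \<Rightarrow> bool \<Rightarrow> real \<Rightarrow> complex" where
  "picard u t b k = (if t \<in> I then of_real (exp (- nu b k * t)) * u0 b k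
      + (LINT s:{0..t}|lborel. of_real (exp (- nu b k * (t - s))) * N (u s) b k) else 0)"

lemma admissible_zero: "t \<in> I \<Longrightarrow> admissible (W t) (\<lambda>b k. 0)"
  by (simp add: admissible_def hermitian_def W_nonneg)

lemma norm_N_le:
  assumes "t \<in> I" "admissible (W t) u"
  shows "norm (N u b k) \<le> 1 / 2 * H t b k"
  using N_lipschitz[OF assms admissible_zero[OF assms(1)], of 1] assms(2) N_zero
  by (simp add: admissible_def)

lemma N_section_measurable:
  assumes "family u"
  shows "(\<lambda>s. N (u s) b k) \<in> borel_measurable borel"
proof -
  have "case_prod (\<lambda>t. N (u t) b) \<in> borel_measurable (borel \<Otimes>\<^sub>M borel)"
    using assms by (intro N_measurable) (simp add: family_def)
  from borel_measurable_curried[OF this, of "\<lambda>s. s" borel "\<lambda>s. k"] show ?thesis by simp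
qed

lemma duhamel_integrable:
  assumes t: "t \<in> I" and u: "family u"
  shows "set_integrable lborel {0..t} (\<lambda>s. of_real (exp (- nu b k * (t - s))) * N (u s) b k)"
proof (rule set_integrable_bound[OF H_integrable[OF t]])
  show "set_borel_measurable lborel {0..t} (\<lambda>s. of_real (exp (- nu b k * (t - s))) * N (u s) b k)"
    unfolding set_borel_measurable_def using N_section_measurable[OF u] by measurable
  show "AE s in lborel. s \<in> {0..t} \<longrightarrow> norm (of_real (exp (- nu b k * (t - s))) * N (u s) b k)
      \<le> norm (exp (- nu b k * (t - s)) * H s b k)"
  proof (intro AE_I2 impI)
    fix s assume "s \<in> {0..t}"
    then have s: "s \<in> I" using I_down[OF t] by auto
    have "norm (N (u s) b k) \<le> 1 / 2 * H s b k" using u s by (intro norm_N_le) (auto simp: family_def)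
    then have "norm (N (u s) b k) \<le> \<bar>H s b k\<bar>" using norm_ge_zero[of "N (u s) b k"] by linarith
    then show "norm (of_real (exp (- nu b k * (t - s))) * N (u s) b k) \<le> norm (exp (- nu b k * (t - s)) * H s b k)"
      by (simp add: norm_mult abs_mult mult_left_mono)
  qed
qed

lemma picard_diff_le:
  assumes t: "t \<in> I" and u: "family u" and v: "family v" and D: "0 \<le> D"
    and d: "\<And>t b k. t \<in> I \<Longrightarrow> norm (u t b k - v t b k) \<le> D * W t b k"
  shows "norm (picard u t b k - picard v t b k) \<le> D / 2 * W t b k"
proof -
  have eq: "picard u t b k - picard v t b k = (LINT s:{0..t}|lborel. of_real (exp (- nu b k * (t - s))) * N (u s) b k
      - of_real (exp (- nu b k * (t - s))) * N (v s) b k)"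
    using t duhamel_integrable[OF t u] duhamel_integrable[OF t v]
    by (simp add: picard_def set_integral_diff)
  have "norm (picard u t b k - picard v t b k) \<le> (LINT s:{0..t}|lborel. D / 2 * (exp (- nu b k * (t - s)) * H s b k))"
    unfolding eq
    unfolding set_lebesgue_integral_def
  proof (rule Bochner_Integration.integral_norm_bound_integral)
    show "integrable lborel (\<lambda>s. indicator {0..t} s *\<^sub>R (of_real (exp (- nu b k * (t - s))) * N (u s) b k
      - of_real (exp (- nu b k * (t - s))) * N (v s) b k))"
      using set_integral_diff(1)[OF duhamel_integrable[OF t u] duhamel_integrable[OF t v]]
      by (simp add: set_integrable_def)
    show "integrable lborel (\<lambda>s. indicator {0..t} s *\<^sub>R (D / 2 * (exp (- nu b k * (t - s)) * H s b k)))"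
      using set_integrable_mult_right[OF H_integrable[OF t], of "D / 2"] by (simp add: set_integrable_def)
    fix s
    show "norm (indicator {0..t} s *\<^sub>R (of_real (exp (- nu b k * (t - s))) * N (u s) b k
        - of_real (exp (- nu b k * (t - s))) * N (v s) b k))
      \<le> indicator {0..t} s *\<^sub>R (D / 2 * (exp (- nu b k * (t - s)) * H s b k))"
    proof (cases "s \<in> {0..t}")
      case True
      then have s: "s \<in> I" using I_down[OF t] by auto
      have "norm (N (u s) b k - N (v s) b k) \<le> D / 2 * H s b k"
        by (rule N_lipschitz[OF s]) (use s u v D d in \<open>auto simp: family_def\<close>)
      then have "exp (- nu b k * (t - s)) * norm (N (u s) b k - N (v s) b k) \<le> exp (- nu b k * (t - s)) * (D / 2 * H s b k)"
        by (intro mult_left_mono) auto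
      moreover have "norm (of_real (exp (- nu b k * (t - s))) * N (u s) b k - of_real (exp (- nu b k * (t - s))) * N (v s) b k)
          = exp (- nu b k * (t - s)) * norm (N (u s) b k - N (v s) b k)"
        by (subst right_diff_distrib[symmetric], subst norm_mult) simp
      moreover have "exp (- nu b k * (t - s)) * (D / 2 * H s b k) = D / 2 * (exp (- nu b k * (t - s)) * H s b k)"
        by (rule mult.left_commute)
      ultimately show ?thesis unfolding indicator_simps(1)[OF True] scaleR_one by linarith
    qed simp
  qed
  also have "\<dots> = D / 2 * (LINT s:{0..t}|lborel. exp (- nu b k * (t - s)) * H s b k)"
    by (rule set_integral_mult_right)
  also have "\<dots> \<le> D / 2 * W t b k" using D H_le[OF t] by (intro mult_left_mono) auto
  finally show ?thesis .
qed

lemma family_zero: "family (\<lambda>t b k. 0)"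
  by (simp add: family_def admissible_zero)

lemma picard_zero: "t \<in> I \<Longrightarrow> picard (\<lambda>t b k. 0) t b k = of_real (exp (- nu b k * t)) * u0 b k"
  by (simp add: picard_def N_zero)

lemma family_picard:
  assumes u: "family u"
  shows "family (picard u)"
  unfolding family_def
proof (intro conjI allI ballI impI)
  fix b
  have "case_prod (\<lambda>t. N (u t) b) \<in> borel_measurable (borel \<Otimes>\<^sub>M borel)"
    using u by (intro N_measurable) (simp add: family_def)
  then have [measurable]: "(\<lambda>x. N (u (snd x)) b (snd (fst x))) \<in> borel_measurable ((borel \<Otimes>\<^sub>M borel) \<Otimes>\<^sub>M lborel)"
    by (rule borel_measurable_curried) measurable
  have [measurable]: "u0 b \<in> borel_measurable borel" by (rule u0_measurable)
  have "(\<lambda>x. (if 0 \<le> snd x \<and> snd x \<le> fst (fst x) then 1 else 0) *\<^sub>R (of_real (exp (- nu b (snd (fst x)) * (fst (fst x) - snd x))) * N (u (snd x)) b (snd (fst x))))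
      \<in> borel_measurable ((borel \<Otimes>\<^sub>M borel) \<Otimes>\<^sub>M lborel)"
    by measurable
  then have "(\<lambda>x. LINT s|lborel. (if 0 \<le> s \<and> s \<le> fst x then 1 else 0) *\<^sub>R (of_real (exp (- nu b (snd x) * (fst x - s))) * N (u s) b (snd x)))
      \<in> borel_measurable (borel \<Otimes>\<^sub>M borel)"
    by (intro lborel.borel_measurable_lebesgue_integral) (simp add: case_prod_beta')
  moreover have "(if 0 \<le> s \<and> s \<le> t then 1 else 0) = (indicator {0..t} s :: real)" for s t :: real
    by (simp add: indicator_def)
  ultimately have [measurable]: "(\<lambda>x. LINT s:{0..fst x}|lborel. of_real (exp (- nu b (snd x) * (fst x - s))) * N (u s) b (snd x))
      \<in> borel_measurable (borel \<Otimes>\<^sub>M borel)"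
    by (simp add: set_lebesgue_integral_def)
  show "case_prod (\<lambda>t. picard u t b) \<in> borel_measurable (borel \<Otimes>\<^sub>M borel)"
    unfolding case_prod_beta' picard_def by measurable
next
  fix t assume t: "t \<in> I"
  show "admissible (W t) (picard u t)"
    unfolding admissible_def
  proof (intro allI conjI)
    fix b
    have "case_prod (\<lambda>t. N (u t) b) \<in> borel_measurable (borel \<Otimes>\<^sub>M borel)"
      using u by (intro N_measurable) (simp add: family_def)
    then have [measurable]: "(\<lambda>x. N (u (snd x)) b (fst x)) \<in> borel_measurable (borel \<Otimes>\<^sub>M lborel)"
      by (rule borel_measurable_curried) measurable
    have [measurable]: "u0 b \<in> borel_measurable borel" by (rule u0_measurable)
    show "picard u t b \<in> borel_measurable borel"
      unfolding picard_def[abs_def] set_lebesgue_integral_def by measurable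
    show "hermitian (picard u t b)"
      unfolding hermitian_def
    proof
      fix k
      have "(LINT s:{0..t}|lborel. of_real (exp (- nu b (- k) * (t - s))) * N (u s) b (- k))
        = (LINT s:{0..t}|lborel. cnj (of_real (exp (- nu b k * (t - s))) * N (u s) b k))"
      proof (rule set_lebesgue_integral_cong)
        show "\<forall>s. s \<in> {0..t} \<longrightarrow> of_real (exp (- nu b (- k) * (t - s))) * N (u s) b (- k)
           = cnj (of_real (exp (- nu b k * (t - s))) * N (u s) b k)"
        proof (intro allI impI)
          fix s assume "s \<in> {0..t}"
          then have s: "s \<in> I" using I_down[OF t] by auto
          then have "hermitian (N (u s) b)" using u by (intro N_hermitian) (auto simp: family_def)
          then show "of_real (exp (- nu b (- k) * (t - s))) * N (u s) b (- k) = cnj (of_real (exp (- nu b k * (t - s))) * N (u s) b k)"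
            by (simp add: hermitian_def nu_minus)
        qed
      qed simp
      also have "\<dots> = cnj (LINT s:{0..t}|lborel. of_real (exp (- nu b k * (t - s))) * N (u s) b k)"
        unfolding set_lebesgue_integral_def Bochner_Integration.integral_cnj[symmetric] by (simp only: complex_cnj_scaleR)
      finally show "picard u t b (- k) = cnj (picard u t b k)"
        using t u0_hermitian[of b] by (simp add: picard_def hermitian_def nu_minus)
    qed
    fix k
    have "norm (picard u t b k - picard (\<lambda>t b k. 0) t b k) \<le> 1 / 2 * W t b k"
      by (rule picard_diff_le[OF t u family_zero]) (use u in \<open>auto simp: family_def admissible_def\<close>)
    moreover have "norm (picard (\<lambda>t b k. 0) t b k) \<le> W t b k / 2"
      using u0_le[OF t] picard_zero[OF t] by (simp add: norm_mult)
    ultimately show "norm (picard u t b k) \<le> W t b k"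
      using norm_triangle_sub[of "picard u t b k" "picard (\<lambda>t b k. 0) t b k"] by simp
  qed
qed (simp add: picard_def)

text \<open>Picard iteration started at zero contracts by \<open>1/2\<close> in the norm weighted by \<open>W\<close>. The iterates converge at
every \<open>(t, b, k)\<close>, geometrically relative to \<open>W\<close>, and this pointwise convergence replaces completeness of a function
space.\<close>

theorem mild_solution_exists: "\<exists>u. family u \<and> (\<forall>t b k. u t b k = picard u t b k)"
proof -
  define x where "x n = (picard ^^ n) (\<lambda>t b k. 0)" for n
  have x_Suc: "x (Suc n) = picard (x n)" for n by (simp add: x_def)
  have fx: "family (x n)" for n
    by (induction n) (auto simp: x_Suc family_picard, simp add: x_def family_zero)
  have inc: "norm (x (Suc n) t b k - x n t b k) \<le> 1 / 2 ^ n * W t b k" if "t \<in> I" for n t b k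
    using that
  proof (induction n arbitrary: t b k)
    case 0
    then show ?case using fx[of "Suc 0"] by (simp add: x_def[of 0] family_def admissible_def)
  next
    case (Suc n)
    have "norm (picard (x (Suc n)) t b k - picard (x n) t b k) \<le> (1 / 2 ^ n) / 2 * W t b k"
      by (rule picard_diff_le[OF Suc.prems fx fx _ Suc.IH]) auto
    then show ?case by (simp add: x_Suc)
  qed
  have inc': "norm (x (Suc n) t b k - x n t b k) \<le> (if t \<in> I then W t b k else 0) / 2 ^ n" for n t b k
    using inc[of t n b k] fx by (auto simp: family_def)
  define u where "u t b k = lim (\<lambda>n. x n t b k)" for t b k
  have lim: "(\<lambda>n. x n t b k) \<longlonglongrightarrow> u t b k" for t b k
    unfolding u_def using geometric_increments_converge(1)[of "\<lambda>n. x n t b k", OF inc'] by (simp add: convergent_LIMSEQ_iff)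
  have err: "norm (u t b k - x n t b k) \<le> 2 / 2 ^ n * W t b k" if "t \<in> I" for t b k n
    using geometric_increments_converge(2)[of "\<lambda>n. x n t b k", OF inc'] that by (simp add: u_def)
  have fu: "family u"
    unfolding family_def
  proof (intro conjI allI ballI impI)
    fix b
    have "(\<lambda>z. x n (fst z) b (snd z)) \<in> borel_measurable (borel \<Otimes>\<^sub>M borel)" for n
      using fx[of n] by (simp add: family_def case_prod_beta')
    then show "case_prod (\<lambda>t. u t b) \<in> borel_measurable (borel \<Otimes>\<^sub>M borel)"
      unfolding case_prod_beta' u_def by (rule borel_measurable_lim_metric)
  next
    fix t assume t: "t \<in> I"
    have ax: "admissible (W t) (x n t)" for n using fx t by (simp add: family_def)
    show "admissible (W t) (u t)"
      unfolding admissible_def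
    proof (intro allI conjI)
      fix b
      show "u t b \<in> borel_measurable borel"
        by (rule borel_measurable_LIMSEQ_metric[OF admissibleD(1)[OF ax] lim])
      show "hermitian (u t b)"
        unfolding hermitian_def
      proof
        fix k
        have "(\<lambda>n. x n t b (- k)) = (\<lambda>n. cnj (x n t b k))"
          using admissibleD(2)[OF ax] by (simp add: hermitian_def)
        then have "(\<lambda>n. x n t b (- k)) \<longlonglongrightarrow> cnj (u t b k)"
          using lim by (simp add: lim_cnj)
        then show "u t b (- k) = cnj (u t b k)" using lim LIMSEQ_unique by blast
      qed
      show "norm (u t b k) \<le> W t b k" for k
        by (rule Lim_norm_ubound[OF _ lim]) (auto intro: always_eventually admissibleD(3)[OF ax])
    qed
  next
    fix t b k assume "t \<notin> I"
    then have "(\<lambda>n. x n t b k) = (\<lambda>n. 0)" using fx by (simp add: family_def)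
    then show "u t b k = 0" by (simp add: u_def)
  qed
  have "u t b k = picard u t b k" for t b k
  proof (cases "t \<in> I")
    case True
    have "norm (x (Suc n) t b k - picard u t b k) \<le> W t b k / 2 ^ n" for n
    proof -
      have "norm (picard u t b k - picard (x n) t b k) \<le> (2 / 2 ^ n) / 2 * W t b k"
        by (rule picard_diff_le[OF True fu fx _ err]) auto
      then show ?thesis unfolding x_Suc by (subst norm_minus_commute) simp
    qed
    moreover have "(\<lambda>n. W t b k / 2 ^ n) \<longlonglongrightarrow> 0"
      by (rule LIMSEQ_divide_realpow_zero) simp
    ultimately have "(\<lambda>n. x (Suc n) t b k - picard u t b k) \<longlonglongrightarrow> 0"
      by (rule Lim_null_comparison[OF always_eventually[OF allI]])
    then have "(\<lambda>n. x (Suc n) t b k) \<longlonglongrightarrow> picard u t b k" by (rule LIM_zero_cancel)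
    moreover have "(\<lambda>n. x (Suc n) t b k) \<longlonglongrightarrow> u t b k" using lim by (rule LIMSEQ_Suc)
    ultimately show ?thesis by (rule LIMSEQ_unique[rotated])
  next
    case False
    then show ?thesis using fu by (simp add: picard_def family_def)
  qed
  then show ?thesis using fu by blast
qed

end

section \<open>From mild solutions to classical solutions\<close>

lemma inverse_fourier_time_derivative:
  assumes t0: "t0 \<in> {a<..<b}"
    and int: "\<And>t. t \<in> {a<..<b} \<Longrightarrow> integrable lborel (f t)"
    and deriv: "\<And>t k. t \<in> {a<..<b} \<Longrightarrow> ((\<lambda>t. f t k) has_vector_derivative f' t k) (at t)"
    and bound: "\<And>t k. t \<in> {a<..<b} \<Longrightarrow> norm (f' t k) \<le> g k"
    and g: "integrable lborel g" and F: "f' t0 \<in> borel_measurable borel"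
  shows "((\<lambda>t. inverse_fourier (f t) x) has_vector_derivative inverse_fourier (f' t0) x) (at t0)"
  unfolding inverse_fourier_def
proof (rule has_vector_derivative_integral_dominated[OF t0 _ _ _ g])
  show "integrable lborel (\<lambda>k. f t k * exp (\<i> * of_real (k * x)))" if "t \<in> {a<..<b}" for t
    by (rule integrable_fourier[OF int[OF that]])
  show "((\<lambda>t. f t k * exp (\<i> * of_real (k * x))) has_vector_derivative f' t k * exp (\<i> * of_real (k * x))) (at t)"
    if "t \<in> {a<..<b}" for t k
    by (rule has_vector_derivative_mult_left[OF deriv[OF that]])
  show "norm (f' t k * exp (\<i> * of_real (k * x))) \<le> g k" if "t \<in> {a<..<b}" for t k
    unfolding norm_mult norm_fourier_kernel using bound[OF that] by simp
  show "(\<lambda>k. f' t0 k * exp (\<i> * of_real (k * x))) \<in> borel_measurable borel"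
    using F by measurable
qed

lemma amp_add: "amp (\<lambda>b k. u b k + v b k) k = amp u k + amp v k"
  and pha_add: "pha (\<lambda>b k. u b k + v b k) k = pha u k + pha v k"
  by (simp_all add: amp_def pha_def algebra_simps add_divide_distrib diff_divide_distrib)

lemma amp_has_vector_derivative:
  assumes "\<And>b. ((\<lambda>t. u t b k) has_vector_derivative v b k) (at t)"
  shows "((\<lambda>t. amp (u t) k) has_vector_derivative amp v k) (at t)"
    and "((\<lambda>t. pha (u t) k) has_vector_derivative pha v k) (at t)"
  unfolding amp_def pha_def
  by (intro has_vector_derivative_divide has_vector_derivative_diff has_vector_derivative_mult_right assms)+

lemma amp_continuous:
  assumes "\<And>b. continuous_on S (\<lambda>t. u t b k)"
  shows "continuous_on S (\<lambda>t. amp (u t) k)" and "continuous_on S (\<lambda>t. pha (u t) k)"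
proof -
  have "of_real (1 + (beta k)\<^sup>2) \<noteq> (0::complex)"
    using one_plus_beta_sq_pos[of k] by (metis less_irrefl of_real_eq_0_iff)
  then show "continuous_on S (\<lambda>t. amp (u t) k)" "continuous_on S (\<lambda>t. pha (u t) k)"
    unfolding amp_def pha_def by (auto intro!: continuous_intros assms)
qed

lemma abs_le_one_plus_sq: "\<bar>k\<bar> \<le> 1 + k\<^sup>2" for k :: real
proof -
  have "0 \<le> k\<^sup>2 + 1 - 2 * \<bar>k\<bar>" using zero_le_power2[of "\<bar>k\<bar> - 1"] by (simp add: power2_diff)
  then show ?thesis by linarith
qed

text \<open>The additional condition gives, away from the initial time, an integrable majorant for two derivatives of
the solution and for the nonlinearity. It is what differentiation under the Fourier integral requires.\<close>

locale mild_solution = mild_problem +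
  fixes u
  assumes family_u: "family u" and picard_u: "\<And>t b k. u t b k = picard u t b k"
    and dominated_at: "\<And>t1 T. 0 < t1 \<Longrightarrow> T \<in> I \<Longrightarrow>
      \<exists>g. integrable lborel g \<and> (\<forall>t\<in>{t1..T}. \<forall>b k. (1 + k\<^sup>2) * W t b k \<le> g k \<and> H t b k \<le> g k)"
begin

lemma admissible_u: "t \<in> I \<Longrightarrow> admissible (W t) (u t)"
  using family_u by (simp add: family_def)

text \<open>The mild equation with the time dependent exponential taken out of the integral, in the form that the
fundamental theorem of calculus differentiates.\<close>

lemma u_variation_of_constants:
  assumes T: "T \<in> I"
  shows "(\<lambda>s. of_real (exp (nu b k * s)) * N (u s) b k) integrable_on {0..T}"
    and "t \<in> {0..T} \<Longrightarrow> u t b k = of_real (exp (- nu b k * t)) *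
      (u0 b k + integral {0..t} (\<lambda>s. of_real (exp (nu b k * s)) * N (u s) b k))"
proof -
  have G: "set_integrable lborel {0..t} (\<lambda>s. of_real (exp (nu b k * s)) * N (u s) b k)" if "t \<in> I" for t
  proof -
    have e: "of_real (exp (nu b k * t)) * (of_real (exp (- nu b k * (t - s))) * N (u s) b k)
        = of_real (exp (nu b k * s)) * N (u s) b k" for s
    proof -
      have "exp (nu b k * t) * exp (- nu b k * (t - s)) = exp (nu b k * s)"
        unfolding exp_add[symmetric] by (simp add: algebra_simps)
      then show ?thesis by (metis mult.assoc of_real_mult)
    qed
    then show ?thesis
      using set_integrable_mult_right[OF duhamel_integrable[OF that family_u], of "of_real (exp (nu b k * t))" b k]
      by (simp only: e)
  qed
  show "(\<lambda>s. of_real (exp (nu b k * s)) * N (u s) b k) integrable_on {0..T}"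
    using set_borel_integral_eq_integral(1)[OF G[OF T]] .
  assume t: "t \<in> {0..T}"
  then have tI: "t \<in> I" using I_down[OF T] by auto
  have e: "of_real (exp (- nu b k * (t - s))) * N (u s) b k
      = of_real (exp (- nu b k * t)) * (of_real (exp (nu b k * s)) * N (u s) b k)" for s
  proof -
    have "exp (- nu b k * (t - s)) = exp (- nu b k * t) * exp (nu b k * s)"
      unfolding exp_add[symmetric] by (simp add: algebra_simps)
    then show ?thesis by (metis mult.assoc of_real_mult)
  qed
  have "(LINT s:{0..t}|lborel. of_real (exp (- nu b k * (t - s))) * N (u s) b k)
      = integral {0..t} (\<lambda>s. of_real (exp (- nu b k * (t - s))) * N (u s) b k)"
    by (rule set_borel_integral_eq_integral(2)[OF duhamel_integrable[OF tI family_u]])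
  moreover have "integral {0..t} (\<lambda>s. of_real (exp (- nu b k * (t - s))) * N (u s) b k)
      = of_real (exp (- nu b k * t)) * integral {0..t} (\<lambda>s. of_real (exp (nu b k * s)) * N (u s) b k)"
    unfolding e by (rule Henstock_Kurzweil_Integration.integral_mult_right)
  moreover have "u t b k = of_real (exp (- nu b k * t)) * u0 b k
      + (LINT s:{0..t}|lborel. of_real (exp (- nu b k * (t - s))) * N (u s) b k)"
    using tI by (subst picard_u) (simp add: picard_def)
  ultimately show "u t b k = of_real (exp (- nu b k * t)) *
      (u0 b k + integral {0..t} (\<lambda>s. of_real (exp (nu b k * s)) * N (u s) b k))"
    by (simp only: distrib_left)
qed

lemma u_initial: "0 \<in> I \<Longrightarrow> u 0 b k = u0 b k"
  using u_variation_of_constants(2)[of 0 0 b k] by simp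

lemma u_continuous:
  assumes T: "T \<in> I"
  shows "continuous_on {0..T} (\<lambda>t. u t b k)"
proof -
  have "continuous_on {0..T} (\<lambda>t. of_real (exp (- nu b k * t)) *
      (u0 b k + integral {0..t} (\<lambda>s. of_real (exp (nu b k * s)) * N (u s) b k)))"
    by (intro continuous_intros indefinite_integral_continuous_1 u_variation_of_constants(1) T)
  then show ?thesis
    using u_variation_of_constants(2)[OF T] by (subst continuous_on_cong[OF refl]) auto
qed

lemma N_u_continuous:
  assumes T: "T \<in> I"
  shows "continuous_on {0..T} (\<lambda>t. N (u t) b k)"
proof (rule N_continuous[OF T _ u_continuous[OF T]])
  fix t assume "t \<in> {0..T}"
  then have "t \<in> I" using I_down[OF T] by auto
  then show "admissible (W t) (u t)" by (rule admissible_u)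
qed

lemma u_has_vector_derivative:
  assumes T: "T \<in> I" and t: "t \<in> {0<..<T}"
  shows "((\<lambda>t. u t b k) has_vector_derivative (- of_real (nu b k) * u t b k + N (u t) b k)) (at t)"
proof -
  define G where "G s = of_real (exp (nu b k * s)) * N (u s) b k" for s
  define E where "E t = (of_real (exp (- nu b k * t)) :: complex)" for t
  have cG: "continuous_on {0..T} G"
    unfolding G_def by (intro continuous_intros N_u_continuous T)
  have "((\<lambda>t. integral {0..t} G) has_vector_derivative G t) (at t within {0..T})"
    by (rule integral_has_vector_derivative[OF cG]) (use t in auto)
  then have dI: "((\<lambda>t. integral {0..t} G) has_vector_derivative G t) (at t)"
    using t by (simp add: at_within_Icc_at)
  have "((\<lambda>t. exp (- nu b k * t)) has_real_derivative - nu b k * exp (- nu b k * t)) (at t)"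
    by (auto intro!: derivative_eq_intros)
  then have dE: "(E has_vector_derivative of_real (- nu b k * exp (- nu b k * t))) (at t)"
    unfolding E_def[abs_def]
    by (intro bounded_linear.has_vector_derivative[OF bounded_linear_of_real])
      (simp only: has_real_derivative_iff_has_vector_derivative)
  have d1: "((\<lambda>t. E t * (u0 b k + integral {0..t} G)) has_vector_derivative
      (E t * (0 + G t) + of_real (- nu b k * exp (- nu b k * t)) * (u0 b k + integral {0..t} G))) (at t)"
    by (intro has_vector_derivative_mult dE has_vector_derivative_add has_vector_derivative_const dI)
  have eq: "E s * (u0 b k + integral {0..s} G) = u s b k" if "s \<in> {0<..<T}" for s
    unfolding E_def G_def using u_variation_of_constants(2)[OF T, of s b k] that by simp
  have "((\<lambda>t. u t b k) has_vector_derivative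
      (E t * (0 + G t) + of_real (- nu b k * exp (- nu b k * t)) * (u0 b k + integral {0..t} G))) (at t)"
    by (rule has_vector_derivative_transform_within_open[OF d1 open_greaterThanLessThan t eq])
  moreover have "E t * (0 + G t) = N (u t) b k"
  proof -
    have "exp (- nu b k * t) * exp (nu b k * t) = 1" unfolding exp_add[symmetric] by simp
    then show ?thesis unfolding E_def G_def
      by (metis add.left_neutral mult.assoc mult_1 of_real_1 of_real_mult)
  qed
  moreover have "of_real (- nu b k * exp (- nu b k * t)) * (u0 b k + integral {0..t} G) = - of_real (nu b k) * u t b k"
    unfolding eq[OF t, symmetric] E_def by (simp add: mult.assoc)
  ultimately show ?thesis by (simp only: add.commute)
qed

lemma fields_continuous:
  assumes "T \<in> I"
  shows "continuous_on {0..T} (\<lambda>t. amp (u t) k)" "continuous_on {0..T} (\<lambda>t. pha (u t) k)"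
  by (rule amp_continuous[OF u_continuous[OF assms]])+

lemma u_measurable: "t \<in> I \<Longrightarrow> u t b \<in> borel_measurable borel"
  using admissible_u by (simp add: admissible_def)

lemma fields_hermitian: "t \<in> I \<Longrightarrow> hermitian (amp (u t))" "t \<in> I \<Longrightarrow> hermitian (pha (u t))"
  by (intro hermitian_amp hermitian_pha admissibleD(2)[OF admissible_u], assumption)+

lemma N_u_measurable: "t \<in> I \<Longrightarrow> N (u t) b \<in> borel_measurable borel"
proof -
  have "case_prod (\<lambda>t. N (u t) b) \<in> borel_measurable (borel \<Otimes>\<^sub>M borel)"
    using family_u by (intro N_measurable) (simp add: family_def)
  from measurable_Pair2[OF this, of t] show ?thesis unfolding case_prod_conv by simp
qed

lemma fields_dominated:
  assumes T: "T \<in> I" and t1: "0 < t1"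
  obtains g where "integrable lborel g"
    "\<And>t k. t \<in> {t1..T} \<Longrightarrow> (1 + k\<^sup>2) * norm (amp (u t) k) \<le> g k"
    "\<And>t k. t \<in> {t1..T} \<Longrightarrow> (1 + k\<^sup>2) * norm (pha (u t) k) \<le> g k"
    "\<And>t k. t \<in> {t1..T} \<Longrightarrow> norm (amp (N (u t)) k) \<le> g k"
    "\<And>t k. t \<in> {t1..T} \<Longrightarrow> norm (pha (N (u t)) k) \<le> g k"
proof -
  obtain g where g: "integrable lborel g" "\<And>t b k. t \<in> {t1..T} \<Longrightarrow> (1 + k\<^sup>2) * W t b k \<le> g k"
      "\<And>t b k. t \<in> {t1..T} \<Longrightarrow> H t b k \<le> g k"
    using dominated_at[OF t1 T] by (elim exE conjE) (rule that, auto)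
  have tI: "t \<in> I" if "t \<in> {t1..T}" for t using that t1 I_down[OF T] by auto
  have w: "(1 + k\<^sup>2) * norm (u t b k) \<le> g k" if "t \<in> {t1..T}" for t b k
  proof -
    have "(1 + k\<^sup>2) * norm (u t b k) \<le> (1 + k\<^sup>2) * W t b k"
      by (intro mult_left_mono admissibleD(3)[OF admissible_u[OF tI[OF that]]]) (simp add: add_nonneg_nonneg)
    then show ?thesis using g(2)[OF that, where b = b and k = k] by linarith
  qed
  have h: "norm (N (u t) b k) \<le> g k" if "t \<in> {t1..T}" for t b k
    using norm_N_le[OF tI[OF that] admissible_u[OF tI[OF that]], of b k] g(3)[OF that, of b k]
      norm_ge_zero[of "N (u t) b k"] by linarith
  have two: "(1 + k\<^sup>2) * x \<le> 2 * g k" if "x \<le> y + z" "(1 + k\<^sup>2) * y \<le> g k" "(1 + k\<^sup>2) * z \<le> g k" for k x y z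
  proof -
    have "(1 + k\<^sup>2) * x \<le> (1 + k\<^sup>2) * (y + z)" using that(1) by (intro mult_left_mono) (auto simp: add_nonneg_nonneg)
    then show ?thesis using that(2,3) unfolding distrib_left by linarith
  qed
  show ?thesis
  proof (rule that[of "\<lambda>k. 2 * g k"])
    show "integrable lborel (\<lambda>k. 2 * g k)" using g(1) by simp
    fix t k assume t: "t \<in> {t1..T}"
    show "(1 + k\<^sup>2) * norm (amp (u t) k) \<le> 2 * g k" "(1 + k\<^sup>2) * norm (pha (u t) k) \<le> 2 * g k"
      by (rule two[OF norm_amp_pha_le(1)]; rule w[OF t]) (rule two[OF norm_amp_pha_le(2)]; rule w[OF t])
    show "norm (amp (N (u t)) k) \<le> 2 * g k" "norm (pha (N (u t)) k) \<le> 2 * g k"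
      using norm_amp_pha_le[of "N (u t)" k] h[OF t, of True k] h[OF t, of False k] by linarith+
  qed
qed

lemma weighted_integrable:
  assumes g: "integrable lborel g" and f: "f \<in> borel_measurable borel" and le: "\<And>k. (1 + k\<^sup>2) * norm (f k) \<le> g k"
  shows "integrable lborel f" "integrable lborel (\<lambda>k. of_real k * f k)"
    "integrable lborel (\<lambda>k. of_real k * (\<i> * of_real k * f k))"
proof -
  have *: "c * norm (f k) \<le> g k" if "c \<le> 1 + k\<^sup>2" for c k
    using mult_right_mono[OF that norm_ge_zero[of "f k"]] le[of k] by linarith
  show "integrable lborel f"
    by (rule integrable_dominated[OF f g]) (use *[of 1] in simp)
  show "integrable lborel (\<lambda>k. of_real k * f k)"
    by (rule integrable_dominated[OF _ g]) (use f *[OF abs_le_one_plus_sq] in \<open>auto simp: norm_mult\<close>)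
  show "integrable lborel (\<lambda>k. of_real k * (\<i> * of_real k * f k))"
  proof (rule integrable_dominated[OF _ g])
    show "norm (of_real k * (\<i> * of_real k * f k)) \<le> g k" for k
      using *[of "k\<^sup>2" k] by (simp add: norm_mult power2_eq_square mult.assoc[symmetric])
  qed (use f in measurable)
qed

lemma field_space_derivatives:
  assumes T: "T \<in> I" and t: "t \<in> {0<..<T}" and f: "f = amp (u t) \<or> f = pha (u t)"
  shows "(inverse_fourier f has_vector_derivative inverse_fourier (\<lambda>k. \<i> * of_real k * f k) x) (at x)"
    and "(inverse_fourier (\<lambda>k. \<i> * of_real k * f k) has_vector_derivative
      inverse_fourier (\<lambda>k. \<i> * of_real k * (\<i> * of_real k * f k)) x) (at x)"
    and "integrable lborel f" "integrable lborel (\<lambda>k. \<i> * of_real k * f k)"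
    and "integrable lborel (\<lambda>k. \<i> * of_real k * (\<i> * of_real k * f k))"
    and "integrable lborel (amp (N (u t)))" "integrable lborel (pha (N (u t)))"
proof -
  have tI: "t \<in> I" using t I_down[OF T] by auto
  have t': "t \<in> {t..T}" and t0: "0 < t" using t by auto
  from fields_dominated[OF T t0] obtain g where g: "integrable lborel g"
    "\<And>k. (1 + k\<^sup>2) * norm (amp (u t) k) \<le> g k" "\<And>k. (1 + k\<^sup>2) * norm (pha (u t) k) \<le> g k"
    "\<And>k. norm (amp (N (u t)) k) \<le> g k" "\<And>k. norm (pha (N (u t)) k) \<le> g k"
    using t' by metis
  have fm: "f \<in> borel_measurable borel"
    using f measurable_amp[OF u_measurable[OF tI]] by auto
  have le: "(1 + k\<^sup>2) * norm (f k) \<le> g k" for k using f g by auto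
  note w = weighted_integrable[OF g(1) fm le]
  have w2: "integrable lborel (\<lambda>k. \<i> * of_real k * f k)"
    using integrable_mult_right[OF w(2), of \<i>] by (simp add: mult.assoc)
  show "(inverse_fourier f has_vector_derivative inverse_fourier (\<lambda>k. \<i> * of_real k * f k) x) (at x)"
    by (rule inverse_fourier_has_vector_derivative[OF w(1,2)])
  show "(inverse_fourier (\<lambda>k. \<i> * of_real k * f k) has_vector_derivative
      inverse_fourier (\<lambda>k. \<i> * of_real k * (\<i> * of_real k * f k)) x) (at x)"
    by (rule inverse_fourier_has_vector_derivative[OF w2 w(3)])
  show "integrable lborel f" by (rule w(1))
  show "integrable lborel (\<lambda>k. \<i> * of_real k * f k)" by (rule w2)
  show "integrable lborel (\<lambda>k. \<i> * of_real k * (\<i> * of_real k * f k))"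
    using integrable_mult_right[OF w(3), of \<i>] by (simp add: mult.assoc)
  show "integrable lborel (amp (N (u t)))" "integrable lborel (pha (N (u t)))"
    using measurable_amp[OF N_u_measurable[OF tI]] g by (auto intro: integrable_dominated)
qed

lemma fields_time_derivative:
  assumes T: "T \<in> I" and t: "t \<in> {0<..<T}"
  shows "((\<lambda>t. inverse_fourier (amp (u t)) x) has_vector_derivative
      (inverse_fourier (\<lambda>k. \<i> * of_real k * (\<i> * of_real k * amp (u t) k)) x
        - of_real (4/3) * inverse_fourier (amp (u t)) x
        - 2 * of_real (sqrt (1/3)) * inverse_fourier (\<lambda>k. \<i> * of_real k * pha (u t) k) x
        + inverse_fourier (amp (N (u t))) x)) (at t)"
    and "((\<lambda>t. inverse_fourier (pha (u t)) x) has_vector_derivative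
      (inverse_fourier (\<lambda>k. \<i> * of_real k * (\<i> * of_real k * pha (u t) k)) x
        + 2 * of_real (sqrt (1/3)) * inverse_fourier (\<lambda>k. \<i> * of_real k * amp (u t) k) x
        + inverse_fourier (pha (N (u t))) x)) (at t)"
proof -
  have tI: "s \<in> I" if "s \<in> {t/2<..<T}" for s using t that I_down[OF T] by auto
  have t2: "t \<in> {t/2<..<T}" and t20: "0 < t / 2" using t by auto
  obtain g where g: "integrable lborel g"
    "\<And>s k. s \<in> {t/2..T} \<Longrightarrow> (1 + k\<^sup>2) * norm (amp (u s) k) \<le> g k"
    "\<And>s k. s \<in> {t/2..T} \<Longrightarrow> (1 + k\<^sup>2) * norm (pha (u s) k) \<le> g k"
    "\<And>s k. s \<in> {t/2..T} \<Longrightarrow> norm (amp (N (u s)) k) \<le> g k"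
    "\<And>s k. s \<in> {t/2..T} \<Longrightarrow> norm (pha (N (u s)) k) \<le> g k"
    using fields_dominated[OF T t20] by metis
  define q where "q = sqrt (1/3)"
  have q: "0 \<le> q" "q \<le> 1" by (auto simp: q_def real_le_lsqrt)
  define L where "L s b k = - of_real (nu b k) * u s b k + N (u s) b k" for s b k
  have dA: "((\<lambda>t. amp (u t) k) has_vector_derivative amp (L s) k) (at s)"
    and dP: "((\<lambda>t. pha (u t) k) has_vector_derivative pha (L s) k) (at s)" if "s \<in> {t/2<..<T}" for s k
  proof -
    have s: "s \<in> {0<..<T}" using that t by auto
    have d: "((\<lambda>t. u t b k) has_vector_derivative L s b k) (at s)" for b
      unfolding L_def by (rule u_has_vector_derivative[OF T s])
    show "((\<lambda>t. amp (u t) k) has_vector_derivative amp (L s) k) (at s)"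
      "((\<lambda>t. pha (u t) k) has_vector_derivative pha (L s) k) (at s)"
      by (rule amp_has_vector_derivative[where u = u and v = "L s", OF d])+
  qed
  have LA: "amp (L s) k = - of_real (k\<^sup>2 + 4/3) * amp (u s) k - 2 * of_real q * (\<i> * of_real k * pha (u s) k) + amp (N (u s)) k"
    and LP: "pha (L s) k = - of_real (k\<^sup>2) * pha (u s) k + 2 * of_real q * (\<i> * of_real k * amp (u s) k) + pha (N (u s)) k" for s k
    unfolding L_def amp_add pha_add amp_linear pha_linear q_def by (rule refl)+
  have gen: "norm (of_real c * z + 2 * of_real d * (\<i> * of_real k * w) + y) \<le> 5 * g k"
    if "\<bar>c\<bar> \<le> 2 * (1 + k\<^sup>2)" "\<bar>d\<bar> \<le> 1" "(1 + k\<^sup>2) * norm z \<le> g k" "(1 + k\<^sup>2) * norm w \<le> g k" "norm y \<le> g k" for c d k and z w y :: complex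
  proof -
    have "\<bar>c\<bar> * norm z \<le> 2 * (1 + k\<^sup>2) * norm z" by (rule mult_right_mono[OF that(1)]) simp
    moreover have "\<bar>d\<bar> * (\<bar>k\<bar> * norm w) \<le> 1 * ((1 + k\<^sup>2) * norm w)"
      by (intro mult_mono mult_right_mono abs_le_one_plus_sq that(2)) (auto simp: add_nonneg_nonneg)
    moreover have "norm (of_real c * z + 2 * of_real d * (\<i> * of_real k * w) + y) \<le> \<bar>c\<bar> * norm z + 2 * (\<bar>d\<bar> * (\<bar>k\<bar> * norm w)) + norm y"
      by (intro norm_triangle_le add_mono order_refl) (simp_all add: norm_mult)
    ultimately show ?thesis using that(3-5) by linarith
  qed
  have bA: "norm (amp (L s) k) \<le> 5 * g k" and bP: "norm (pha (L s) k) \<le> 5 * g k" if "s \<in> {t/2<..<T}" for s k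
  proof -
    have s: "s \<in> {t/2..T}" using that by auto
    have c1: "\<bar>- (k\<^sup>2 + 4/3)\<bar> \<le> 2 * (1 + k\<^sup>2)" and c2: "\<bar>- (k\<^sup>2)\<bar> \<le> 2 * (1 + k\<^sup>2)"
      unfolding abs_minus_cancel by (simp_all add: abs_of_nonneg add_nonneg_nonneg)
    have "norm (of_real (- (k\<^sup>2 + 4/3)) * amp (u s) k + 2 * of_real (- q) * (\<i> * of_real k * pha (u s) k) + amp (N (u s)) k) \<le> 5 * g k"
      by (rule gen[OF c1 _ g(2)[OF s] g(3)[OF s] g(4)[OF s]]) (use q in auto)
    then show "norm (amp (L s) k) \<le> 5 * g k" unfolding LA by simp
    have "norm (of_real (- (k\<^sup>2)) * pha (u s) k + 2 * of_real q * (\<i> * of_real k * amp (u s) k) + pha (N (u s)) k) \<le> 5 * g k"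
      by (rule gen[OF c2 _ g(3)[OF s] g(2)[OF s] g(5)[OF s]]) (use q in auto)
    then show "norm (pha (L s) k) \<le> 5 * g k" unfolding LP by simp
  qed
  have mL: "L s b \<in> borel_measurable borel" if "s \<in> {t/2<..<T}" for s b
    unfolding L_def[abs_def] using u_measurable[OF tI[OF that]] N_u_measurable[OF tI[OF that]] by measurable
  have g5: "integrable lborel (\<lambda>k. 5 * g k)" using g(1) by simp
  have iA: "integrable lborel (amp (u s))" "integrable lborel (pha (u s))" if "s \<in> {t/2<..<T}" for s
    using field_space_derivatives(3)[OF T, of s] that t by auto
  have "((\<lambda>t. inverse_fourier (amp (u t)) x) has_vector_derivative inverse_fourier (amp (L t)) x) (at t)"
    by (rule inverse_fourier_time_derivative[OF t2 iA(1) dA bA g5 measurable_amp(1)[OF mL[OF t2]]])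
  moreover note fsA = field_space_derivatives[OF T t, of "amp (u t)", simplified]
    and fsP = field_space_derivatives[OF T t, of "pha (u t)", simplified]
  have "inverse_fourier (amp (L t)) x = inverse_fourier (\<lambda>k. (\<i> * of_real k * (\<i> * of_real k * amp (u t) k)
        - of_real (4/3) * amp (u t) k)
        - 2 * of_real q * (\<i> * of_real k * pha (u t) k)
        + amp (N (u t)) k) x"
  proof (rule arg_cong[where f = "\<lambda>f. inverse_fourier f x"], rule ext)
    fix k
    have i2: "\<i> * of_real k * (\<i> * of_real k * amp (u t) k) = - (of_real k * of_real k * amp (u t) k)"
      by (simp add: algebra_simps)
    show "amp (L t) k = (\<i> * of_real k * (\<i> * of_real k * amp (u t) k) - of_real (4/3) * amp (u t) k)
        - 2 * of_real q * (\<i> * of_real k * pha (u t) k) + amp (N (u t)) k"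
      unfolding LA i2 by (simp add: power2_eq_square ring_distribs)
  qed
  moreover have "\<dots> = inverse_fourier (\<lambda>k. \<i> * of_real k * (\<i> * of_real k * amp (u t) k)) x
        - of_real (4/3) * inverse_fourier (amp (u t)) x
        - 2 * of_real q * inverse_fourier (\<lambda>k. \<i> * of_real k * pha (u t) k) x
        + inverse_fourier (amp (N (u t))) x"
    by (simp only: inverse_fourier_add inverse_fourier_diff inverse_fourier_cmult
        Bochner_Integration.integrable_diff integrable_mult_right fsA fsP)
  ultimately show "((\<lambda>t. inverse_fourier (amp (u t)) x) has_vector_derivative
      (inverse_fourier (\<lambda>k. \<i> * of_real k * (\<i> * of_real k * amp (u t) k)) x
        - of_real (4/3) * inverse_fourier (amp (u t)) x
        - 2 * of_real (sqrt (1/3)) * inverse_fourier (\<lambda>k. \<i> * of_real k * pha (u t) k) x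
        + inverse_fourier (amp (N (u t))) x)) (at t)"
    unfolding q_def by simp
  have "((\<lambda>t. inverse_fourier (pha (u t)) x) has_vector_derivative inverse_fourier (pha (L t)) x) (at t)"
    by (rule inverse_fourier_time_derivative[OF t2 iA(2) dP bP g5 measurable_amp(2)[OF mL[OF t2]]])
  moreover have "inverse_fourier (pha (L t)) x = inverse_fourier (\<lambda>k. \<i> * of_real k * (\<i> * of_real k * pha (u t) k)
        + 2 * of_real q * (\<i> * of_real k * amp (u t) k)
        + pha (N (u t)) k) x"
  proof (rule arg_cong[where f = "\<lambda>f. inverse_fourier f x"], rule ext)
    fix k
    have i2: "\<i> * of_real k * (\<i> * of_real k * pha (u t) k) = - (of_real k * of_real k * pha (u t) k)"
      by (simp add: algebra_simps)
    show "pha (L t) k = \<i> * of_real k * (\<i> * of_real k * pha (u t) k)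
        + 2 * of_real q * (\<i> * of_real k * amp (u t) k) + pha (N (u t)) k"
      unfolding LP i2 by (simp add: power2_eq_square)
  qed
  moreover have "\<dots> = inverse_fourier (\<lambda>k. \<i> * of_real k * (\<i> * of_real k * pha (u t) k)) x
        + 2 * of_real q * inverse_fourier (\<lambda>k. \<i> * of_real k * amp (u t) k) x
        + inverse_fourier (pha (N (u t))) x"
    by (simp only: inverse_fourier_add inverse_fourier_cmult
        Bochner_Integration.integrable_add integrable_mult_right fsA fsP)
  ultimately show "((\<lambda>t. inverse_fourier (pha (u t)) x) has_vector_derivative
      (inverse_fourier (\<lambda>k. \<i> * of_real k * (\<i> * of_real k * pha (u t) k)) x
        + 2 * of_real (sqrt (1/3)) * inverse_fourier (\<lambda>k. \<i> * of_real k * amp (u t) k) x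
        + inverse_fourier (pha (N (u t))) x)) (at t)"
    unfolding q_def by simp
qed

end

section \<open>Membership in the solution class\<close>

lemma wave_train_lipschitz: "norm (wave_train q x - wave_train q y) \<le> 3 * (\<bar>sqrt (1 - q\<^sup>2)\<bar> * \<bar>q\<bar>) * \<bar>x - y\<bar>"
proof -
  define c where "c = sqrt (1 - q\<^sup>2)"
  define f' where "f' x = of_real c * (exp (\<i> * of_real (q * x)) * (\<i> * of_real q))" for x
  have d: "(wave_train q has_vector_derivative f' x) (at x)" for x
  proof -
    have "((\<lambda>z. exp (\<i> * of_real q * z)) has_field_derivative exp (\<i> * of_real q * of_real x) * (\<i> * of_real q)) (at (of_real x))"
      by (auto intro!: derivative_eq_intros)
    from has_vector_derivative_mult_right[OF has_vector_derivative_real_field[OF this], of "of_real c"]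
    show ?thesis unfolding wave_train_def[abs_def] f'_def c_def of_real_mult by (simp only: mult.assoc)
  qed
  have nf: "norm (f' x) = \<bar>c\<bar> * \<bar>q\<bar>" for x
    unfolding f'_def norm_mult norm_of_real norm_fourier_kernel by simp
  have "norm (wave_train q x - wave_train q y - (x - y) *\<^sub>R f' y) \<le> norm (x - y) * (2 * (\<bar>c\<bar> * \<bar>q\<bar>))"
  proof (rule vector_differentiable_bound_linearization[where S = UNIV])
    show "norm (f' z - f' y) \<le> 2 * (\<bar>c\<bar> * \<bar>q\<bar>)" for z
      using norm_triangle_ineq4[of "f' z" "f' y"] nf[of z] nf[of y] by linarith
  qed (auto intro: d)
  moreover have "norm ((x - y) *\<^sub>R f' y) = norm (x - y) * (\<bar>c\<bar> * \<bar>q\<bar>)" by (simp add: nf)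
  ultimately have "norm (wave_train q x - wave_train q y) \<le> norm (x - y) * (2 * (\<bar>c\<bar> * \<bar>q\<bar>)) + norm (x - y) * (\<bar>c\<bar> * \<bar>q\<bar>)"
    using norm_triangle_sub[of "wave_train q x - wave_train q y" "(x - y) *\<^sub>R f' y"] by linarith
  then show ?thesis by (simp add: c_def algebra_simps)
qed

text \<open>Continuity in time with values in the bounded uniformly continuous functions follows from dominated
convergence: the sup norm of a difference is at most the integral of the difference of the transforms.\<close>

lemma gl_onI_fourier:
  assumes A: "\<And>t x. t \<in> {a..b} \<Longrightarrow> A t x = wave_train q x + inverse_fourier (Vh t) x"
    and meas: "\<And>t. t \<in> {a..b} \<Longrightarrow> Vh t \<in> borel_measurable borel"
    and bound: "\<And>t k. t \<in> {a..b} \<Longrightarrow> norm (Vh t k) \<le> g k" and g: "integrable lborel g"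
    and cont: "\<And>k. continuous_on {a..b} (\<lambda>t. Vh t k)"
    and pde: "\<And>t x. t \<in> {a<..<b} \<Longrightarrow> ((\<lambda>x. A t x) has_vector_derivative AX t x) (at x)"
      "\<And>t x. t \<in> {a<..<b} \<Longrightarrow> ((\<lambda>x. AX t x) has_vector_derivative AXX t x) (at x)"
      "\<And>t x. t \<in> {a<..<b} \<Longrightarrow> ((\<lambda>t. A t x) has_vector_derivative
           (AXX t x + A t x - A t x * of_real ((norm (A t x))\<^sup>2))) (at t)"
  shows "gl_on a b A"
  unfolding gl_on_def
proof (intro conjI ballI)
  fix T assume T: "T \<in> {a..b}"
  have int: "integrable lborel (Vh t)" if "t \<in> {a..b}" for t
    by (rule integrable_dominated[OF meas[OF that] g bound[OF that]])
  have AT: "A T = (\<lambda>x. wave_train q x + inverse_fourier (Vh T) x)" using A[OF T] by auto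
  have "norm (A T x) \<le> \<bar>sqrt (1 - q\<^sup>2)\<bar> + (LINT k|lborel. norm (Vh T k))" for x
    unfolding AT
  proof (rule norm_triangle_le[OF add_mono[OF _ inverse_fourier_norm_le[OF int[OF T]]]])
    show "norm (wave_train q x) \<le> \<bar>sqrt (1 - q\<^sup>2)\<bar>"
      unfolding wave_train_def norm_mult norm_of_real norm_fourier_kernel by simp
  qed
  then show "bounded (range (A T))" unfolding bounded_iff by blast
  have "uniformly_continuous_on UNIV (wave_train q)"
  proof (rule lipschitz_on_uniformly_continuous)
    show "(3 * (\<bar>sqrt (1 - q\<^sup>2)\<bar> * \<bar>q\<bar>))-lipschitz_on UNIV (wave_train q)"
      by (rule lipschitz_onI) (use wave_train_lipschitz in \<open>auto simp: dist_norm\<close>)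
  qed
  then show "uniformly_continuous_on UNIV (A T)"
    unfolding AT by (intro uniformly_continuous_on_add inverse_fourier_uniformly_continuous int T)
  have "((\<lambda>t. LINT k|lborel. norm (Vh t k - Vh T k)) \<longlongrightarrow> (LINT k::real|lborel. (0::real))) (at T within {a..b})"
  proof (rule tendsto_integral_dominated[where f = "\<lambda>t k. norm (Vh t k - Vh T k)" and F = "\<lambda>k. 0" and g = "\<lambda>k. 2 * g k"])
    show "(\<lambda>k. norm (Vh t k - Vh T k)) \<in> borel_measurable borel" if "t \<in> {a..b}" for t
      using meas[OF that] meas[OF T] by measurable
    show "norm (norm (Vh t k - Vh T k)) \<le> 2 * g k" if "t \<in> {a..b}" for t k
      using norm_triangle_ineq4[of "Vh t k" "Vh T k"] bound[OF that, of k] bound[OF T, of k] by simp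
    show "integrable lborel (\<lambda>k. 2 * g k)" using g by simp
    show "((\<lambda>t. norm (Vh t k - Vh T k)) \<longlongrightarrow> 0) (at T within {a..b})" for k
      using cont[of k] T by (intro tendsto_norm_zero LIM_zero) (auto simp: continuous_on_def)
  qed simp
  then have lim: "((\<lambda>t. LINT k|lborel. norm (Vh t k - Vh T k)) \<longlongrightarrow> 0) (at T within {a..b})" by simp
  have le: "dist (A t x) (A T x) \<le> (LINT k|lborel. norm (Vh t k - Vh T k))" if "t \<in> {a..b}" for t x
  proof -
    have "A t x - A T x = inverse_fourier (\<lambda>k. Vh t k - Vh T k) x"
      unfolding A[OF that] A[OF T] inverse_fourier_diff[OF int[OF that] int[OF T]] by simp
    then show ?thesis unfolding dist_norm
      using inverse_fourier_norm_le[OF Bochner_Integration.integrable_diff[OF int[OF that] int[OF T]], of x] by simp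
  qed
  show "uniform_limit UNIV A (A T) (at T within {a..b})"
    unfolding uniform_limit_iff
  proof (intro allI impI)
    fix e :: real assume e: "e > 0"
    have "\<forall>\<^sub>F t in at T within {a..b}. (LINT k|lborel. norm (Vh t k - Vh T k)) < e"
      by (rule order_tendstoD(2)[OF lim e])
    moreover have "\<forall>\<^sub>F t in at T within {a..b}. t \<in> {a..b}" by (simp add: eventually_at_filter)
    ultimately show "\<forall>\<^sub>F t in at T within {a..b}. \<forall>x\<in>UNIV. dist (A t x) (A T x) < e"
      by eventually_elim (use le in \<open>auto intro: le_less_trans\<close>)
  qed
next
  show "\<exists>AX AXX. \<forall>T\<in>{a<..<b}. \<forall>X.
        ((\<lambda>x. A T x) has_vector_derivative AX T X) (at X) \<and>
        ((\<lambda>x. AX T x) has_vector_derivative AXX T X) (at X) \<and>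
        ((\<lambda>t. A t X) has_vector_derivative
           (AXX T X + A T X - A T X * of_real ((norm (A T X))\<^sup>2))) (at T)"
    by (rule exI[of _ AX], rule exI[of _ AXX]) (intro ballI allI conjI pde)
qed

section \<open>Self-similar weights\<close>

definition theta :: "real \<Rightarrow> real" where "theta t = (1 + t) powr (1/4)"

text \<open>A function of the self-similar variable \<open>|k| (1 + t)^(1/4)\<close>. The exponent \<open>5\<close> will be used for the critical mode;
smaller exponents remain after multiplication by powers of \<open>|k|\<close>.\<close>

definition wgt :: "nat \<Rightarrow> real \<Rightarrow> real \<Rightarrow> real" where
  "wgt n t k = 1 / (1 + \<bar>k\<bar> * theta t) ^ n"

definition wgt_mass :: real where "wgt_mass = (LINT x|lborel. 1 / (1 + \<bar>x\<bar>) ^ 2)"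

lemma theta_ge_1: "0 \<le> t \<Longrightarrow> 1 \<le> theta t"
  by (simp add: theta_def ge_one_powr_ge_zero)

lemma theta_pos: "0 \<le> t \<Longrightarrow> 0 < theta t"
  using theta_ge_1[of t] by simp

lemma theta_neq_0: "0 \<le> t \<Longrightarrow> theta t \<noteq> 0"
  using theta_pos[of t] by simp

lemma theta_0: "theta 0 = 1"
  by (simp add: theta_def)

lemma theta_pow4: "0 \<le> t \<Longrightarrow> theta t ^ 4 = 1 + t"
  by (simp add: theta_def powr_realpow[symmetric] powr_powr del: powr_realpow)

lemma theta_mono: "0 \<le> s \<Longrightarrow> s \<le> t \<Longrightarrow> theta s \<le> theta t"
  by (simp add: theta_def powr_mono2)

lemma wgt_base_pos: "0 \<le> t \<Longrightarrow> 1 \<le> 1 + \<bar>k\<bar> * theta t"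
  using theta_ge_1[of t] by simp

lemma wgt_pos: "0 \<le> t \<Longrightarrow> 0 < wgt n t k"
  using wgt_base_pos[of t k] by (simp add: wgt_def)

lemma wgt_nonneg: "0 \<le> t \<Longrightarrow> 0 \<le> wgt n t k"
  using wgt_pos[of t n k] by simp

lemma wgt_le_1: "0 \<le> t \<Longrightarrow> wgt n t k \<le> 1"
  using wgt_base_pos[of t k] one_le_power[of "1 + \<bar>k\<bar> * theta t" n] by (simp add: wgt_def)

lemma wgt_antimono: "0 \<le> t \<Longrightarrow> m \<le> n \<Longrightarrow> wgt n t k \<le> wgt m t k"
  unfolding wgt_def using wgt_base_pos[of t k] by (intro divide_left_mono power_increasing) auto

lemma wgt_time_antimono: "0 \<le> s \<Longrightarrow> s \<le> t \<Longrightarrow> wgt n t k \<le> wgt n s k"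
  unfolding wgt_def using wgt_base_pos[of t k] wgt_base_pos[of s k] theta_mono[of s t]
  by (intro divide_left_mono power_mono add_left_mono mult_left_mono mult_pos_pos zero_less_power) auto

text \<open>A derivative is traded for a factor \<open>(1 + t)^(-1/4)\<close> and one power of the weight.\<close>

lemma wgt_gain: "0 \<le> t \<Longrightarrow> \<bar>k\<bar> * wgt (Suc n) t k \<le> wgt n t k / theta t"
proof -
  assume t: "0 \<le> t"
  define c where "c = 1 + \<bar>k\<bar> * theta t"
  have c: "1 \<le> c" and th: "1 \<le> theta t" using wgt_base_pos[OF t] theta_ge_1[OF t] by (auto simp: c_def)
  have "\<bar>k\<bar> * theta t \<le> c" by (simp add: c_def)
  then show ?thesis unfolding wgt_def c_def[symmetric] using c th by (simp add: field_simps)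
qed

lemma wgt_zero_eq: "wgt n 0 k = 1 / (1 + \<bar>k\<bar>) ^ n"
  by (simp add: wgt_def theta_0)

lemma measurable_wgt [measurable]: "wgt n t \<in> borel_measurable borel"
  unfolding wgt_def[abs_def] by measurable

lemma integrable_unit_weight: "integrable lborel (\<lambda>x::real. 1 / (1 + \<bar>x\<bar>) ^ 2)"
proof (rule integrable_dominated)
  have "set_integrable lborel (einterval (-\<infinity>) \<infinity>) (\<lambda>x. inverse (1 + x^2))"
    by (rule Sinc_Integral.integrable_inverse_1_plus_square)
  then show "integrable lborel (\<lambda>x::real. inverse (1 + x^2))"
    by (simp add: set_integrable_def)
  show "norm (1 / (1 + \<bar>x\<bar>) ^ 2) \<le> inverse (1 + x\<^sup>2)" for x :: real
  proof -
    have "1 + x\<^sup>2 \<le> (1 + \<bar>x\<bar>)\<^sup>2" by (simp add: power2_sum)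
    then show ?thesis by (simp add: divide_inverse le_imp_inverse_le add_pos_nonneg)
  qed
qed measurable

lemma wgt_mass_nonneg: "0 \<le> wgt_mass"
  unfolding wgt_mass_def by (rule integral_nonneg_AE) simp

lemma wgt_2_integral:
  assumes t: "0 \<le> t"
  shows "integrable lborel (wgt 2 t)" "(LINT k|lborel. wgt 2 t k) = wgt_mass / theta t"
proof -
  have th: "0 < theta t" using theta_ge_1[OF t] by simp
  have eq: "wgt 2 t k = 1 / (1 + \<bar>0 + theta t * k\<bar>) ^ 2" for k
    using th by (simp add: wgt_def abs_mult mult.commute)
  show "integrable lborel (wgt 2 t)"
    unfolding eq[abs_def] by (rule lborel_integrable_real_affine[OF integrable_unit_weight]) (use th in simp)
  have m: "wgt_mass = theta t * (LINT k|lborel. wgt 2 t k)"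
    unfolding wgt_mass_def eq by (subst lborel_integral_real_affine[where c = "theta t" and t = 0]) (use th in auto)
  show "(LINT k|lborel. wgt 2 t k) = wgt_mass / theta t"
    unfolding m using th by simp
qed

lemma wgt_integral:
  assumes t: "0 \<le> t" and n: "2 \<le> n"
  shows "integrable lborel (wgt n t)" "(LINT k|lborel. wgt n t k) \<le> wgt_mass / theta t"
proof -
  show i: "integrable lborel (wgt n t)"
    by (rule integrable_dominated[OF measurable_wgt wgt_2_integral(1)[OF t]])
      (use wgt_nonneg[OF t] wgt_antimono[OF t n] in auto)
  have "(LINT k|lborel. wgt n t k) \<le> (LINT k|lborel. wgt 2 t k)"
    by (rule integral_mono[OF i wgt_2_integral(1)[OF t]]) (rule wgt_antimono[OF t n])
  then show "(LINT k|lborel. wgt n t k) \<le> wgt_mass / theta t" by (simp add: wgt_2_integral(2)[OF t])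
qed

text \<open>One of \<open>|l|\<close> and \<open>|k - l|\<close> is at least \<open>|k| / 2\<close>, so one of the two factors is at most \<open>2^n\<close>
times the weight at \<open>k\<close>.\<close>

lemma wgt_product_le:
  assumes t: "0 \<le> t"
  shows "wgt n t l * wgt n t (k - l) \<le> 2 ^ n * wgt n t k * (wgt n t l + wgt n t (k - l))"
proof -
  define A B C where "A = 1 + \<bar>l\<bar> * theta t" and "B = 1 + \<bar>k - l\<bar> * theta t" and "C = 1 + \<bar>k\<bar> * theta t"
  have ABC: "1 \<le> A" "1 \<le> B" "1 \<le> C" using wgt_base_pos[OF t] by (simp_all add: A_def B_def C_def)
  have "\<bar>k\<bar> * theta t \<le> (\<bar>l\<bar> + \<bar>k - l\<bar>) * theta t" using theta_ge_1[OF t] by (intro mult_right_mono) auto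
  then have "C \<le> A + B" by (simp add: A_def B_def C_def distrib_right)
  also have "\<dots> \<le> 2 * max A B" by simp
  finally have "C ^ n \<le> (2 * max A B) ^ n" using ABC by (intro power_mono) auto
  also have "\<dots> = 2 ^ n * max A B ^ n" by (rule power_mult_distrib)
  also have "max A B ^ n \<le> A ^ n + B ^ n" using ABC by (cases "A \<le> B") (auto simp: max_def)
  finally have *: "C ^ n \<le> 2 ^ n * (A ^ n + B ^ n)" by simp
  define X Y Z where "X = A ^ n" and "Y = B ^ n" and "Z = C ^ n"
  have p: "0 < X" "0 < Y" "0 < Z" using ABC by (auto simp: X_def Y_def Z_def)
  have "1 / X * (1 / Y) \<le> 2 ^ n * (1 / Z) * (1 / X + 1 / Y)"
    using * p unfolding X_def[symmetric] Y_def[symmetric] Z_def[symmetric] by (simp add: field_simps)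
  then show ?thesis by (simp add: wgt_def A_def B_def C_def X_def Y_def Z_def)
qed

text \<open>Integration of \<open>wgt_product_le\<close>; the constant is \<open>2^5\<close> from the product bound, times \<open>2\<close> for the two summands.\<close>

lemma conv_weight_wgt:
  assumes t: "0 \<le> t" and n: "2 \<le> n" "n \<le> 5"
  shows "conv_weight (wgt n t) (64 * wgt_mass / theta t)"
proof
  note i = wgt_integral(1)[OF t n(1)]
  show "integrable lborel (wgt n t)" by (rule i)
  show "0 \<le> wgt n t k" for k by (rule wgt_nonneg[OF t])
  show "\<exists>B. \<forall>k. wgt n t k \<le> B" using wgt_le_1[OF t] by blast
  show "0 \<le> 64 * wgt_mass / theta t" using wgt_mass_nonneg theta_ge_1[OF t] by simp
  fix k
  have i2: "integrable lborel (\<lambda>l. wgt n t (k - l))"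
    using lborel_integrable_real_affine[OF i, of "-1" k] by simp
  have e2: "(LINT l|lborel. wgt n t (k - l)) = (LINT l|lborel. wgt n t l)"
    by (subst (2) lborel_integral_real_affine[where c = "-1" and t = k]) auto
  have ip: "integrable lborel (\<lambda>l. 2 ^ n * wgt n t k * (wgt n t l + wgt n t (k - l)))"
    using i i2 by simp
  have il: "integrable lborel (\<lambda>l. wgt n t l * wgt n t (k - l))"
    by (rule integrable_dominated[OF _ ip])
      (use wgt_product_le[OF t] wgt_nonneg[OF t] in \<open>auto simp: abs_mult\<close>)
  have "(LINT l|lborel. wgt n t l * wgt n t (k - l)) \<le> (LINT l|lborel. 2 ^ n * wgt n t k * (wgt n t l + wgt n t (k - l)))"
    by (rule integral_mono[OF il ip]) (rule wgt_product_le[OF t])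
  also have "\<dots> = 2 ^ n * wgt n t k * (2 * (LINT l|lborel. wgt n t l))"
    using i i2 e2 by simp
  also have "\<dots> \<le> 2 ^ 5 * wgt n t k * (2 * (wgt_mass / theta t))"
    by (intro mult_mono power_increasing wgt_integral(2)[OF t n(1)] order_refl n(2))
      (use wgt_nonneg[OF t] wgt_mass_nonneg theta_ge_1[OF t] in \<open>auto intro!: integral_nonneg_AE mult_nonneg_nonneg\<close>)
  finally show "(LINT l|lborel. wgt n t l * wgt n t (k - l)) \<le> 64 * wgt_mass / theta t * wgt n t k"
    by (simp add: mult_ac)
qed

section \<open>Duhamel integrals of the weights\<close>

lemma duhamel_set_integrable:
  fixes \<phi> :: "real \<Rightarrow> real"
  assumes "continuous_on {0..t} \<phi>"
  shows "set_integrable lborel {0..t} (\<lambda>s. exp (- a * (t - s)) * \<phi> s)"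
  unfolding set_integrable_def
  by (rule borel_integrable_compact) (auto intro!: continuous_intros assms)

text \<open>Any \<open>Y\<close> with \<open>Y' + a Y \<ge> \<phi>\<close> and \<open>Y 0 \<ge> 0\<close> lies above the solution of \<open>Y' + a Y = \<phi>\<close> that vanishes
at time zero. Bounds for Duhamel integrals are then verified by differentiation.\<close>

lemma duhamel_le_supersolution:
  fixes \<phi> Y Y' :: "real \<Rightarrow> real"
  assumes t: "0 \<le> t" and cont: "continuous_on {0..t} \<phi>" and Y0: "0 \<le> Y 0"
    and dY: "\<And>s. s \<in> {0..t} \<Longrightarrow> (Y has_real_derivative Y' s) (at s)"
    and super: "\<And>s. s \<in> {0..t} \<Longrightarrow> \<phi> s \<le> Y' s + a * Y s"
  shows "(LINT s:{0..t}|lborel. exp (- a * (t - s)) * \<phi> s) \<le> Y t"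
proof -
  have "(LINT s:{0..t}|lborel. exp (- a * (t - s)) * \<phi> s) = integral {0..t} (\<lambda>s. exp (- a * (t - s)) * \<phi> s)"
    and I: "(\<lambda>s. exp (- a * (t - s)) * \<phi> s) integrable_on {0..t}"
    using set_borel_integral_eq_integral[OF duhamel_set_integrable[OF cont]] by auto
  moreover have "((\<lambda>s. exp (- a * (t - s)) * (Y' s + a * Y s)) has_integral
      (exp (- a * (t - t)) * Y t - exp (- a * (t - 0)) * Y 0)) {0..t}"
  proof (rule fundamental_theorem_of_calculus[OF t])
    fix s assume s: "s \<in> {0..t}"
    have "((\<lambda>s. exp (- a * (t - s)) * Y s) has_real_derivative exp (- a * (t - s)) * (Y' s + a * Y s)) (at s)"
      by (auto intro!: derivative_eq_intros dY s simp: algebra_simps)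
    then show "((\<lambda>s. exp (- a * (t - s)) * Y s) has_vector_derivative exp (- a * (t - s)) * (Y' s + a * Y s)) (at s within {0..t})"
      by (auto simp: has_real_derivative_iff_has_vector_derivative intro: has_vector_derivative_at_within)
  qed
  then have "integral {0..t} (\<lambda>s. exp (- a * (t - s)) * \<phi> s) \<le> exp (- a * (t - t)) * Y t - exp (- a * (t - 0)) * Y 0"
    by (rule has_integral_le[OF integrable_integral[OF I]]) (auto intro!: mult_left_mono super)
  moreover have "0 \<le> exp (- a * (t - 0)) * Y 0" using Y0 by simp
  ultimately show ?thesis by simp
qed

lemma theta_has_derivative:
  assumes "0 \<le> s"
  shows "(theta has_real_derivative theta s / (4 * (1 + s))) (at s)"
proof -
  have "(theta has_real_derivative (1/4) * (1 + s) powr (1/4 - 1)) (at s)"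
    unfolding theta_def[abs_def] using assms by (auto intro!: derivative_eq_intros)
  moreover have "(1 + s) powr (1/4 - 1) = (1 + s) powr (1/4) / (1 + s) powr 1" by (rule powr_diff)
  ultimately show ?thesis using assms by (simp add: theta_def mult.commute)
qed

lemma theta_continuous: "continuous_on {0..t} theta"
  by (rule DERIV_continuous_on[OF has_field_derivative_at_within[OF theta_has_derivative]]) auto

text \<open>For small \<open>a (1 + t)\<close> the integral of \<open>(1 + s)^(-3/4)\<close> grows like \<open>(1 + t)^(1/4)\<close>; for large \<open>a (1 + t)\<close> the balance
\<open>a Y = (1 + t)^(-3/4)\<close> is reached. The right-hand side interpolates between the two, and it is
a supersolution itself.\<close>

lemma duhamel_theta_3:
  assumes a: "0 \<le> a" and t: "0 \<le> t"
  shows "(LINT s:{0..t}|lborel. exp (- a * (t - s)) * (1 / theta s ^ 3)) \<le> 5 * theta t / (1 + a * (1 + t))"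
proof (rule duhamel_le_supersolution[OF t, where Y = "\<lambda>s. 5 * theta s / (1 + a * (1 + s))" and
      Y' = "\<lambda>s. (5 * (theta s / (4 * (1 + s))) * (1 + a * (1 + s)) - 5 * theta s * a) / (1 + a * (1 + s))\<^sup>2"])
  show "continuous_on {0..t} (\<lambda>s. 1 / theta s ^ 3)"
    by (intro continuous_intros theta_continuous) (simp add: theta_neq_0)
  show "0 \<le> 5 * theta 0 / (1 + a * (1 + 0))" using a by (simp add: theta_0)
  fix s assume s: "s \<in> {0..t}"
  define h where "h = theta s"
  have h: "1 \<le> h" "h ^ 4 = 1 + s" using theta_ge_1[of s] theta_pow4[of s] s by (auto simp: h_def)
  define b where "b = a * (1 + s)"
  have b: "0 \<le> b" using a s by (simp add: b_def)
  show "((\<lambda>s. 5 * theta s / (1 + a * (1 + s))) has_real_derivative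
     (5 * (theta s / (4 * (1 + s))) * (1 + a * (1 + s)) - 5 * theta s * a) / (1 + a * (1 + s))\<^sup>2) (at s)"
    using b s unfolding b_def by (auto intro!: derivative_eq_intros theta_has_derivative simp: power2_eq_square)
  \<comment> \<open>The supersolution inequality after division by \<open>h^(-3)\<close>; it is a quadratic inequality in \<open>b\<close>.\<close>
  have "(1 + b)\<^sup>2 \<le> 5/4 * (1 + b) - 5 * b + 5 * b * (1 + b)"
  proof -
    have "0 \<le> (2 * b - 3/16)\<^sup>2 + 1/4 - 9/256" by simp
    then show ?thesis by (simp add: power2_eq_square field_simps)
  qed
  then have "1 / h ^ 3 \<le> (5/4 * (1 + b) - 5 * b + 5 * b * (1 + b)) / (1 + b)\<^sup>2 / h ^ 3"
    using b h by (intro divide_right_mono) (auto simp: le_divide_eq)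
  also have "\<dots> = (5 * (h / (4 * h ^ 4)) * (1 + b) - 5 * h * (b / h ^ 4)) / (1 + b)\<^sup>2 + (b / h ^ 4) * (5 * h / (1 + b))"
  proof -
    have "h \<noteq> 0" "1 + b \<noteq> 0" using h b by auto
    then show ?thesis by (simp add: divide_simps) (simp add: power2_eq_square power3_eq_cube power4_eq_xxxx algebra_simps)
  qed
  also have "b / h ^ 4 = a" using h(2) s by (simp add: b_def)
  finally show "1 / theta s ^ 3 \<le> (5 * (theta s / (4 * (1 + s))) * (1 + a * (1 + s)) - 5 * theta s * a) / (1 + a * (1 + s))\<^sup>2
      + a * (5 * theta s / (1 + a * (1 + s)))"
    unfolding h_def[symmetric] h(2) b_def by simp
qed

text \<open>Here the source is integrable in time. The bound without the factor \<open>2 - (1 + s)^(-1/2)\<close> is no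
supersolution when \<open>a (1 + s)\<close> is small; this factor stays between \<open>1\<close> and \<open>2\<close>, and its derivative
\<open>(1 + s)^(-3/2) / 2\<close> supplies the source.\<close>

lemma duhamel_theta_6:
  assumes a: "0 \<le> a" and t: "0 \<le> t"
  shows "(LINT s:{0..t}|lborel. exp (- a * (t - s)) * (1 / theta s ^ 6)) \<le> 6 / (1 + a * (1 + t))"
proof -
  have "(LINT s:{0..t}|lborel. exp (- a * (t - s)) * (1 / theta s ^ 6)) \<le> 3 * (2 - 1 / theta t ^ 2) / (1 + a * (1 + t))"
  proof (rule duhamel_le_supersolution[OF t, where Y = "\<lambda>s. 3 * (2 - 1 / theta s ^ 2) / (1 + a * (1 + s))" and
      Y' = "\<lambda>s. (3 / (2 * theta s ^ 2 * (1 + s)) * (1 + a * (1 + s)) - 3 * (2 - 1 / theta s ^ 2) * a) / (1 + a * (1 + s))\<^sup>2"])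
    show "continuous_on {0..t} (\<lambda>s. 1 / theta s ^ 6)"
      by (intro continuous_intros theta_continuous) (simp add: theta_neq_0)
    show "0 \<le> 3 * (2 - 1 / theta 0 ^ 2) / (1 + a * (1 + 0))" using a by (simp add: theta_0)
    fix s assume s: "s \<in> {0..t}"
    define h where "h = theta s"
    have h: "1 \<le> h" "h ^ 4 = 1 + s" using theta_ge_1[of s] theta_pow4[of s] s by (auto simp: h_def)
    define b where "b = a * (1 + s)"
    have b: "0 \<le> b" using a s by (simp add: b_def)
    have d2: "((\<lambda>s. 1 / theta s ^ 2) has_real_derivative - 1 / (2 * theta s ^ 2 * (1 + s))) (at s)"
    proof (rule DERIV_cong)
      show "((\<lambda>s. 1 / theta s ^ 2) has_real_derivative
          (0 * theta s ^ 2 - 1 * (of_nat 2 * (theta s / (4 * (1 + s)) * theta s ^ (2 - Suc 0)))) / (theta s ^ 2 * theta s ^ 2)) (at s)"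
        by (intro DERIV_divide DERIV_const DERIV_power theta_has_derivative) (use s h in \<open>auto simp: h_def\<close>)
      show "(0 * theta s ^ 2 - 1 * (of_nat 2 * (theta s / (4 * (1 + s)) * theta s ^ (2 - Suc 0)))) / (theta s ^ 2 * theta s ^ 2)
          = - 1 / (2 * theta s ^ 2 * (1 + s))"
      proof -
        define r where "r = 1 + s"
        have "h \<noteq> 0" "r \<noteq> 0" using h s by (auto simp: r_def)
        then show ?thesis unfolding h_def[symmetric] r_def[symmetric]
          by (simp add: divide_simps power2_eq_square)
      qed
    qed
    have d3: "((\<lambda>s. 3 * (2 - 1 / theta s ^ 2)) has_real_derivative 3 / (2 * theta s ^ 2 * (1 + s))) (at s)"
      by (rule DERIV_cong[OF DERIV_cmult[OF DERIV_diff[OF DERIV_const d2]]]) simp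
    have d4: "((\<lambda>s. 1 + a * (1 + s)) has_real_derivative a) (at s)"
      by (auto intro!: derivative_eq_intros)
    show "((\<lambda>s. 3 * (2 - 1 / theta s ^ 2) / (1 + a * (1 + s))) has_real_derivative
      (3 / (2 * theta s ^ 2 * (1 + s)) * (1 + a * (1 + s)) - 3 * (2 - 1 / theta s ^ 2) * a) / (1 + a * (1 + s))\<^sup>2) (at s)"
      by (rule DERIV_cong[OF DERIV_divide[OF d3 d4]]) (use b in \<open>auto simp: b_def power2_eq_square\<close>)
    define g where "g = 2 - 1 / h ^ 2"
    have h2: "1 \<le> h ^ 2" "1 \<le> h ^ 6" using h one_le_power by auto
    have "1 / h ^ 2 \<le> 1 / 1" using h2 by (intro divide_left_mono) auto
    then have g: "1 \<le> g" by (simp add: g_def)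
    have "0 \<le> (b - 1/8)\<^sup>2 + 1/4 - 1/64" by simp
    then have "(1 + b)\<^sup>2 \<le> 3/2 * (1 + b) + 3 * b\<^sup>2" by (simp add: power2_eq_square field_simps)
    also have "3 * b\<^sup>2 \<le> 3 * (g * b\<^sup>2 * h ^ 2)"
    proof -
      have "1 * 1 \<le> g * h ^ 2" using g h2 by (intro mult_mono) auto
      then have "1 * b\<^sup>2 \<le> g * h ^ 2 * b\<^sup>2" by (intro mult_right_mono) auto
      then show ?thesis by (simp add: mult_ac)
    qed
    finally have "1 / h ^ 6 \<le> (3/2 * (1 + b) + 3 * (g * b\<^sup>2 * h ^ 2)) / (1 + b)\<^sup>2 / h ^ 6"
      using b h2 by (intro divide_right_mono) (auto simp: le_divide_eq)
    also have "\<dots> = (3 / (2 * h ^ 2 * h ^ 4) * (1 + b) - 3 * g * (b / h ^ 4)) / (1 + b)\<^sup>2 + (b / h ^ 4) * (3 * g / (1 + b))"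
    proof -
      have *: "h \<noteq> 0" "1 + b \<noteq> 0" using h b by auto
      have "h ^ 6 = h ^ 2 * h ^ 4" by (simp flip: power_add)
      then show ?thesis using * by (simp add: divide_simps) (simp add: power2_eq_square algebra_simps)
    qed
    also have "b / h ^ 4 = a" using h(2) s by (simp add: b_def)
    finally show "1 / theta s ^ 6 \<le> (3 / (2 * theta s ^ 2 * (1 + s)) * (1 + a * (1 + s)) - 3 * (2 - 1 / theta s ^ 2) * a) / (1 + a * (1 + s))\<^sup>2
        + a * (3 * (2 - 1 / theta s ^ 2) / (1 + a * (1 + s)))"
      unfolding h_def[symmetric] g_def[symmetric] h(2) b_def by simp
  qed
  also have "\<dots> \<le> 6 / (1 + a * (1 + t))"
    using a t theta_ge_1[OF t] by (intro divide_right_mono) auto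
  finally show ?thesis .
qed

text \<open>Half of an exponential rate pays for the quadratic loss in \<open>wgt_transfer_large\<close>.\<close>

lemma exp_absorbs_quadratic:
  fixes a x :: real
  assumes a: "1/3 \<le> a" and x: "0 \<le> x"
  shows "exp (- a * x) * (1 + x)\<^sup>2 \<le> 144 * exp (- (a / 2) * x)"
proof -
  have "1 + x \<le> 12 * (1 + x / 12)" using x by simp
  also have "\<dots> \<le> 12 * exp (x / 12)" by (intro mult_left_mono exp_ge_add_one_self) simp
  finally have "(1 + x)\<^sup>2 \<le> (12 * exp (x / 12))\<^sup>2" using x by (intro power_mono) auto
  also have "\<dots> = 144 * exp (x / 6)" by (simp add: power_mult_distrib power2_eq_square flip: exp_add)
  also have "\<dots> \<le> 144 * exp (a / 2 * x)"
    using mult_right_mono[OF a x] by simp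
  finally have "exp (- a * x) * (1 + x)\<^sup>2 \<le> exp (- a * x) * (144 * exp (a / 2 * x))" by (intro mult_left_mono) auto
  also have "\<dots> = 144 * exp (- (a / 2) * x)" by (simp flip: exp_add)
  finally show ?thesis .
qed

lemma theta_transfer:
  assumes s: "0 \<le> s" "s \<le> t"
  shows "theta t \<le> theta s * (1 + (t - s)) powr (1/4)"
    and "theta t \<le> theta s + (t - s) powr (1/4)"
proof -
  have "1 + t \<le> (1 + s) * (1 + (t - s))" using s by (simp add: algebra_simps mult_left_mono)
  then have "(1 + t) powr (1/4) \<le> ((1 + s) * (1 + (t - s))) powr (1/4)" using s by (intro powr_mono2) auto
  then show "theta t \<le> theta s * (1 + (t - s)) powr (1/4)" using s by (simp add: theta_def powr_mult)
  define z where "z = (t - s) powr (1/4)"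
  have z: "0 \<le> z" "z ^ 4 = t - s"
    using s by (auto simp: z_def powr_powr powr_realpow' [symmetric] simp del: powr_realpow')
  show "theta t \<le> theta s + (t - s) powr (1/4)"
    unfolding z_def[symmetric]
  proof (rule power_le_imp_le_base[where n = 3])
    have h: "1 \<le> theta s" by (rule theta_ge_1[OF s(1)])
    have "theta t ^ Suc 3 = theta s ^ 4 + z ^ 4"
      using theta_pow4[of t] theta_pow4[of s] s z by (simp add: numeral_eq_Suc)
    also have "\<dots> \<le> (theta s + z) ^ 4"
    proof -
      have "0 \<le> theta s * z * (4 * theta s ^ 2 + 6 * theta s * z + 4 * z ^ 2)"
        using h z by (intro mult_nonneg_nonneg add_nonneg_nonneg) auto
      then show ?thesis by (simp add: power4_eq_xxxx power2_eq_square algebra_simps)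
    qed
    finally show "theta t ^ Suc 3 \<le> (theta s + z) ^ Suc 3" by simp
    show "0 \<le> theta s + z" using h z by simp
  qed
qed

definition duh :: "(real \<Rightarrow> real) \<Rightarrow> real \<Rightarrow> real \<Rightarrow> real" where
  "duh \<phi> a t = (LINT s:{0..t}|lborel. exp (- a * (t - s)) * \<phi> s)"

lemma duh_mono:
  assumes "continuous_on {0..t} \<phi>" "continuous_on {0..t} \<psi>"
    and "\<And>s. s \<in> {0..t} \<Longrightarrow> exp (- a * (t - s)) * \<phi> s \<le> exp (- b * (t - s)) * \<psi> s"
  shows "duh \<phi> a t \<le> duh \<psi> b t"
  unfolding duh_def
  by (rule set_integral_mono[OF duhamel_set_integrable[OF assms(1)] duhamel_set_integrable[OF assms(2)]]) (rule assms(3))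

lemma duh_cmult: "duh (\<lambda>s. c * \<phi> s) a t = c * duh \<phi> a t"
proof -
  have "(\<lambda>s. exp (- a * (t - s)) * (c * \<phi> s)) = (\<lambda>s. c * (exp (- a * (t - s)) * \<phi> s))"
    by (simp add: fun_eq_iff)
  then show ?thesis unfolding duh_def by (simp only: set_integral_mult_right)
qed

lemma duh_add:
  assumes "continuous_on {0..t} \<phi>" "continuous_on {0..t} \<psi>"
  shows "duh (\<lambda>s. \<phi> s + \<psi> s) a t = duh \<phi> a t + duh \<psi> a t"
  unfolding duh_def distrib_left
  by (rule set_integral_add(2)[OF duhamel_set_integrable[OF assms(1)] duhamel_set_integrable[OF assms(2)]])

lemma duh_const: "0 < a \<Longrightarrow> 0 \<le> t \<Longrightarrow> 0 \<le> c \<Longrightarrow> duh (\<lambda>s. c) a t \<le> c / a"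
  unfolding duh_def
  by (rule duhamel_le_supersolution[where Y' = "\<lambda>s. 0"]) auto

lemma wgt_continuous: "continuous_on {0..t} (\<lambda>s. wgt n s k)"
  unfolding wgt_def
proof (intro continuous_intros theta_continuous ballI)
  show "(1 + \<bar>k\<bar> * theta s) ^ n \<noteq> 0" if "s \<in> {0..t}" for s
    using wgt_base_pos[of s k] that by auto
qed

lemma inv_theta_continuous: "continuous_on {0..t} (\<lambda>s. 1 / theta s ^ n)"
  by (intro continuous_intros theta_continuous) (simp add: theta_neq_0)

text \<open>From \<open>(sig k - 1) (sig k + 1) = 3 k^2\<close> and an upper bound for \<open>sig k\<close>: at most \<open>2\<close> for \<open>|k| \<le> 1\<close> and at
most \<open>2 |k|\<close> otherwise.\<close>

lemma nu_lower:
  shows "\<bar>k\<bar> \<le> 1 \<Longrightarrow> k ^ 4 / 3 \<le> nu True k" and "1 \<le> \<bar>k\<bar> \<Longrightarrow> k\<^sup>2 / 3 \<le> nu True k"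
    and "1 + k\<^sup>2 \<le> nu False k"
proof -
  define s where "s = sig k"
  have s: "1 \<le> s" "s\<^sup>2 = 1 + 3 * k\<^sup>2" "(s - 1) * (s + 1) = 3 * k\<^sup>2"
    using sig_ge_1[of k] sig_sq[of k] by (auto simp: s_def power2_eq_square algebra_simps)
  have nu: "nu True k = (s - 1)\<^sup>2 / 3" "nu False k = (s + 1)\<^sup>2 / 3" by (simp_all add: nu_def s_def)
  show "1 + k\<^sup>2 \<le> nu False k" unfolding nu using s by (simp add: power2_sum)
  show "k ^ 4 / 3 \<le> nu True k" if k: "\<bar>k\<bar> \<le> 1"
  proof -
    have "k\<^sup>2 \<le> 1" using k by (simp add: abs_square_le_1)
    then have "s\<^sup>2 \<le> 2\<^sup>2" using s by simp
    then have "s \<le> 2" by (rule power2_le_imp_le) simp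
    then have "(s - 1) * (s + 1) \<le> (s - 1) * 3" using s by (intro mult_left_mono) auto
    then have "k\<^sup>2 \<le> s - 1" using s(3) by simp
    then have "(k\<^sup>2)\<^sup>2 \<le> (s - 1)\<^sup>2" by (intro power_mono) auto
    then show ?thesis unfolding nu by (simp flip: power_mult)
  qed
  show "k\<^sup>2 / 3 \<le> nu True k" if k: "1 \<le> \<bar>k\<bar>"
  proof -
    have "1 \<le> k\<^sup>2" using k by (metis abs_le_square_iff abs_one one_power2)
    then have "s\<^sup>2 \<le> (2 * \<bar>k\<bar>)\<^sup>2" using s by (simp add: power_mult_distrib)
    then have "s \<le> 2 * \<bar>k\<bar>" by (rule power2_le_imp_le) simp
    then have "(s - 1) * (s + 1) \<le> (s - 1) * (3 * \<bar>k\<bar>)" using s k by (intro mult_left_mono) auto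
    moreover have "\<bar>k\<bar> * (3 * \<bar>k\<bar>) = 3 * k\<^sup>2" by (simp add: power2_eq_square)
    ultimately have "\<bar>k\<bar> * (3 * \<bar>k\<bar>) \<le> (s - 1) * (3 * \<bar>k\<bar>)" using s(3) by linarith
    then have "\<bar>k\<bar> \<le> s - 1" using k by (subst (asm) mult_le_cancel_right) auto
    then have "\<bar>k\<bar>\<^sup>2 \<le> (s - 1)\<^sup>2" by (intro power_mono) auto
    then show ?thesis unfolding nu by simp
  qed
qed

text \<open>The loss from moving a weight from time \<open>s\<close> to \<open>t\<close> is at most \<open>(1 + t - s)^((n + m) / 4)\<close>, which is harmless
where the semigroup decays exponentially.\<close>

lemma wgt_transfer_large:
  assumes s: "0 \<le> s" "s \<le> t" and n: "n + m \<le> 8"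
  shows "wgt n s k / theta s ^ m \<le> (1 + (t - s))\<^sup>2 * (wgt n t k / theta t ^ m)"
proof -
  define p where "p = (1 + (t - s)) powr (1/4)"
  have p1: "1 \<le> p" unfolding p_def using s by (intro ge_one_powr_ge_zero) auto
  have p8: "p ^ 8 = (1 + (t - s))\<^sup>2"
  proof -
    have "p ^ 4 = 1 + (t - s)" using theta_pow4[of "t - s"] s by (simp add: p_def theta_def)
    moreover have "p ^ 8 = (p ^ 4)\<^sup>2" by (simp flip: power_mult)
    ultimately show ?thesis by simp
  qed
  have th: "1 \<le> theta s" "1 \<le> theta t" using theta_ge_1 s by auto
  have tt: "theta t \<le> theta s * p" unfolding p_def by (rule theta_transfer[OF s])
  define c d where "c = 1 + \<bar>k\<bar> * theta s" and "d = 1 + \<bar>k\<bar> * theta t"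
  have cd: "1 \<le> c" "1 \<le> d" using wgt_base_pos s by (auto simp: c_def d_def)
  have "\<bar>k\<bar> * theta t \<le> \<bar>k\<bar> * (theta s * p)" using tt by (intro mult_left_mono) auto
  then have "d \<le> c * p" using p1 by (simp add: c_def d_def algebra_simps)
  then have "d ^ n * theta t ^ m \<le> (c * p) ^ n * (theta s * p) ^ m"
    using cd th tt p1 by (intro mult_mono power_mono) auto
  also have "\<dots> = c ^ n * theta s ^ m * p ^ (n + m)" by (simp add: power_mult_distrib power_add mult_ac)
  also have "\<dots> \<le> c ^ n * theta s ^ m * p ^ 8"
    using cd th p1 n by (intro mult_left_mono power_increasing) auto
  finally have le: "d ^ n * theta t ^ m \<le> p ^ 8 * (c ^ n * theta s ^ m)" by (simp add: mult_ac)
  define X Y where "X = c ^ n * theta s ^ m" and "Y = d ^ n * theta t ^ m"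
  have XY: "0 < X" "0 < Y" using cd th by (auto simp: X_def Y_def)
  have "1 / X \<le> p ^ 8 * (1 / Y)" using le XY unfolding X_def[symmetric] Y_def[symmetric] by (simp add: field_simps)
  then show ?thesis unfolding p8 wgt_def c_def[symmetric] d_def[symmetric] X_def Y_def by simp
qed

lemma quintic_le_exp:
  fixes y :: real
  assumes "0 \<le> y" shows "(1 + y) ^ 5 \<le> 30 ^ 5 * exp (y ^ 4 / 6)"
proof -
  have "y \<le> 1 + y ^ 4"
  proof (cases "y \<le> 1")
    case False
    then have "y ^ 1 \<le> y ^ 4" by (intro power_increasing) auto
    then show ?thesis by simp
  qed (use assms in \<open>simp add: add_increasing2\<close>)
  then have "1 + y \<le> 30 * (1 + y ^ 4 / 30)" by simp
  also have "\<dots> \<le> 30 * exp (y ^ 4 / 30)" by (intro mult_left_mono exp_ge_add_one_self) simp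
  finally have "(1 + y) ^ 5 \<le> (30 * exp (y ^ 4 / 30)) ^ 5" using assms by (intro power_mono) auto
  also have "\<dots> = 30 ^ 5 * exp (y ^ 4 / 6)" by (simp add: power_mult_distrib flip: exp_of_nat_mult)
  finally show ?thesis .
qed

text \<open>Moving the weight from time \<open>s\<close> to \<open>t\<close> costs \<open>(1 + y)^5\<close> with \<open>y = |k| (t - s)^(1/4)\<close>. Half of the decay
\<open>exp (- k^4 (t - s) / 3) = exp (- y^4 / 3)\<close> of the critical mode pays for it, the other half is kept for the
Duhamel integral.\<close>

lemma wgt_transfer_small:
  assumes s: "0 \<le> s" "s \<le> t" and n: "n \<le> 5" and k: "\<bar>k\<bar> \<le> 1"
  shows "exp (- nu True k * (t - s)) * wgt n s k \<le> 30 ^ 5 * (exp (- (k ^ 4 / 6) * (t - s)) * wgt n t k)"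
proof -
  define z where "z = (t - s) powr (1/4)"
  have z: "0 \<le> z" "z ^ 4 = t - s"
    using s by (auto simp: z_def powr_powr powr_realpow' [symmetric] simp del: powr_realpow')
  define y where "y = \<bar>k\<bar> * z"
  have y: "0 \<le> y" "y ^ 4 = k ^ 4 * (t - s)" using z by (auto simp: y_def power_mult_distrib)
  define c d where "c = 1 + \<bar>k\<bar> * theta s" and "d = 1 + \<bar>k\<bar> * theta t"
  have cd: "1 \<le> c" "1 \<le> d" using wgt_base_pos s by (auto simp: c_def d_def)
  have "\<bar>k\<bar> * theta t \<le> \<bar>k\<bar> * (theta s + z)" using theta_transfer(2)[OF s] by (intro mult_left_mono) (auto simp: z_def)
  then have "d \<le> c + y" by (simp add: c_def d_def y_def algebra_simps)
  also have "\<dots> \<le> c * (1 + y)" using mult_right_mono[OF cd(1) y(1)] by (simp add: algebra_simps)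
  finally have "d ^ n \<le> (c * (1 + y)) ^ n" using cd by (intro power_mono) auto
  also have "\<dots> = c ^ n * (1 + y) ^ n" by (rule power_mult_distrib)
  also have "\<dots> \<le> c ^ n * (1 + y) ^ 5" using cd y n by (intro mult_left_mono power_increasing) auto
  also have "\<dots> \<le> c ^ n * (30 ^ 5 * exp (y ^ 4 / 6))" using cd quintic_le_exp[OF y(1)] by (intro mult_left_mono) auto
  finally have le: "d ^ n \<le> c ^ n * (30 ^ 5 * exp (k ^ 4 / 6 * (t - s)))" by (simp add: y(2))
  define X Y where "X = c ^ n" and "Y = d ^ n"
  have XY: "0 < X" "0 < Y" using cd by (auto simp: X_def Y_def)
  have "1 / X \<le> 30 ^ 5 * exp (k ^ 4 / 6 * (t - s)) * (1 / Y)"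
    using le XY unfolding X_def[symmetric] Y_def[symmetric] by (simp add: field_simps)
  moreover have "exp (- nu True k * (t - s)) \<le> exp (- (k ^ 4 / 3) * (t - s))"
    using mult_right_mono[OF nu_lower(1)[OF k], of "t - s"] s by simp
  ultimately have "exp (- nu True k * (t - s)) * (1 / X) \<le> exp (- (k ^ 4 / 3) * (t - s)) * (30 ^ 5 * exp (k ^ 4 / 6 * (t - s)) * (1 / Y))"
    using XY by (intro mult_mono) auto
  also have "\<dots> = 30 ^ 5 * (exp (- (k ^ 4 / 3) * (t - s)) * exp (k ^ 4 / 6 * (t - s)) * (1 / Y))" by simp
  also have "exp (- (k ^ 4 / 3) * (t - s)) * exp (k ^ 4 / 6 * (t - s)) = exp (- (k ^ 4 / 6) * (t - s))"
    unfolding exp_add[symmetric] by (simp add: field_simps)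
  finally show ?thesis by (simp add: wgt_def X_def Y_def c_def d_def)
qed

text \<open>The factor \<open>30^5\<close> is the price of \<open>wgt_transfer_small\<close>, and \<open>250 = 100 + 150\<close> adds the two critical terms in
\<open>duhamel_polH\<close>.\<close>

definition duhamel_const :: real where "duhamel_const = 30 ^ 5 * 250"

text \<open>The majorant of the modes in polar coordinates. The stable mode follows the quadratic source
\<open>wgt 4 t k / theta t ^ 3\<close> instantaneously, and the smoothing of its rate \<open>1 + k^2\<close> gives the factor \<open>1 / (1 + |k|)\<close>.\<close>

definition polW :: "real \<Rightarrow> bool \<Rightarrow> real \<Rightarrow> real" where
  "polW t b k = (if b then wgt 5 t k else wgt 4 t k / theta t ^ 3 / (1 + \<bar>k\<bar>))"

text \<open>The majorant of the nonlinearity. On the critical mode at small \<open>k\<close> it consists of the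
derivative terms, with a factor \<open>|k|\<close>, and of the term with the slaved combination, which
decays like \<open>theta t ^ -6\<close>; everywhere else the plain quadratic bound suffices.\<close>

definition polH :: "real \<Rightarrow> bool \<Rightarrow> real \<Rightarrow> real" where
  "polH t b k = (if b \<and> \<bar>k\<bar> \<le> 1 then \<bar>k\<bar> * (wgt 4 t k / theta t ^ 3) + wgt 2 t k / theta t ^ 6
     else wgt 4 t k / theta t ^ 3)"

lemma polH_continuous: "continuous_on {0..t} (\<lambda>s. polH s b k)"
proof -
  have c: "continuous_on {0..t} (\<lambda>s. wgt n s k / theta s ^ m)" for n m
    by (intro continuous_intros wgt_continuous theta_continuous) (simp add: theta_neq_0)
  show ?thesis
  proof (cases "b \<and> \<bar>k\<bar> \<le> 1")
    case True
    then show ?thesis unfolding polH_def by (simp only: if_True simp_thms) (intro continuous_on_add continuous_on_mult_left c)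
  next
    case False
    then show ?thesis unfolding polH_def by (simp only: if_False) (rule c)
  qed
qed

lemma duhamel_wgt_large:
  assumes a: "1/3 \<le> a" and t: "0 \<le> t"
  shows "duh (\<lambda>s. wgt 4 s k / theta s ^ 3) a t \<le> 288 / a * (wgt 4 t k / theta t ^ 3)"
proof -
  define w where "w = wgt 4 t k / theta t ^ 3"
  have w: "0 \<le> w" unfolding w_def using wgt_nonneg[OF t] theta_ge_1[OF t] by simp
  have "duh (\<lambda>s. wgt 4 s k / theta s ^ 3) a t \<le> duh (\<lambda>s. 144 * w) (a / 2) t"
  proof (rule duh_mono)
    show "continuous_on {0..t} (\<lambda>s. wgt 4 s k / theta s ^ 3)"
      by (intro continuous_intros wgt_continuous theta_continuous) (simp add: theta_neq_0)
    fix s assume s: "s \<in> {0..t}"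
    have "exp (- a * (t - s)) * (wgt 4 s k / theta s ^ 3) \<le> exp (- a * (t - s)) * ((1 + (t - s))\<^sup>2 * w)"
      unfolding w_def using s by (intro mult_left_mono wgt_transfer_large) auto
    also have "\<dots> = exp (- a * (t - s)) * (1 + (t - s))\<^sup>2 * w" by simp
    also have "\<dots> \<le> 144 * exp (- (a / 2) * (t - s)) * w"
      using s w a by (intro mult_right_mono exp_absorbs_quadratic) auto
    finally show "exp (- a * (t - s)) * (wgt 4 s k / theta s ^ 3) \<le> exp (- (a / 2) * (t - s)) * (144 * w)"
      by (simp add: mult_ac)
  qed simp
  also have "\<dots> \<le> 144 * w / (a / 2)" using a t w by (intro duh_const) auto
  also have "\<dots> = 288 / a * w" by simp
  finally show ?thesis by (simp add: w_def)
qed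

text \<open>The closing estimate. At small \<open>k\<close> the critical Duhamel integral is, in terms of \<open>x = |k| theta t\<close>, bounded by
\<open>x / (1 + x^4 / 6)\<close> times \<open>wgt 4\<close> plus \<open>1 / (1 + x^4 / 6)\<close> times \<open>wgt 2\<close>; the quartic denominator restores the lost powers
of the weight, since \<open>x (1 + x)\<close> and \<open>(1 + x)^3\<close> are at most a multiple of \<open>1 + x^4 / 6\<close>. Without the factor \<open>|k|\<close> in
the first term there would be \<open>theta t\<close> in place of \<open>x\<close>. In the remaining cases the rate
is bounded below, and its size for large \<open>k\<close> supplies the missing power of \<open>1 + |k|\<close>.\<close>

lemma duhamel_polH:
  assumes t: "0 \<le> t"
  shows "duh (\<lambda>s. polH s b k) (nu b k) t \<le> duhamel_const * polW t b k"
proof (cases "b \<and> \<bar>k\<bar> \<le> 1")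
  case True
  then have b: "b = True" and k: "\<bar>k\<bar> \<le> 1" by auto
  define a where "a = k ^ 4 / 6"
  have a: "0 \<le> a" by (simp add: a_def)
  define x where "x = \<bar>k\<bar> * theta t"
  have x: "0 \<le> x" "1 + a * (1 + t) = 1 + x ^ 4 / 6"
    using theta_ge_1[OF t] theta_pow4[OF t] by (auto simp: x_def a_def power_mult_distrib)
  define w where "w n = wgt n t k" for n
  have w: "0 < w n" for n using wgt_pos[OF t] by (simp add: w_def)
  define \<psi> where "\<psi> s = 30 ^ 5 * (\<bar>k\<bar> * w 4 * (1 / theta s ^ 3) + w 2 * (1 / theta s ^ 6))" for s
  have c: "continuous_on {0..t} (\<lambda>s. c * (1 / theta s ^ n))" for c n
    by (intro continuous_intros inv_theta_continuous)
  have "duh (\<lambda>s. polH s b k) (nu b k) t \<le> duh \<psi> a t"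
  proof (rule duh_mono[OF polH_continuous])
    show "continuous_on {0..t} \<psi>" unfolding \<psi>_def by (intro continuous_on_mult_left continuous_on_add c)
    fix s assume s: "s \<in> {0..t}"
    have th: "0 < theta s" using theta_ge_1[of s] s by auto
    have "exp (- nu True k * (t - s)) * wgt n s k \<le> 30 ^ 5 * (exp (- a * (t - s)) * w n)" if "n \<le> 5" for n
      unfolding a_def w_def by (rule wgt_transfer_small[OF _ _ that k]) (use s in auto)
    then have e: "exp (- nu True k * (t - s)) * wgt n s k * d \<le> 30 ^ 5 * (exp (- a * (t - s)) * w n) * d" if "n \<le> 5" "0 \<le> d" for n d
      using that by (intro mult_right_mono) auto
    have "exp (- nu True k * (t - s)) * polH s True k
        = exp (- nu True k * (t - s)) * wgt 4 s k * (\<bar>k\<bar> / theta s ^ 3) + exp (- nu True k * (t - s)) * wgt 2 s k * (1 / theta s ^ 6)"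
      using k by (simp add: polH_def algebra_simps)
    also have "\<dots> \<le> 30 ^ 5 * (exp (- a * (t - s)) * w 4) * (\<bar>k\<bar> / theta s ^ 3) + 30 ^ 5 * (exp (- a * (t - s)) * w 2) * (1 / theta s ^ 6)"
      using th by (intro add_mono e) auto
    also have "\<dots> = exp (- a * (t - s)) * \<psi> s" by (simp add: \<psi>_def algebra_simps)
    finally show "exp (- nu b k * (t - s)) * polH s b k \<le> exp (- a * (t - s)) * \<psi> s" unfolding b .
  qed
  also have "\<dots> = 30 ^ 5 * (\<bar>k\<bar> * w 4 * duh (\<lambda>s. 1 / theta s ^ 3) a t + w 2 * duh (\<lambda>s. 1 / theta s ^ 6) a t)"
    unfolding \<psi>_def duh_cmult duh_add[OF c c] ..
  also have "\<dots> \<le> 30 ^ 5 * (\<bar>k\<bar> * w 4 * (5 * theta t / (1 + x ^ 4 / 6)) + w 2 * (6 / (1 + x ^ 4 / 6)))"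
    using duhamel_theta_3[OF a t] duhamel_theta_6[OF a t] w[of 4] w[of 2]
    unfolding duh_def x(2) by (intro mult_left_mono add_mono) auto
  also have "\<dots> \<le> 30 ^ 5 * (100 * w 5 + 150 * w 5)"
  proof (intro mult_left_mono add_mono)
    define P where "P = 1 + x ^ 4 / 6"
    have P: "0 < P" by (simp add: P_def add_pos_nonneg)
    have x1: "0 < 1 + x" using x by simp
    have "0 \<le> x ^ 2 + 1 - 2 * x" using zero_le_power2[of "x - 1"] by (simp add: power2_diff)
    then have x2: "2 * x \<le> 1 + x ^ 2" by simp
    have "0 \<le> (x ^ 2) ^ 2 + 1 - 2 * x ^ 2" using zero_le_power2[of "x ^ 2 - 1"] by (simp add: power2_diff)
    then have x4: "2 * x ^ 2 \<le> 1 + x ^ 4" by (simp flip: power_mult)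
    define c where "c = 1 + x"
    have c0: "c \<noteq> 0" using x1 by (simp add: c_def)
    have c: "1 / c ^ 4 = c * (1 / c ^ 5)" "1 / c ^ 2 = c ^ 3 * (1 / c ^ 5)"
      unfolding times_divide_eq_right mult_1_right
      by (subst frac_eq_eq; use c0 in \<open>simp add: eval_nat_numeral mult.assoc\<close>)+
    have w5: "w 4 = (1 + x) * w 5" "w 2 = (1 + x) ^ 3 * w 5"
      unfolding w_def wgt_def x_def[symmetric] c_def[symmetric]
      by (rule c)+
    have lin: "5 * x + 5 * y \<le> 100 * (1 + z / 6)" if "2 * x \<le> 1 + y" "2 * y \<le> 1 + z" "0 \<le> z" for y z :: real
      using that by (simp add: field_simps)
    have lin3: "6 * (1 + 3 * x + 3 * y + w) \<le> 150 * (1 + z / 6)"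
      if "2 * x \<le> 1 + y" "2 * y \<le> 1 + z" "2 * w \<le> y + z" "0 \<le> z" for y z w :: real
      using that by (simp add: field_simps)
    have e1: "5 * x * (1 + x) = 5 * x + 5 * x ^ 2" by (simp add: power2_eq_square algebra_simps)
    have "5 * x * (1 + x) \<le> 100 * P"
      unfolding P_def e1 using lin[OF x2 x4] zero_le_power[OF x(1), of 4] by blast
    then have "5 * x * (1 + x) * w 5 \<le> 100 * P * w 5" using w[of 5] by (intro mult_right_mono) auto
    then have "5 * x * (1 + x) * w 5 / P \<le> 100 * w 5" using P by (simp add: field_simps)
    then show "\<bar>k\<bar> * w 4 * (5 * theta t / (1 + x ^ 4 / 6)) \<le> 100 * w 5"
      unfolding w5 P_def x_def by (simp add: mult_ac)
    have x3: "2 * x ^ 3 \<le> x ^ 2 + x ^ 4"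
    proof -
      have "0 \<le> x ^ 2 * (x - 1) ^ 2" by simp
      then show ?thesis by (simp add: power2_eq_square power3_eq_cube power4_eq_xxxx algebra_simps)
    qed
    have e3: "(1 + x) ^ 3 = 1 + 3 * x + 3 * x ^ 2 + x ^ 3"
      by (simp add: power2_eq_square power3_eq_cube algebra_simps)
    have "6 * (1 + x) ^ 3 \<le> 150 * P"
      unfolding P_def e3 using lin3[OF x2 x4] x3 zero_le_power[OF x(1), of 4] by blast
    then have "6 * (1 + x) ^ 3 * w 5 \<le> 150 * P * w 5" using w[of 5] by (intro mult_right_mono) auto
    then have "6 * (1 + x) ^ 3 * w 5 / P \<le> 150 * w 5" using P by (simp add: field_simps)
    then show "w 2 * (6 / (1 + x ^ 4 / 6)) \<le> 150 * w 5"
      unfolding w5 P_def by (simp add: mult_ac)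
  qed simp
  also have "\<dots> = duhamel_const * polW t b k" by (simp add: duhamel_const_def polW_def b w_def)
  finally show ?thesis .
next
  case False
  then have H: "(\<lambda>s. polH s b k) = (\<lambda>s. wgt 4 s k / theta s ^ 3)" by (auto simp: polH_def)
  define w where "w = wgt 4 t k / theta t ^ 3"
  have th: "1 \<le> theta t" by (rule theta_ge_1[OF t])
  have w: "0 \<le> w" unfolding w_def using wgt_nonneg[OF t] th by simp
  show ?thesis
  proof (cases b)
    case True
    then have k: "1 \<le> \<bar>k\<bar>" using False by auto
    then have "1 \<le> \<bar>k\<bar>\<^sup>2" by (intro one_le_power)
    then have k2: "1 \<le> k\<^sup>2" by simp
    have nu: "1/3 \<le> nu b k" "k\<^sup>2 / 3 \<le> nu b k" using nu_lower(2)[OF k] k2 True by auto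
    have "duh (\<lambda>s. polH s b k) (nu b k) t \<le> 288 / nu b k * w"
      unfolding H w_def by (rule duhamel_wgt_large[OF nu(1) t])
    also have "\<dots> \<le> 288 / (k\<^sup>2 / 3) * w"
      using nu k2 w by (intro mult_right_mono divide_left_mono mult_pos_pos; linarith)
    also have "\<dots> \<le> 1728 * wgt 5 t k"
    proof -
      define c where "c = 1 + \<bar>k\<bar> * theta t"
      have c: "1 \<le> c" using wgt_base_pos[OF t] by (simp add: c_def)
      have "1 * 1 \<le> \<bar>k\<bar> * theta t" using k th by (intro mult_mono) auto
      then have "c \<le> 2 * (\<bar>k\<bar> * theta t)" by (simp add: c_def)
      also have "\<dots> \<le> 2 * (\<bar>k\<bar>\<^sup>2 * theta t ^ 3)"
        using k th by (intro mult_left_mono mult_mono self_le_power) auto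
      finally have *: "c \<le> 2 * (k\<^sup>2 * theta t ^ 3)" by simp
      define Q where "Q = k\<^sup>2 * theta t ^ 3"
      have "0 < k\<^sup>2" "0 < theta t ^ 3" using k2 th by (linarith, simp)
      then have Q: "0 < Q" unfolding Q_def by (rule mult_pos_pos)
      have "864 / Q \<le> 1728 / c" using * Q c unfolding Q_def[symmetric] by (simp add: field_simps)
      then have "864 / Q * (1 / c ^ 4) \<le> 1728 / c * (1 / c ^ 4)" using c by (intro mult_right_mono) auto
      moreover have "288 / (k\<^sup>2 / 3) * w = 864 / Q * (1 / c ^ 4)"
        by (simp add: w_def wgt_def c_def Q_def)
      moreover have "c ^ 5 = c * c ^ 4" by (simp add: eval_nat_numeral)
      ultimately show ?thesis by (simp add: wgt_def flip: c_def)
    qed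
    also have "\<dots> \<le> duhamel_const * wgt 5 t k" using wgt_nonneg[OF t] by (intro mult_right_mono) (auto simp: duhamel_const_def)
    finally show ?thesis using True by (simp add: polW_def)
  next
    case b: False
    have "1 + k\<^sup>2 \<le> nu False k" "1/3 \<le> nu False k" using nu_lower(3)[of k] zero_le_power2[of k] by linarith+
    then have nu: "1/3 \<le> nu b k" "1 + k\<^sup>2 \<le> nu b k" using b by simp_all
    have "duh (\<lambda>s. polH s b k) (nu b k) t \<le> 288 / nu b k * w"
      unfolding H w_def by (rule duhamel_wgt_large[OF nu(1) t])
    also have "\<dots> \<le> 288 / (1 + k\<^sup>2) * w"
      using nu w zero_le_power2[of k] by (intro mult_right_mono divide_left_mono mult_pos_pos; linarith)
    also have "\<dots> \<le> 576 / (1 + \<bar>k\<bar>) * w"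
    proof (rule mult_right_mono[OF _ w])
      have "1 + \<bar>k\<bar> \<le> 1 + (1 + k\<^sup>2)" using abs_le_one_plus_sq[of k] by simp
      also have "\<dots> \<le> 2 * (1 + k\<^sup>2)" by simp
      finally have "1 + \<bar>k\<bar> \<le> 2 * (1 + k\<^sup>2)" .
      then have "288 / (1 + k\<^sup>2) \<le> 288 / ((1 + \<bar>k\<bar>) / 2)"
        by (intro divide_left_mono) (auto intro!: mult_pos_pos add_pos_nonneg)
      then show "288 / (1 + k\<^sup>2) \<le> 576 / (1 + \<bar>k\<bar>)" by simp
    qed
    also have "\<dots> \<le> duhamel_const / (1 + \<bar>k\<bar>) * w"
      using w by (intro mult_right_mono divide_right_mono) (auto simp: duhamel_const_def)
    finally show ?thesis using b by (simp add: polW_def w_def mult.commute)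
  qed
qed

text \<open>The semigroup spreads the initial weight to the weight at time \<open>t\<close>, by the same transfer estimates.\<close>

lemma linear_polW:
  assumes t: "0 \<le> t"
  shows "exp (- nu b k * t) * wgt 5 0 k \<le> 30 ^ 5 * polW t b k"
proof (cases "b \<and> \<bar>k\<bar> \<le> 1")
  case True
  have "exp (- nu True k * (t - 0)) * wgt 5 0 k \<le> 30 ^ 5 * (exp (- (k ^ 4 / 6) * (t - 0)) * wgt 5 t k)"
    by (rule wgt_transfer_small) (use t True in auto)
  also have "\<dots> \<le> 30 ^ 5 * (1 * wgt 5 t k)"
    using t wgt_nonneg[OF t] by (intro mult_left_mono mult_right_mono) auto
  finally show ?thesis using True by (simp add: polW_def)
next
  case False
  have nu: "1/3 \<le> nu b k"
  proof (cases b)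
    case True
    then have k: "1 \<le> \<bar>k\<bar>" using False by auto
    then have "1 \<le> \<bar>k\<bar>\<^sup>2" by (intro one_le_power)
    then show ?thesis using nu_lower(2)[OF k] True by auto
  next
    case b: False
    have "1/3 \<le> nu False k" using nu_lower(3)[of k] zero_le_power2[of k] by linarith
    then show ?thesis using b by simp
  qed
  have e: "exp (- nu b k * t) * (1 + (t - 0))\<^sup>2 \<le> 144"
  proof -
    have "exp (- nu b k * t) * (1 + t)\<^sup>2 \<le> 144 * exp (- (nu b k / 2) * t)"
      by (rule exp_absorbs_quadratic[OF nu t])
    also have "\<dots> \<le> 144 * 1" using nu t by (intro mult_left_mono) auto
    finally show ?thesis by simp
  qed
  have key: "exp (- nu b k * t) * (wgt n 0 k / theta 0 ^ m) \<le> 144 * (wgt n t k / theta t ^ m)" if "n + m \<le> 8" for n m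
  proof -
    have "exp (- nu b k * t) * (wgt n 0 k / theta 0 ^ m) \<le> exp (- nu b k * t) * ((1 + (t - 0))\<^sup>2 * (wgt n t k / theta t ^ m))"
      using wgt_transfer_large[OF order_refl t that] by (intro mult_left_mono) auto
    also have "\<dots> = (exp (- nu b k * t) * (1 + (t - 0))\<^sup>2) * (wgt n t k / theta t ^ m)" by simp
    also have "\<dots> \<le> 144 * (wgt n t k / theta t ^ m)"
      using e wgt_nonneg[OF t] theta_ge_1[OF t] by (intro mult_right_mono) auto
    finally show ?thesis .
  qed
  have pW: "0 \<le> polW t b k" using wgt_nonneg[OF t] theta_ge_1[OF t] by (simp add: polW_def)
  have "exp (- nu b k * t) * wgt 5 0 k \<le> 144 * polW t b k"
  proof (cases b)
    case True
    then show ?thesis using key[of 5 0] by (simp add: polW_def)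
  next
    case bF: False
    have "wgt 5 0 k = wgt 4 0 k / theta 0 ^ 3 / (1 + \<bar>k\<bar>)"
      by (simp add: wgt_zero_eq theta_0 eval_nat_numeral)
    moreover have "exp (- nu b k * t) * (wgt 4 0 k / theta 0 ^ 3) / (1 + \<bar>k\<bar>) \<le> 144 * (wgt 4 t k / theta t ^ 3) / (1 + \<bar>k\<bar>)"
      using key[of 4 3] by (intro divide_right_mono) auto
    ultimately show ?thesis using bF by (simp add: polW_def)
  qed
  also have "\<dots> \<le> 30 ^ 5 * polW t b k" using pW by (intro mult_right_mono) auto
  finally show ?thesis .
qed

section \<open>The nonlinearity in polar coordinates\<close>

definition dk :: "(real \<Rightarrow> complex) \<Rightarrow> real \<Rightarrow> complex" where "dk f k = \<i> * of_real k * f k"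

text \<open>With the index shift of \<open>conv_series\<close> these are the coefficients of \<open>exp (2 w) - 1 - 2 w\<close>; the linear term
vanishes.\<close>

definition exp_coeff :: "nat \<Rightarrow> real" where
  "exp_coeff n = (if n = 0 then 0 else 2 ^ (n + 1) / fact (n + 1))"

text \<open>The transforms of \<open>\<rho>_x^2 - \<phi>_x^2 - (2/3) (exp (2 \<rho>) - 1 - 2 \<rho>)\<close> and, next, of \<open>2 \<rho>_x \<phi>_x\<close>.\<close>

definition pol_rho :: "(real \<Rightarrow> complex) \<Rightarrow> (real \<Rightarrow> complex) \<Rightarrow> real \<Rightarrow> complex" where
  "pol_rho a p k = conv (dk a) (dk a) k - conv (dk p) (dk p) k - of_real (2/3) * conv_series exp_coeff a k"

definition pol_phi :: "(real \<Rightarrow> complex) \<Rightarrow> (real \<Rightarrow> complex) \<Rightarrow> real \<Rightarrow> complex" where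
  "pol_phi a p k = 2 * conv (dk a) (dk p) k"

definition polN :: "(bool \<Rightarrow> real \<Rightarrow> complex) \<Rightarrow> bool \<Rightarrow> real \<Rightarrow> complex" where
  "polN u = modes (pol_rho (amp u) (pha u)) (pol_phi (amp u) (pha u))"

text \<open>The stationary amplitude equation reads \<open>(4/3) \<rho> + 2 q \<phi>_x = 0\<close> at leading order, so \<open>\<rho>\<close> follows
\<open>- (sqrt 3 / 2) \<phi>_x\<close>; this is the deviation.\<close>

definition slaved :: "(bool \<Rightarrow> real \<Rightarrow> complex) \<Rightarrow> real \<Rightarrow> complex" where
  "slaved u k = amp u k + of_real (sqrt 3 / 2) * dk (pha u) k"

lemma two_power_le_fact: "(2::real) ^ n \<le> 2 * fact n"
proof (induction n)
  case (Suc n)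
  show ?case
  proof (cases n)
    case (Suc m)
    have "2 ^ Suc n \<le> 2 * (2 * fact n :: real)" using Suc.IH by simp
    also have "\<dots> \<le> real (Suc n) * (2 * fact n)" using Suc by (intro mult_right_mono) auto
    finally show ?thesis by (simp add: algebra_simps)
  qed simp
qed simp

lemma exp_coeff_le: "\<bar>exp_coeff n\<bar> \<le> 2"
  using two_power_le_fact[of "n + 1"] by (simp add: exp_coeff_def divide_le_eq)

lemma exp_coeff_0: "exp_coeff 0 = 0"
  by (simp add: exp_coeff_def)

lemma dk_diff: "dk f k - dk g k = dk (\<lambda>k. f k - g k) k"
  by (simp add: dk_def right_diff_distrib)

lemma norm_dk: "norm (dk f k) = \<bar>k\<bar> * norm (f k)"
  by (simp add: dk_def norm_mult)

lemma measurable_dk [measurable]: "f \<in> borel_measurable borel \<Longrightarrow> dk f \<in> borel_measurable borel"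
  unfolding dk_def[abs_def] by measurable

lemma hermitian_dk: "hermitian f \<Longrightarrow> hermitian (dk f)"
  unfolding dk_def[abs_def] by (rule hermitian_derivative)

lemma measurable_dk_param:
  fixes f :: "real \<Rightarrow> real \<Rightarrow> complex"
  assumes "case_prod f \<in> borel_measurable (borel \<Otimes>\<^sub>M borel)"
  shows "case_prod (\<lambda>t. dk (f t)) \<in> borel_measurable (borel \<Otimes>\<^sub>M borel)"
proof -
  have [measurable]: "(\<lambda>x. f (fst x) (snd x)) \<in> borel_measurable (borel \<Otimes>\<^sub>M borel)"
    using assms by (simp add: case_prod_beta')
  show ?thesis unfolding case_prod_beta' dk_def by measurable
qed

lemma slaved_diff: "slaved u k - slaved v k = slaved (\<lambda>b k. u b k - v b k) k"
  by (simp add: slaved_def amp_diff pha_diff dk_def algebra_simps)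

text \<open>The critical mode enters with the coefficient \<open>(sqrt 3 / 2) k - beta k\<close>, in which the linear terms in \<open>k\<close>
cancel; it equals \<open>(sqrt 3 / 2) k (beta k)^2\<close>.\<close>

lemma norm_slaved_le: "norm (slaved u k) \<le> norm (u False k) * (1 + \<bar>k\<bar>) + \<bar>k\<bar> ^ 3 * norm (u True k)"
proof -
  define r where "r = sqrt 3 / 2"
  have "sqrt 3 \<le> 2" by (rule real_le_lsqrt) auto
  then have r: "0 \<le> r" "r \<le> 1" by (auto simp: r_def)
  define B where "B = beta k"
  have B: "\<bar>B\<bar> \<le> 1" "\<bar>B\<bar> \<le> \<bar>k\<bar>" by (simp_all add: B_def abs_beta_le_1 abs_beta_le)
  have Bk: "r * k - B = r * k * B\<^sup>2"
  proof -
    define g where "g = 2 / (sig k + 1)"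
    have h1: "B\<^sup>2 = 1 - g" unfolding B_def beta_sq g_def using sig_ge_1[of k] by (simp add: field_simps)
    have h2: "B = r * k * g" by (simp add: B_def beta_def r_def g_def)
    have "r * k - B = r * k * (1 - g)" by (subst h2) (simp add: algebra_simps)
    then show ?thesis by (simp only: h1)
  qed
  define D where "D = (of_real (1 + B\<^sup>2) :: complex)"
  have D: "1 \<le> norm D" unfolding D_def norm_of_real by simp
  have "slaved u k = (of_real (1 + r * k * B) * u False k + \<i> * of_real (r * k - B) * u True k) / D"
    unfolding slaved_def amp_def pha_def dk_def B_def[symmetric] D_def[symmetric] r_def[symmetric]
    by (simp add: add_divide_distrib diff_divide_distrib algebra_simps)
  then have "norm (slaved u k) = norm (of_real (1 + r * k * B) * u False k + \<i> * of_real (r * k - B) * u True k) / norm D"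
    by (simp only: norm_divide)
  also have "\<dots> \<le> norm (of_real (1 + r * k * B) * u False k + \<i> * of_real (r * k - B) * u True k)"
    using D mult_left_mono[OF D norm_ge_zero] by (subst pos_divide_le_eq) auto
  also have "\<dots> \<le> \<bar>1 + r * k * B\<bar> * norm (u False k) + \<bar>r * k - B\<bar> * norm (u True k)"
    by (rule order_trans[OF norm_triangle_ineq]) (simp add: norm_mult del: of_real_add of_real_diff of_real_mult)
  also have "\<dots> \<le> (1 + \<bar>k\<bar>) * norm (u False k) + \<bar>k\<bar> ^ 3 * norm (u True k)"
  proof (intro add_mono mult_right_mono)
    have "r * \<bar>k\<bar> * \<bar>B\<bar> \<le> 1 * \<bar>k\<bar> * 1" using r B by (intro mult_mono) auto
    then have "\<bar>r * k * B\<bar> \<le> \<bar>k\<bar>" using r by (simp add: abs_mult)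
    then show "\<bar>1 + r * k * B\<bar> \<le> 1 + \<bar>k\<bar>" by linarith
    have "r * \<bar>k\<bar> * \<bar>B\<bar>\<^sup>2 \<le> 1 * \<bar>k\<bar> * \<bar>k\<bar>\<^sup>2" using r B by (intro mult_mono power_mono) auto
    then show "\<bar>r * k - B\<bar> \<le> \<bar>k\<bar> ^ 3" unfolding Bk using r by (simp add: abs_mult power3_eq_cube power2_eq_square)
  qed simp_all
  finally show ?thesis by (simp add: mult.commute)
qed

definition mode_bound :: "real \<Rightarrow> real \<Rightarrow> (bool \<Rightarrow> real \<Rightarrow> complex) \<Rightarrow> bool" where
  "mode_bound E t u \<longleftrightarrow> (\<forall>b. u b \<in> borel_measurable borel) \<and> (\<forall>b k. norm (u b k) \<le> E * polW t b k)"

lemma polW_nonneg: "0 \<le> t \<Longrightarrow> 0 \<le> polW t b k"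
  using wgt_nonneg[of t] theta_pos[of t] by (simp add: polW_def)

text \<open>Power counting. The amplitude carries a factor \<open>k\<close> on the critical mode and the slaved
combination a factor \<open>k^3\<close>, and \<open>wgt_gain\<close> converts each of them into \<open>1 / theta t\<close>. The stable mode has the factor
\<open>1 / theta t ^ 3\<close> from the start.\<close>

lemma mode_bound_fields:
  assumes t: "0 \<le> t" and E: "0 \<le> E" and u: "mode_bound E t u"
  shows "dominated (wgt 4 t) (2 * E / theta t) (amp u)"
    and "dominated (wgt 4 t) (2 * E / theta t) (dk (amp u))"
    and "dominated (wgt 4 t) (2 * E / theta t) (dk (pha u))"
    and "dominated (wgt 2 t) (2 * E / theta t ^ 2) (dk (amp u))"
    and "dominated (wgt 2 t) (2 * E / theta t ^ 3) (slaved u)"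
    and "dominated (wgt 5 t) (2 * E) (amp u)" "dominated (wgt 5 t) (2 * E) (pha u)"
proof -
  have m: "u b \<in> borel_measurable borel" for b using u by (simp add: mode_bound_def)
  note ma = measurable_amp[OF m]
  have ms: "slaved u \<in> borel_measurable borel"
    unfolding slaved_def[abs_def] using ma measurable_dk[OF ma(2)] by measurable
  define h where "h = theta t"
  have h: "1 \<le> h" by (simp add: h_def theta_ge_1 t)
  define w where "w n k = wgt n t k" for n k
  have w: "0 \<le> w n k" for n k by (simp add: w_def wgt_nonneg t)
  have wm: "w n k \<le> w m k" if "m \<le> n" for m n k unfolding w_def by (rule wgt_antimono[OF t that])
  have gain: "\<bar>k\<bar> * w (Suc n) k \<le> w n k / h" for n k unfolding w_def h_def by (rule wgt_gain[OF t])
  have h1: "x / h ^ n \<le> x / h ^ m" if "0 \<le> x" "m \<le> n" for x m n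
    using h that by (intro divide_left_mono power_increasing) auto
  define T F where "T k = norm (u True k)" and "F k = norm (u False k)" for k
  have T: "T k \<le> E * w 5 k" "0 \<le> T k" for k
    using u unfolding mode_bound_def T_def w_def by (auto simp: polW_def dest: spec[of _ True])
  have F0: "F k \<le> E * (w 4 k / h ^ 3 / (1 + \<bar>k\<bar>))" "0 \<le> F k" for k
    using u unfolding mode_bound_def F_def w_def h_def by (auto simp: polW_def dest: spec[of _ False])
  have Fk: "F k * (1 + \<bar>k\<bar>) \<le> E * w 4 k / h ^ 3" for k
  proof -
    have "F k * (1 + \<bar>k\<bar>) \<le> E * (w 4 k / h ^ 3 / (1 + \<bar>k\<bar>)) * (1 + \<bar>k\<bar>)" using F0 by (intro mult_right_mono) auto
    then show ?thesis by simp
  qed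
  have F1: "F k \<le> E * w 4 k / h ^ 3" for k
    using Fk[of k] F0(2)[of k] by (simp add: distrib_left) (smt (verit) mult_nonneg_nonneg abs_ge_zero)
  have F2: "\<bar>k\<bar> * F k \<le> E * w 4 k / h ^ 3" for k
    using Fk[of k] F0(2)[of k] by (simp add: distrib_left mult.commute)
  have T1: "\<bar>k\<bar> * T k \<le> E * w 4 k / h" for k
  proof -
    have "\<bar>k\<bar> * T k \<le> \<bar>k\<bar> * (E * w 5 k)" using T by (intro mult_left_mono) auto
    also have "\<dots> = E * (\<bar>k\<bar> * w (Suc 4) k)" by (simp add: mult.left_commute)
    also have "\<dots> \<le> E * (w 4 k / h)" by (intro mult_left_mono gain E)
    finally show ?thesis by simp
  qed
  have T2: "\<bar>k\<bar> * (\<bar>k\<bar> * T k) \<le> E * w 3 k / h ^ 2" for k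
  proof -
    have "\<bar>k\<bar> * (\<bar>k\<bar> * T k) \<le> \<bar>k\<bar> * (E * w 4 k / h)" using T1 by (intro mult_left_mono) auto
    also have "\<dots> = E / h * (\<bar>k\<bar> * w (Suc 3) k)" by simp
    also have "\<dots> \<le> E / h * (w 3 k / h)" using E h by (intro mult_left_mono gain) auto
    finally show ?thesis by (simp add: power2_eq_square)
  qed
  have T3: "\<bar>k\<bar> ^ 3 * T k \<le> E * w 2 k / h ^ 3" for k
  proof -
    have "\<bar>k\<bar> ^ 3 * T k = \<bar>k\<bar> * (\<bar>k\<bar> * (\<bar>k\<bar> * T k))" by (simp add: power3_eq_cube mult.assoc)
    also have "\<dots> \<le> \<bar>k\<bar> * (E * w 3 k / h ^ 2)" using T2 by (intro mult_left_mono) auto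
    also have "\<dots> = E / h ^ 2 * (\<bar>k\<bar> * w (Suc 2) k)" by simp
    also have "\<dots> \<le> E / h ^ 2 * (w 2 k / h)" using E h by (intro mult_left_mono gain) auto
    finally show ?thesis by (simp add: power2_eq_square power3_eq_cube)
  qed
  have Ew: "0 \<le> E * w n k" for n k using E w by simp
  have c1: "E * w 4 k / h ^ 3 \<le> E * w 4 k / h" for k using h1[OF Ew, of 1 3 4 k] by simp
  have c2: "E * w 4 k / h ^ 3 \<le> E * w 2 k / h ^ 2" for k
    using h1[OF Ew, of 2 3 4 k] divide_right_mono[OF mult_left_mono[OF wm[of 2 4 k] E], of "h ^ 2"] h by simp
  have c3: "E * w 3 k / h ^ 2 \<le> E * w 2 k / h ^ 2" for k
    using divide_right_mono[OF mult_left_mono[OF wm[of 2 3 k] E], of "h ^ 2"] h by simp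
  have c4: "E * w 4 k / h ^ 3 \<le> E * w 2 k / h ^ 3" for k
    using divide_right_mono[OF mult_left_mono[OF wm[of 2 4 k] E], of "h ^ 3"] h by simp
  have A: "norm (amp u k) \<le> F k + \<bar>k\<bar> * T k" "norm (amp u k) \<le> F k + T k"
    "norm (pha u k) \<le> T k + F k" for k
    using norm_amp_le[of u k] mult_right_mono[OF abs_beta_le T(2)[unfolded T_def], of k k] norm_amp_pha_le[of u k]
    by (auto simp: T_def F_def)
  show "dominated (wgt 4 t) (2 * E / theta t) (amp u)"
  proof (rule dominatedI[OF ma(1)])
    fix k show "norm (amp u k) \<le> 2 * E / theta t * wgt 4 t k"
      using A(1)[of k] F1[of k] T1[of k] c1[of k] unfolding h_def[symmetric] w_def[symmetric] by simp
  qed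
  show "dominated (wgt 4 t) (2 * E / theta t) (dk (amp u))"
  proof (rule dominatedI[OF measurable_dk[OF ma(1)]])
    fix k
    have "\<bar>k\<bar> * norm (amp u k) \<le> \<bar>k\<bar> * (F k + T k)" using A by (intro mult_left_mono) auto
    then show "norm (dk (amp u) k) \<le> 2 * E / theta t * wgt 4 t k"
      using F2[of k] T1[of k] c1[of k] unfolding h_def[symmetric] w_def[symmetric] norm_dk by (simp add: distrib_left)
  qed
  show "dominated (wgt 4 t) (2 * E / theta t) (dk (pha u))"
  proof (rule dominatedI[OF measurable_dk[OF ma(2)]])
    fix k
    have "\<bar>k\<bar> * norm (pha u k) \<le> \<bar>k\<bar> * (T k + F k)" using A by (intro mult_left_mono) auto
    then show "norm (dk (pha u) k) \<le> 2 * E / theta t * wgt 4 t k"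
      using F2[of k] T1[of k] c1[of k] unfolding h_def[symmetric] w_def[symmetric] norm_dk by (simp add: distrib_left)
  qed
  show "dominated (wgt 2 t) (2 * E / theta t ^ 2) (dk (amp u))"
  proof (rule dominatedI[OF measurable_dk[OF ma(1)]])
    fix k
    have "\<bar>k\<bar> * norm (amp u k) \<le> \<bar>k\<bar> * (F k + \<bar>k\<bar> * T k)" using A by (intro mult_left_mono) auto
    then show "norm (dk (amp u) k) \<le> 2 * E / theta t ^ 2 * wgt 2 t k"
      using F2[of k] T2[of k] c2[of k] c3[of k] unfolding h_def[symmetric] w_def[symmetric] norm_dk by (simp add: distrib_left)
  qed
  show "dominated (wgt 2 t) (2 * E / theta t ^ 3) (slaved u)"
  proof (rule dominatedI[OF ms])
    fix k show "norm (slaved u k) \<le> 2 * E / theta t ^ 3 * wgt 2 t k"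
      using norm_slaved_le[of u k] Fk[of k] T3[of k] c4[of k]
      unfolding h_def[symmetric] w_def[symmetric] T_def F_def by simp
  qed
  have F5: "F k \<le> E * w 5 k" for k
  proof -
    define c where "c = 1 + \<bar>k\<bar> * h"
    have c: "1 \<le> c" using h by (simp add: c_def)
    have "c \<le> h * (1 + \<bar>k\<bar>)" using h by (simp add: c_def algebra_simps)
    also have "\<dots> \<le> h ^ 3 * (1 + \<bar>k\<bar>)" using h by (intro mult_right_mono self_le_power) auto
    finally have "1 / (h ^ 3 * (1 + \<bar>k\<bar>)) \<le> 1 / c" using c by (intro divide_left_mono) (auto intro!: mult_pos_pos)
    then have "w 4 k * (1 / (h ^ 3 * (1 + \<bar>k\<bar>))) \<le> w 4 k * (1 / c)" using w by (intro mult_left_mono)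
    also have "w 4 k * (1 / c) = w 5 k" by (simp add: w_def wgt_def c_def h_def eval_nat_numeral)
    finally have "E * (w 4 k / h ^ 3 / (1 + \<bar>k\<bar>)) \<le> E * w 5 k" using E by (intro mult_left_mono) auto
    then show ?thesis using F0(1)[of k] by linarith
  qed
  show "dominated (wgt 5 t) (2 * E) (amp u)"
  proof (rule dominatedI[OF ma(1)])
    fix k show "norm (amp u k) \<le> 2 * E * wgt 5 t k"
      using A(2)[of k] T(1)[of k] F5[of k] unfolding w_def by simp
  qed
  show "dominated (wgt 5 t) (2 * E) (pha u)"
  proof (rule dominatedI[OF ma(2)])
    fix k show "norm (pha u k) \<le> 2 * E * wgt 5 t k"
      using A(3)[of k] T(1)[of k] F5[of k] unfolding w_def by simp
  qed
qed

text \<open>The transform of \<open>a_x a = (a^2)_x / 2\<close>.\<close>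

lemma conv_derivative_self:
  assumes cw: "conv_weight M \<kappa>" and a: "dominated M A a" "0 \<le> A" and da: "dominated M B (dk a)" "0 \<le> B"
  shows "conv (dk a) a k = \<i> * of_real k / 2 * conv a a k"
proof -
  interpret conv_weight M \<kappa> by (rule cw)
  have "conv (dk a) a k + conv a (dk a) k = (LINT l|lborel. dk a l * a (k - l) + a l * dk a (k - l))"
    unfolding conv_def
    by (rule Bochner_Integration.integral_add[symmetric, OF conv_integrable[OF da(1) a(1) da(2)] conv_integrable[OF a(1) da(1) a(2)]])
  also have "\<dots> = (LINT l|lborel. \<i> * of_real k * (a l * a (k - l)))"
    by (intro Bochner_Integration.integral_cong refl) (simp add: dk_def algebra_simps)
  also have "\<dots> = \<i> * of_real k * conv a a k" unfolding conv_def by (rule integral_mult_right_zero)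
  finally have e: "2 * conv (dk a) a k = \<i> * of_real k * conv a a k" using conv_commute[of a "dk a" k] by simp
  have "conv (dk a) a k = (2 * conv (dk a) a k) / 2" by simp
  then show ?thesis unfolding e by simp
qed

text \<open>Substituting \<open>\<phi>_x = (2 / sqrt 3) (y - \<rho>)\<close>, where \<open>y\<close> is the slaved combination, into \<open>2 \<rho>_x \<phi>_x\<close> leaves a
product with \<open>y\<close>, which decays faster, and the total derivative of \<open>\<rho>^2\<close>. The factor \<open>k\<close> of the
latter is decisive for the critical mode.\<close>

lemma pol_phi_conservative:
  assumes t: "0 \<le> t" and E: "0 \<le> E" and u: "mode_bound E t u"
  shows "pol_phi (amp u) (pha u) k =
    of_real (4 / sqrt 3) * conv (dk (amp u)) (slaved u) k
    - of_real (2 / sqrt 3) * (\<i> * of_real k * conv (amp u) (amp u) k)"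
proof -
  note f = mode_bound_fields[OF t E u]
  note cw = conv_weight_wgt[OF t, of 4]
  interpret conv_weight "wgt 4 t" "64 * wgt_mass / theta t" by (rule cw) auto
  have e: "0 \<le> 2 * E / theta t" using E theta_pos[OF t] by simp
  have s: "dominated (wgt 4 t) (norm (of_real (sqrt 3 / 2) :: complex) * (2 * E / theta t)) (\<lambda>k. of_real (sqrt 3 / 2) * dk (pha u) k)"
    by (rule dominated_cmult[OF f(3)])
  have "conv (dk (amp u)) (slaved u) k = conv (dk (amp u)) (amp u) k
      + conv (dk (amp u)) (\<lambda>k. of_real (sqrt 3 / 2) * dk (pha u) k) k"
    unfolding slaved_def[abs_def] by (rule conv_add_right[OF f(2) f(1) s e])
  moreover have "conv (dk (amp u)) (\<lambda>k. of_real (sqrt 3 / 2) * dk (pha u) k) k = of_real (sqrt 3 / 2) * conv (dk (amp u)) (dk (pha u)) k"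
    unfolding conv_def mult.left_commute[of _ "of_real (sqrt 3 / 2)"] by (rule integral_mult_right_zero)
  moreover have "conv (dk (amp u)) (amp u) k = \<i> * of_real k / 2 * conv (amp u) (amp u) k"
    by (rule conv_derivative_self[OF conv_weight_axioms f(1) e f(2) e])
  ultimately have S: "conv (dk (amp u)) (slaved u) k = \<i> * of_real k * conv (amp u) (amp u) k / 2
      + of_real (sqrt 3 / 2) * conv (dk (amp u)) (dk (pha u)) k" by simp
  define c where "c = (of_real (2 / sqrt 3) :: complex)"
  have c4: "of_real (4 / sqrt 3) = 2 * c" by (simp add: c_def)
  have c1: "c * of_real (sqrt 3 / 2) = 1" unfolding c_def of_real_mult[symmetric] by simp
  define r X Y where "r = (of_real (sqrt 3 / 2) :: complex)" and "X = conv (dk (amp u)) (dk (pha u)) k"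
    and "Y = \<i> * of_real k * conv (amp u) (amp u) k"
  have "2 * c * (Y / 2 + r * X) - c * Y = 2 * (c * r) * X" by (simp add: algebra_simps)
  then show ?thesis
    unfolding S c4 c_def[symmetric] pol_phi_def X_def[symmetric] Y_def[symmetric] r_def[symmetric]
    using c1 by (simp add: r_def)
qed

text \<open>Every quadratic term is estimated by its power count in \<open>conv_weight (wgt 4 t)\<close>, except for the product with the slaved
combination, where \<open>wgt 2 t\<close> is what three factors of \<open>k\<close> leave of \<open>wgt 5 t\<close>. At small \<open>k\<close> the critical component
uses the conservative form of the phase nonlinearity and the factor \<open>beta k\<close> in front of the amplitude
nonlinearity; in all other cases the direct bound is enough.\<close>

lemma polN_difference:
  assumes t: "0 \<le> t" and e: "0 \<le> e" and small: "8 * (64 * wgt_mass) * e \<le> 1" and D: "0 \<le> D"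
    and u: "mode_bound e t u" and v: "mode_bound e t v" and d: "mode_bound (D * e) t (\<lambda>b k. u b k - v b k)"
  shows "norm (polN u b k - polN v b k) \<le> 64 * e\<^sup>2 * (64 * wgt_mass) * D * polH t b k"
proof -
  define K where "K = 64 * wgt_mass"
  have K: "0 \<le> K" by (simp add: K_def wgt_mass_nonneg)
  define h where "h = theta t"
  have h: "1 \<le> h" by (simp add: h_def theta_ge_1 t)
  have De: "0 \<le> D * e" using D e by simp
  note fu = mode_bound_fields[OF t e u, folded h_def] and fv = mode_bound_fields[OF t e v, folded h_def]
    and fd = mode_bound_fields[OF t De d, folded h_def]
  interpret w4: conv_weight "wgt 4 t" "K / h" unfolding K_def h_def by (rule conv_weight_wgt[OF t]) auto
  interpret w2: conv_weight "wgt 2 t" "K / h" unfolding K_def h_def by (rule conv_weight_wgt[OF t]) auto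
  have r1: "0 \<le> 2 * e / h" "0 \<le> 2 * e / h ^ 2" "0 \<le> 2 * e / h ^ 3" using e h by auto
  have da: "dominated (wgt 4 t) (2 * e / h * D) (\<lambda>k. amp u k - amp v k)"
    "dominated (wgt 4 t) (2 * e / h * D) (\<lambda>k. dk (amp u) k - dk (amp v) k)"
    "dominated (wgt 4 t) (2 * e / h * D) (\<lambda>k. dk (pha u) k - dk (pha v) k)"
    "dominated (wgt 2 t) (2 * e / h ^ 2 * D) (\<lambda>k. dk (amp u) k - dk (amp v) k)"
    "dominated (wgt 2 t) (2 * e / h ^ 3 * D) (\<lambda>k. slaved u k - slaved v k)"
  proof -
    have eqs: "amp (\<lambda>b k. u b k - v b k) = (\<lambda>k. amp u k - amp v k)" "pha (\<lambda>b k. u b k - v b k) = (\<lambda>k. pha u k - pha v k)"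
      by (auto simp: amp_diff pha_diff)
    show "dominated (wgt 4 t) (2 * e / h * D) (\<lambda>k. amp u k - amp v k)"
      "dominated (wgt 4 t) (2 * e / h * D) (\<lambda>k. dk (amp u) k - dk (amp v) k)"
      "dominated (wgt 4 t) (2 * e / h * D) (\<lambda>k. dk (pha u) k - dk (pha v) k)"
      "dominated (wgt 2 t) (2 * e / h ^ 2 * D) (\<lambda>k. dk (amp u) k - dk (amp v) k)"
      "dominated (wgt 2 t) (2 * e / h ^ 3 * D) (\<lambda>k. slaved u k - slaved v k)"
      unfolding dk_diff slaved_diff eqs[symmetric] using fd(1-5) by (simp_all add: mult_ac)
  qed
  define Q where "Q = e\<^sup>2 * K * D"
  have Q: "0 \<le> Q" using K D by (simp add: Q_def)
  define W4 where "W4 = wgt 4 t k / h ^ 3"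
  define W2 where "W2 = wgt 2 t k / h ^ 6"
  have W: "0 \<le> W4" "0 \<le> W2" using wgt_nonneg[OF t] h by (auto simp: W4_def W2_def)
  have q4: "2 * (2 * e / h) * (2 * e / h) * (K / h) * D * wgt 4 t k = 8 * Q * W4"
    by (simp add: Q_def W4_def power2_eq_square power3_eq_cube)
  have n1: "norm (conv (dk (amp u)) (dk (amp u)) k - conv (dk (amp v)) (dk (amp v)) k) \<le> 8 * Q * W4"
    using dominated_le[OF w4.dominated_conv_diff[OF fu(2) fv(2) fu(2) fv(2) da(2) da(2) r1(1) r1(1) D], of k] unfolding q4 .
  have n2: "norm (conv (dk (pha u)) (dk (pha u)) k - conv (dk (pha v)) (dk (pha v)) k) \<le> 8 * Q * W4"
    using dominated_le[OF w4.dominated_conv_diff[OF fu(3) fv(3) fu(3) fv(3) da(3) da(3) r1(1) r1(1) D], of k] unfolding q4 .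
  have n3: "norm (conv (dk (amp u)) (dk (pha u)) k - conv (dk (amp v)) (dk (pha v)) k) \<le> 8 * Q * W4"
    using dominated_le[OF w4.dominated_conv_diff[OF fu(2) fv(2) fu(3) fv(3) da(2) da(3) r1(1) r1(1) D], of k] unfolding q4 .
  have n4: "norm (conv (amp u) (amp u) k - conv (amp v) (amp v) k) \<le> 8 * Q * W4"
    using dominated_le[OF w4.dominated_conv_diff[OF fu(1) fv(1) fu(1) fv(1) da(1) da(1) r1(1) r1(1) D], of k] unfolding q4 .
  have sm: "2 * e / h * (K / h) \<le> 1/4"
  proof -
    have "2 * e / h * (K / h) = (2 * e * K) / h\<^sup>2" by (simp add: power2_eq_square)
    also have "\<dots> \<le> (2 * e * K) / 1" using e K h by (intro divide_left_mono) auto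
    also have "\<dots> \<le> 1/4" using small by (simp add: K_def mult_ac)
    finally show ?thesis .
  qed
  have De0: "0 \<le> 2 * e / h * D" by (rule mult_nonneg_nonneg[OF r1(1) D])
  have n5: "norm (conv_series exp_coeff (amp u) k - conv_series exp_coeff (amp v) k) \<le> 32 * Q * W4"
    using dominated_le[OF w4.dominated_conv_series_diff[where a = exp_coeff, OF fu(1) fv(1) da(1) r1(1) De0 exp_coeff_le sm exp_coeff_0], of k]
    by (simp add: exp_coeff_def Q_def W4_def power2_eq_square power3_eq_cube mult_ac)
  have n6: "norm (conv (dk (amp u)) (slaved u) k - conv (dk (amp v)) (slaved v) k) \<le> 8 * Q * W2"
  proof -
    have "2 * (2 * e / h ^ 2) * (2 * e / h ^ 3) * (K / h) * D * wgt 2 t k = 8 * Q * W2"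
      by (simp add: Q_def W2_def power2_eq_square eval_nat_numeral)
    then show ?thesis
      using dominated_le[OF w2.dominated_conv_diff[OF fu(4) fv(4) fu(5) fv(5) da(4) da(5) r1(2) r1(3) D], of k] by simp
  qed
  define R where "R = pol_rho (amp u) (pha u) k - pol_rho (amp v) (pha v) k"
  define P where "P = pol_phi (amp u) (pha u) k - pol_phi (amp v) (pha v) k"
  have R: "norm R \<le> 40 * Q * W4"
  proof -
    define X Y Z where "X = conv (dk (amp u)) (dk (amp u)) k - conv (dk (amp v)) (dk (amp v)) k"
      and "Y = conv (dk (pha u)) (dk (pha u)) k - conv (dk (pha v)) (dk (pha v)) k"
      and "Z = conv_series exp_coeff (amp u) k - conv_series exp_coeff (amp v) k"
    have "R = X - Y - of_real (2/3) * Z" by (simp add: R_def pol_rho_def X_def Y_def Z_def algebra_simps)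
    then have "norm R \<le> norm X + norm Y + 2/3 * norm Z"
      using norm_triangle_ineq4[of "X - Y" "of_real (2/3) * Z"] norm_triangle_ineq4[of X Y] by (simp add: norm_mult)
    moreover have "0 \<le> Q * W4" using Q W by simp
    ultimately show ?thesis using n1 n2 n5 by (simp add: X_def Y_def Z_def)
  qed
  have P1: "norm P \<le> 16 * Q * W4"
  proof -
    define Z where "Z = conv (dk (amp u)) (dk (pha u)) k - conv (dk (amp v)) (dk (pha v)) k"
    have PZ: "P = 2 * Z" by (simp add: P_def Z_def pol_phi_def right_diff_distrib)
    show ?thesis using n3 unfolding PZ norm_mult Z_def[symmetric] by simp
  qed
  have P2: "norm P \<le> \<bar>k\<bar> * (16 * Q * W4) + 32 * Q * W2"
  proof -
    have s3: "1 \<le> sqrt 3" by (rule real_le_rsqrt) simp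
    then have c: "0 \<le> 4 / sqrt 3" "4 / sqrt 3 \<le> 4" "0 \<le> 2 / sqrt 3" "2 / sqrt 3 \<le> 2" by (auto simp: divide_le_eq)
    define X Y where "X = conv (dk (amp u)) (slaved u) k - conv (dk (amp v)) (slaved v) k"
      and "Y = conv (amp u) (amp u) k - conv (amp v) (amp v) k"
    have "P = of_real (4 / sqrt 3) * X - of_real (2 / sqrt 3) * (\<i> * of_real k * Y)"
      unfolding P_def pol_phi_conservative[OF t e u] pol_phi_conservative[OF t e v] X_def Y_def
      by (simp only: right_diff_distrib) (simp only: algebra_simps)
    then have "norm P \<le> norm (of_real (4 / sqrt 3) * X) + norm (of_real (2 / sqrt 3) * (\<i> * of_real k * Y))"
      by (simp only: norm_triangle_ineq4)
    also have "\<dots> = 4 / sqrt 3 * norm X + 2 / sqrt 3 * (\<bar>k\<bar> * norm Y)" by (simp add: norm_mult norm_divide)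
    also have "\<dots> \<le> 4 * (8 * Q * W2) + 2 * (\<bar>k\<bar> * (8 * Q * W4))"
      using c n4 n6 Q W by (intro add_mono mult_mono mult_left_mono) (auto simp: X_def Y_def)
    finally show ?thesis by simp
  qed
  have bk: "\<bar>beta k\<bar> \<le> 1" "\<bar>beta k\<bar> \<le> \<bar>k\<bar>" by (rule abs_beta_le_1, rule abs_beta_le)
  have QW: "0 \<le> Q * W4" "0 \<le> Q * W2" using Q W by auto
  have diff: "polN u b k - polN v b k = (if b then P + \<i> * of_real (beta k) * R else R + \<i> * of_real (beta k) * P)"
    by (simp add: polN_def modes_def P_def R_def algebra_simps)
  have nb: "norm (\<i> * of_real (beta k) * z) = \<bar>beta k\<bar> * norm z" for z by (simp add: norm_mult)
  have "norm (polN u b k - polN v b k) \<le> 64 * Q * polH t b k"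
  proof (cases "b \<and> \<bar>k\<bar> \<le> 1")
    case True
    have "norm (polN u b k - polN v b k) \<le> norm P + \<bar>beta k\<bar> * norm R"
      unfolding diff using True norm_triangle_ineq[of P "\<i> * of_real (beta k) * R"] by (simp add: nb)
    also have "\<bar>beta k\<bar> * norm R \<le> \<bar>k\<bar> * (40 * Q * W4)" using bk R by (intro mult_mono) auto
    finally have "norm (polN u b k - polN v b k) \<le> 56 * (\<bar>k\<bar> * (Q * W4)) + 32 * (Q * W2)" using P2 by simp
    moreover have "0 \<le> \<bar>k\<bar> * (Q * W4)" using QW by simp
    moreover have "64 * Q * polH t b k = 64 * (\<bar>k\<bar> * (Q * W4)) + 64 * (Q * W2)"
      using True by (simp add: polH_def W4_def W2_def h_def algebra_simps)
    ultimately show ?thesis using QW by linarith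
  next
    case False
    have H: "polH t b k = W4" using False by (auto simp: polH_def W4_def h_def)
    have "\<bar>beta k\<bar> * norm R \<le> 1 * (40 * Q * W4)" "\<bar>beta k\<bar> * norm P \<le> 1 * (16 * Q * W4)"
      using bk R P1 by (intro mult_mono; simp)+
    then have "norm P + \<bar>beta k\<bar> * norm R \<le> 56 * (Q * W4)" "norm R + \<bar>beta k\<bar> * norm P \<le> 56 * (Q * W4)"
      using R P1 by simp_all
    moreover have "norm (polN u b k - polN v b k) \<le> (if b then norm P + \<bar>beta k\<bar> * norm R else norm R + \<bar>beta k\<bar> * norm P)"
      unfolding diff using norm_triangle_ineq[of P "\<i> * of_real (beta k) * R"] norm_triangle_ineq[of R "\<i> * of_real (beta k) * P"]
      by (simp add: nb)
    ultimately show ?thesis unfolding H using QW by (auto split: if_splits)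
  qed
  then show ?thesis by (simp add: Q_def K_def mult_ac)
qed

lemma conv_zero: "conv (\<lambda>k. 0) g = (\<lambda>k. 0)"
  by (simp add: conv_def fun_eq_iff)

lemma conv_series_zero: "conv_series a (\<lambda>k. 0) = (\<lambda>k. 0)"
proof -
  have "conv_power (\<lambda>k. 0) n = (\<lambda>k. 0)" for n by (cases n) (auto simp: conv_zero)
  then show ?thesis by (simp add: conv_series_def fun_eq_iff)
qed

lemma dk_zero: "dk (\<lambda>k. 0) = (\<lambda>k. 0)"
  by (simp add: dk_def fun_eq_iff)

lemma polN_zero: "polN (\<lambda>b k. 0) b k = 0"
  unfolding polN_def amp_zero pha_zero
  by (simp add: modes_def pol_rho_def pol_phi_def dk_zero conv_zero conv_series_zero)

lemma measurable_polN_param: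
  assumes "\<And>b. case_prod (\<lambda>t::real. u t b) \<in> borel_measurable (borel \<Otimes>\<^sub>M borel)"
  shows "case_prod (\<lambda>t. polN (u t) b) \<in> borel_measurable (borel \<Otimes>\<^sub>M borel)"
proof -
  note a = measurable_amp_param[OF assms]
  note d = measurable_dk_param[OF a(1)] measurable_dk_param[OF a(2)]
  have [measurable]: "(\<lambda>x. conv (dk (amp (u (fst x)))) (dk (amp (u (fst x)))) (snd x)) \<in> borel_measurable (borel \<Otimes>\<^sub>M borel)"
    "(\<lambda>x. conv (dk (pha (u (fst x)))) (dk (pha (u (fst x)))) (snd x)) \<in> borel_measurable (borel \<Otimes>\<^sub>M borel)"
    "(\<lambda>x. conv (dk (amp (u (fst x)))) (dk (pha (u (fst x)))) (snd x)) \<in> borel_measurable (borel \<Otimes>\<^sub>M borel)"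
    "(\<lambda>x. conv_series exp_coeff (amp (u (fst x))) (snd x)) \<in> borel_measurable (borel \<Otimes>\<^sub>M borel)"
    using measurable_conv_param[OF d(1) d(1)] measurable_conv_param[OF d(2) d(2)] measurable_conv_param[OF d(1) d(2)]
      measurable_conv_series_param[OF a(1), of exp_coeff] by (simp_all only: case_prod_beta')
  show ?thesis unfolding polN_def
  proof (rule measurable_modes_param)
    show "case_prod (\<lambda>t. pol_rho (amp (u t)) (pha (u t))) \<in> borel_measurable (borel \<Otimes>\<^sub>M borel)"
      unfolding case_prod_beta' pol_rho_def by measurable
    show "case_prod (\<lambda>t. pol_phi (amp (u t)) (pha (u t))) \<in> borel_measurable (borel \<Otimes>\<^sub>M borel)"
      unfolding case_prod_beta' pol_phi_def by measurable
  qed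
qed

lemma modes_continuous:
  assumes "continuous_on S (\<lambda>t. f t k)" "continuous_on S (\<lambda>t. g t k)"
  shows "continuous_on S (\<lambda>t. modes (f t) (g t) b k)"
  unfolding modes_def by (cases b) (auto intro!: continuous_intros assms)

lemma duhamel_const_ge_1: "1 \<le> duhamel_const"
  by (simp add: duhamel_const_def)

text \<open>The smallness of \<open>e\<close> makes the quadratic nonlinearity, of size \<open>e^2\<close>, a contraction relative to \<open>e\<close>: the factor \<open>128\<close> is
twice the \<open>64\<close> in \<open>polN_difference\<close>. The bound on the data compensates the \<open>30^5\<close> in \<open>linear_polW\<close> and leaves
the factor \<open>1/2\<close> that \<open>mild_problem\<close> asks for.\<close>

locale polar_data =
  fixes e :: real and u0 :: "bool \<Rightarrow> real \<Rightarrow> complex"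
  assumes e_pos: "0 < e" and e_small: "128 * e * (64 * wgt_mass) * duhamel_const \<le> 1"
    and u0_meas: "\<And>b. u0 b \<in> borel_measurable borel" and u0_herm: "\<And>b. hermitian (u0 b)"
    and u0_bound: "\<And>b k. norm (u0 b k) \<le> e / (2 * 30 ^ 5) * wgt 5 0 k"
begin

lemma e_nonneg: "0 \<le> e"
  using e_pos by simp

lemma e_small': "8 * (64 * wgt_mass) * e \<le> 1" "4 * e * (64 * wgt_mass) \<le> 1/4"
proof -
  define x where "x = e * (64 * wgt_mass)"
  have x: "0 \<le> x" using e_pos wgt_mass_nonneg by (simp add: x_def)
  have "128 * x * 1 \<le> 128 * x * duhamel_const" using x duhamel_const_ge_1 by (intro mult_left_mono) auto
  also have "\<dots> \<le> 1" using e_small by (simp add: x_def mult_ac)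
  finally have "128 * x \<le> 1" by simp
  then show "8 * (64 * wgt_mass) * e \<le> 1" "4 * e * (64 * wgt_mass) \<le> 1/4"
    using x by (simp_all add: x_def mult_ac)
qed

lemma admissible_mode_bound: "admissible (\<lambda>b k. e * polW t b k) u \<Longrightarrow> mode_bound e t u"
  by (simp add: admissible_def mode_bound_def)

lemma fields_dominated_initial:
  assumes t: "0 \<le> t" and u: "admissible (\<lambda>b k. e * polW t b k) u"
  shows "dominated (wgt 4 0) (2 * e) (amp u)" "dominated (wgt 4 0) (2 * e) (dk (amp u))"
    "dominated (wgt 4 0) (2 * e) (dk (pha u))"
proof -
  note f = mode_bound_fields[OF t e_nonneg admissible_mode_bound[OF u]]
  have "2 * e / theta t * wgt 4 t k \<le> 2 * e * wgt 4 0 k" for k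
  proof -
    have "2 * e / theta t \<le> 2 * e / 1" using theta_ge_1[OF t] e_pos by (intro divide_left_mono) auto
    then have "2 * e / theta t * wgt 4 t k \<le> 2 * e / 1 * wgt 4 0 k"
      using e_pos wgt_nonneg[OF t] by (intro mult_mono wgt_time_antimono t) auto
    then show ?thesis by simp
  qed
  then show "dominated (wgt 4 0) (2 * e) (amp u)" "dominated (wgt 4 0) (2 * e) (dk (amp u))"
    "dominated (wgt 4 0) (2 * e) (dk (pha u))"
    using f(1-3) by (auto intro: dominated_mono)
qed

lemma polN_hermitian:
  assumes t: "0 \<le> t" and u: "admissible (\<lambda>b k. e * polW t b k) u"
  shows "hermitian (polN u b)"
proof -
  interpret conv_weight "wgt 4 0" "64 * wgt_mass / theta 0" by (rule conv_weight_wgt) auto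
  note f = fields_dominated_initial[OF t u]
  have h: "hermitian (amp u)" "hermitian (pha u)"
    by (intro hermitian_amp hermitian_pha admissibleD(2)[OF u])+
  have "hermitian (conv_series exp_coeff (amp u))"
    by (rule hermitian_conv_series[where a = exp_coeff, OF f(1) _ exp_coeff_le _ h(1)])
      (use e_small' e_pos wgt_mass_nonneg in \<open>auto simp: theta_0\<close>)
  moreover have "hermitian (conv (dk (amp u)) (dk (amp u)))" "hermitian (conv (dk (pha u)) (dk (pha u)))"
    "hermitian (conv (dk (amp u)) (dk (pha u)))"
    by (intro hermitian_conv hermitian_dk h)+
  ultimately show ?thesis
    unfolding polN_def by (intro hermitian_modes) (auto simp: hermitian_def pol_rho_def pol_phi_def)
qed

lemma polN_continuous:
  assumes u: "\<And>t. t \<in> {0..T} \<Longrightarrow> admissible (\<lambda>b k. e * polW t b k) (u t)"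
    and c: "\<And>b k. continuous_on {0..T} (\<lambda>t. u t b k)"
  shows "continuous_on {0..T} (\<lambda>t. polN (u t) b k)"
proof -
  interpret conv_weight "wgt 4 0" "64 * wgt_mass / theta 0" by (rule conv_weight_wgt) auto
  have f: "dominated (wgt 4 0) (2 * e) (amp (u t))" "dominated (wgt 4 0) (2 * e) (dk (amp (u t)))"
    "dominated (wgt 4 0) (2 * e) (dk (pha (u t)))" if "t \<in> {0..T}" for t
    using fields_dominated_initial[OF _ u[OF that]] that by auto
  have ca: "continuous_on {0..T} (\<lambda>t. amp (u t) k)" "continuous_on {0..T} (\<lambda>t. pha (u t) k)" for k
    by (rule amp_continuous[OF c])+
  then have cd: "continuous_on {0..T} (\<lambda>t. dk (amp (u t)) k)" "continuous_on {0..T} (\<lambda>t. dk (pha (u t)) k)" for k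
    unfolding dk_def by (auto intro: continuous_on_mult_left)
  have e2: "0 \<le> 2 * e" using e_pos by simp
  have s: "2 * e * (64 * wgt_mass / theta 0) \<le> 1/4"
    using e_small'(2) e_pos wgt_mass_nonneg by (auto simp: theta_0)
  have "continuous_on {0..T} (\<lambda>t. conv (dk (amp (u t))) (dk (amp (u t))) k)"
    "continuous_on {0..T} (\<lambda>t. conv (dk (pha (u t))) (dk (pha (u t))) k)"
    "continuous_on {0..T} (\<lambda>t. conv (dk (amp (u t))) (dk (pha (u t))) k)"
    by (rule continuous_conv[OF f(2) f(2) cd(1) cd(1) e2] continuous_conv[OF f(3) f(3) cd(2) cd(2) e2]
        continuous_conv[OF f(2) f(3) cd(1) cd(2) e2]; assumption)+
  moreover have "continuous_on {0..T} (\<lambda>t. conv_series exp_coeff (amp (u t)) k)"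
    by (rule continuous_conv_series[where a = exp_coeff, OF f(1) ca(1) e2 exp_coeff_le s])
  ultimately show ?thesis
    unfolding polN_def by (intro modes_continuous) (auto simp: pol_rho_def pol_phi_def intro!: continuous_intros)
qed

lemma polar_mild_problem:
  "mild_problem polN (\<lambda>t b k. e * polW t b k) (\<lambda>t b k. e / duhamel_const * polH t b k) {0..} u0"
proof
  fix t :: real and b k assume "t \<in> {0..}"
  then have t: "0 \<le> t" by simp
  show "0 \<le> e * polW t b k" using polW_nonneg[OF t] e_pos by simp
  have c: "continuous_on {0..t} (\<lambda>s. e / duhamel_const * polH s b k)"
    by (intro continuous_on_mult_left polH_continuous)
  show "set_integrable lborel {0..t} (\<lambda>s. exp (- nu b k * (t - s)) * (e / duhamel_const * polH s b k))"
    by (rule duhamel_set_integrable[OF c])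
  have "duh (\<lambda>s. e / duhamel_const * polH s b k) (nu b k) t \<le> e / duhamel_const * (duhamel_const * polW t b k)"
    unfolding duh_cmult using duhamel_polH[OF t] e_pos duhamel_const_ge_1 by (intro mult_left_mono) auto
  then show "(LINT s:{0..t}|lborel. exp (- nu b k * (t - s)) * (e / duhamel_const * polH s b k)) \<le> e * polW t b k"
    using duhamel_const_ge_1 by (simp add: duh_def)
  have "exp (- nu b k * t) * norm (u0 b k) \<le> exp (- nu b k * t) * (e / (2 * 30 ^ 5) * wgt 5 0 k)"
    by (intro mult_left_mono u0_bound) simp
  also have "\<dots> = e / (2 * 30 ^ 5) * (exp (- nu b k * t) * wgt 5 0 k)" by simp
  also have "\<dots> \<le> e / (2 * 30 ^ 5) * (30 ^ 5 * polW t b k)"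
    using e_pos by (intro mult_left_mono linear_polW t) auto
  finally show "exp (- nu b k * t) * norm (u0 b k) \<le> e * polW t b k / 2" by simp
next
  fix t :: real and u v :: "bool \<Rightarrow> real \<Rightarrow> complex" and D b k
  assume "t \<in> {0..}" and u: "admissible (\<lambda>b k. e * polW t b k) u" and v: "admissible (\<lambda>b k. e * polW t b k) v"
    and D: "0 \<le> D" and d: "\<And>b k. norm (u b k - v b k) \<le> D * (e * polW t b k)"
  then have t: "0 \<le> t" by simp
  have "mode_bound (D * e) t (\<lambda>b k. u b k - v b k)"
    unfolding mode_bound_def using d admissibleD(1)[OF u] admissibleD(1)[OF v] by (auto simp: mult.assoc)
  then have "norm (polN u b k - polN v b k) \<le> 64 * e\<^sup>2 * (64 * wgt_mass) * D * polH t b k"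
    by (rule polN_difference[OF t e_nonneg e_small'(1) D admissible_mode_bound[OF u] admissible_mode_bound[OF v]])
  also have "\<dots> \<le> D / 2 * (e / duhamel_const) * polH t b k"
  proof (rule mult_right_mono)
    have "D * e * (128 * e * (64 * wgt_mass) * duhamel_const) \<le> D * e * 1"
      using D e_pos by (intro mult_left_mono e_small) auto
    then show "64 * e\<^sup>2 * (64 * wgt_mass) * D \<le> D / 2 * (e / duhamel_const)"
      using duhamel_const_ge_1 by (simp add: power2_eq_square field_simps)
    show "0 \<le> polH t b k" using wgt_nonneg[OF t] theta_pos[OF t] by (simp add: polH_def)
  qed
  finally show "norm (polN u b k - polN v b k) \<le> D / 2 * (e / duhamel_const * polH t b k)" by (simp add: mult.assoc)
qed (auto intro: u0_meas u0_herm polN_zero polN_hermitian measurable_polN_param polN_continuous)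

lemma one_plus_sq_wgt5: "(1 + k\<^sup>2) * wgt 5 0 k \<le> wgt 2 0 k"
proof -
  define c where "c = 1 + \<bar>k\<bar>"
  have c: "1 \<le> c" by (simp add: c_def)
  have "1 + k\<^sup>2 \<le> c ^ 2" by (simp add: c_def power2_sum)
  also have "\<dots> \<le> c ^ 3" using c by (intro power_increasing) auto
  finally have "(1 + k\<^sup>2) * (1 / c ^ 5) \<le> c ^ 3 * (1 / c ^ 5)" using c by (intro mult_right_mono) auto
  also have "c ^ 3 * (1 / c ^ 5) = 1 / c ^ 2" using c by (simp add: field_simps eval_nat_numeral)
  finally show ?thesis by (simp add: wgt_zero_eq c_def)
qed

text \<open>Five powers in the weight pay for two derivatives and for integrability; the majorant does not depend on time, so
that it is valid up to the initial time.\<close>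

lemma polar_dominated:
  "(1 + k\<^sup>2) * (e * polW t b k) \<le> 2 * e * wgt 2 0 k" (is ?A)
  "e / duhamel_const * polH t b k \<le> 2 * e * wgt 2 0 k" (is ?B) if t: "0 \<le> t"
proof -
  have th: "1 \<le> theta t" by (rule theta_ge_1[OF t])
  have w0: "0 \<le> wgt n 0 k" for n by (rule wgt_nonneg) simp
  have dv: "wgt n t k / theta t ^ m \<le> wgt n 0 k" for n m
  proof -
    have "wgt n t k / theta t ^ m \<le> wgt n t k / 1" using wgt_nonneg[OF t] th by (intro divide_left_mono) auto
    then show ?thesis using wgt_time_antimono[of 0 t n k] t by simp
  qed
  have "polW t b k \<le> wgt 5 0 k"
  proof (cases b)
    case True
    then show ?thesis using dv[of 5 0] by (simp add: polW_def)
  next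
    case False
    have "wgt 4 t k / theta t ^ 3 / (1 + \<bar>k\<bar>) \<le> wgt 4 0 k / (1 + \<bar>k\<bar>)" using dv by (intro divide_right_mono) auto
    also have "\<dots> = wgt 5 0 k" by (simp add: wgt_zero_eq eval_nat_numeral)
    finally show ?thesis using False by (simp add: polW_def)
  qed
  then have "(1 + k\<^sup>2) * polW t b k \<le> (1 + k\<^sup>2) * wgt 5 0 k" by (intro mult_left_mono) (auto simp: add_nonneg_nonneg)
  also have "\<dots> \<le> wgt 2 0 k" by (rule one_plus_sq_wgt5)
  finally have "e * ((1 + k\<^sup>2) * polW t b k) \<le> e * wgt 2 0 k" using e_pos by (intro mult_left_mono) auto
  also have "\<dots> \<le> 2 * e * wgt 2 0 k" using e_pos w0 by (intro mult_right_mono) auto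
  finally show ?A by (simp add: mult.left_commute)
  have w42: "wgt 4 0 k \<le> wgt 2 0 k" by (rule wgt_antimono) auto
  have "polH t b k \<le> 2 * wgt 2 0 k"
  proof (cases "b \<and> \<bar>k\<bar> \<le> 1")
    case True
    have "\<bar>k\<bar> * (wgt 4 t k / theta t ^ 3) \<le> 1 * wgt 4 0 k"
      using True dv[of 4 3] wgt_nonneg[OF t] th by (intro mult_mono) auto
    then show ?thesis using True dv[of 2 6] w42 by (simp add: polH_def)
  next
    case False
    then have "polH t b k = wgt 4 t k / theta t ^ 3" by (auto simp: polH_def)
    then show ?thesis using dv[of 4 3] w42 w0[of 2] by linarith
  qed
  then have "e / duhamel_const * polH t b k \<le> e / duhamel_const * (2 * wgt 2 0 k)" using e_pos duhamel_const_ge_1 by (intro mult_left_mono) auto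
  also have "\<dots> \<le> e / 1 * (2 * wgt 2 0 k)"
    using e_pos duhamel_const_ge_1 w0 by (intro mult_right_mono divide_left_mono) auto
  finally show ?B by simp
qed

lemma polar_solution_exists:
  "\<exists>u. mild_solution polN (\<lambda>t b k. e * polW t b k) (\<lambda>t b k. e / duhamel_const * polH t b k) {0..} u0 u"
proof -
  interpret mild_problem polN "\<lambda>t b k. e * polW t b k" "\<lambda>t b k. e / duhamel_const * polH t b k" "{0..}" u0
    by (rule polar_mild_problem)
  obtain u where u: "family u" "\<And>t b k. u t b k = picard u t b k" using mild_solution_exists by blast
  have "mild_solution polN (\<lambda>t b k. e * polW t b k) (\<lambda>t b k. e / duhamel_const * polH t b k) {0..} u0 u"
  proof
    show "family u" "u t b k = picard u t b k" for t b k by (rule u)+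
    fix t1 T :: real assume t1: "0 < t1"
    show "\<exists>g. integrable lborel g \<and> (\<forall>t\<in>{t1..T}. \<forall>b k. (1 + k\<^sup>2) * (e * polW t b k) \<le> g k \<and> e / duhamel_const * polH t b k \<le> g k)"
    proof (intro exI[of _ "\<lambda>k. 2 * e * wgt 2 0 k"] conjI ballI allI)
      show "integrable lborel (\<lambda>k. 2 * e * wgt 2 0 k)" using wgt_integral(1)[of 0 2] by simp
      fix t b k assume "t \<in> {t1..T}"
      then have t: "0 \<le> t" using t1 by simp
      show "(1 + k\<^sup>2) * (e * polW t b k) \<le> 2 * e * wgt 2 0 k" "e / duhamel_const * polH t b k \<le> 2 * e * wgt 2 0 k"
        by (rule polar_dominated[OF t])+
    qed
  qed
  then show ?thesis by blast
qed

end

section \<open>The solution in polar coordinates\<close>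

lemma exp_shift_sums: "(\<lambda>n. w ^ Suc n / fact (Suc n)) sums (exp w - 1)" for w :: complex
proof -
  have "(\<lambda>n. w ^ n / fact n) sums exp w"
    using exp_converges[of w] by (simp add: scaleR_conv_of_real divide_inverse mult.commute)
  from sums_split_initial_segment[OF this, of 1] show ?thesis by simp
qed

text \<open>The coefficients of \<open>exp w - 1\<close> with the index shift of \<open>conv_series\<close>.\<close>

definition inv_fact_coeff :: "nat \<Rightarrow> real" where "inv_fact_coeff n = 1 / fact (Suc n)"

lemma inv_fact_coeff_le: "\<bar>inv_fact_coeff n\<bar> \<le> 2"
proof -
  have "(1::real) \<le> fact (Suc n)" by (rule fact_ge_1)
  then have "1 / fact (Suc n) \<le> (1::real) / 1" by (intro divide_left_mono) auto
  moreover have "\<bar>inv_fact_coeff n\<bar> = 1 / fact (Suc n)" by (simp add: inv_fact_coeff_def del: fact_Suc)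
  ultimately show ?thesis by linarith
qed

lemma inverse_fourier_exp:
  assumes cw: "conv_weight M \<kappa>" and f: "dominated M \<epsilon> f" "0 \<le> \<epsilon>" and small: "\<epsilon> * \<kappa> \<le> 1/4"
  shows "inverse_fourier (conv_series inv_fact_coeff f) x = exp (inverse_fourier f x) - 1"
    and "inverse_fourier (conv_series exp_coeff f) x = exp (2 * inverse_fourier f x) - 1 - 2 * inverse_fourier f x"
proof -
  interpret conv_weight M \<kappa> by (rule cw)
  define w where "w = inverse_fourier f x"
  have "(\<lambda>n. of_real (inv_fact_coeff n) * w ^ Suc n) sums inverse_fourier (conv_series inv_fact_coeff f) x"
    unfolding w_def by (rule inverse_fourier_conv_series[OF f inv_fact_coeff_le small])
  moreover have "of_real (inv_fact_coeff n) * w ^ Suc n = w ^ Suc n / fact (Suc n)" for n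
    by (simp add: inv_fact_coeff_def)
  ultimately show "inverse_fourier (conv_series inv_fact_coeff f) x = exp (inverse_fourier f x) - 1"
    using exp_shift_sums[of w] unfolding w_def by (simp only: sums_unique2)
  have s: "(\<lambda>n. of_real (exp_coeff n) * w ^ Suc n) sums inverse_fourier (conv_series exp_coeff f) x"
    unfolding w_def by (rule inverse_fourier_conv_series[OF f exp_coeff_le small])
  have "(\<lambda>n. (2 * w) ^ Suc n / fact (Suc n) - (if n = 0 then 2 * w else 0)) sums (exp (2 * w) - 1 - 2 * w)"
    by (intro sums_diff exp_shift_sums sums_single)
  moreover have "(2 * w) ^ Suc n / fact (Suc n) - (if n = 0 then 2 * w else 0) = of_real (exp_coeff n) * w ^ Suc n" for n
    by (cases n) (simp_all add: exp_coeff_def power_mult_distrib del: fact_Suc)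
  ultimately have "(\<lambda>n. of_real (exp_coeff n) * w ^ Suc n) sums (exp (2 * w) - 1 - 2 * w)" by simp
  from sums_unique2[OF s this] show "inverse_fourier (conv_series exp_coeff f) x = exp (2 * inverse_fourier f x) - 1 - 2 * inverse_fourier f x"
    by (simp add: w_def)
qed

text \<open>The wave number at the Eckhaus boundary and, next, the modulus of its wave train.\<close>

definition qE :: real where "qE = sqrt (1/3)"
definition rE :: real where "rE = sqrt (2/3)"

lemma qE_sq: "qE\<^sup>2 = 1/3" and rE_sq: "rE\<^sup>2 = 2/3" and rE_pos: "0 < rE" and rE_le_1: "rE \<le> 1"
  by (simp_all add: qE_def rE_def)

lemma wave_train_qE: "wave_train qE x = of_real rE * exp (\<i> * of_real (qE * x))"
  unfolding wave_train_def qE_sq by (simp add: rE_def)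

lemma exp_has_vector_derivative:
  fixes h :: "real \<Rightarrow> complex"
  assumes "(h has_vector_derivative h') (at x)"
  shows "((\<lambda>x. exp (h x)) has_vector_derivative h' * exp (h x)) (at x)"
  using field_vector_diff_chain_at[OF assms DERIV_exp] by (simp add: o_def)

lemma phase_has_vector_derivative: "((\<lambda>x. exp (\<i> * of_real (q * x))) has_vector_derivative \<i> * of_real q * exp (\<i> * of_real (q * x))) (at x)"
proof (rule exp_has_vector_derivative)
  have "((\<lambda>z. \<i> * of_real q * z) has_field_derivative \<i> * of_real q) (at (of_real x))"
    by (auto intro!: derivative_eq_intros)
  from has_vector_derivative_real_field[OF this]
  show "((\<lambda>x. \<i> * of_real (q * x)) has_vector_derivative \<i> * of_real q) (at x)"
    by (simp add: mult.assoc)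
qed

text \<open>The polar ansatz turns the Ginzburg-Landau equation into this identity for the logarithmic derivative, with \<open>E\<close> standing for
\<open>exp (2 \<rho>)\<close>; real and imaginary part are the equations for \<open>\<rho>\<close> and \<open>\<phi>\<close>.\<close>

lemma polar_pde_algebra:
  fixes q R Rx Rxx P Px Pxx :: complex
  assumes q: "q\<^sup>2 = 1/3"
  shows "(\<i> * q + (Rx + \<i> * Px))\<^sup>2 + (Rxx + \<i> * Pxx) + 1 - 2/3 * E
    = (Rxx - 4/3 * R - 2 * q * Px + (Rx * Rx - Px * Px - 2/3 * (E - 1 - 2 * R)))
      + \<i> * (Pxx + 2 * q * Rx + 2 * (Rx * Px))"
proof -
  have sq: "(\<i> * q + (Rx + \<i> * Px))\<^sup>2 = - (q\<^sup>2) + 2 * q * \<i> * Rx - 2 * q * Px + Rx * Rx + 2 * \<i> * (Rx * Px) - Px * Px"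
    by (simp add: power2_eq_square algebra_simps)
  show ?thesis unfolding sq q by (simp add: field_simps)
qed

lemma wave_exp_derivatives:
  fixes z zx :: "real \<Rightarrow> complex"
  assumes z: "\<And>x. (z has_vector_derivative zx x) (at x)" and zx: "\<And>x. (zx has_vector_derivative zxx x) (at x)"
  shows "((\<lambda>x. wave_train qE x * exp (z x)) has_vector_derivative
      wave_train qE x * exp (z x) * (\<i> * of_real qE + zx x)) (at x)"
    and "((\<lambda>x. wave_train qE x * exp (z x) * (\<i> * of_real qE + zx x)) has_vector_derivative
      wave_train qE x * exp (z x) * ((\<i> * of_real qE + zx x)\<^sup>2 + zxx x)) (at x)"
proof -
  have w: "(wave_train qE has_vector_derivative \<i> * of_real qE * wave_train qE x) (at x)" for x
    using has_vector_derivative_mult_right[OF phase_has_vector_derivative[of qE x], of "of_real rE"]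
    by (simp add: wave_train_qE[abs_def] mult_ac)
  have A: "((\<lambda>x. wave_train qE x * exp (z x)) has_vector_derivative
      wave_train qE x * exp (z x) * (\<i> * of_real qE + zx x)) (at x)" for x
    by (rule has_vector_derivative_eq_rhs[OF has_vector_derivative_mult[OF w exp_has_vector_derivative[OF z]]])
      (simp add: algebra_simps)
  show "((\<lambda>x. wave_train qE x * exp (z x)) has_vector_derivative
      wave_train qE x * exp (z x) * (\<i> * of_real qE + zx x)) (at x)" by (rule A)
  have B: "((\<lambda>x. \<i> * of_real qE + zx x) has_vector_derivative 0 + zxx x) (at x)"
    by (intro has_vector_derivative_add has_vector_derivative_const zx)
  show "((\<lambda>x. wave_train qE x * exp (z x) * (\<i> * of_real qE + zx x)) has_vector_derivative
      wave_train qE x * exp (z x) * ((\<i> * of_real qE + zx x)\<^sup>2 + zxx x)) (at x)"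
    by (rule has_vector_derivative_eq_rhs[OF has_vector_derivative_mult[OF A B]])
      (simp add: power2_eq_square algebra_simps)
qed

lemma complex_of_real_Re: "Im z = 0 \<Longrightarrow> of_real (Re z) = z"
  by (simp add: complex_eq_iff)

text \<open>The transform of \<open>exp (\<rho> + \<i> \<phi>) - 1\<close> is a series of convolution powers, hence inherits the weight \<open>wgt 5\<close> with a
factor \<open>4\<close>; the sum of the two fields is bounded by \<open>4 e\<close>, which makes \<open>16 e\<close>.\<close>

lemma (in polar_data) polar_gl:
  obtains Vh A where
    "\<And>t. 0 \<le> t \<Longrightarrow> Vh t \<in> borel_measurable borel"
    "\<And>t k. 0 \<le> t \<Longrightarrow> norm (Vh t k) \<le> 16 * e * wgt 5 t (k - qE)"
    "\<And>t x. 0 \<le> t \<Longrightarrow> A t x = wave_train qE x + inverse_fourier (Vh t) x"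
    "\<And>b. gl_on 0 b A"
    "\<And>x. A 0 x = wave_train qE x * exp (inverse_fourier (amp u0) x + \<i> * inverse_fourier (pha u0) x)"
proof -
  obtain u where "mild_solution polN (\<lambda>t b k. e * polW t b k) (\<lambda>t b k. e / duhamel_const * polH t b k) {0..} u0 u"
    using polar_solution_exists by blast
  then interpret mild_solution polN "\<lambda>t b k. e * polW t b k" "\<lambda>t b k. e / duhamel_const * polH t b k" "{0..}" u0 u .
  have adm: "admissible (\<lambda>b k. e * polW t b k) (u t)" if "0 \<le> t" for t using admissible_u that by simp
  have mb: "mode_bound e t (u t)" if "0 \<le> t" for t by (rule admissible_mode_bound[OF adm[OF that]])
  define zh where "zh t k = amp (u t) k + \<i> * pha (u t) k" for t k
  define z where "z t x = inverse_fourier (amp (u t)) x + \<i> * inverse_fourier (pha (u t)) x" for t x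
  define Eh where "Eh t = conv_series inv_fact_coeff (zh t)" for t
  define Vh where "Vh t k = of_real rE * Eh t (k - qE)" for t k
  define A where "A t x = wave_train qE x * exp (z t x)" for t x
  have e4: "0 \<le> 4 * e" using e_pos by simp
  have dz: "dominated (wgt 5 t) (4 * e) (zh t)" if t: "0 \<le> t" for t
  proof -
    have "dominated (wgt 5 t) (2 * e + norm \<i> * (2 * e)) (\<lambda>k. amp (u t) k + \<i> * pha (u t) k)"
      by (intro dominated_add dominated_cmult mode_bound_fields[OF t e_nonneg mb[OF t]])
    then show ?thesis by (simp add: zh_def[abs_def])
  qed
  have cw: "conv_weight (wgt 5 t) (64 * wgt_mass / theta t)" if "0 \<le> t" for t
    by (rule conv_weight_wgt[OF that]) auto
  have sm: "4 * e * (64 * wgt_mass / theta t) \<le> 1/4" if "0 \<le> t" for t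
  proof -
    have "64 * wgt_mass / theta t \<le> 64 * wgt_mass / 1"
      using theta_ge_1[OF that] wgt_mass_nonneg by (intro divide_left_mono) auto
    then have "4 * e * (64 * wgt_mass / theta t) \<le> 4 * e * (64 * wgt_mass / 1)"
      using e_pos by (intro mult_left_mono) auto
    then show ?thesis using e_small'(2) by simp
  qed
  have dE: "dominated (wgt 5 t) (16 * e) (Eh t)" if "0 \<le> t" for t
    using conv_weight.dominated_conv_series[where a = inv_fact_coeff, OF cw[OF that] dz[OF that] e4 inv_fact_coeff_le sm[OF that]]
    by (simp add: Eh_def)
  have mE: "Eh t \<in> borel_measurable borel" if "0 \<le> t" for t by (rule dominated_measurable[OF dE[OF that]])
  have mV: "Vh t \<in> borel_measurable borel" if "0 \<le> t" for t
    unfolding Vh_def[abs_def] using mE[OF that] by measurable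
  have bV: "norm (Vh t k) \<le> 16 * e * wgt 5 t (k - qE)" if t: "0 \<le> t" for t k
  proof -
    have "norm (Vh t k) = rE * norm (Eh t (k - qE))" using rE_pos by (simp add: Vh_def norm_mult)
    also have "\<dots> \<le> 1 * norm (Eh t (k - qE))" by (intro mult_right_mono rE_le_1) simp
    also have "\<dots> \<le> 16 * e * wgt 5 t (k - qE)" using dominated_le[OF dE[OF t], of "k - qE"] by simp
    finally show ?thesis .
  qed
  have iAP: "integrable lborel (amp (u t))" "integrable lborel (pha (u t))" if t: "0 \<le> t" for t
    by (rule conv_weight.dominated_integrable[OF cw[OF t] mode_bound_fields(6)[OF t e_nonneg mb[OF t]]],
        rule conv_weight.dominated_integrable[OF cw[OF t] mode_bound_fields(7)[OF t e_nonneg mb[OF t]]])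
  have zF: "inverse_fourier (zh t) x = z t x" if t: "0 \<le> t" for t x
    unfolding zh_def[abs_def] z_def
    by (subst inverse_fourier_add[OF iAP(1)[OF t] integrable_mult_right[OF iAP(2)[OF t]]]) (simp add: inverse_fourier_cmult)
  have AV: "A t x = wave_train qE x + inverse_fourier (Vh t) x" if t: "0 \<le> t" for t x
  proof -
    have "inverse_fourier (Vh t) x = of_real rE * (exp (\<i> * of_real (qE * x)) * inverse_fourier (Eh t) x)"
      unfolding Vh_def[abs_def] inverse_fourier_cmult inverse_fourier_shift ..
    also have "inverse_fourier (Eh t) x = exp (z t x) - 1"
      unfolding Eh_def inverse_fourier_exp(1)[OF cw[OF t] dz[OF t] e4 sm[OF t]] zF[OF t] ..
    finally show ?thesis by (simp add: A_def wave_train_qE algebra_simps)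
  qed
  have gl: "gl_on 0 b A" for b
  proof (rule gl_onI_fourier[where q = qE and Vh = Vh and g = "\<lambda>k. 16 * e * wgt 5 0 (k - qE)"])
    show "A t x = wave_train qE x + inverse_fourier (Vh t) x" if "t \<in> {0..b}" for t x using AV that by simp
    show "Vh t \<in> borel_measurable borel" if "t \<in> {0..b}" for t using mV that by simp
    show "norm (Vh t k) \<le> 16 * e * wgt 5 0 (k - qE)" if "t \<in> {0..b}" for t k
    proof -
      have "16 * e * wgt 5 t (k - qE) \<le> 16 * e * wgt 5 0 (k - qE)"
        using that e_pos by (intro mult_left_mono wgt_time_antimono) auto
      then show ?thesis using bV[of t k] that by simp
    qed
    show "integrable lborel (\<lambda>k. 16 * e * wgt 5 0 (k - qE))"
      using lborel_integrable_real_affine[OF wgt_integral(1)[of 0 5], of 1 "- qE"] by simp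
    show "continuous_on {0..b} (\<lambda>t. Vh t k)" for k
    proof (cases "0 \<le> b")
      case True
      then have bI: "b \<in> {0..}" by simp
      have cz: "continuous_on {0..b} (\<lambda>t. zh t k)" for k
        unfolding zh_def by (intro continuous_on_add continuous_on_mult_left fields_continuous[OF bI])
      have d0: "dominated (wgt 5 0) (4 * e) (zh t)" if "t \<in> {0..b}" for t
        by (rule dominated_mono[OF dz]) (use that e_pos wgt_time_antimono[of 0 t 5] in \<open>auto intro!: mult_left_mono\<close>)
      have "continuous_on {0..b} (\<lambda>t. Eh t k)" for k
        unfolding Eh_def
        by (rule conv_weight.continuous_conv_series[where a = inv_fact_coeff, OF cw[of 0] d0 cz e4 inv_fact_coeff_le sm[of 0]]) auto
      then show ?thesis unfolding Vh_def by (intro continuous_on_mult_left)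
    qed simp
  next
    fix t x assume t: "t \<in> {0<..<b}"
    then have t0: "0 \<le> t" and bI: "b \<in> {0..}" by auto
    note fa = field_space_derivatives[OF bI t, of "amp (u t)", simplified]
      and fp = field_space_derivatives[OF bI t, of "pha (u t)", simplified]
    define R where "R x = inverse_fourier (amp (u t)) x" for x
    define P where "P x = inverse_fourier (pha (u t)) x" for x
    define Rx where "Rx x = inverse_fourier (dk (amp (u t))) x" for x
    define Px where "Px x = inverse_fourier (dk (pha (u t))) x" for x
    define Rxx where "Rxx x = inverse_fourier (dk (dk (amp (u t)))) x" for x
    define Pxx where "Pxx x = inverse_fourier (dk (dk (pha (u t)))) x" for x
    have dR: "(R has_vector_derivative Rx x) (at x)" "(Rx has_vector_derivative Rxx x) (at x)"
      "(P has_vector_derivative Px x) (at x)" "(Px has_vector_derivative Pxx x) (at x)" for x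
      using fa(1,2)[of x] fp(1,2)[of x]
      by (simp_all add: R_def[abs_def] P_def[abs_def] Rx_def[abs_def] Px_def[abs_def] Rxx_def Pxx_def dk_def[abs_def] mult.assoc)
    define zx where "zx x = Rx x + \<i> * Px x" for x
    define zxx where "zxx x = Rxx x + \<i> * Pxx x" for x
    have dzx: "(z t has_vector_derivative zx x) (at x)" "(zx has_vector_derivative zxx x) (at x)" for x
      unfolding z_def[abs_def] zx_def[abs_def] zxx_def R_def[symmetric] P_def[symmetric]
      by (intro has_vector_derivative_add has_vector_derivative_mult_right dR)+
    show "((\<lambda>x. A t x) has_vector_derivative
        wave_train qE x * exp (z t x) * (\<i> * of_real qE + (inverse_fourier (dk (amp (u t))) x + \<i> * inverse_fourier (dk (pha (u t))) x))) (at x)"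
      using wave_exp_derivatives(1)[OF dzx] unfolding A_def zx_def Rx_def Px_def .
    show "((\<lambda>x. wave_train qE x * exp (z t x) * (\<i> * of_real qE + (inverse_fourier (dk (amp (u t))) x + \<i> * inverse_fourier (dk (pha (u t))) x)))
       has_vector_derivative
        wave_train qE x * exp (z t x) * ((\<i> * of_real qE + (inverse_fourier (dk (amp (u t))) x + \<i> * inverse_fourier (dk (pha (u t))) x))\<^sup>2
          + (inverse_fourier (dk (dk (amp (u t)))) x + \<i> * inverse_fourier (dk (dk (pha (u t)))) x))) (at x)"
      using wave_exp_derivatives(2)[OF dzx] unfolding zx_def zxx_def Rx_def Px_def Rxx_def Pxx_def .
    define E where "E = exp (2 * R x)"
    have tI: "t \<in> {0..}" using t0 by simp
    have ImR: "Im (R x) = 0" and ImP: "Im (P x) = 0"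
      unfolding R_def P_def by (intro inverse_fourier_hermitian fields_hermitian tI)+
    have AE: "of_real ((norm (A t x))\<^sup>2) = 2/3 * E"
    proof -
      have "norm (exp (\<i> * of_real (qE * x))) = 1" by (rule norm_fourier_kernel)
      moreover have "Re (z t x) = Re (R x)" using ImP by (simp add: z_def R_def P_def)
      ultimately have "norm (A t x) = rE * exp (Re (R x))"
        using rE_pos unfolding A_def wave_train_qE norm_mult norm_exp_eq_Re by simp
      then have n: "(norm (A t x))\<^sup>2 = 2/3 * exp (2 * Re (R x))"
        by (simp add: power_mult_distrib rE_sq exp_double)
      have E: "E = of_real (exp (2 * Re (R x)))"
        unfolding E_def exp_of_real[symmetric] using complex_of_real_Re[OF ImR] by simp
      show ?thesis unfolding n E by simp
    qed
    have NR: "inverse_fourier (amp (polN (u t))) x = Rx x * Rx x - Px x * Px x - 2/3 * (E - 1 - 2 * R x)"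
      and NP: "inverse_fourier (pha (polN (u t))) x = 2 * (Rx x * Px x)"
    proof -
      interpret cw4: conv_weight "wgt 4 t" "64 * wgt_mass / theta t" by (rule conv_weight_wgt[OF t0]) auto
      note f = mode_bound_fields[OF t0 e_nonneg mb[OF t0]]
      have e2: "0 \<le> 2 * e / theta t" using e_pos theta_pos[OF t0] by simp
      have s2: "2 * e / theta t * (64 * wgt_mass / theta t) \<le> 1/4"
      proof -
        have "2 * e / theta t \<le> 4 * e / 1" using e_pos theta_ge_1[OF t0] by (intro frac_le) auto
        then have "2 * e / theta t * (64 * wgt_mass / theta t) \<le> 4 * e / 1 * (64 * wgt_mass / theta t)"
          using wgt_mass_nonneg theta_pos[OF t0] by (intro mult_right_mono) auto
        then show ?thesis using sm[OF t0] by simp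
      qed
      note i = cw4.dominated_integrable[OF f(2)] cw4.dominated_integrable[OF f(3)]
      have ic: "integrable lborel (conv (dk (amp (u t))) (dk (amp (u t))))" "integrable lborel (conv (dk (pha (u t))) (dk (pha (u t))))"
        "integrable lborel (conv_series exp_coeff (amp (u t)))"
        by (rule cw4.dominated_integrable[OF cw4.dominated_conv[OF f(2) f(2) e2 e2]],
            rule cw4.dominated_integrable[OF cw4.dominated_conv[OF f(3) f(3) e2 e2]],
            rule cw4.dominated_integrable[OF cw4.dominated_conv_series[where a = exp_coeff, OF f(1) e2 exp_coeff_le s2]])
      have "inverse_fourier (pol_rho (amp (u t)) (pha (u t))) x
        = inverse_fourier (conv (dk (amp (u t))) (dk (amp (u t)))) x - inverse_fourier (conv (dk (pha (u t))) (dk (pha (u t)))) x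
          - of_real (2/3) * inverse_fourier (conv_series exp_coeff (amp (u t))) x"
        unfolding pol_rho_def[abs_def]
        by (subst inverse_fourier_diff[OF Bochner_Integration.integrable_diff[OF ic(1,2)] integrable_mult_right[OF ic(3)]],
            subst inverse_fourier_diff[OF ic(1,2)], subst inverse_fourier_cmult) (rule refl)
      then show "inverse_fourier (amp (polN (u t))) x = Rx x * Rx x - Px x * Px x - 2/3 * (E - 1 - 2 * R x)"
        unfolding polN_def amp_modes inverse_fourier_conv[OF i(1) i(1)] inverse_fourier_conv[OF i(2) i(2)]
          inverse_fourier_exp(2)[OF cw4.conv_weight_axioms f(1) e2 s2]
        by (simp add: Rx_def Px_def R_def E_def)
      show "inverse_fourier (pha (polN (u t))) x = 2 * (Rx x * Px x)"
        unfolding polN_def pha_modes pol_phi_def[abs_def] inverse_fourier_cmult inverse_fourier_conv[OF i(1) i(2)]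
        by (simp add: Rx_def Px_def)
    qed
    note td = fields_time_derivative[OF bI t, of x]
    have hz: "((\<lambda>t. z t x) has_vector_derivative
       (Rxx x - of_real (4/3) * R x - 2 * of_real qE * Px x + (Rx x * Rx x - Px x * Px x - 2/3 * (E - 1 - 2 * R x)))
       + \<i> * (Pxx x + 2 * of_real qE * Rx x + 2 * (Rx x * Px x))) (at t)"
      unfolding z_def
      using has_vector_derivative_add[OF td(1) has_vector_derivative_mult_right[OF td(2), of \<i>]]
      unfolding NR NP R_def[symmetric] qE_def[symmetric] dk_def[symmetric] Rx_def[symmetric] Px_def[symmetric]
        Rxx_def[symmetric] Pxx_def[symmetric] .
    have q2: "(of_real qE :: complex)\<^sup>2 = 1/3" unfolding of_real_power[symmetric] qE_sq by simp
    have o43: "of_real (4/3) = (4/3 :: complex)" by simp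
    have zt: "((\<lambda>t. z t x) has_vector_derivative (\<i> * of_real qE + zx x)\<^sup>2 + zxx x + 1 - 2/3 * E) (at t)"
      unfolding zx_def zxx_def polar_pde_algebra[OF q2, where R = "R x"] by (rule hz[unfolded o43])
    have "((\<lambda>t. A t x) has_vector_derivative wave_train qE x * (((\<i> * of_real qE + zx x)\<^sup>2 + zxx x + 1 - 2/3 * E) * exp (z t x))) (at t)"
      unfolding A_def by (intro has_vector_derivative_mult_right exp_has_vector_derivative zt)
    moreover have "wave_train qE x * (((\<i> * of_real qE + zx x)\<^sup>2 + zxx x + 1 - 2/3 * E) * exp (z t x))
      = wave_train qE x * exp (z t x) * ((\<i> * of_real qE + zx x)\<^sup>2 + zxx x) + A t x - A t x * of_real ((norm (A t x))\<^sup>2)"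
      unfolding AE by (simp add: A_def algebra_simps)
    ultimately show "((\<lambda>t. A t x) has_vector_derivative
        wave_train qE x * exp (z t x) * ((\<i> * of_real qE + (inverse_fourier (dk (amp (u t))) x + \<i> * inverse_fourier (dk (pha (u t))) x))\<^sup>2
          + (inverse_fourier (dk (dk (amp (u t)))) x + \<i> * inverse_fourier (dk (dk (pha (u t)))) x))
         + A t x - A t x * of_real ((norm (A t x))\<^sup>2)) (at t)"
      unfolding zx_def zxx_def Rx_def Px_def Rxx_def Pxx_def by simp
  qed
  have "u 0 = u0" using u_initial by (intro ext) simp
  then have "A 0 x = wave_train qE x * exp (inverse_fourier (amp u0) x + \<i> * inverse_fourier (pha u0) x)" for x
    by (simp add: A_def z_def)
  with mV bV AV gl show ?thesis by (rule that)
qed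

section \<open>A majorant reproduced by convolution\<close>

lemma real_self_conv:
  fixes M :: "real \<Rightarrow> real"
  assumes M: "integrable lborel M"
  shows "integrable lborel (\<lambda>k. LINT l|lborel. M l * M (k - l))"
    and "(LINT k|lborel. LINT l|lborel. M l * M (k - l)) = (LINT k|lborel. M k)\<^sup>2"
proof -
  have [measurable]: "M \<in> borel_measurable borel" using borel_measurable_integrable[OF M] by simp
  have M': "integrable lborel (\<lambda>k. M (k - l))" for l
    using lborel_integrable_real_affine[OF M, of 1 "- l"] by (simp add: add.commute)
  have eqn: "(LINT k|lborel. h (k - l)) = (LINT k|lborel. h k)" for l and h :: "real \<Rightarrow> real"
    by (subst lborel_integral_real_affine[where c = 1 and t = l]) auto
  have I: "integrable (lborel \<Otimes>\<^sub>M lborel) (case_prod (\<lambda>l k. M l * M (k - l)))"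
  proof (rule lborel_pair.Fubini_integrable)
    have "(LINT k|lborel. norm (M l * M (k - l))) = \<bar>M l\<bar> * (LINT k|lborel. \<bar>M k\<bar>)" for l
      using eqn[of "\<lambda>k. \<bar>M k\<bar>" l] by (simp add: abs_mult)
    then show "integrable lborel (\<lambda>l. LINT k|lborel. norm (case (l, k) of (l, k) \<Rightarrow> M l * M (k - l)))"
      using M by simp
    show "AE l in lborel. integrable lborel (\<lambda>k. case (l, k) of (l, k) \<Rightarrow> M l * M (k - l))"
      using M' by simp
  qed measurable
  show "integrable lborel (\<lambda>k. LINT l|lborel. M l * M (k - l))"
    by (rule lborel_pair.integrable_snd[OF I])
  have "(LINT k|lborel. LINT l|lborel. M l * M (k - l)) = (LINT l|lborel. LINT k|lborel. M l * M (k - l))"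
    by (rule lborel_pair.Fubini_integral[OF I])
  also have "\<dots> = (LINT l|lborel. M l * (LINT k|lborel. M k))" using eqn[of M] by simp
  finally show "(LINT k|lborel. LINT l|lborel. M l * M (k - l)) = (LINT k|lborel. M k)\<^sup>2"
    by (simp add: power2_eq_square)
qed

text \<open>No fixed integrable weight lies above all bounded integrable data, so the majorant
is adapted to \<open>g\<close>: it solves \<open>m = g + (m * m) / \<epsilon>\<close> and is the limit of the increasing
iteration that starts with \<open>g\<close>. Both the supremum and the integral stay below \<open>2 a\<close>, since
\<open>(2 a)^2 / \<epsilon> \<le> a\<close>.\<close>

lemma convolution_majorant:
  fixes g :: "real \<Rightarrow> real"
  assumes g: "integrable lborel g" and g0: "\<And>k. 0 \<le> g k" and ga: "\<And>k. g k \<le> a"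
    and gi: "(LINT k|lborel. g k) \<le> a" and a: "0 \<le> a" "4 * a \<le> \<epsilon>" and \<epsilon>: "0 < \<epsilon>"
  obtains m where "integrable lborel m" "\<And>k. g k \<le> m k" "\<And>k. m k \<le> 2 * a"
    "(LINT k|lborel. m k) \<le> 2 * a" "\<And>k. (LINT l|lborel. m l * m (k - l)) \<le> \<epsilon> * m k"
proof -
  define F where "F M k = g k + (LINT l|lborel. M l * M (k - l)) / \<epsilon>" for M :: "real \<Rightarrow> real" and k
  define M where "M n = (F ^^ n) g" for n
  have MS: "M (Suc n) k = g k + (LINT l|lborel. M n l * M n (k - l)) / \<epsilon>" for n k by (simp add: M_def F_def)
  have M0: "M 0 = g" by (simp add: M_def)
  have small: "4 * a\<^sup>2 / \<epsilon> \<le> a"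
  proof -
    have "(4 * a) * a \<le> \<epsilon> * a" using a by (intro mult_right_mono) auto
    then show ?thesis using \<epsilon> by (simp add: divide_le_eq power2_eq_square mult.commute)
  qed
  have props: "integrable lborel (M n) \<and> (\<forall>k. 0 \<le> M n k \<and> M n k \<le> 2 * a) \<and> (LINT k|lborel. M n k) \<le> 2 * a" for n
  proof (induction n)
    case 0
    have "M 0 k \<le> 2 * a" for k using ga[of k] a(1) by (simp add: M0)
    then show ?case using g g0 gi a(1) by (simp add: M0)
  next
    case (Suc n)
    then have i: "integrable lborel (M n)" and b: "\<And>k. 0 \<le> M n k" "\<And>k. M n k \<le> 2 * a" and ib: "(LINT k|lborel. M n k) \<le> 2 * a"
      by auto
    note sc = real_self_conv[OF i]
    have il: "integrable lborel (\<lambda>l. M n l * M n (k - l))" for k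
    proof (rule integrable_dominated)
      show "integrable lborel (\<lambda>l. M n l * (2 * a))" using i by simp
      show "norm (M n l * M n (k - l)) \<le> M n l * (2 * a)" for l using b by (simp add: mult_left_mono)
      have [measurable]: "M n \<in> borel_measurable borel" using borel_measurable_integrable[OF i] by simp
      show "(\<lambda>l. M n l * M n (k - l)) \<in> borel_measurable borel" by measurable
    qed
    have c0: "0 \<le> (LINT l|lborel. M n l * M n (k - l))" for k
      by (rule integral_nonneg_AE) (use b in simp)
    have c1: "(LINT l|lborel. M n l * M n (k - l)) \<le> 4 * a\<^sup>2" for k
    proof -
      have "(LINT l|lborel. M n l * M n (k - l)) \<le> (LINT l|lborel. M n l * (2 * a))"
        by (rule integral_mono[OF il]) (use i b in \<open>auto intro: mult_left_mono\<close>)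
      also have "\<dots> = (LINT l|lborel. M n l) * (2 * a)" by simp
      also have "\<dots> \<le> 2 * a * (2 * a)" using ib a by (intro mult_right_mono) auto
      finally show ?thesis by (simp add: power2_eq_square)
    qed
    show ?case
    proof (intro conjI allI)
      have iS: "integrable lborel (\<lambda>k. g k + (LINT l|lborel. M n l * M n (k - l)) / \<epsilon>)"
        using g sc(1) by simp
      then show "integrable lborel (M (Suc n))" by (simp add: MS[abs_def])
      fix k
      have "0 \<le> (LINT l|lborel. M n l * M n (k - l)) / \<epsilon>" using c0 \<epsilon> by simp
      then show "0 \<le> M (Suc n) k" using g0[of k] by (simp add: MS)
      have "(LINT l|lborel. M n l * M n (k - l)) / \<epsilon> \<le> 4 * a\<^sup>2 / \<epsilon>" using c1 \<epsilon> by (intro divide_right_mono) auto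
      then show "M (Suc n) k \<le> 2 * a" using ga[of k] small by (simp add: MS)
      have "(LINT k|lborel. M n k)\<^sup>2 \<le> (2 * a)\<^sup>2" by (intro power_mono ib integral_nonneg_AE) (use b in simp)
      then have "(LINT k|lborel. M n k)\<^sup>2 / \<epsilon> \<le> 4 * a\<^sup>2 / \<epsilon>" using \<epsilon> by (intro divide_right_mono) (auto simp: power_mult_distrib)
      moreover have "(LINT k|lborel. M (Suc n) k) = (LINT k|lborel. g k) + (LINT k|lborel. M n k)\<^sup>2 / \<epsilon>"
        unfolding MS[abs_def] using g sc by simp
      ultimately show "(LINT k|lborel. M (Suc n) k) \<le> 2 * a" using gi small by simp
    qed
  qed
  have i: "integrable lborel (M n)" and b: "0 \<le> M n k" "M n k \<le> 2 * a" and ib: "(LINT k|lborel. M n k) \<le> 2 * a" for n k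
    using props by auto
  have il: "integrable lborel (\<lambda>l. M n l * M n (k - l))" for n k
  proof (rule integrable_dominated)
    show "integrable lborel (\<lambda>l. M n l * (2 * a))" using i by simp
    show "norm (M n l * M n (k - l)) \<le> M n l * (2 * a)" for l using b by (simp add: mult_left_mono)
    have [measurable]: "M n \<in> borel_measurable borel" using borel_measurable_integrable[OF i] by simp
    show "(\<lambda>l. M n l * M n (k - l)) \<in> borel_measurable borel" by measurable
  qed
  have step: "M n k \<le> M (Suc n) k" for n k
  proof (induction n arbitrary: k)
    case 0
    have "0 \<le> (LINT l|lborel. M 0 l * M 0 (k - l)) / \<epsilon>"
      using \<epsilon> by (intro divide_nonneg_pos integral_nonneg_AE) (use b in simp_all)
    then show ?case by (simp add: MS M0)
  next
    case (Suc n)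
    have "(LINT l|lborel. M n l * M n (k - l)) \<le> (LINT l|lborel. M (Suc n) l * M (Suc n) (k - l))"
      by (rule integral_mono[OF il il]) (intro mult_mono Suc b)
    then show ?case using \<epsilon> by (simp add: MS[of n] MS[of "Suc n"] divide_right_mono)
  qed
  have inc: "incseq (\<lambda>n. M n k)" for k using step by (intro incseq_SucI)
  define m where "m k = lim (\<lambda>n. M n k)" for k
  have lim: "(\<lambda>n. M n k) \<longlonglongrightarrow> m k" for k
  proof -
    obtain L where "(\<lambda>n. M n k) \<longlonglongrightarrow> L" by (rule incseq_convergent[OF inc]) (use b in blast)
    then show ?thesis unfolding m_def by (simp add: limI)
  qed
  have Mm: "M n k \<le> m k" for n k by (rule incseq_le[OF inc lim])
  have m2: "m k \<le> 2 * a" for k by (rule LIMSEQ_le_const2[OF lim]) (use b in auto)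
  have Mb: "M n \<in> borel_measurable borel" for n using borel_measurable_integrable[OF i[of n]] by simp
  have mb: "m \<in> borel_measurable borel" by (rule borel_measurable_LIMSEQ_metric[OF Mb lim])
  have incI: "incseq (\<lambda>n. LINT k|lborel. M n k)"
    by (rule incseq_SucI, rule integral_mono[OF i i]) (rule step)
  obtain L where L: "(\<lambda>n. LINT k|lborel. M n k) \<longlonglongrightarrow> L" by (rule incseq_convergent[OF incI]) (use ib in blast)
  have mi: "integrable lborel m" "(LINT k|lborel. m k) = L"
    by (rule integrable_monotone_convergence[OF i _ _ L] integral_monotone_convergence[OF i _ _ L];
        use inc lim mb in \<open>auto simp: incseq_def mono_def\<close>)+
  have conv: "(\<lambda>n. LINT l|lborel. M n l * M n (k - l)) \<longlonglongrightarrow> (LINT l|lborel. m l * m (k - l))" for k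
  proof (rule integral_dominated_convergence[where w = "\<lambda>l. m l * (2 * a)"])
    show "(\<lambda>l. m l * m (k - l)) \<in> borel_measurable lborel" using mb by measurable
    show "(\<lambda>l. M n l * M n (k - l)) \<in> borel_measurable lborel" for n using Mb[of n] by measurable
    show "integrable lborel (\<lambda>l. m l * (2 * a))" using mi(1) by simp
    show "AE l in lborel. (\<lambda>n. M n l * M n (k - l)) \<longlonglongrightarrow> m l * m (k - l)"
      by (intro AE_I2 tendsto_mult lim)
    show "AE l in lborel. norm (M n l * M n (k - l)) \<le> m l * (2 * a)" for n
      using b Mm order_trans[OF b(1) Mm] by (intro AE_I2) (auto simp: abs_mult intro!: mult_mono)
  qed
  have fixpoint: "m k = g k + (LINT l|lborel. m l * m (k - l)) / \<epsilon>" for k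
  proof -
    have "(\<lambda>n. M (Suc n) k) \<longlonglongrightarrow> g k + (LINT l|lborel. m l * m (k - l)) / \<epsilon>"
      unfolding MS using \<epsilon> by (intro tendsto_intros conv) auto
    moreover have "(\<lambda>n. M (Suc n) k) \<longlonglongrightarrow> m k" using lim by (rule LIMSEQ_Suc)
    ultimately show ?thesis by (rule LIMSEQ_unique[rotated])
  qed
  show ?thesis
  proof (rule that[OF mi(1)])
    show "g k \<le> m k" for k using Mm[of 0 k] by (simp add: M0)
    show "m k \<le> 2 * a" for k by (rule m2)
    show "(LINT k|lborel. m k) \<le> 2 * a" unfolding mi(2) by (rule LIMSEQ_le_const2[OF L]) (use ib in auto)
    have "(LINT l|lborel. m l * m (k - l)) = \<epsilon> * (m k - g k)" for k using fixpoint[of k] \<epsilon> by (simp add: field_simps)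
    then show "(LINT l|lborel. m l * m (k - l)) \<le> \<epsilon> * m k" for k using g0[of k] \<epsilon> by (simp add: mult_left_mono)
  qed
qed

section \<open>The nonlinearity in Cartesian coordinates\<close>

definition sqs :: "(real \<Rightarrow> complex) \<Rightarrow> (real \<Rightarrow> complex) \<Rightarrow> real \<Rightarrow> complex" where
  "sqs a b k = conv a a k + conv b b k"

text \<open>The transforms of the nonlinear terms for \<open>A = exp (\<i> q X) (r + a + \<i> b)\<close>, where \<open>r = sqrt (2/3)\<close>:
\<open>- r (3 a^2 + b^2) - a (a^2 + b^2)\<close> and, next, \<open>- 2 r a b - b (a^2 + b^2)\<close>.\<close>

definition car_rho :: "(real \<Rightarrow> complex) \<Rightarrow> (real \<Rightarrow> complex) \<Rightarrow> real \<Rightarrow> complex" where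
  "car_rho a b k = - (of_real rE * (3 * conv a a k + conv b b k)) - conv a (sqs a b) k"

definition car_phi :: "(real \<Rightarrow> complex) \<Rightarrow> (real \<Rightarrow> complex) \<Rightarrow> real \<Rightarrow> complex" where
  "car_phi a b k = - (of_real rE * (2 * conv a b k)) - conv b (sqs a b) k"

definition carN :: "(bool \<Rightarrow> real \<Rightarrow> complex) \<Rightarrow> bool \<Rightarrow> real \<Rightarrow> complex" where
  "carN u = modes (car_rho (amp u) (pha u)) (car_phi (amp u) (pha u))"

text \<open>Small enough for the Lipschitz constant in \<open>carN_difference\<close>, where products of two fields of size \<open>40\<close>
(relative to the weight) occur.\<close>

definition eps :: real where "eps = 1 / 100000"

lemma carN_zero: "carN (\<lambda>b k. 0) b k = 0"
  unfolding carN_def amp_zero pha_zero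
  by (simp add: modes_def car_rho_def car_phi_def conv_zero)

lemma measurable_carN_param:
  assumes "\<And>b. case_prod (\<lambda>t::real. u t b) \<in> borel_measurable (borel \<Otimes>\<^sub>M borel)"
  shows "case_prod (\<lambda>t. carN (u t) b) \<in> borel_measurable (borel \<Otimes>\<^sub>M borel)"
proof -
  note a = measurable_amp_param[OF assms]
  have c: "(\<lambda>x. conv (amp (u (fst x))) (amp (u (fst x))) (snd x)) \<in> borel_measurable (borel \<Otimes>\<^sub>M borel)"
    "(\<lambda>x. conv (pha (u (fst x))) (pha (u (fst x))) (snd x)) \<in> borel_measurable (borel \<Otimes>\<^sub>M borel)"
    "(\<lambda>x. conv (amp (u (fst x))) (pha (u (fst x))) (snd x)) \<in> borel_measurable (borel \<Otimes>\<^sub>M borel)"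
    using measurable_conv_param[OF a(1) a(1)] measurable_conv_param[OF a(2) a(2)] measurable_conv_param[OF a(1) a(2)]
    by (simp_all only: case_prod_beta')
  note [measurable] = c
  have s: "case_prod (\<lambda>t. sqs (amp (u t)) (pha (u t))) \<in> borel_measurable (borel \<Otimes>\<^sub>M borel)"
    unfolding case_prod_beta' sqs_def by measurable
  have [measurable]: "(\<lambda>x. conv (amp (u (fst x))) (sqs (amp (u (fst x))) (pha (u (fst x)))) (snd x)) \<in> borel_measurable (borel \<Otimes>\<^sub>M borel)"
    "(\<lambda>x. conv (pha (u (fst x))) (sqs (amp (u (fst x))) (pha (u (fst x)))) (snd x)) \<in> borel_measurable (borel \<Otimes>\<^sub>M borel)"
    using measurable_conv_param[OF a(1) s] measurable_conv_param[OF a(2) s] by (simp_all only: case_prod_beta')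
  show ?thesis unfolding carN_def
  proof (rule measurable_modes_param)
    show "case_prod (\<lambda>t. car_rho (amp (u t)) (pha (u t))) \<in> borel_measurable (borel \<Otimes>\<^sub>M borel)"
      unfolding case_prod_beta' car_rho_def by measurable
    show "case_prod (\<lambda>t. car_phi (amp (u t)) (pha (u t))) \<in> borel_measurable (borel \<Otimes>\<^sub>M borel)"
      unfolding case_prod_beta' car_phi_def by measurable
  qed
qed

lemma hermitian_carN:
  assumes "\<And>b. hermitian (u b)"
  shows "hermitian (carN u b)"
proof -
  have h: "hermitian (amp u)" "hermitian (pha u)" by (intro hermitian_amp hermitian_pha assms)+
  then have s: "hermitian (sqs (amp u) (pha u))"
    unfolding sqs_def[abs_def] by (intro hermitian_add hermitian_conv)
  have "hermitian (conv (amp u) (amp u))" "hermitian (conv (pha u) (pha u))" "hermitian (conv (amp u) (pha u))"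
    "hermitian (conv (amp u) (sqs (amp u) (pha u)))" "hermitian (conv (pha u) (sqs (amp u) (pha u)))"
    by (intro hermitian_conv h s)+
  then show ?thesis
    unfolding carN_def by (intro hermitian_modes) (auto simp: hermitian_def car_rho_def car_phi_def)
qed

text \<open>The smallness comes from the weight alone: each convolution contributes a factor \<open>eps\<close>, so the
solution may be as large as \<open>20\<close> times the weight.\<close>

lemma carN_difference:
  assumes cw: "conv_weight M eps" and D: "0 \<le> D"
    and u: "\<And>b. dominated M 20 (u b)" and v: "\<And>b. dominated M 20 (v b)" and d: "\<And>b. dominated M (20 * D) (\<lambda>k. u b k - v b k)"
  shows "norm (carN u b k - carN v b k) \<le> D / 2 * M k"
proof -
  interpret conv_weight M eps by (rule cw)
  have fb: "dominated M (2 * E) (amp w)" "dominated M (2 * E) (pha w)" if w: "\<And>b. dominated M E (w b)" for w E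
  proof -
    have m: "w b \<in> borel_measurable borel" for b using dominated_measurable[OF w] .
    have "norm (w True k) + norm (w False k) \<le> 2 * E * M k" for k
      using dominated_le[OF w, of True k] dominated_le[OF w, of False k] by simp
    then show "dominated M (2 * E) (amp w)" "dominated M (2 * E) (pha w)"
      using norm_amp_pha_le[of w] order_trans by (auto intro!: dominatedI measurable_amp m) blast+
  qed
  have fu: "dominated M 40 (amp u)" "dominated M 40 (pha u)" and fv: "dominated M 40 (amp v)" "dominated M 40 (pha v)"
    using fb[OF u] fb[OF v] by simp_all
  have fd: "dominated M (40 * D) (\<lambda>k. amp u k - amp v k)" "dominated M (40 * D) (\<lambda>k. pha u k - pha v k)"
    using fb[OF d] by (simp_all add: amp_diff[abs_def] pha_diff[abs_def])
  have c: "dominated M (3200 * eps * D) (\<lambda>k. conv (amp u) (amp u) k - conv (amp v) (amp v) k)"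
    "dominated M (3200 * eps * D) (\<lambda>k. conv (pha u) (pha u) k - conv (pha v) (pha v) k)"
    "dominated M (3200 * eps * D) (\<lambda>k. conv (amp u) (pha u) k - conv (amp v) (pha v) k)"
    using dominated_conv_diff[OF fu(1) fv(1) fu(1) fv(1) fd(1) fd(1) _ _ D]
      dominated_conv_diff[OF fu(2) fv(2) fu(2) fv(2) fd(2) fd(2) _ _ D]
      dominated_conv_diff[OF fu(1) fv(1) fu(2) fv(2) fd(1) fd(2) _ _ D] by simp_all
  have s: "dominated M (6400 * eps) (sqs (amp w) (pha w))" if w: "dominated M 40 (amp w)" "dominated M 40 (pha w)" for w
  proof -
    have "dominated M (40 * 40 * eps + 40 * 40 * eps) (sqs (amp w) (pha w))"
      unfolding sqs_def[abs_def] by (intro dominated_add dominated_conv w) auto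
    then show ?thesis by (rule dominated_scale_mono) (auto simp: eps_def M_nonneg)
  qed
  have sd: "dominated M (6400 * eps * D) (\<lambda>k. sqs (amp u) (pha u) k - sqs (amp v) (pha v) k)"
    using dominated_add[OF c(1) c(2)] by (simp add: sqs_def algebra_simps)
  have e6: "0 \<le> 6400 * eps" by (simp add: eps_def)
  have c': "dominated M (2 * 40 * (6400 * eps) * eps * D) (\<lambda>k. conv (amp u) (sqs (amp u) (pha u)) k - conv (amp v) (sqs (amp v) (pha v)) k)"
    "dominated M (2 * 40 * (6400 * eps) * eps * D) (\<lambda>k. conv (pha u) (sqs (amp u) (pha u)) k - conv (pha v) (sqs (amp v) (pha v)) k)"
    by (rule dominated_conv_diff[OF fu(1) fv(1) s[OF fu] s[OF fv] fd(1) sd _ e6 D],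
        simp, rule dominated_conv_diff[OF fu(2) fv(2) s[OF fu] s[OF fv] fd(2) sd _ e6 D], simp)
  define x where "x = D * M k"
  have x: "0 \<le> x" using D M_nonneg by (simp add: x_def)
  define A B C P Q where "A = conv (amp u) (amp u) k - conv (amp v) (amp v) k"
    and "B = conv (pha u) (pha u) k - conv (pha v) (pha v) k"
    and "C = conv (amp u) (pha u) k - conv (amp v) (pha v) k"
    and "P = conv (amp u) (sqs (amp u) (pha u)) k - conv (amp v) (sqs (amp v) (pha v)) k"
    and "Q = conv (pha u) (sqs (amp u) (pha u)) k - conv (pha v) (sqs (amp v) (pha v)) k"
  have n: "norm A \<le> 0.032 * x" "norm B \<le> 0.032 * x" "norm C \<le> 0.032 * x" "norm P \<le> 0.001 * x" "norm Q \<le> 0.001 * x"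
    using dominated_le[OF c(1), of k] dominated_le[OF c(2), of k] dominated_le[OF c(3), of k]
      dominated_le[OF c'(1), of k] dominated_le[OF c'(2), of k] x
    by (simp_all add: A_def B_def C_def P_def Q_def x_def eps_def mult.assoc)
  define R where "R = car_rho (amp u) (pha u) k - car_rho (amp v) (pha v) k"
  define S where "S = car_phi (amp u) (pha u) k - car_phi (amp v) (pha v) k"
  have "R = - (of_real rE * (3 * A + B)) - P" by (simp add: R_def car_rho_def A_def B_def P_def algebra_simps)
  then have "norm R \<le> norm (of_real rE * (3 * A + B)) + norm P"
    using norm_triangle_ineq4[of "- (of_real rE * (3 * A + B))" P] by simp
  also have "norm (of_real rE * (3 * A + B)) \<le> 1 * (3 * norm A + norm B)"
    unfolding norm_mult norm_of_real using rE_pos rE_le_1 norm_triangle_ineq[of "3 * A" B]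
    by (intro mult_mono) (simp_all add: norm_mult)
  finally have R: "norm R \<le> 0.13 * x" using n x by simp
  have "S = - (of_real rE * (2 * C)) - Q" by (simp add: S_def car_phi_def C_def Q_def algebra_simps)
  then have "norm S \<le> norm (of_real rE * (2 * C)) + norm Q"
    using norm_triangle_ineq4[of "- (of_real rE * (2 * C))" Q] by simp
  also have "norm (of_real rE * (2 * C)) \<le> 1 * (2 * norm C)"
    unfolding norm_mult norm_of_real using rE_pos rE_le_1 by (intro mult_mono) simp_all
  finally have S: "norm S \<le> 0.07 * x" using n x by simp
  have "carN u b k - carN v b k = modes (\<lambda>k. car_rho (amp u) (pha u) k - car_rho (amp v) (pha v) k)
      (\<lambda>k. car_phi (amp u) (pha u) k - car_phi (amp v) (pha v) k) b k"
    unfolding carN_def by (rule modes_diff)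
  then have "norm (carN u b k - carN v b k) \<le> norm R + norm S"
    using norm_modes_le by (simp add: R_def S_def)
  then show ?thesis using R S x by (simp add: x_def)
qed

text \<open>On a bounded time interval this linear lower bound lets the semigroup produce the decay \<open>exp (- |k| t)\<close>, at the
cost of a factor \<open>exp t\<close>.\<close>

lemma nu_ge: "\<bar>k\<bar> - 1 \<le> nu b k"
proof (cases b)
  case True
  show ?thesis
  proof (cases "\<bar>k\<bar> \<le> 1")
    case False
    have "0 \<le> (\<bar>k\<bar> - 3/2)\<^sup>2 + 3/4" by (simp add: add_nonneg_nonneg)
    also have "(\<bar>k\<bar> - 3/2)\<^sup>2 = k\<^sup>2 - 3 * \<bar>k\<bar> + 9/4" by (simp add: power2_diff power_divide)
    finally have "\<bar>k\<bar> - 1 \<le> k\<^sup>2 / 3" by simp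
    then show ?thesis using nu_lower(2)[of k] False True by simp
  qed (use nu_nonneg[of b k] in simp)
next
  case False
  have "\<bar>k\<bar> - 1 \<le> 1 + k\<^sup>2" using abs_le_one_plus_sq[of k] by simp
  also have "\<dots> \<le> nu False k" by (rule nu_lower(3))
  finally show ?thesis using False by simp
qed

lemma exp_le_9: "x \<le> 2 \<Longrightarrow> exp x \<le> (9::real)"
proof -
  assume "x \<le> 2"
  then have "exp x \<le> exp (1 + 1 :: real)" by simp
  also have "\<dots> = exp 1 * exp 1" by (rule exp_add)
  also have "\<dots> \<le> 3 * 3" by (intro mult_mono exp_le) auto
  finally show ?thesis by simp
qed

text \<open>The initial layer: the data lie below a majorant \<open>m\<close> as in \<open>convolution_majorant\<close>, without decay in \<open>k\<close>.\<close>

locale cart_data =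
  fixes m :: "real \<Rightarrow> real" and u0 :: "bool \<Rightarrow> real \<Rightarrow> complex"
  assumes m_int: "integrable lborel m" and m_nonneg: "\<And>k. 0 \<le> m k" and m_bdd: "\<exists>B. \<forall>k. m k \<le> B"
    and m_conv: "\<And>k. (LINT l|lborel. m l * m (k - l)) \<le> eps * m k"
    and u0_meas: "\<And>b. u0 b \<in> borel_measurable borel" and u0_herm: "\<And>b. hermitian (u0 b)"
    and u0_bound: "\<And>b k. norm (u0 b k) \<le> m k"
begin

text \<open>The factor \<open>exp (- |k| t)\<close> records that the solution is analytic in a strip of width \<open>t\<close>.\<close>

definition mt :: "real \<Rightarrow> real \<Rightarrow> real" where "mt t k = m k * exp (- \<bar>k\<bar> * t)"

lemma mt_nonneg: "0 \<le> mt t k"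
  by (simp add: mt_def m_nonneg)

lemma mt_le: "0 \<le> t \<Longrightarrow> mt t k \<le> m k"
  using m_nonneg by (auto simp: mt_def mult_le_cancel_left1 intro!: mult_left_le)

lemma m_meas [measurable]: "m \<in> borel_measurable borel"
  using borel_measurable_integrable[OF m_int] by simp

text \<open>Since \<open>|k| \<le> |l| + |k - l|\<close>, the exponential is submultiplicative and the convolution property of
\<open>m\<close> is inherited.\<close>

lemma conv_weight_mt:
  assumes t: "0 \<le> t"
  shows "conv_weight (mt t) eps"
proof
  have meas [measurable]: "mt t \<in> borel_measurable borel" unfolding mt_def[abs_def] by measurable
  show "integrable lborel (mt t)"
    by (rule integrable_dominated[OF meas m_int]) (simp add: mt_nonneg mt_le[OF t])
  show "0 \<le> mt t k" for k by (rule mt_nonneg)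
  show "\<exists>B. \<forall>k. mt t k \<le> B" using m_bdd mt_le[OF t] order_trans by meson
  show "0 \<le> eps" by (simp add: eps_def)
  fix k
  obtain B where B: "\<And>k. m k \<le> B" using m_bdd by blast
  have il: "integrable lborel (\<lambda>l. m l * m (k - l))"
    by (rule integrable_dominated[where g = "\<lambda>l. m l * B"])
      (use m_int m_nonneg B in \<open>auto simp: abs_mult intro!: mult_left_mono\<close>)
  have ile: "mt t l * mt t (k - l) \<le> m l * m (k - l) * exp (- \<bar>k\<bar> * t)" for l
  proof -
    have "\<bar>k\<bar> * t \<le> (\<bar>l\<bar> + \<bar>k - l\<bar>) * t" using t by (intro mult_right_mono) auto
    then have "exp (- \<bar>l\<bar> * t) * exp (- \<bar>k - l\<bar> * t) \<le> exp (- \<bar>k\<bar> * t)"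
      unfolding exp_add[symmetric] by (simp add: algebra_simps)
    then have "(m l * m (k - l)) * (exp (- \<bar>l\<bar> * t) * exp (- \<bar>k - l\<bar> * t)) \<le> (m l * m (k - l)) * exp (- \<bar>k\<bar> * t)"
      using m_nonneg by (intro mult_left_mono) auto
    then show ?thesis by (simp add: mt_def mult_ac)
  qed
  have ir: "integrable lborel (\<lambda>l. m l * m (k - l) * exp (- \<bar>k\<bar> * t))" using il by simp
  have "(LINT l|lborel. mt t l * mt t (k - l)) \<le> (LINT l|lborel. m l * m (k - l) * exp (- \<bar>k\<bar> * t))"
    by (rule integral_mono[OF _ ir ile], rule integrable_dominated[OF _ ir])
      (use ile mt_nonneg in \<open>auto simp: abs_mult\<close>)
  also have "\<dots> = (LINT l|lborel. m l * m (k - l)) * exp (- \<bar>k\<bar> * t)" by simp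
  also have "\<dots> \<le> eps * m k * exp (- \<bar>k\<bar> * t)" by (intro mult_right_mono m_conv) simp
  finally show "(LINT l|lborel. mt t l * mt t (k - l)) \<le> eps * mt t k" by (simp add: mt_def)
qed

text \<open>The constant \<open>9\<close> bounds \<open>exp 2\<close>, the loss in \<open>nu_ge\<close> over a time interval of length \<open>2\<close>.\<close>

lemma exp_nu_mt: "0 \<le> s \<Longrightarrow> s \<le> t \<Longrightarrow> t \<le> 2 \<Longrightarrow> exp (- nu b k * (t - s)) * mt s k \<le> 9 * mt t k"
proof -
  assume s: "0 \<le> s" "s \<le> t" "t \<le> 2"
  have "(\<bar>k\<bar> - 1) * (t - s) \<le> nu b k * (t - s)" using s by (intro mult_right_mono nu_ge) auto
  then have "- nu b k * (t - s) + - \<bar>k\<bar> * s \<le> (t - s) + - \<bar>k\<bar> * t" by (simp add: algebra_simps)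
  then have "exp (- nu b k * (t - s)) * exp (- \<bar>k\<bar> * s) \<le> exp (t - s) * exp (- \<bar>k\<bar> * t)"
    unfolding exp_add[symmetric] by simp
  also have "\<dots> \<le> 9 * exp (- \<bar>k\<bar> * t)" using s by (intro mult_right_mono exp_le_9) auto
  finally have "m k * (exp (- nu b k * (t - s)) * exp (- \<bar>k\<bar> * s)) \<le> m k * (9 * exp (- \<bar>k\<bar> * t))"
    using m_nonneg by (intro mult_left_mono)
  then show ?thesis by (simp add: mt_def mult_ac)
qed

lemma admissible_dominated:
  assumes "admissible (\<lambda>b k. 20 * mt t k) u"
  shows "dominated (mt t) 20 (u b)" "0 \<le> t \<Longrightarrow> dominated (mt 0) 20 (u b)"
proof -
  show d: "dominated (mt t) 20 (u b)" using assms by (auto intro: dominatedI simp: admissible_def)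
  show "dominated (mt 0) 20 (u b)" if "0 \<le> t"
    by (rule dominated_mono[OF d]) (use mt_le[OF that] in \<open>simp add: mt_def[of 0]\<close>)
qed

lemma dominated_fields:
  assumes cw: "conv_weight M eps" and u: "\<And>b. dominated M 20 (u b)"
  shows "dominated M 40 (amp u)" "dominated M 40 (pha u)" "dominated M 1 (sqs (amp u) (pha u))"
proof -
  interpret conv_weight M eps by (rule cw)
  have m: "u b \<in> borel_measurable borel" for b using dominated_measurable[OF u] .
  have le: "norm (u True k) + norm (u False k) \<le> 40 * M k" for k
    using dominated_le[OF u, of True k] dominated_le[OF u, of False k] by simp
  show a: "dominated M 40 (amp u)"
    by (rule dominatedI[OF measurable_amp(1)[OF m]]) (rule order_trans[OF norm_amp_pha_le(1) le])
  show p: "dominated M 40 (pha u)"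
    by (rule dominatedI[OF measurable_amp(2)[OF m]]) (rule order_trans[OF norm_amp_pha_le(2) le])
  have "dominated M (40 * 40 * eps + 40 * 40 * eps) (sqs (amp u) (pha u))"
    unfolding sqs_def[abs_def] by (intro dominated_add dominated_conv a p) auto
  then show "dominated M 1 (sqs (amp u) (pha u))"
    by (rule dominated_scale_mono) (auto simp: eps_def M_nonneg)
qed

lemma carN_continuous:
  assumes u: "\<And>t. t \<in> {0..T} \<Longrightarrow> admissible (\<lambda>b k. 20 * mt t k) (u t)"
    and c: "\<And>b k. continuous_on {0..T} (\<lambda>t. u t b k)"
  shows "continuous_on {0..T} (\<lambda>t. carN (u t) b k)"
proof -
  interpret conv_weight "mt 0" eps by (rule conv_weight_mt) simp
  have f: "dominated (mt 0) 40 (amp (u t))" "dominated (mt 0) 40 (pha (u t))" "dominated (mt 0) 1 (sqs (amp (u t)) (pha (u t)))"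
    if "t \<in> {0..T}" for t
    using dominated_fields[OF conv_weight_axioms admissible_dominated(2)[OF u[OF that]]] that by auto
  note ca = amp_continuous[OF c]
  have e: "(0::real) \<le> 40" by simp
  have cc: "continuous_on {0..T} (\<lambda>t. conv (amp (u t)) (amp (u t)) k)"
    "continuous_on {0..T} (\<lambda>t. conv (pha (u t)) (pha (u t)) k)"
    "continuous_on {0..T} (\<lambda>t. conv (amp (u t)) (pha (u t)) k)" for k
    by (rule continuous_conv[OF f(1) f(1) ca(1) ca(1) e] continuous_conv[OF f(2) f(2) ca(2) ca(2) e]
        continuous_conv[OF f(1) f(2) ca(1) ca(2) e]; assumption)+
  have cs: "continuous_on {0..T} (\<lambda>t. sqs (amp (u t)) (pha (u t)) k)" for k
    unfolding sqs_def by (intro continuous_on_add cc)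
  have "continuous_on {0..T} (\<lambda>t. conv (amp (u t)) (sqs (amp (u t)) (pha (u t))) k)"
    "continuous_on {0..T} (\<lambda>t. conv (pha (u t)) (sqs (amp (u t)) (pha (u t))) k)"
    by (rule continuous_conv[OF f(1) f(3) ca(1) cs e] continuous_conv[OF f(2) f(3) ca(2) cs e]; assumption)+
  with cc show ?thesis
    unfolding carN_def by (intro modes_continuous) (auto simp: car_rho_def car_phi_def intro!: continuous_intros)
qed

text \<open>The linear evolution stays below \<open>9\<close> times the weight and the Duhamel integral over time at most \<open>2\<close> below
\<open>18\<close> times the weight; \<open>20\<close> leaves room for both conditions.\<close>

lemma cart_mild_problem: "mild_problem carN (\<lambda>t b k. 20 * mt t k) (\<lambda>t b k. mt t k) {0..2} u0"
proof
  fix t :: real and b k assume "t \<in> {0..2}"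
  then have t: "0 \<le> t" "t \<le> 2" by auto
  show "0 \<le> 20 * mt t k" by (simp add: mt_nonneg)
  have c: "continuous_on {0..t} (\<lambda>s. mt s k)" unfolding mt_def by (intro continuous_intros)
  show "set_integrable lborel {0..t} (\<lambda>s. exp (- nu b k * (t - s)) * mt s k)"
    by (rule duhamel_set_integrable[OF c])
  have "duh (\<lambda>s. mt s k) (nu b k) t \<le> duh (\<lambda>s. 9 * mt t k) 0 t"
    by (rule duh_mono[OF c]) (use exp_nu_mt[of _ t b k] t in auto)
  also have "\<dots> \<le> 9 * mt t k * t"
    unfolding duh_def
    by (rule duhamel_le_supersolution[where Y = "\<lambda>s. 9 * mt t k * s" and Y' = "\<lambda>s. 9 * mt t k"])
      (use t in \<open>auto intro!: derivative_eq_intros\<close>)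
  also have "\<dots> \<le> 9 * mt t k * 2" using t mt_nonneg by (intro mult_left_mono) auto
  also have "\<dots> \<le> 20 * mt t k" using mt_nonneg[of t k] by simp
  finally show "(LINT s:{0..t}|lborel. exp (- nu b k * (t - s)) * mt s k) \<le> 20 * mt t k" by (simp add: duh_def)
  have "exp (- nu b k * t) * norm (u0 b k) \<le> exp (- nu b k * t) * m k" by (intro mult_left_mono u0_bound) simp
  also have "\<dots> \<le> 9 * mt t k" using exp_nu_mt[of 0 t b k] t by (simp add: mt_def[of 0])
  finally show "exp (- nu b k * t) * norm (u0 b k) \<le> 20 * mt t k / 2" using mt_nonneg[of t k] by simp
next
  fix t :: real and u v :: "bool \<Rightarrow> real \<Rightarrow> complex" and D b k
  assume "t \<in> {0..2}" and u: "admissible (\<lambda>b k. 20 * mt t k) u" and v: "admissible (\<lambda>b k. 20 * mt t k) v"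
    and D: "0 \<le> D" and d: "\<And>b k. norm (u b k - v b k) \<le> D * (20 * mt t k)"
  then have t: "0 \<le> t" by simp
  have "dominated (mt t) (20 * D) (\<lambda>k. u b k - v b k)" for b
    by (rule dominatedI) (use d admissibleD(1)[OF u] admissibleD(1)[OF v] in \<open>auto simp: mult_ac\<close>)
  then show "norm (carN u b k - carN v b k) \<le> D / 2 * mt t k"
    by (rule carN_difference[OF conv_weight_mt[OF t] D admissible_dominated(1)[OF u] admissible_dominated(1)[OF v]])
next
  show "hermitian (carN u b)" if "admissible (\<lambda>b k. 20 * mt t k) u" for t u b
    by (rule hermitian_carN) (rule admissibleD(2)[OF that])
qed (auto intro: u0_meas u0_herm carN_zero measurable_carN_param carN_continuous)

lemma cart_solution_exists:
  "\<exists>u. mild_solution carN (\<lambda>t b k. 20 * mt t k) (\<lambda>t b k. mt t k) {0..2} u0 u"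
proof -
  interpret mild_problem carN "\<lambda>t b k. 20 * mt t k" "\<lambda>t b k. mt t k" "{0..2}" u0
    by (rule cart_mild_problem)
  obtain u where u: "family u" "\<And>t b k. u t b k = picard u t b k" using mild_solution_exists by blast
  have "mild_solution carN (\<lambda>t b k. 20 * mt t k) (\<lambda>t b k. mt t k) {0..2} u0 u"
  proof
    show "family u" "u t b k = picard u t b k" for t b k by (rule u)+
    fix t1 T :: real assume t1: "0 < t1"
    define c where "c = 1 + 2 / t1\<^sup>2"
    have c: "1 \<le> c" by (simp add: c_def)
    have le: "(1 + k\<^sup>2) * mt t k \<le> c * m k" if "t1 \<le> t" for t k
    proof -
      define x where "x = \<bar>k\<bar> * t1"
      have x: "0 \<le> x" "x\<^sup>2 = k\<^sup>2 * t1\<^sup>2" using t1 by (simp_all add: x_def power_mult_distrib)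
      have "1 + k\<^sup>2 \<le> c * (1 + x\<^sup>2 / 2)"
      proof -
        have "c * (1 + x\<^sup>2 / 2) = 1 + 2 / t1\<^sup>2 + k\<^sup>2 * t1\<^sup>2 / 2 + k\<^sup>2"
          using t1 by (simp add: c_def x(2) field_simps)
        then show ?thesis using t1 by simp
      qed
      also have "\<dots> \<le> c * exp x"
        using exp_lower_Taylor_quadratic[OF x(1)] x(1) c by (intro mult_left_mono) auto
      finally have "(1 + k\<^sup>2) * exp (- x) \<le> c * exp x * exp (- x)" by (intro mult_right_mono) auto
      also have "\<dots> = c" by (simp add: exp_minus)
      finally have 1: "(1 + k\<^sup>2) * exp (- x) \<le> c" .
      have "exp (- \<bar>k\<bar> * t) \<le> exp (- x)" using that by (simp add: x_def mult_left_mono)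
      then have "(1 + k\<^sup>2) * exp (- \<bar>k\<bar> * t) \<le> (1 + k\<^sup>2) * exp (- x)"
        by (intro mult_left_mono) (auto simp: add_nonneg_nonneg)
      then have "m k * ((1 + k\<^sup>2) * exp (- \<bar>k\<bar> * t)) \<le> m k * c" using 1 m_nonneg by (intro mult_left_mono) auto
      then show ?thesis by (simp add: mt_def mult_ac)
    qed
    show "\<exists>g. integrable lborel g \<and> (\<forall>t\<in>{t1..T}. \<forall>b k. (1 + k\<^sup>2) * (20 * mt t k) \<le> g k \<and> mt t k \<le> g k)"
    proof (intro exI[of _ "\<lambda>k. 20 * (c * m k)"] conjI ballI allI)
      show "integrable lborel (\<lambda>k. 20 * (c * m k))" using m_int by simp
      fix t k assume t: "t \<in> {t1..T}"
      show "(1 + k\<^sup>2) * (20 * mt t k) \<le> 20 * (c * m k)" using le[of t k] t by simp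
      have "1 * mt t k \<le> (1 + k\<^sup>2) * mt t k" by (intro mult_right_mono mt_nonneg) simp
      then show "mt t k \<le> 20 * (c * m k)" using le[of t k] t c mt_nonneg[of t k] by simp
    qed
  qed
  then show ?thesis by blast
qed

lemma cartesian_pde_algebra:
  fixes q r R Rx Rxx P Px Pxx :: complex
  assumes q: "q\<^sup>2 = 1/3" and r: "r\<^sup>2 = 2/3"
  shows "- (q\<^sup>2) * (r + (R + \<i> * P)) + 2 * \<i> * q * (Rx + \<i> * Px) + (Rxx + \<i> * Pxx)
      + (r + (R + \<i> * P)) - (r + (R + \<i> * P)) * ((r + R) * (r + R) + P * P)
    = (Rxx - 4/3 * R - 2 * q * Px + (- (r * (3 * (R * R) + P * P)) - R * (R * R + P * P)))
      + \<i> * (Pxx + 2 * q * Rx + (- (r * (2 * (R * P))) - P * (R * R + P * P)))"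
proof -
  have e: "(r + (R + \<i> * P)) * ((r + R) * (r + R) + P * P)
    = r\<^sup>2 * (r + (R + \<i> * P)) + 2 * r\<^sup>2 * R + r * (3 * (R * R) + P * P) + R * (R * R + P * P)
      + \<i> * (r * (2 * (R * P)) + P * (R * R + P * P))"
    by (simp add: power2_eq_square algebra_simps)
  have i: "2 * \<i> * q * (Rx + \<i> * Px) = 2 * \<i> * q * Rx - 2 * q * Px"
    by (simp add: algebra_simps)
  show ?thesis unfolding e i q r by (simp add: field_simps)
qed

text \<open>The last three conclusions prepare the passage to polar coordinates at time one, when the
exponential factor in the weight has become \<open>exp (- |k|)\<close>. The constant \<open>100\<close> bounds \<open>80\<close> divided by the modulus of
the wave train.\<close>

lemma cart_gl:
  obtains Vh A f where
    "\<And>t. t \<in> {0..2} \<Longrightarrow> Vh t \<in> borel_measurable borel"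
    "\<And>t k. t \<in> {0..2} \<Longrightarrow> norm (Vh t k) \<le> 80 * m (k - qE)"
    "\<And>t x. t \<in> {0..2} \<Longrightarrow> A t x = wave_train qE x + inverse_fourier (Vh t) x"
    "gl_on 0 2 A"
    "\<And>x. A 0 x = wave_train qE x + exp (\<i> * of_real (qE * x)) * (inverse_fourier (amp u0) x + \<i> * inverse_fourier (pha u0) x)"
    "f \<in> borel_measurable borel" "\<And>k. norm (f k) \<le> 100 * (m k * exp (- \<bar>k\<bar>))"
    "\<And>x. A 1 x = wave_train qE x * (1 + inverse_fourier f x)"
proof -
  obtain u where "mild_solution carN (\<lambda>t b k. 20 * mt t k) (\<lambda>t b k. mt t k) {0..2} u0 u"
    using cart_solution_exists by blast
  then interpret mild_solution carN "\<lambda>t b k. 20 * mt t k" "\<lambda>t b k. mt t k" "{0..2}" u0 u .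
  have two: "(2::real) \<in> {0..2}" by simp
  have du: "dominated (mt t) 20 (u t b)" if "t \<in> {0..2}" for t b
    by (rule admissible_dominated(1)[OF admissible_u[OF that]])
  have df: "dominated (mt t) 40 (amp (u t))" "dominated (mt t) 40 (pha (u t))" "dominated (mt t) 1 (sqs (amp (u t)) (pha (u t)))"
    if "t \<in> {0..2}" for t
    using dominated_fields[OF conv_weight_mt du[OF that]] that by auto
  define E where "E x = exp (\<i> * of_real (qE * x))" for x
  define vh where "vh t k = amp (u t) k + \<i> * pha (u t) k" for t k
  define v where "v t x = inverse_fourier (amp (u t)) x + \<i> * inverse_fourier (pha (u t)) x" for t x
  define Vh where "Vh t k = vh t (k - qE)" for t k
  define A where "A t x = E x * (of_real rE + v t x)" for t x
  have dv: "dominated (mt t) 80 (vh t)" if t: "t \<in> {0..2}" for t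
  proof -
    have "dominated (mt t) (40 + norm \<i> * 40) (\<lambda>k. amp (u t) k + \<i> * pha (u t) k)"
      by (intro dominated_add dominated_cmult df t)
    then show ?thesis by (simp add: vh_def[abs_def])
  qed
  have mV: "Vh t \<in> borel_measurable borel" if "t \<in> {0..2}" for t
    unfolding Vh_def[abs_def] using dominated_measurable[OF dv[OF that]] by measurable
  have bV: "norm (Vh t k) \<le> 80 * m (k - qE)" if "t \<in> {0..2}" for t k
    using dominated_le[OF dv[OF that], of "k - qE"] mt_le[of t "k - qE"] that by (simp add: Vh_def)
  have iAP: "integrable lborel (amp (u t))" "integrable lborel (pha (u t))" if t: "t \<in> {0..2}" for t
    using conv_weight.dominated_integrable[OF conv_weight_mt] df(1,2)[OF t] t by auto
  have vF: "inverse_fourier (vh t) x = v t x" if t: "t \<in> {0..2}" for t x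
    unfolding vh_def[abs_def] v_def
    by (subst inverse_fourier_add[OF iAP(1)[OF t] integrable_mult_right[OF iAP(2)[OF t]]]) (simp add: inverse_fourier_cmult)
  have AV: "A t x = wave_train qE x + inverse_fourier (Vh t) x" if t: "t \<in> {0..2}" for t x
    unfolding Vh_def[abs_def] inverse_fourier_shift vF[OF t] wave_train_qE A_def E_def by (simp add: algebra_simps)
  have gl: "gl_on 0 2 A"
  proof (rule gl_onI_fourier[where q = qE and Vh = Vh and g = "\<lambda>k. 80 * m (k - qE)"])
    show "A t x = wave_train qE x + inverse_fourier (Vh t) x" if "t \<in> {0..2}" for t x by (rule AV[OF that])
    show "Vh t \<in> borel_measurable borel" if "t \<in> {0..2}" for t by (rule mV[OF that])
    show "norm (Vh t k) \<le> 80 * m (k - qE)" if "t \<in> {0..2}" for t k by (rule bV[OF that])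
    show "integrable lborel (\<lambda>k. 80 * m (k - qE))"
      using lborel_integrable_real_affine[OF m_int, of 1 "- qE"] by simp
    show "continuous_on {0..2} (\<lambda>t. Vh t k)" for k
      unfolding Vh_def vh_def by (intro continuous_on_add continuous_on_mult_left fields_continuous[OF two])
  next
    fix t x :: real assume t: "t \<in> {0<..<2}"
    then have tI: "t \<in> {0..2}" and t0: "0 \<le> t" by auto
    note fa = field_space_derivatives[OF two t, of "amp (u t)", simplified]
      and fp = field_space_derivatives[OF two t, of "pha (u t)", simplified]
    define R where "R x = inverse_fourier (amp (u t)) x" for x
    define P where "P x = inverse_fourier (pha (u t)) x" for x
    define Rx where "Rx x = inverse_fourier (dk (amp (u t))) x" for x
    define Px where "Px x = inverse_fourier (dk (pha (u t))) x" for x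
    define Rxx where "Rxx x = inverse_fourier (dk (dk (amp (u t)))) x" for x
    define Pxx where "Pxx x = inverse_fourier (dk (dk (pha (u t)))) x" for x
    have dR: "(R has_vector_derivative Rx x) (at x)" "(Rx has_vector_derivative Rxx x) (at x)"
      "(P has_vector_derivative Px x) (at x)" "(Px has_vector_derivative Pxx x) (at x)" for x
      using fa(1,2)[of x] fp(1,2)[of x]
      by (simp_all add: R_def[abs_def] P_def[abs_def] Rx_def[abs_def] Px_def[abs_def] Rxx_def Pxx_def dk_def[abs_def] mult.assoc)
    have At: "A t = (\<lambda>x. E x * (of_real rE + (R x + \<i> * P x)))" by (simp add: A_def v_def R_def P_def fun_eq_iff)
    have dE: "(E has_vector_derivative \<i> * of_real qE * E x) (at x)" for x
      unfolding E_def[abs_def] by (rule phase_has_vector_derivative)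
    have dA: "((\<lambda>x. E x * g x) has_vector_derivative E x * (\<i> * of_real qE * g x + d)) (at x)"
      if "(g has_vector_derivative d) (at x)" for g d x
      by (rule has_vector_derivative_eq_rhs[OF has_vector_derivative_mult[OF dE that]]) (simp add: algebra_simps)
    have dr: "((\<lambda>x. of_real rE + (R x + \<i> * P x)) has_vector_derivative (0 + (Rx x + \<i> * Px x))) (at x)" for x
      by (intro has_vector_derivative_add has_vector_derivative_mult_right has_vector_derivative_const dR)
    have dr2: "((\<lambda>x. \<i> * of_real qE * (of_real rE + (R x + \<i> * P x)) + (0 + (Rx x + \<i> * Px x))) has_vector_derivative
        (\<i> * of_real qE * (0 + (Rx x + \<i> * Px x)) + (0 + (Rxx x + \<i> * Pxx x)))) (at x)" for x
      by (intro has_vector_derivative_add has_vector_derivative_mult_right has_vector_derivative_const dr dR)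
    show "((\<lambda>x. A t x) has_vector_derivative
      E x * (\<i> * of_real qE * (of_real rE + (inverse_fourier (amp (u t)) x + \<i> * inverse_fourier (pha (u t)) x))
        + (0 + (inverse_fourier (dk (amp (u t))) x + \<i> * inverse_fourier (dk (pha (u t))) x)))) (at x)"
      unfolding At using dA[OF dr] by (simp add: R_def P_def Rx_def Px_def)
    show "((\<lambda>x. E x * (\<i> * of_real qE * (of_real rE + (inverse_fourier (amp (u t)) x + \<i> * inverse_fourier (pha (u t)) x))
        + (0 + (inverse_fourier (dk (amp (u t))) x + \<i> * inverse_fourier (dk (pha (u t))) x)))) has_vector_derivative
      E x * (\<i> * of_real qE * (\<i> * of_real qE * (of_real rE + (inverse_fourier (amp (u t)) x + \<i> * inverse_fourier (pha (u t)) x))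
        + (0 + (inverse_fourier (dk (amp (u t))) x + \<i> * inverse_fourier (dk (pha (u t))) x)))
       + (\<i> * of_real qE * (0 + (inverse_fourier (dk (amp (u t))) x + \<i> * inverse_fourier (dk (pha (u t))) x))
        + (0 + (inverse_fourier (dk (dk (amp (u t)))) x + \<i> * inverse_fourier (dk (dk (pha (u t)))) x))))) (at x)"
      using dA[OF dr2] unfolding R_def P_def Rx_def Px_def Rxx_def Pxx_def .
    have ImR: "Im (R x) = 0" and ImP: "Im (P x) = 0"
      unfolding R_def P_def by (intro inverse_fourier_hermitian fields_hermitian tI)+
    have nA: "of_real ((norm (A t x))\<^sup>2) = (of_real rE + R x) * (of_real rE + R x) + P x * P x"
    proof -
      have "norm (E x) = 1" unfolding E_def by (rule norm_fourier_kernel)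
      then have "norm (A t x) = norm (of_real rE + (R x + \<i> * P x))" by (simp add: At norm_mult)
      moreover have "of_real rE + (R x + \<i> * P x) = Complex (rE + Re (R x)) (Re (P x))"
        using ImR ImP by (simp add: complex_eq_iff)
      ultimately have "(norm (A t x))\<^sup>2 = (rE + Re (R x))\<^sup>2 + (Re (P x))\<^sup>2" by (simp add: cmod_power2)
      then have "of_real ((norm (A t x))\<^sup>2) = (of_real rE + of_real (Re (R x))) * (of_real rE + of_real (Re (R x)))
          + of_real (Re (P x)) * (of_real (Re (P x)) :: complex)"
        by (simp only: power2_eq_square of_real_add of_real_mult)
      then show ?thesis by (simp only: complex_of_real_Re[OF ImR] complex_of_real_Re[OF ImP])
    qed
    interpret cwt: conv_weight "mt t" eps by (rule conv_weight_mt[OF t0])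
    note i = iAP[OF tI]
    have p40: "(0::real) \<le> 40" "(0::real) \<le> 1" by auto
    note dft = df[OF tI]
    have ic: "integrable lborel (conv (amp (u t)) (amp (u t)))" "integrable lborel (conv (pha (u t)) (pha (u t)))"
      "integrable lborel (conv (amp (u t)) (pha (u t)))" "integrable lborel (sqs (amp (u t)) (pha (u t)))"
      "integrable lborel (conv (amp (u t)) (sqs (amp (u t)) (pha (u t))))" "integrable lborel (conv (pha (u t)) (sqs (amp (u t)) (pha (u t))))"
      by (rule cwt.dominated_integrable[OF cwt.dominated_conv[OF dft(1) dft(1) p40(1,1)]],
          rule cwt.dominated_integrable[OF cwt.dominated_conv[OF dft(2) dft(2) p40(1,1)]],
          rule cwt.dominated_integrable[OF cwt.dominated_conv[OF dft(1) dft(2) p40(1,1)]],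
          rule cwt.dominated_integrable[OF dft(3)],
          rule cwt.dominated_integrable[OF cwt.dominated_conv[OF dft(1) dft(3) p40(1,2)]],
          rule cwt.dominated_integrable[OF cwt.dominated_conv[OF dft(2) dft(3) p40(1,2)]])
    have S: "inverse_fourier (sqs (amp (u t)) (pha (u t))) x = R x * R x + P x * P x"
      unfolding sqs_def[abs_def] inverse_fourier_add[OF ic(1,2)] inverse_fourier_conv[OF i(1) i(1)] inverse_fourier_conv[OF i(2) i(2)]
      by (simp add: R_def P_def)
    have NR: "inverse_fourier (amp (carN (u t))) x = - (of_real rE * (3 * (R x * R x) + P x * P x)) - R x * (R x * R x + P x * P x)"
    proof -
      have "inverse_fourier (car_rho (amp (u t)) (pha (u t))) x
        = inverse_fourier (\<lambda>k. (- of_real rE) * (3 * conv (amp (u t)) (amp (u t)) k + conv (pha (u t)) (pha (u t)) k)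
            - conv (amp (u t)) (sqs (amp (u t)) (pha (u t))) k) x"
        by (simp add: car_rho_def[abs_def])
      also have "\<dots> = (- of_real rE) * (3 * (R x * R x) + P x * P x) - R x * (R x * R x + P x * P x)"
        by (simp only: inverse_fourier_diff inverse_fourier_add inverse_fourier_cmult Bochner_Integration.integrable_add
            integrable_mult_right ic inverse_fourier_conv i S R_def[symmetric] P_def[symmetric])
      finally show ?thesis unfolding carN_def amp_modes by simp
    qed
    have NP: "inverse_fourier (pha (carN (u t))) x = - (of_real rE * (2 * (R x * P x))) - P x * (R x * R x + P x * P x)"
    proof -
      have "inverse_fourier (car_phi (amp (u t)) (pha (u t))) x
        = inverse_fourier (\<lambda>k. (- of_real rE) * (2 * conv (amp (u t)) (pha (u t)) k)
            - conv (pha (u t)) (sqs (amp (u t)) (pha (u t))) k) x"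
        by (simp add: car_phi_def[abs_def])
      also have "\<dots> = (- of_real rE) * (2 * (R x * P x)) - P x * (R x * R x + P x * P x)"
        by (simp only: inverse_fourier_diff inverse_fourier_cmult
            integrable_mult_right ic inverse_fourier_conv i S R_def[symmetric] P_def[symmetric])
      finally show ?thesis unfolding carN_def pha_modes by simp
    qed
    note td = fields_time_derivative[OF two t, of x]
    have hv: "((\<lambda>t. v t x) has_vector_derivative
       (Rxx x - of_real (4/3) * R x - 2 * of_real qE * Px x + (- (of_real rE * (3 * (R x * R x) + P x * P x)) - R x * (R x * R x + P x * P x)))
       + \<i> * (Pxx x + 2 * of_real qE * Rx x + (- (of_real rE * (2 * (R x * P x))) - P x * (R x * R x + P x * P x)))) (at t)"
      unfolding v_def
      using has_vector_derivative_add[OF td(1) has_vector_derivative_mult_right[OF td(2), of \<i>]]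
      unfolding NR NP R_def[symmetric] P_def[symmetric] qE_def[symmetric] dk_def[symmetric] Rx_def[symmetric] Px_def[symmetric]
        Rxx_def[symmetric] Pxx_def[symmetric] .
    have q2: "(of_real qE :: complex)\<^sup>2 = 1/3" unfolding of_real_power[symmetric] qE_sq by simp
    have r2: "(of_real rE :: complex)\<^sup>2 = 2/3" unfolding of_real_power[symmetric] rE_sq by simp
    have o43: "of_real (4/3) = (4/3 :: complex)" by simp
    define rhs where "rhs = - ((of_real qE)\<^sup>2) * (of_real rE + (R x + \<i> * P x)) + 2 * \<i> * of_real qE * (Rx x + \<i> * Px x) + (Rxx x + \<i> * Pxx x)
      + (of_real rE + (R x + \<i> * P x)) - (of_real rE + (R x + \<i> * P x)) * ((of_real rE + R x) * (of_real rE + R x) + P x * P x)"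
    have hv': "((\<lambda>t. v t x) has_vector_derivative rhs) (at t)"
      unfolding rhs_def cartesian_pde_algebra[OF q2 r2] by (rule hv[unfolded o43])
    have "((\<lambda>t. A t x) has_vector_derivative E x * (0 + rhs)) (at t)"
      unfolding A_def by (intro has_vector_derivative_mult_right has_vector_derivative_add has_vector_derivative_const hv')
    moreover have "E x * (0 + rhs) =
      E x * (\<i> * of_real qE * (\<i> * of_real qE * (of_real rE + (R x + \<i> * P x)) + (0 + (Rx x + \<i> * Px x)))
       + (\<i> * of_real qE * (0 + (Rx x + \<i> * Px x)) + (0 + (Rxx x + \<i> * Pxx x)))) + A t x - A t x * of_real ((norm (A t x))\<^sup>2)"
      unfolding nA unfolding At rhs_def by (simp add: power2_eq_square algebra_simps)
    ultimately show "((\<lambda>t. A t x) has_vector_derivative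
      E x * (\<i> * of_real qE * (\<i> * of_real qE * (of_real rE + (inverse_fourier (amp (u t)) x + \<i> * inverse_fourier (pha (u t)) x))
        + (0 + (inverse_fourier (dk (amp (u t))) x + \<i> * inverse_fourier (dk (pha (u t))) x)))
       + (\<i> * of_real qE * (0 + (inverse_fourier (dk (amp (u t))) x + \<i> * inverse_fourier (dk (pha (u t))) x))
        + (0 + (inverse_fourier (dk (dk (amp (u t)))) x + \<i> * inverse_fourier (dk (dk (pha (u t)))) x))))
       + A t x - A t x * of_real ((norm (A t x))\<^sup>2)) (at t)"
      unfolding R_def P_def Rx_def Px_def Rxx_def Pxx_def by simp
  qed
  have "u 0 = u0" using u_initial by (intro ext) simp
  then have A0: "A 0 x = wave_train qE x + exp (\<i> * of_real (qE * x)) * (inverse_fourier (amp u0) x + \<i> * inverse_fourier (pha u0) x)" for x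
    by (simp add: A_def v_def E_def wave_train_qE algebra_simps)
  have one: "(1::real) \<in> {0..2}" by simp
  define f where "f k = of_real (1 / rE) * vh 1 k" for k
  have fm: "f \<in> borel_measurable borel"
    unfolding f_def[abs_def] using dominated_measurable[OF dv[OF one]] by measurable
  have fb: "norm (f k) \<le> 100 * (m k * exp (- \<bar>k\<bar>))" for k
  proof -
    have "4/5 \<le> rE" unfolding rE_def by (rule real_le_rsqrt) (simp add: power_divide)
    then have "1 / rE \<le> 5/4" using rE_pos by (simp add: field_simps)
    then have "1 / rE * norm (vh 1 k) \<le> 5/4 * (80 * mt 1 k)"
      using dominated_le[OF dv[OF one], of k] rE_pos by (intro mult_mono) auto
    then show ?thesis using rE_pos by (simp add: f_def norm_mult norm_divide mt_def)
  qed
  have "A 1 x = wave_train qE x * (1 + inverse_fourier f x)" for x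
    using rE_pos unfolding f_def[abs_def] inverse_fourier_cmult vF[OF one]
    by (simp add: A_def E_def wave_train_qE field_simps)
  with mV bV AV gl A0 fm fb show ?thesis by (rule that)
qed

end

section \<open>Solutions on time intervals\<close>

lemma gl_onI:
  assumes "\<And>T. T \<in> {a..b} \<Longrightarrow> bounded (range (A T)) \<and> uniformly_continuous_on UNIV (A T)"
    and lim: "\<And>T e. T \<in> {a..b} \<Longrightarrow> e > 0 \<Longrightarrow> \<exists>d>0. \<forall>t\<in>{a..b}. dist t T < d \<longrightarrow> (\<forall>x. dist (A t x) (A T x) < e)"
    and "\<And>T X. T \<in> {a<..<b} \<Longrightarrow> ((\<lambda>x. A T x) has_vector_derivative AX T X) (at X) \<and>
        ((\<lambda>x. AX T x) has_vector_derivative AXX T X) (at X) \<and>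
        ((\<lambda>t. A t X) has_vector_derivative (AXX T X + A T X - A T X * of_real ((norm (A T X))\<^sup>2))) (at T)"
  shows "gl_on a b A"
proof -
  have "uniform_limit UNIV A (A T) (at T within {a..b})" if "T \<in> {a..b}" for T
    unfolding uniform_limit_iff eventually_at using lim[OF that] by (metis UNIV_I)
  then show ?thesis unfolding gl_on_def using assms(1,3) by blast
qed

lemma gl_on_subset:
  assumes A: "gl_on a b A" and sub: "a \<le> a'" "b' \<le> b"
  shows "gl_on a' b' A"
proof -
  obtain AX AXX where pde: "\<And>T X. T \<in> {a<..<b} \<Longrightarrow> ((\<lambda>x. A T x) has_vector_derivative AX T X) (at X) \<and>
        ((\<lambda>x. AX T x) has_vector_derivative AXX T X) (at X) \<and>
        ((\<lambda>t. A t X) has_vector_derivative (AXX T X + A T X - A T X * of_real ((norm (A T X))\<^sup>2))) (at T)"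
    using A unfolding gl_on_def by blast
  show ?thesis
  proof (rule gl_onI[where AX = AX and AXX = AXX])
    fix T e assume T: "T \<in> {a'..b'}"
    then have T': "T \<in> {a..b}" using sub by auto
    show "bounded (range (A T)) \<and> uniformly_continuous_on UNIV (A T)" using A T' by (simp add: gl_on_def)
    assume "(0::real) < e"
    from gl_on_time_continuous[OF A T' this]
    show "\<exists>d>0. \<forall>t\<in>{a'..b'}. dist t T < d \<longrightarrow> (\<forall>x. dist (A t x) (A T x) < e)"
      using sub by (meson atLeastAtMost_iff order_trans)
  qed (use pde sub in auto)
qed

lemma gl_on_shift:
  assumes A: "gl_on a b A"
  shows "gl_on (a + c) (b + c) (\<lambda>T. A (T - c))"
proof -
  obtain AX AXX where pde: "\<And>T X. T \<in> {a<..<b} \<Longrightarrow> ((\<lambda>x. A T x) has_vector_derivative AX T X) (at X)"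
        "\<And>T X. T \<in> {a<..<b} \<Longrightarrow> ((\<lambda>x. AX T x) has_vector_derivative AXX T X) (at X)"
        "\<And>T X. T \<in> {a<..<b} \<Longrightarrow> ((\<lambda>t. A t X) has_vector_derivative (AXX T X + A T X - A T X * of_real ((norm (A T X))\<^sup>2))) (at T)"
    using A unfolding gl_on_def by metis
  show ?thesis
  proof (rule gl_onI[where AX = "\<lambda>T. AX (T - c)" and AXX = "\<lambda>T. AXX (T - c)"])
    fix T e assume T: "T \<in> {a + c..b + c}"
    then have T': "T - c \<in> {a..b}" by auto
    show "bounded (range (A (T - c))) \<and> uniformly_continuous_on UNIV (A (T - c))" using A T' by (simp add: gl_on_def)
    assume "(0::real) < e"
    from gl_on_time_continuous[OF A T' this] obtain d where d: "d > 0"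
      "\<And>t x. t \<in> {a..b} \<Longrightarrow> dist t (T - c) < d \<Longrightarrow> dist (A t x) (A (T - c) x) < e" by blast
    have "dist (A (t - c) x) (A (T - c) x) < e" if "t \<in> {a + c..b + c}" "dist t T < d" for t x
      by (rule d(2)) (use that in \<open>auto simp: dist_real_def\<close>)
    then show "\<exists>d>0. \<forall>t\<in>{a + c..b + c}. dist t T < d \<longrightarrow> (\<forall>x. dist (A (t - c) x) (A (T - c) x) < e)"
      using d(1) by blast
  next
    fix T X assume "T \<in> {a + c<..<b + c}"
    then have T': "T - c \<in> {a<..<b}" by auto
    have s: "((\<lambda>t. t - c) has_vector_derivative 1) (at T)"
      by (auto intro!: derivative_eq_intros simp: has_real_derivative_iff_has_vector_derivative[symmetric])
    have "((\<lambda>t. A (t - c) X) has_vector_derivative 1 *\<^sub>R (AXX (T - c) X + A (T - c) X - A (T - c) X * of_real ((norm (A (T - c) X))\<^sup>2))) (at T)"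
      using vector_diff_chain_at[OF s pde(3)[OF T', of X]] by (simp add: o_def)
    then show "((\<lambda>x. A (T - c) x) has_vector_derivative AX (T - c) X) (at X) \<and>
        ((\<lambda>x. AX (T - c) x) has_vector_derivative AXX (T - c) X) (at X) \<and>
        ((\<lambda>t. A (t - c) X) has_vector_derivative (AXX (T - c) X + A (T - c) X - A (T - c) X * of_real ((norm (A (T - c) X))\<^sup>2))) (at T)"
      using pde(1,2)[OF T'] by simp
  qed
qed

lemma gl_on_of_solution:
  assumes A: "ginzburg_landau_solution A"
  shows "gl_on 0 b A"
proof -
  have "uniform_limit UNIV A (A T) (at T within {0..b})" if "T \<in> {0..b}" for T
  proof (rule filterlim_mono[OF _ order_refl])
    show "uniform_limit UNIV A (A T) (at T within {0..})" using A that by (simp add: ginzburg_landau_solution_def)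
    show "at T within {0..b} \<le> at T within {0..}" by (rule at_le) auto
  qed
  moreover have "\<forall>T\<in>{0..b}. bounded (range (A T)) \<and> uniformly_continuous_on UNIV (A T)"
    using A by (simp add: ginzburg_landau_solution_def)
  moreover obtain AX AXX where "\<forall>T>0. \<forall>X.
        ((\<lambda>x. A T x) has_vector_derivative AX T X) (at X) \<and>
        ((\<lambda>x. AX T x) has_vector_derivative AXX T X) (at X) \<and>
        ((\<lambda>t. A t X) has_vector_derivative
           (AXX T X + A T X - A T X * of_real ((norm (A T X))\<^sup>2))) (at T)"
    using A unfolding ginzburg_landau_solution_def by blast
  ultimately show ?thesis unfolding gl_on_def by (metis greaterThanLessThan_iff)
qed

text \<open>Being a solution is a local property in time: near each \<open>T\<close> it is enough to agree with some solution on an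
interval, which contains \<open>T\<close> in its interior unless \<open>T = 0\<close>.\<close>

lemma ginzburg_landau_solutionI_local:
  assumes loc: "\<And>T. 0 \<le> T \<Longrightarrow> \<exists>a b B d. gl_on a b B \<and> 0 < d \<and> (\<forall>t\<ge>0. dist t T < d \<longrightarrow> t \<in> {a..b} \<and> A t = B t) \<and> (0 < T \<longrightarrow> T \<in> {a<..<b})"
  shows "ginzburg_landau_solution A"
proof -
  have 1: "bounded (range (A T)) \<and> uniformly_continuous_on UNIV (A T) \<and> uniform_limit UNIV A (A T) (at T within {0..})"
    if T: "0 \<le> T" for T
  proof -
    obtain a b B d where B: "gl_on a b B" "0 < d" "\<And>t. 0 \<le> t \<Longrightarrow> dist t T < d \<Longrightarrow> t \<in> {a..b} \<and> A t = B t"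
      using loc[OF T] by blast
    have TT: "T \<in> {a..b}" "A T = B T" using B(3)[OF T] B(2) by auto
    have "uniform_limit UNIV A (A T) (at T within {0..})"
      unfolding uniform_limit_iff
    proof (intro allI impI)
      fix e :: real assume "e > 0"
      from gl_on_time_continuous[OF B(1) TT(1) this] obtain d' where d': "d' > 0"
        "\<And>t x. t \<in> {a..b} \<Longrightarrow> dist t T < d' \<Longrightarrow> dist (B t x) (B T x) < e" by blast
      have "\<forall>x\<in>UNIV. dist (A t x) (A T x) < e" if "t \<in> {0..}" "dist t T < min d d'" for t
        using B(3)[of t] d'(2)[of t] that TT(2) by auto
      then show "\<forall>\<^sub>F t in at T within {0..}. \<forall>x\<in>UNIV. dist (A t x) (A T x) < e"
        unfolding eventually_at using B(2) d'(1) by (intro exI[of _ "min d d'"]) auto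
    qed
    then show ?thesis using B(1) TT by (simp add: gl_on_def)
  qed
  have 2: "\<exists>AX AXX. \<forall>X. ((\<lambda>x. A T x) has_vector_derivative AX X) (at X) \<and>
        ((\<lambda>x. AX x) has_vector_derivative AXX X) (at X) \<and>
        ((\<lambda>t. A t X) has_vector_derivative (AXX X + A T X - A T X * of_real ((norm (A T X))\<^sup>2))) (at T)"
    if T: "0 < T" for T
  proof -
    obtain a b B d where B: "gl_on a b B" "0 < d" "\<And>t. 0 \<le> t \<Longrightarrow> dist t T < d \<Longrightarrow> t \<in> {a..b} \<and> A t = B t" "T \<in> {a<..<b}"
      using loc[of T] T by (metis less_imp_le)
    have TT: "A T = B T" using B(3)[of T] B(2) T by simp
    obtain AX AXX where pde: "\<And>X. ((\<lambda>x. B T x) has_vector_derivative AX T X) (at X)"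
        "\<And>X. ((\<lambda>x. AX T x) has_vector_derivative AXX T X) (at X)"
        "\<And>X. ((\<lambda>t. B t X) has_vector_derivative (AXX T X + B T X - B T X * of_real ((norm (B T X))\<^sup>2))) (at T)"
      using B(1,4) unfolding gl_on_def by metis
    define S where "S = ball T (min d T)"
    have S: "open S" "T \<in> S" using B(2) T by (auto simp: S_def)
    have eq: "B t X = A t X" if "t \<in> S" for t X
    proof -
      have "dist t T < d" "0 \<le> t" using that by (auto simp: S_def dist_real_def)
      then show ?thesis using B(3)[of t] by simp
    qed
    have "((\<lambda>t. A t X) has_vector_derivative (AXX T X + A T X - A T X * of_real ((norm (A T X))\<^sup>2))) (at T)" for X
      using has_vector_derivative_transform_within_open[OF pde(3)[of X] S eq] by (simp add: TT)
    then show ?thesis using pde(1,2) TT by (intro exI[of _ "AX T"] exI[of _ "AXX T"]) simp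
  qed
  then obtain AX AXX where "\<And>T X. 0 < T \<Longrightarrow> ((\<lambda>x. A T x) has_vector_derivative AX T X) (at X) \<and>
        ((\<lambda>x. AX T x) has_vector_derivative AXX T X) (at X) \<and>
        ((\<lambda>t. A t X) has_vector_derivative (AXX T X + A T X - A T X * of_real ((norm (A T X))\<^sup>2))) (at T)"
    by metis
  then show ?thesis unfolding ginzburg_landau_solution_def using 1 by blast
qed

section \<open>Real and imaginary parts, and the logarithm, in Fourier variables\<close>

text \<open>The transforms of the real and the imaginary part of the inverse transform of \<open>v\<close>.\<close>

definition re_hat :: "(real \<Rightarrow> complex) \<Rightarrow> real \<Rightarrow> complex" where "re_hat v k = (v k + cnj (v (- k))) / 2"
definition im_hat :: "(real \<Rightarrow> complex) \<Rightarrow> real \<Rightarrow> complex" where "im_hat v k = (v k - cnj (v (- k))) / (2 * \<i>)"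

lemma hermitian_re_im_hat: "hermitian (re_hat v)" "hermitian (im_hat v)"
  by (simp_all add: hermitian_def re_hat_def im_hat_def field_simps)

lemma re_im_hat_sum: "re_hat v k + \<i> * im_hat v k = v k"
  by (simp add: re_hat_def im_hat_def field_simps)

lemma norm_re_im_hat: "norm (re_hat v k) \<le> (norm (v k) + norm (v (- k))) / 2" "norm (im_hat v k) \<le> (norm (v k) + norm (v (- k))) / 2"
  using norm_triangle_ineq[of "v k" "cnj (v (- k))"] norm_triangle_ineq4[of "v k" "cnj (v (- k))"]
  by (simp_all add: re_hat_def im_hat_def norm_divide norm_mult)

lemma measurable_re_im_hat [measurable]:
  assumes [measurable]: "v \<in> borel_measurable borel"
  shows "re_hat v \<in> borel_measurable borel" "im_hat v \<in> borel_measurable borel"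
proof -
  have [measurable]: "(\<lambda>k. cnj (v (- k))) \<in> borel_measurable borel"
    by (rule borel_measurable_continuous_on[OF _ measurable_compose[OF _ assms]]) (auto intro: continuous_intros)
  show "re_hat v \<in> borel_measurable borel" "im_hat v \<in> borel_measurable borel"
    unfolding re_hat_def[abs_def] im_hat_def[abs_def] by (measurable, measurable)
qed

lemma integrable_reflect:
  assumes "integrable lborel (v :: real \<Rightarrow> complex)"
  shows "integrable lborel (\<lambda>k. v (- k))"
  using lborel_integrable_real_affine[OF assms, of "-1" 0] by simp

lemma inverse_fourier_re_im_hat:
  assumes v: "integrable lborel v"
  shows "inverse_fourier (re_hat v) x + \<i> * inverse_fourier (im_hat v) x = inverse_fourier v x"
proof -
  have vm: "v \<in> borel_measurable borel" using borel_measurable_integrable[OF v] by simp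
  have g: "integrable lborel (\<lambda>k. (norm (v k) + norm (v (- k))) / 2)" using v integrable_reflect[OF v] by simp
  have "integrable lborel (re_hat v)" "integrable lborel (im_hat v)"
    by (rule integrable_dominated[OF measurable_re_im_hat(1)[OF vm] g norm_re_im_hat(1)],
        rule integrable_dominated[OF measurable_re_im_hat(2)[OF vm] g norm_re_im_hat(2)])
  then have "inverse_fourier (\<lambda>k. re_hat v k + \<i> * im_hat v k) x = inverse_fourier (re_hat v) x + \<i> * inverse_fourier (im_hat v) x"
    by (simp only: inverse_fourier_add inverse_fourier_cmult integrable_mult_right)
  then show ?thesis by (simp add: re_im_hat_sum)
qed

text \<open>The coefficients of \<open>ln (1 + w)\<close> with the index shift of \<open>conv_series\<close>.\<close>

definition log_coeff :: "nat \<Rightarrow> real" where "log_coeff n = (-1) ^ n / real (Suc n)"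

lemma log_coeff_le: "\<bar>log_coeff n\<bar> \<le> 2"
  by (simp add: log_coeff_def abs_divide power_abs divide_le_eq)

text \<open>Since the inverse transform is smaller than one in modulus, the series in convolution powers is the
transform of the principal logarithm.\<close>

lemma inverse_fourier_log:
  assumes cw: "conv_weight M \<kappa>" and f: "dominated M \<epsilon> f" "0 \<le> \<epsilon>" and small: "\<epsilon> * \<kappa> \<le> 1/4"
    and lt: "norm (inverse_fourier f x) < 1"
  shows "exp (inverse_fourier (conv_series log_coeff f) x) = 1 + inverse_fourier f x"
proof -
  interpret conv_weight M \<kappa> by (rule cw)
  define w where "w = inverse_fourier f x"
  have "(\<lambda>n. of_real (log_coeff n) * w ^ Suc n) sums inverse_fourier (conv_series log_coeff f) x"
    unfolding w_def by (rule inverse_fourier_conv_series[OF f log_coeff_le small])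
  moreover have "(\<lambda>n. of_real (log_coeff n) * w ^ Suc n) sums ln (1 + w)"
  proof -
    have "(\<lambda>n. - ((- w) ^ n) / of_nat n) sums ln (1 + w)" using lt unfolding w_def by (rule Ln_series')
    from sums_split_initial_segment[OF this, of 1]
    have "(\<lambda>n. - ((- w) ^ Suc n) / of_nat (Suc n)) sums ln (1 + w)" by simp
    moreover have "- ((- w) ^ Suc n) / of_nat (Suc n) = of_real (log_coeff n) * w ^ Suc n" for n
    proof -
      have "(- w) ^ Suc n = (-1) ^ Suc n * w ^ Suc n" by (rule power_minus)
      then show ?thesis by (simp add: log_coeff_def)
    qed
    ultimately show ?thesis by simp
  qed
  ultimately have "inverse_fourier (conv_series log_coeff f) x = ln (1 + w)" by (rule sums_unique2)
  moreover have "1 + w \<noteq> 0"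
  proof
    assume "1 + w = 0"
    then have "w = -1" by (simp add: eq_neg_iff_add_eq_0 add.commute)
    then show False using lt by (simp add: w_def)
  qed
  ultimately show ?thesis by (simp add: w_def)
qed

lemma exp_le_wgt5: "exp (- \<bar>k\<bar>) \<le> 3125 * wgt 5 0 k"
proof -
  define x where "x = \<bar>k\<bar>"
  have x: "0 \<le> x" by (simp add: x_def)
  have "1 + x \<le> 5 * (1 + x / 5)" using x by simp
  also have "\<dots> \<le> 5 * exp (x / 5)" by (intro mult_left_mono exp_ge_add_one_self) simp
  finally have "(1 + x) ^ 5 \<le> (5 * exp (x / 5)) ^ 5" using x by (intro power_mono) auto
  also have "\<dots> = 3125 * exp x" by (simp add: power_mult_distrib flip: exp_of_nat_mult)
  finally have "(1 + x) ^ 5 * exp (- x) \<le> 3125 * exp x * exp (- x)" by (intro mult_right_mono) auto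
  also have "\<dots> = 3125" by (simp add: exp_minus)
  finally show ?thesis using x by (simp add: wgt_zero_eq x_def[symmetric] field_simps)
qed

text \<open>The logarithm of \<open>1 + inverse_fourier f\<close> provides the polar data. Its series costs a factor \<open>4\<close> and the passage to
the two modes a factor \<open>2\<close>; this turns the \<open>16\<close> in the hypothesis into the \<open>2\<close> of \<open>polar_data\<close>.\<close>

lemma polar_start:
  assumes e: "0 < e" "128 * e * (64 * wgt_mass) * duhamel_const \<le> 1"
    and fm: "f \<in> borel_measurable borel" and fb: "\<And>k. norm (f k) \<le> e / (16 * 30 ^ 5) * wgt 5 0 k"
  obtains Vh A where
    "\<And>t. 0 \<le> t \<Longrightarrow> Vh t \<in> borel_measurable borel"
    "\<And>t k. 0 \<le> t \<Longrightarrow> norm (Vh t k) \<le> 16 * e * wgt 5 t (k - qE)"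
    "\<And>t x. 0 \<le> t \<Longrightarrow> A t x = wave_train qE x + inverse_fourier (Vh t) x"
    "\<And>b. gl_on 0 b A"
    "\<And>x. A 0 x = wave_train qE x * (1 + inverse_fourier f x)"
proof -
  define \<eta> where "\<eta> = e / (16 * 30 ^ 5)"
  have eta: "0 \<le> \<eta>" using e by (simp add: \<eta>_def)
  define K where "K = 64 * wgt_mass"
  have K: "0 \<le> K" by (simp add: K_def wgt_mass_nonneg)
  have eK: "128 * (e * K) \<le> 1"
  proof -
    have "128 * (e * K) * 1 \<le> 128 * (e * K) * duhamel_const" using e K duhamel_const_ge_1 by (intro mult_left_mono) auto
    also have "\<dots> \<le> 1" using e(2) by (simp add: K_def mult_ac)
    finally show ?thesis by simp
  qed
  have "\<eta> \<le> e" using e by (simp add: \<eta>_def divide_le_eq)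
  then have etaK: "\<eta> * K \<le> 1/128" using mult_right_mono[of \<eta> e K] K eK by simp
  interpret conv_weight "wgt 5 0" K
    using conv_weight_wgt[of 0 5] by (simp add: K_def theta_0)
  have df: "dominated (wgt 5 0) \<eta> f" by (rule dominatedI[OF fm]) (use fb in \<open>simp add: \<eta>_def\<close>)
  have small: "\<eta> * K \<le> 1/4" using etaK by simp
  define z where "z = conv_series log_coeff f"
  have dz: "dominated (wgt 5 0) (4 * \<eta>) z"
    unfolding z_def by (rule dominated_conv_series[where a = log_coeff, OF df eta log_coeff_le small])
  have zi: "integrable lborel z" by (rule dominated_integrable[OF dz])
  have zm: "z \<in> borel_measurable borel" by (rule dominated_measurable[OF dz])
  have wm: "wgt 5 0 (- k) = wgt 5 0 k" for k by (simp add: wgt_def)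
  have rb: "norm (re_hat z k) \<le> 4 * \<eta> * wgt 5 0 k" "norm (im_hat z k) \<le> 4 * \<eta> * wgt 5 0 k" for k
    using norm_re_im_hat[of z k] dominated_le[OF dz, of k] dominated_le[OF dz, of "- k"] by (simp_all add: wm)
  define u0 where "u0 = modes (re_hat z) (im_hat z)"
  interpret polar_data e u0
  proof
    show "0 < e" "128 * e * (64 * wgt_mass) * duhamel_const \<le> 1" by (rule e)+
    fix b show "u0 b \<in> borel_measurable borel" "hermitian (u0 b)"
      unfolding u0_def by (intro measurable_modes measurable_re_im_hat zm, intro hermitian_modes hermitian_re_im_hat)
    fix k
    have "norm (u0 b k) \<le> 4 * \<eta> * wgt 5 0 k + 4 * \<eta> * wgt 5 0 k"
      unfolding u0_def by (rule order_trans[OF norm_modes_le add_mono[OF rb]])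
    then show "norm (u0 b k) \<le> e / (2 * 30 ^ 5) * wgt 5 0 k" by (simp add: \<eta>_def)
  qed
  have lt: "norm (inverse_fourier f x) < 1" for x
  proof -
    have "norm (inverse_fourier f x) \<le> (LINT k|lborel. norm (f k))"
      by (rule inverse_fourier_norm_le[OF dominated_integrable[OF df]])
    also have "\<dots> \<le> (LINT k|lborel. \<eta> * wgt 5 0 k)"
      by (rule integral_mono) (use dominated_integrable[OF df] M_integrable dominated_le[OF df] in auto)
    also have "\<dots> = \<eta> * (LINT k|lborel. wgt 5 0 k)" by simp
    also have "\<dots> \<le> \<eta> * K"
      using wgt_integral(2)[of 0 5] wgt_mass_nonneg eta by (intro mult_left_mono) (auto simp: K_def theta_0)
    finally show ?thesis using etaK by simp
  qed
  obtain Vh A where VA: "\<And>t. 0 \<le> t \<Longrightarrow> Vh t \<in> borel_measurable borel"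
    "\<And>t k. 0 \<le> t \<Longrightarrow> norm (Vh t k) \<le> 16 * e * wgt 5 t (k - qE)"
    "\<And>t x. 0 \<le> t \<Longrightarrow> A t x = wave_train qE x + inverse_fourier (Vh t) x"
    "\<And>b. gl_on 0 b A"
    "\<And>x. A 0 x = wave_train qE x * exp (inverse_fourier (amp u0) x + \<i> * inverse_fourier (pha u0) x)"
    using polar_gl by blast
  have "A 0 x = wave_train qE x * (1 + inverse_fourier f x)" for x
    unfolding VA(5) u0_def amp_modes pha_modes inverse_fourier_re_im_hat[OF zi]
    unfolding z_def inverse_fourier_log[OF conv_weight_axioms df eta small lt] ..
  with VA(1-4) show ?thesis by (rule that)
qed

text \<open>The majorant is built from \<open>|v k| + |v (- k)|\<close>, because taking real and imaginary parts mixes \<open>k\<close> with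
\<open>- k\<close>; this doubles \<open>\<delta>\<close>, and \<open>convolution_majorant\<close> doubles it again.\<close>

lemma cart_start:
  assumes v: "integrable lborel v" and d: "0 < \<delta>" "8 * \<delta> \<le> eps" and vb: "\<And>k. norm (v k) \<le> \<delta>" and vi: "(LINT k|lborel. norm (v k)) \<le> \<delta>"
  obtains m Vh A f where
    "integrable lborel m" "\<And>k. m k \<le> 4 * \<delta>" "(LINT k|lborel. m k) \<le> 4 * \<delta>"
    "\<And>t. t \<in> {0..2} \<Longrightarrow> Vh t \<in> borel_measurable borel"
    "\<And>t k. t \<in> {0..2} \<Longrightarrow> norm (Vh t k) \<le> 80 * m (k - qE)"
    "\<And>t x. t \<in> {0..2} \<Longrightarrow> A t x = wave_train qE x + inverse_fourier (Vh t) x"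
    "gl_on 0 2 A"
    "\<And>x. A 0 x = wave_train qE x + inverse_fourier (\<lambda>k. v (k - qE)) x"
    "f \<in> borel_measurable borel" "\<And>k. norm (f k) \<le> 400 * \<delta> * exp (- \<bar>k\<bar>)"
    "\<And>x. A 1 x = wave_train qE x * (1 + inverse_fourier f x)"
proof -
  define g where "g k = norm (v k) + norm (v (- k))" for k
  note vr = integrable_reflect[OF v]
  have g: "integrable lborel g" unfolding g_def[abs_def] using v vr by simp
  have "(LINT k|lborel. norm (v (- k))) = (LINT k|lborel. norm (v k))"
    by (subst (2) lborel_integral_real_affine[where c = "-1" and t = 0]) auto
  then have gi: "(LINT k|lborel. g k) \<le> 2 * \<delta>"
    unfolding g_def using v vr vi by simp
  have gb: "g k \<le> 2 * \<delta>" for k using vb[of k] vb[of "- k"] by (simp add: g_def)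
  have d2: "0 \<le> 2 * \<delta>" "4 * (2 * \<delta>) \<le> eps" using d by auto
  obtain m where m: "integrable lborel m" "\<And>k. g k \<le> m k" "\<And>k. m k \<le> 2 * (2 * \<delta>)"
      "(LINT k|lborel. m k) \<le> 2 * (2 * \<delta>)" "\<And>k. (LINT l|lborel. m l * m (k - l)) \<le> eps * m k"
    by (rule convolution_majorant[OF g _ gb gi d2]) (auto simp: g_def eps_def)
  define u0 where "u0 = modes (re_hat v) (im_hat v)"
  have vm: "v \<in> borel_measurable borel" using borel_measurable_integrable[OF v] by simp
  interpret cart_data m u0
  proof
    show "integrable lborel m" by (rule m)
    show "0 \<le> m k" for k using m(2)[of k] by (simp add: g_def) (smt (verit) norm_ge_zero)
    show "\<exists>B. \<forall>k. m k \<le> B" using m(3) by blast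
    show "(LINT l|lborel. m l * m (k - l)) \<le> eps * m k" for k by (rule m(5))
    fix b show "u0 b \<in> borel_measurable borel" "hermitian (u0 b)"
      unfolding u0_def by (intro measurable_modes measurable_re_im_hat vm, intro hermitian_modes hermitian_re_im_hat)
    fix k
    have "norm (u0 b k) \<le> g k / 2 + g k / 2"
      unfolding u0_def g_def by (rule order_trans[OF norm_modes_le add_mono[OF norm_re_im_hat]])
    then show "norm (u0 b k) \<le> m k" using m(2)[of k] by simp
  qed
  obtain Vh A f where VA: "\<And>t. t \<in> {0..2} \<Longrightarrow> Vh t \<in> borel_measurable borel"
    "\<And>t k. t \<in> {0..2} \<Longrightarrow> norm (Vh t k) \<le> 80 * m (k - qE)"
    "\<And>t x. t \<in> {0..2} \<Longrightarrow> A t x = wave_train qE x + inverse_fourier (Vh t) x"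
    "gl_on 0 2 A"
    "\<And>x. A 0 x = wave_train qE x + exp (\<i> * of_real (qE * x)) * (inverse_fourier (amp u0) x + \<i> * inverse_fourier (pha u0) x)"
    "f \<in> borel_measurable borel" "\<And>k. norm (f k) \<le> 100 * (m k * exp (- \<bar>k\<bar>))"
    "\<And>x. A 1 x = wave_train qE x * (1 + inverse_fourier f x)"
    using cart_gl by blast
  have A0: "A 0 x = wave_train qE x + inverse_fourier (\<lambda>k. v (k - qE)) x" for x
    unfolding VA(5) u0_def amp_modes pha_modes inverse_fourier_re_im_hat[OF v] inverse_fourier_shift ..
  have fb: "norm (f k) \<le> 400 * \<delta> * exp (- \<bar>k\<bar>)" for k
  proof -
    have "m k * exp (- \<bar>k\<bar>) \<le> 4 * \<delta> * exp (- \<bar>k\<bar>)" using m(3)[of k] by (intro mult_right_mono) auto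
    then show ?thesis using VA(7)[of k] by linarith
  qed
  show ?thesis
    by (rule that[OF m(1) _ _ VA(1-4) A0 VA(6) fb VA(8)]) (use m(3,4) in auto)
qed

section \<open>Nonlinear stability\<close>

theorem theorem1p1:
  shows "\<forall>C::real. C > 0 \<longrightarrow> (\<exists>\<delta>::real. \<delta> > 0 \<and>
    (\<forall>V0hat :: real \<Rightarrow> complex.
       integrable lborel V0hat \<and> Linf_norm V0hat < \<infinity> \<and>
       ereal (L1_norm V0hat) + Linf_norm V0hat \<le> ereal \<delta> \<longrightarrow>
       (\<exists>V :: real \<Rightarrow> real \<Rightarrow> complex.
          ginzburg_landau_solution (\<lambda>T X. wave_train (sqrt (1/3)) X + V T X) \<and>
          V 0 = inverse_fourier V0hat \<and>
          (\<forall>W :: real \<Rightarrow> real \<Rightarrow> complex.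
             ginzburg_landau_solution (\<lambda>T X. wave_train (sqrt (1/3)) X + W T X) \<and>
             W 0 = inverse_fourier V0hat \<longrightarrow> (\<forall>T\<ge>0. W T = V T)) \<and>
          (\<forall>T\<ge>0. \<exists>Vhat :: real \<Rightarrow> complex.
             has_fourier_transform (V T) Vhat \<and>
             Linf_norm Vhat \<le> ereal C \<and>
             sup_norm (V T) \<le> ereal (L1_norm Vhat) \<and>
             L1_norm Vhat \<le> C * (1 + T) powr (- 1 / 4)))))"
proof (intro allI impI)
  fix C :: real assume C: "0 < C"
  define K where "K = 1 + 64 * wgt_mass"
  have K: "1 \<le> K" "64 * wgt_mass \<le> K" "wgt_mass \<le> K" using wgt_mass_nonneg by (auto simp: K_def)
  \<comment> \<open>The size of the polar solution; it has to meet the smallness condition of \<open>polar_data\<close>, and \<open>16 e\<close> times the weight has to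
      respect the bounds by \<open>C\<close>.\<close>
  define e where "e = min 1 C / (128 * K * duhamel_const)"
  have e: "0 < e" using C K duhamel_const_ge_1 by (simp add: e_def)
  have e1: "128 * e * (64 * wgt_mass) * duhamel_const \<le> 1"
  proof -
    have "128 * e * (64 * wgt_mass) * duhamel_const \<le> 128 * e * K * duhamel_const"
      using e K duhamel_const_ge_1 by (intro mult_right_mono mult_left_mono) auto
    also have "\<dots> = min 1 C" using K duhamel_const_ge_1 by (simp add: e_def)
    finally show ?thesis by simp
  qed
  have e2: "16 * e \<le> C" "32 * e * wgt_mass \<le> C"
  proof -
    have "128 * e * (K * duhamel_const) = min 1 C" using K duhamel_const_ge_1 by (simp add: e_def)
    moreover have "128 * e * (1 * 1) \<le> 128 * e * (K * duhamel_const)" "128 * e * (wgt_mass * 1) \<le> 128 * e * (K * duhamel_const)"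
      using e K duhamel_const_ge_1 wgt_mass_nonneg by (intro mult_left_mono mult_mono; simp)+
    moreover have "0 \<le> e * wgt_mass" using e wgt_mass_nonneg by simp
    ultimately show "16 * e \<le> C" "32 * e * wgt_mass \<le> C" using e by simp_all
  qed
  \<comment> \<open>The three conditions are the existence on \<open>[0,2]\<close>, the bound by \<open>C\<close> there (\<open>640 = 2 * 80 * 4\<close>, where the \<open>2\<close> covers the
      decaying factor), and the smallness at time one (\<open>1250000 = 400 * 3125\<close>, by \<open>cart_start\<close> and \<open>exp_le_wgt5\<close>).\<close>
  define \<delta> where "\<delta> = min (min (eps / 8) (C / 640)) (e / (16 * 30 ^ 5) / 1250000)"
  have d: "0 < \<delta>" "8 * \<delta> \<le> eps" "640 * \<delta> \<le> C" "1250000 * \<delta> \<le> e / (16 * 30 ^ 5)"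
    using C e by (auto simp: \<delta>_def eps_def)
  show "\<exists>\<delta>::real. \<delta> > 0 \<and>
    (\<forall>V0hat :: real \<Rightarrow> complex.
       integrable lborel V0hat \<and> Linf_norm V0hat < \<infinity> \<and>
       ereal (L1_norm V0hat) + Linf_norm V0hat \<le> ereal \<delta> \<longrightarrow>
       (\<exists>V :: real \<Rightarrow> real \<Rightarrow> complex.
          ginzburg_landau_solution (\<lambda>T X. wave_train (sqrt (1/3)) X + V T X) \<and>
          V 0 = inverse_fourier V0hat \<and>
          (\<forall>W :: real \<Rightarrow> real \<Rightarrow> complex.
             ginzburg_landau_solution (\<lambda>T X. wave_train (sqrt (1/3)) X + W T X) \<and>
             W 0 = inverse_fourier V0hat \<longrightarrow> (\<forall>T\<ge>0. W T = V T)) \<and>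
          (\<forall>T\<ge>0. \<exists>Vhat :: real \<Rightarrow> complex.
             has_fourier_transform (V T) Vhat \<and>
             Linf_norm Vhat \<le> ereal C \<and>
             sup_norm (V T) \<le> ereal (L1_norm Vhat) \<and>
             L1_norm Vhat \<le> C * (1 + T) powr (- 1 / 4))))"
    unfolding qE_def[symmetric]
  proof (intro exI[of _ \<delta>] conjI allI impI d(1))
    fix V0 :: "real \<Rightarrow> complex"
    assume "integrable lborel V0 \<and> Linf_norm V0 < \<infinity> \<and> ereal (L1_norm V0) + Linf_norm V0 \<le> ereal \<delta>"
    then have V0: "integrable lborel V0" and V0s: "ereal (L1_norm V0) + Linf_norm V0 \<le> ereal \<delta>" by auto
    have V0m [measurable]: "V0 \<in> borel_measurable borel" using borel_measurable_integrable[OF V0] by simp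
    have L1pos: "0 \<le> L1_norm V0" unfolding L1_norm_def by (rule integral_nonneg_AE) simp
    have Linf_le: "Linf_norm V0 \<le> ereal \<delta>"
    proof -
      have "ereal 0 + Linf_norm V0 \<le> ereal (L1_norm V0) + Linf_norm V0" using L1pos by (intro add_mono) auto
      then show ?thesis using V0s by (simp add: zero_ereal_def[symmetric])
    qed
    have V0AE: "AE k in lborel. norm (V0 k) \<le> \<delta>"
    proof -
      have "AE k in lborel. ereal (norm (V0 k)) \<le> Linf_norm V0" unfolding Linf_norm_def by (rule esssup_AE)
      then show ?thesis by eventually_elim (use Linf_le order_trans in fastforce)
    qed
    have Linf_pos: "0 \<le> Linf_norm V0"
    proof -
      have "ereal 0 = esssup lborel (\<lambda>k::real. ereal 0)" by (rule esssup_const[symmetric]) simp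
      also have "\<dots> \<le> Linf_norm V0" unfolding Linf_norm_def by (rule esssup_mono) auto
      finally show ?thesis by (simp add: zero_ereal_def)
    qed
    have L1_le: "L1_norm V0 \<le> \<delta>"
    proof -
      have "ereal (L1_norm V0) + 0 \<le> ereal (L1_norm V0) + Linf_norm V0" by (intro add_mono Linf_pos) simp
      also note V0s
      finally show ?thesis by simp
    qed
    \<comment> \<open>A representative that satisfies the bound everywhere, since all further estimates are pointwise.\<close>
    define w where "w k = (if norm (V0 k) \<le> \<delta> then V0 k else 0)" for k
    have wm [measurable]: "w \<in> borel_measurable borel" unfolding w_def[abs_def] by measurable
    have wAE: "AE k in lborel. w k = V0 k" using V0AE by eventually_elim (simp add: w_def)
    have wi: "integrable lborel w" using V0 wAE by (subst integrable_cong_AE[of _ _ V0]) auto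
    \<comment> \<open>The perturbation relative to the wave train: multiplication by \<open>exp (- \<i> q X)\<close> shifts the transform.\<close>
    define v where "v k = w (k + qE)" for k
    have vi: "integrable lborel v"
      using lborel_integrable_real_affine[OF wi, of 1 qE] by (simp add: v_def[abs_def] add.commute)
    have vb: "norm (v k) \<le> \<delta>" for k using d(1) by (simp add: v_def w_def)
    have "(LINT k|lborel. norm (v k)) = (LINT k|lborel. norm (w k))"
      by (subst (2) lborel_integral_real_affine[where c = 1 and t = qE]) (auto simp: v_def add.commute)
    also have "\<dots> = L1_norm V0" unfolding L1_norm_def by (rule integral_cong_AE) (use wAE in auto)
    finally have vL: "(LINT k|lborel. norm (v k)) \<le> \<delta>" using L1_le by simp
    have vV: "inverse_fourier (\<lambda>k. v (k - qE)) x = inverse_fourier V0 x" for x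
    proof -
      have "inverse_fourier (\<lambda>k. v (k - qE)) x = inverse_fourier w x" by (simp add: v_def)
      also have "\<dots> = inverse_fourier V0 x"
        unfolding inverse_fourier_def by (rule integral_cong_AE) (use wAE in auto)
      finally show ?thesis .
    qed
    obtain m Vh1 A1 f where c: "integrable lborel m" "\<And>k. m k \<le> 4 * \<delta>" "(LINT k|lborel. m k) \<le> 4 * \<delta>"
      "\<And>t. t \<in> {0..2} \<Longrightarrow> Vh1 t \<in> borel_measurable borel"
      "\<And>t k. t \<in> {0..2} \<Longrightarrow> norm (Vh1 t k) \<le> 80 * m (k - qE)"
      "\<And>t x. t \<in> {0..2} \<Longrightarrow> A1 t x = wave_train qE x + inverse_fourier (Vh1 t) x"
      "gl_on 0 2 A1"
      "\<And>x. A1 0 x = wave_train qE x + inverse_fourier (\<lambda>k. v (k - qE)) x"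
      "f \<in> borel_measurable borel" "\<And>k. norm (f k) \<le> 400 * \<delta> * exp (- \<bar>k\<bar>)"
      "\<And>x. A1 1 x = wave_train qE x * (1 + inverse_fourier f x)"
    proof -
      show thesis by (rule cart_start[OF vi d(1,2) vb vL], rule that)
    qed
    have fb: "norm (f k) \<le> e / (16 * 30 ^ 5) * wgt 5 0 k" for k
    proof -
      have "400 * \<delta> * exp (- \<bar>k\<bar>) \<le> 400 * \<delta> * (3125 * wgt 5 0 k)" using d(1) by (intro mult_left_mono exp_le_wgt5) auto
      also have "\<dots> = 1250000 * \<delta> * wgt 5 0 k" by simp
      also have "\<dots> \<le> e / (16 * 30 ^ 5) * wgt 5 0 k" by (intro mult_right_mono d(4) wgt_nonneg) simp
      finally show ?thesis using c(10)[of k] by simp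
    qed
    obtain Vh2 A2 where p: "\<And>t. 0 \<le> t \<Longrightarrow> Vh2 t \<in> borel_measurable borel"
      "\<And>t k. 0 \<le> t \<Longrightarrow> norm (Vh2 t k) \<le> 16 * e * wgt 5 t (k - qE)"
      "\<And>t x. 0 \<le> t \<Longrightarrow> A2 t x = wave_train qE x + inverse_fourier (Vh2 t) x"
      "\<And>b. gl_on 0 b A2"
      "\<And>x. A2 0 x = wave_train qE x * (1 + inverse_fourier f x)"
    proof -
      show thesis by (rule polar_start[OF e e1 c(9) fb], rule that)
    qed
    define B where "B T = A2 (T - 1)" for T
    have glB: "gl_on 1 b B" for b
      using gl_on_shift[OF p(4)[of "b - 1"], of 1] by (simp add: B_def[abs_def])
    have agree: "A1 T = B T" if "T \<in> {1..<2}" for T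
    proof (rule gl_on_unique[OF gl_on_subset[OF c(7), of 1 2] glB _ that])
      show "A1 1 = B 1" by (simp add: fun_eq_iff c(11) B_def p(5))
    qed auto
    define Vh where "Vh T = (if T < 2 then Vh1 T else Vh2 (T - 1))" for T
    define V where "V T = inverse_fourier (Vh T)" for T
    define A where "A T x = wave_train qE x + V T x" for T x
    have AA1: "A T = A1 T" if "0 \<le> T" "T < 2" for T
      using that c(6)[of T] by (auto simp: A_def V_def Vh_def fun_eq_iff)
    have AB: "A T = B T" if "1 \<le> T" for T
    proof (cases "T < 2")
      case True
      then show ?thesis using AA1[of T] agree[of T] that by simp
    next
      case False
      then show ?thesis using p(3)[of "T - 1"] by (auto simp: A_def V_def Vh_def B_def fun_eq_iff)
    qed
    have sol: "ginzburg_landau_solution A"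
    proof (rule ginzburg_landau_solutionI_local)
      fix T :: real assume T: "0 \<le> T"
      show "\<exists>a b B d. gl_on a b B \<and> 0 < d \<and> (\<forall>t\<ge>0. dist t T < d \<longrightarrow> t \<in> {a..b} \<and> A t = B t) \<and> (0 < T \<longrightarrow> T \<in> {a<..<b})"
      proof (cases "T < 2")
        case True
        have "gl_on 0 2 A1 \<and> 0 < 2 - T \<and> (\<forall>t\<ge>0. dist t T < 2 - T \<longrightarrow> t \<in> {0..2} \<and> A t = A1 t) \<and> (0 < T \<longrightarrow> T \<in> {0<..<2})"
          using True c(7) AA1 by (auto simp: dist_real_def)
        then show ?thesis by blast
      next
        case False
        have "gl_on 1 (T + 1) B \<and> 0 < (1::real) \<and> (\<forall>t\<ge>0. dist t T < 1 \<longrightarrow> t \<in> {1..T + 1} \<and> A t = B t) \<and> (0 < T \<longrightarrow> T \<in> {1<..<T + 1})"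
          using False glB AB by (auto simp: dist_real_def)
        then show ?thesis by blast
      qed
    qed
    have V0eq: "V 0 = inverse_fourier V0"
      using AA1[of 0] c(8) vV by (auto simp: A_def fun_eq_iff)
    have uniq: "W T = V T" if W: "ginzburg_landau_solution (\<lambda>T X. wave_train qE X + W T X)" and W0: "W 0 = inverse_fourier V0" and T: "0 \<le> T"
      for W T
    proof -
      define B where "B = (\<lambda>T X. wave_train qE X + W T X)"
      have "B T = A T"
        by (rule gl_on_unique[OF gl_on_of_solution[OF W[folded B_def], of "T + 1"] gl_on_of_solution[OF sol]])
          (use T W0 V0eq in \<open>auto simp: A_def B_def fun_eq_iff\<close>)
      then show ?thesis by (auto simp: A_def B_def fun_eq_iff)
    qed
    have bounds: "Vh T \<in> borel_measurable borel \<and> integrable lborel (Vh T) \<and> (\<forall>k. norm (Vh T k) \<le> C) \<and>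
        (LINT k|lborel. norm (Vh T k)) \<le> C * (1 + T) powr (- 1 / 4)" if T: "0 \<le> T" for T
    proof (cases "T < 2")
      case True
      then have TI: "T \<in> {0..2}" and VT: "Vh T = Vh1 T" using T by (auto simp: Vh_def)
      have gi: "integrable lborel (\<lambda>k. 80 * m (k - qE))"
        using lborel_integrable_real_affine[OF c(1), of 1 "- qE"] by simp
      have i: "integrable lborel (Vh1 T)" by (rule integrable_dominated[OF c(4)[OF TI] gi c(5)[OF TI]])
      have b: "norm (Vh1 T k) \<le> C" for k
      proof -
        have "80 * m (k - qE) \<le> 80 * (4 * \<delta>)" by (intro mult_left_mono c(2)) simp
        then show ?thesis using c(5)[OF TI, of k] d(1,3) by linarith
      qed
      have "(LINT k|lborel. norm (Vh1 T k)) \<le> (LINT k|lborel. 80 * m (k - qE))"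
        by (rule integral_mono[OF integrable_norm[OF i] gi c(5)[OF TI]])
      also have "\<dots> = 80 * (LINT k|lborel. m k)"
        by (subst (2) lborel_integral_real_affine[where c = 1 and t = "- qE"]) (auto simp: add.commute)
      also have "\<dots> \<le> 80 * (4 * \<delta>)" by (intro mult_left_mono c(3)) simp
      also have "\<dots> \<le> C * (1/2)" using d(3) by simp
      also have "\<dots> \<le> C * (1 + T) powr (- 1 / 4)"
      proof (rule mult_left_mono)
        have "(1 + T) powr (1/4) \<le> 16 powr (1/4)" using T True by (intro powr_mono2) auto
        also have "(16::real) powr (1/4) = 2"
        proof -
          have "(16::real) = 2 powr 4" by (simp add: powr_numeral)
          then show ?thesis by (simp add: powr_powr)
        qed
        finally have "1/2 \<le> 1 / (1 + T) powr (1/4)" using T by (intro frac_le) auto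
        then show "1/2 \<le> (1 + T) powr (- 1 / 4)" by (simp add: powr_minus_divide)
      qed (use C in simp)
      finally show ?thesis using c(4)[OF TI] i b VT by simp
    next
      case False
      define s where "s = T - 1"
      have s: "0 \<le> s" "1 \<le> s" and VT: "Vh T = Vh2 s" using False by (auto simp: Vh_def s_def)
      have wi: "integrable lborel (\<lambda>k. wgt 5 s (k - qE))"
        using lborel_integrable_real_affine[OF wgt_integral(1)[OF s(1), of 5], of 1 "- qE"] by simp
      have gi: "integrable lborel (\<lambda>k. 16 * e * wgt 5 s (k - qE))" using wi by simp
      have i: "integrable lborel (Vh2 s)" by (rule integrable_dominated[OF p(1)[OF s(1)] gi p(2)[OF s(1)]])
      have b: "norm (Vh2 s k) \<le> C" for k
      proof -
        have "16 * e * wgt 5 s (k - qE) \<le> 16 * e * 1" using e by (intro mult_left_mono wgt_le_1 s) auto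
        then show ?thesis using p(2)[OF s(1), of k] e2(1) by linarith
      qed
      have "(LINT k|lborel. norm (Vh2 s k)) \<le> (LINT k|lborel. 16 * e * wgt 5 s (k - qE))"
        by (rule integral_mono[OF integrable_norm[OF i] gi p(2)[OF s(1)]])
      also have "\<dots> = 16 * e * (LINT k|lborel. wgt 5 s k)"
        by (subst (2) lborel_integral_real_affine[where c = 1 and t = "- qE"]) (auto simp: add.commute)
      also have "\<dots> \<le> 16 * e * (wgt_mass / theta s)"
        using e by (intro mult_left_mono wgt_integral(2)[OF s(1)]) auto
      also have "\<dots> = 16 * e * wgt_mass * (1 / T powr (1/4))" by (simp add: theta_def s_def)
      also have "\<dots> \<le> 16 * e * wgt_mass * (2 * (1 / (1 + T) powr (1/4)))"
      proof (rule mult_left_mono)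
        have "(1 + T) powr (1/4) \<le> (16 * T) powr (1/4)" using False by (intro powr_mono2) auto
        also have "\<dots> = 2 * T powr (1/4)"
        proof -
          have "(16::real) powr (1/4) = 2"
          proof -
            have "(16::real) = 2 powr 4" by (simp add: powr_numeral)
            then show ?thesis by (simp add: powr_powr)
          qed
          then show ?thesis using False by (simp add: powr_mult)
        qed
        finally have *: "(1 + T) powr (1/4) \<le> 2 * T powr (1/4)" .
        have "0 < (1 + T) powr (1/4)" "0 < T powr (1/4)" using False by auto
        then show "1 / T powr (1/4) \<le> 2 * (1 / (1 + T) powr (1/4))" using * by (simp add: field_simps)
      qed (use e wgt_mass_nonneg in simp)
      also have "\<dots> = 32 * e * wgt_mass * (1 / (1 + T) powr (1/4))" by simp
      also have "\<dots> \<le> C * (1 / (1 + T) powr (1/4))" by (intro mult_right_mono e2(2)) simp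
      also have "\<dots> = C * (1 + T) powr (- 1 / 4)" by (simp add: powr_minus_divide)
      finally show ?thesis using p(1)[OF s(1)] i b VT by simp
    qed
    show "\<exists>V. ginzburg_landau_solution (\<lambda>T X. wave_train qE X + V T X) \<and> V 0 = inverse_fourier V0 \<and>
        (\<forall>W. ginzburg_landau_solution (\<lambda>T X. wave_train qE X + W T X) \<and> W 0 = inverse_fourier V0 \<longrightarrow> (\<forall>T\<ge>0. W T = V T)) \<and>
        (\<forall>T\<ge>0. \<exists>Vhat. has_fourier_transform (V T) Vhat \<and> Linf_norm Vhat \<le> ereal C \<and>
             sup_norm (V T) \<le> ereal (L1_norm Vhat) \<and> L1_norm Vhat \<le> C * (1 + T) powr (- 1 / 4))"
    proof (intro exI[of _ V] conjI allI impI)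
      show "ginzburg_landau_solution (\<lambda>T X. wave_train qE X + V T X)" using sol by (simp add: A_def[abs_def])
      show "V 0 = inverse_fourier V0" by (rule V0eq)
      fix W :: "real \<Rightarrow> real \<Rightarrow> complex" and T :: real
      assume "ginzburg_landau_solution (\<lambda>T X. wave_train qE X + W T X) \<and> W 0 = inverse_fourier V0" and "0 \<le> T"
      then show "W T = V T" using uniq by blast
    next
      fix T :: real assume T: "0 \<le> T"
      note bT = bounds[OF T]
      show "\<exists>Vhat. has_fourier_transform (V T) Vhat \<and> Linf_norm Vhat \<le> ereal C \<and>
             sup_norm (V T) \<le> ereal (L1_norm Vhat) \<and> L1_norm Vhat \<le> C * (1 + T) powr (- 1 / 4)"
      proof (intro exI[of _ "Vh T"] conjI)
        show "has_fourier_transform (V T) (Vh T)" using bT by (simp add: has_fourier_transform_def V_def)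
        show "Linf_norm (Vh T) \<le> ereal C"
          unfolding Linf_norm_def using bT by (intro esssup_I) auto
        show "sup_norm (V T) \<le> ereal (L1_norm (Vh T))"
          unfolding sup_norm_def L1_norm_def V_def using bT by (intro SUP_least) (simp add: inverse_fourier_norm_le)
        show "L1_norm (Vh T) \<le> C * (1 + T) powr (- 1 / 4)" using bT by (simp add: L1_norm_def)
      qed
    qed
  qed
qed

end
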